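(* Let $f:S_d\to[0,+\infty]$ be convex, positively $1$-homogeneous and lower semicontinuous, with $\operatorname{dom}(f)\subset S_d^+$, $\operatorname{dom}(f)\neq\emptyset$, and $\operatorname{dom}(f)\cap S_d^{++}$ dense in $\operatorname{dom}(f)$. Assume that $\operatorname{dom}(f)=S_d^+$ and that there is $\kappa_1>0$ with $f(A)\le\kappa_1\operatorname{tr}(A)$ for all $A\in S_d^+$. Then the following assertions are equivalent. (i) For all $\mu,\nu,p\in\mathcal P_2(\mathbb R^d)$, $H(\mu,\nu)\le H(\mu,p)+H(p,\nu)$. (ii) For each $x\in\mathbb R^d$, each $\nu,p\in\mathcal P_2(\mathbb R^d)$ and each analytically measurable probability kernel $y\in\mathbb R^d\mapsto\gamma^y\in\mathcal P_2(\mathbb R^d)$, $$G(x,\nu)\le G(x,p)+\int_{\mathbb R^d}G(y,\gamma^y)\,dp(y)\quad\text{whenever}\quad \nu=\int_{\mathbb R^d}\gamma^y\,dp(y).$$ (iii) For each $\varphi\in\Phi_{bb,2}(\mathbb R^d)$, $\varphi^{GG}=\varphi^G$.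
   Context: $S_d$ is the space of real symmetric $d\times d$ matrices with inner product $A:B=\operatorname{tr}(A^{T}B)$ and norm $\|A\|=\sqrt{A:A}$; $S_d^+$ (resp. $S_d^{++}$) is the set of nonnegative (resp. positive) definite ones. $\operatorname{dom}(f)=\{M\in S_d: f(M)<+\infty\}$. Positively $1$-homogeneous means $f(tA)=tf(A)$ for all $A\in S_d$, $t\ge 0$. $\Phi_{bb,2}(\mathbb R^d)$ is the set of continuous $\varphi:\mathbb R^d\to\mathbb R$ that are bounded from below and satisfy $|\varphi(x)|\le C(1+|x|^2)$ for some $C>0$. Analytically measurable means measurable with respect to the $\sigma$-algebra generated by the analytic subsets of $\mathbb R^d$, where $\mathcal P_2(\mathbb R^d)$ carries the topology of the $2$-Wasserstein distance. $\mathcal P_2(\mathbb R^d)$ is the set of Borel probability measures on $\mathbb R^d$ with finite second moment; $\mathcal P_2((0,1)\times\mathbb R^d)$ is the set of Borel probability measures $\varrho$ on $(0,1)\times\mathbb R^d$ with $\int |x|^2\,d\varrho(t,x)<\infty$. $\mathcal M((0,1)\times\mathbb R^d,S_d^+)$ is the set of $S_d$-valued Borel measures $\lambda$ on $(0,1)\times\mathbb R^d$ with $\lambda(E)\in S_d^+$ for every Borel $E$; $|\cdot|$ of a measure is its total variation measure. $C_b^{1,2}((0,1)\times\mathbb R^d)$ is the space of functions $\varphi$ that are once continuously differentiable in $t$ and twice in $x$ with $\partial_t\varphi$ and $\nabla_x^2\varphi$ uniformly bounded. Fokker-Planck equation. A pair $(\varrho,\lambda)\in\mathcal P_2((0,1)\times\mathbb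 R^d)\times\mathcal M((0,1)\times\mathbb R^d,S_d^+)$ which can be disintegrated as $\varrho=\varrho_t\otimes\mathcal L^1|_{(0,1)}$, $\lambda=\lambda_t\otimes\mathcal L^1|_{(0,1)}$ solves $\partial_t\varrho=\operatorname{tr}(\frac12\nabla^2\lambda)$ if $\int_0^1|\lambda_t|(\mathbb R^d)\,dt<\infty$ and $$\int_0^1\int_{\mathbb R^d}\partial_t\varphi\,d\varrho_t\,dt=-\int_0^1\int_{\mathbb R^d}\tfrac12\nabla_x^2\varphi:d\lambda_t\,dt$$ for all $\varphi\in C_b^{1,2}((0,1)\times\mathbb R^d)$ whose closed support is contained in $(0,1)\times\mathbb R^d$. For such a solution $t\mapsto\varrho_t$ has a narrowly continuous representative on $[0,1]$ with values in $\mathcal P_2(\mathbb R^d)$, which is always used; $\varrho_0,\varrho_1$ denote its endpoint values. Dynamic cost: $$F(\mu,\nu)=\inf\left\{\int_0^1\int_{\mathbb R^d}f\left(\frac{d\lambda_t}{d|\lambda_t|}\right)d|\lambda_t|\,dt \;:\; \partial_t\varrho=\operatorname{tr}\left(\tfrac12\nabla^2\lambda\right),\ \varrho_0=\mu,\ \varrho_1=\nu\right\},$$ with $\inf\emptyset=+\infty$. Weak transport. $G(x,p)=F(\delta_x,p)$ for $x\in\mathbb R^d$, $p\in\mathcal P_2(\mathbb R^d)$. $\Pi(\mu,\nu)$ is the set of Borel probability measures on $\mathbb R^d\times\mathbb R^d$ with first marginal $\mu$ and second marginal $\nu$; each is disintegrated as $\gamma=\gamma^x\otimes\mu$. Then $H(\mu,\nu)=\inf\{\int_{\mathbb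 R^d}G(x,\gamma^x)\,d\mu(x):\gamma\in\Pi(\mu,\nu)\}$. $G$-transform. For a universally measurable $\varphi:\mathbb R^d\to\mathbb R$ with $|\varphi(x)|\le C(1+|x|^2)$ for some $C>0$, $\varphi^G(x)=\inf\{\int_{\mathbb R^d}\varphi\,dp+G(x,p): p\in\mathcal P_2(\mathbb R^d)\}$, and $\varphi^{GG}=(\varphi^G)^G$ (for $\varphi\in\Phi_{bb,2}(\mathbb R^d)$, $\varphi^G$ is universally measurable, bounded from below and of at most quadratic growth, so $\varphi^{GG}$ is well defined). *)

theory Defs
  imports "HOL-Probability.Probability"
begin

section \<open>Symmetric matrices\<close>

definition sym_mats :: "(real^'d^'d) set" where
  "sym_mats = {A. transpose A = A}"

definition psd_mats :: "(real^'d^'d) set" where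
  "psd_mats = {A \<in> sym_mats. \<forall>v. 0 \<le> v \<bullet> (A *v v)}"

definition pd_mats :: "(real^'d^'d) set" where
  "pd_mats = {A \<in> sym_mats. \<forall>v. v \<noteq> 0 \<longrightarrow> 0 < v \<bullet> (A *v v)}"

text \<open>The library inner product on matrices is the Frobenius one, so \<open>norm\<close> is the Frobenius norm.\<close>

lemma inner_mat_eq_trace: "A \<bullet> B = trace (transpose A ** B)"
  for A B :: "real^'d^'d"
proof -
  have "A \<bullet> B = (\<Sum>i\<in>UNIV. \<Sum>j\<in>UNIV. A $ i $ j * B $ i $ j)"
    by (simp add: inner_vec_def)
  also have "\<dots> = (\<Sum>j\<in>UNIV. \<Sum>i\<in>UNIV. A $ i $ j * B $ i $ j)"
    by (rule sum.swap)
  also have "\<dots> = trace (transpose A ** B)"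
    by (simp add: trace_def matrix_matrix_mult_def transpose_def)
  finally show ?thesis .
qed

text \<open>
  A function on symmetric matrices with values in \<open>[0, \<infinity>]\<close> is a total function into \<^typ>\<open>ennreal\<close>;
  only its values on \<^const>\<open>sym_mats\<close> are ever used.  In \<^typ>\<open>ennreal\<close>, \<open>0 * \<infinity> = 0\<close>.
\<close>

definition fin_dom :: "(real^'d^'d \<Rightarrow> ennreal) \<Rightarrow> (real^'d^'d) set" where
  "fin_dom f = {A \<in> sym_mats. f A < \<infinity>}"

definition convex_fun :: "(real^'d^'d \<Rightarrow> ennreal) \<Rightarrow> bool" where
  "convex_fun f \<longleftrightarrow>
    (\<forall>A\<in>sym_mats. \<forall>B\<in>sym_mats. \<forall>u\<ge>0. \<forall>v\<ge>0. u + v = 1 \<longrightarrow>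
       f (u *\<^sub>R A + v *\<^sub>R B) \<le> ennreal u * f A + ennreal v * f B)"

definition pos_1_homogeneous :: "(real^'d^'d \<Rightarrow> ennreal) \<Rightarrow> bool" where
  "pos_1_homogeneous f \<longleftrightarrow> (\<forall>A\<in>sym_mats. \<forall>t\<ge>0. f (t *\<^sub>R A) = ennreal t * f A)"

definition lower_semicont :: "(real^'d^'d \<Rightarrow> ennreal) \<Rightarrow> bool" where
  "lower_semicont f \<longleftrightarrow> (\<forall>A\<in>sym_mats. f A \<le> Liminf (at A within sym_mats) f)"

section \<open>Matrix-valued measures\<close>

text \<open>
  A matrix-valued measure is a set function on the \<open>\<sigma>\<close>-algebra of an ordinary measure \<open>M\<close>, of which
  only the \<open>\<sigma>\<close>-algebra matters; its values on non-measurable sets are irrelevant.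
\<close>

definition psd_measures :: "'a measure \<Rightarrow> ('a set \<Rightarrow> real^'d^'d) set" where
  "psd_measures M = {V. (\<forall>E\<in>sets M. V E \<in> psd_mats) \<and>
     (\<forall>A. range A \<subseteq> sets M \<longrightarrow> disjoint_family A \<longrightarrow> (\<lambda>i::nat. V (A i)) sums V (\<Union>i. A i))}"

definition tot_var :: "'a measure \<Rightarrow> ('a set \<Rightarrow> real^'d^'d) \<Rightarrow> 'a measure" where
  "tot_var M V = measure_of (space M) (sets M)
     (\<lambda>E. SUP A \<in> {A. range A \<subseteq> sets M \<and> disjoint_family A \<and> (\<Union>i. A i) = E}.
        \<Sum>i::nat. ennreal (norm (V (A i))))"

text \<open>The density \<open>dV/d|V|\<close>, unique up to \<open>|V|\<close>-null sets.\<close>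

definition polar_density :: "'a measure \<Rightarrow> ('a set \<Rightarrow> real^'d^'d) \<Rightarrow> 'a \<Rightarrow> real^'d^'d" where
  "polar_density M V = (SOME g. g \<in> borel_measurable M \<and> (\<forall>x. g x \<in> sym_mats) \<and>
     integrable (tot_var M V) g \<and> (\<forall>E\<in>sets M. V E = (LINT x:E|tot_var M V. g x)))"

text \<open>\<open>\<integral> \<Phi> : dV\<close>\<close>

definition mat_integral :: "'a measure \<Rightarrow> ('a \<Rightarrow> real^'d^'d) \<Rightarrow> ('a set \<Rightarrow> real^'d^'d) \<Rightarrow> real" where
  "mat_integral M \<Phi> V = (LINT x|tot_var M V. \<Phi> x \<bullet> polar_density M V x)"

section \<open>Probability measures and couplings\<close>

definition P2 :: "(real^'d) measure set" where
  "P2 = {\<mu>. sets \<mu> = sets borel \<and> prob_space \<mu> \<and> (\<integral>\<^sup>+ x. ennreal ((norm x)\<^sup>2) \<partial>\<mu>) < \<infinity>}"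

definition couplings ::
    "(real^'d) measure \<Rightarrow> (real^'d) measure \<Rightarrow> ((real^'d) \<times> (real^'d)) measure set" where
  "couplings \<mu> \<nu> = {\<gamma>. sets \<gamma> = sets borel \<and> prob_space \<gamma> \<and>
     distr \<gamma> borel fst = \<mu> \<and> distr \<gamma> borel snd = \<nu>}"

text \<open>\<open>\<gamma> = \<gamma>\<^sup>x \<otimes> \<mu>\<close>, with \<open>k x = \<gamma>\<^sup>x\<close>\<close>

definition disintegrates ::
    "((real^'d) \<times> (real^'d)) measure \<Rightarrow> (real^'d) measure \<Rightarrow> (real^'d \<Rightarrow> (real^'d) measure) \<Rightarrow> bool" where
  "disintegrates \<gamma> \<mu> k \<longleftrightarrow> k \<in> borel \<rightarrow>\<^sub>M prob_algebra borel \<and>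
     (\<forall>E\<in>sets borel. emeasure \<gamma> E = (\<integral>\<^sup>+ x. emeasure (k x) (Pair x -` E) \<partial>\<mu>))"

definition W2 :: "(real^'d) measure \<Rightarrow> (real^'d) measure \<Rightarrow> real" where
  "W2 \<mu> \<nu> = sqrt (enn2real
     (INF \<gamma>\<in>couplings \<mu> \<nu>. \<integral>\<^sup>+ z. ennreal ((norm (fst z - snd z))\<^sup>2) \<partial>\<gamma>))"

definition W2_open :: "(real^'d) measure set \<Rightarrow> bool" where
  "W2_open U \<longleftrightarrow> U \<subseteq> P2 \<and> (\<forall>\<mu>\<in>U. \<exists>e>0. \<forall>\<nu>\<in>P2. W2 \<mu> \<nu> < e \<longrightarrow> \<nu> \<in> U)"

text \<open>Analytic sets are the empty set and the continuous images of the Baire space.\<close>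

definition analytic_set :: "'a::topological_space set \<Rightarrow> bool" where
  "analytic_set A \<longleftrightarrow> A = {} \<or> (\<exists>h :: (nat \<Rightarrow> nat) \<Rightarrow> 'a. continuous_on UNIV h \<and> A = range h)"

definition analytic_kernels :: "(real^'d \<Rightarrow> (real^'d) measure) set" where
  "analytic_kernels = sigma UNIV {A. analytic_set A} \<rightarrow>\<^sub>M sigma P2 {U. W2_open U}"

section \<open>The Fokker-Planck equation\<close>

definition cyl :: "(real \<times> (real^'d)) measure" where
  "cyl = restrict_space borel ({0<..<1} \<times> UNIV)"

definition P2_cyl :: "(real \<times> (real^'d)) measure set" where
  "P2_cyl = {\<rho>. sets \<rho> = sets cyl \<and> prob_space \<rho> \<and> (\<integral>\<^sup>+ z. ennreal ((norm (snd z))\<^sup>2) \<partial>\<rho>) < \<infinity>}"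

definition time_disint :: "(real \<times> (real^'d)) measure \<Rightarrow> (real \<Rightarrow> (real^'d) measure) \<Rightarrow> bool" where
  "time_disint \<rho> r \<longleftrightarrow> r \<in> restrict_space borel {0<..<1} \<rightarrow>\<^sub>M prob_algebra borel \<and>
     (\<forall>E\<in>sets cyl. emeasure \<rho> E = (\<integral>\<^sup>+ t\<in>{0<..<1}. emeasure (r t) (Pair t -` E) \<partial>lborel))"

definition time_disint_mat ::
    "((real \<times> (real^'d)) set \<Rightarrow> real^'d^'d) \<Rightarrow> (real \<Rightarrow> (real^'d) set \<Rightarrow> real^'d^'d) \<Rightarrow> bool" where
  "time_disint_mat \<Lambda> l \<longleftrightarrow> (\<forall>t\<in>{0<..<1}. l t \<in> psd_measures borel) \<and>
     (\<forall>B\<in>sets borel. (\<lambda>t. l t B) \<in> borel_measurable (restrict_space borel {0<..<1})) \<and>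
     (\<forall>E\<in>sets cyl. \<Lambda> E = (LINT t:{0<..<1}|lborel. l t (Pair t -` E)))"

text \<open>
  Test functions of class \<open>C\<^sub>b\<^sup>1\<^sup>,\<^sup>2\<close> with closed support (the closure taken in \<open>\<real> \<times> \<real>\<^sup>d\<close>) inside
  \<open>(0,1) \<times> \<real>\<^sup>d\<close>; \<open>pt\<close>, \<open>D\<close>, \<open>D2\<close> are the time derivative, the spatial gradient and the spatial Hessian.
  Only \<open>pt\<close> and \<open>D2\<close> are required to be bounded.
\<close>

definition test_function ::
    "(real \<Rightarrow> real^'d \<Rightarrow> real) \<Rightarrow> (real \<Rightarrow> real^'d \<Rightarrow> real) \<Rightarrow> (real \<Rightarrow> real^'d \<Rightarrow> real^'d^'d) \<Rightarrow> bool" where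
  "test_function \<phi> pt D2 \<longleftrightarrow> (\<exists>D :: real \<Rightarrow> real^'d \<Rightarrow> real^'d.
     (\<forall>t\<in>{0<..<1}. \<forall>x.
        ((\<lambda>s. \<phi> s x) has_real_derivative pt t x) (at t) \<and>
        (\<phi> t has_derivative (\<lambda>h. D t x \<bullet> h)) (at x) \<and>
        (D t has_derivative (\<lambda>h. D2 t x *v h)) (at x)) \<and>
     continuous_on ({0<..<1} \<times> UNIV) (\<lambda>(t, x). \<phi> t x) \<and>
     continuous_on ({0<..<1} \<times> UNIV) (\<lambda>(t, x). pt t x) \<and>
     continuous_on ({0<..<1} \<times> UNIV) (\<lambda>(t, x). D t x) \<and>
     continuous_on ({0<..<1} \<times> UNIV) (\<lambda>(t, x). D2 t x)) \<and>
   bounded ((\<lambda>(t, x). pt t x) ` ({0<..<1} \<times> UNIV)) \<and>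
   bounded ((\<lambda>(t, x). D2 t x) ` ({0<..<1} \<times> UNIV)) \<and>
   closure {(t, x). t \<in> {0<..<1} \<and> \<phi> t x \<noteq> 0} \<subseteq> {0<..<1} \<times> UNIV"

text \<open>\<open>(\<rho>, \<Lambda>)\<close> solves the equation, with disintegrations \<open>r t = \<rho>\<^sub>t\<close> and \<open>l t = \<lambda>\<^sub>t\<close>.\<close>

definition fokker_planck ::
    "(real \<times> (real^'d)) measure \<Rightarrow> ((real \<times> (real^'d)) set \<Rightarrow> real^'d^'d) \<Rightarrow>
     (real \<Rightarrow> (real^'d) measure) \<Rightarrow> (real \<Rightarrow> (real^'d) set \<Rightarrow> real^'d^'d) \<Rightarrow> bool" where
  "fokker_planck \<rho> \<Lambda> r l \<longleftrightarrow>
     \<rho> \<in> P2_cyl \<and> \<Lambda> \<in> psd_measures cyl \<and> time_disint \<rho> r \<and> time_disint_mat \<Lambda> l \<and>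
     (\<integral>\<^sup>+ t\<in>{0<..<1}. emeasure (tot_var borel (l t)) UNIV \<partial>lborel) < \<infinity> \<and>
     (\<forall>\<phi> pt D2. test_function \<phi> pt D2 \<longrightarrow>
        (LINT t:{0<..<1}|lborel. (LINT x|r t. pt t x)) =
        - (LINT t:{0<..<1}|lborel. mat_integral borel (\<lambda>x. (1/2) *\<^sub>R D2 t x) (l t)))"

definition narrowly_continuous :: "(real \<Rightarrow> (real^'d) measure) \<Rightarrow> bool" where
  "narrowly_continuous r \<longleftrightarrow>
     (\<forall>g :: real^'d \<Rightarrow> real. continuous_on UNIV g \<longrightarrow> bounded (range g) \<longrightarrow>
        continuous_on {0..1} (\<lambda>t. LINT x|r t. g x))"

section \<open>The costs and the transform\<close>

text \<open>
  The disintegration of \<open>\<rho>\<close> is always the narrowly continuous representative on \<open>[0,1]\<close>, whose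
  endpoint values are the prescribed ones.
\<close>

definition F_cost ::
    "(real^'d^'d \<Rightarrow> ennreal) \<Rightarrow> (real^'d) measure \<Rightarrow> (real^'d) measure \<Rightarrow> ennreal" where
  "F_cost f \<mu> \<nu> =
     (INF (\<rho>, \<Lambda>, r, l) \<in> {(\<rho>, \<Lambda>, r, l). fokker_planck \<rho> \<Lambda> r l \<and>
          narrowly_continuous r \<and> (\<forall>t\<in>{0..1}. r t \<in> P2) \<and> r 0 = \<mu> \<and> r 1 = \<nu>}.
        \<integral>\<^sup>+ t\<in>{0<..<1}. (\<integral>\<^sup>+ x. f (polar_density borel (l t) x) \<partial>tot_var borel (l t)) \<partial>lborel)"

definition G_cost :: "(real^'d^'d \<Rightarrow> ennreal) \<Rightarrow> real^'d \<Rightarrow> (real^'d) measure \<Rightarrow> ennreal" where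
  "G_cost f x p = F_cost f (return borel x) p"

text \<open>
  Here and below, integrals of functions that are only universally measurable are taken against the
  completion of the measure.
\<close>

definition H_cost ::
    "(real^'d^'d \<Rightarrow> ennreal) \<Rightarrow> (real^'d) measure \<Rightarrow> (real^'d) measure \<Rightarrow> ennreal" where
  "H_cost f \<mu> \<nu> =
     (INF (\<gamma>, k) \<in> {(\<gamma>, k). \<gamma> \<in> couplings \<mu> \<nu> \<and> disintegrates \<gamma> \<mu> k}.
        \<integral>\<^sup>+ x. G_cost f x (k x) \<partial>completion \<mu>)"

definition G_transform ::
    "(real^'d^'d \<Rightarrow> ennreal) \<Rightarrow> (real^'d \<Rightarrow> real) \<Rightarrow> real^'d \<Rightarrow> ereal" where
  "G_transform f \<phi> x =
     (INF p\<in>P2. ereal (LINT y|completion p. \<phi> y) + enn2ereal (G_cost f x p))"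

text \<open>
  \<open>\<phi>\<^sup>G\<close> is finite for every \<open>\<phi>\<close> in \<open>Phi_bb2\<close> (defined below), so the conversion to real numbers in
  \<open>\<phi>\<^sup>G\<^sup>G\<close> loses nothing there.
\<close>

definition GG_transform ::
    "(real^'d^'d \<Rightarrow> ennreal) \<Rightarrow> (real^'d \<Rightarrow> real) \<Rightarrow> real^'d \<Rightarrow> ereal" where
  "GG_transform f \<phi> = G_transform f (\<lambda>y. real_of_ereal (G_transform f \<phi> y))"

definition Phi_bb2 :: "(real^'d \<Rightarrow> real) set" where
  "Phi_bb2 = {\<phi>. continuous_on UNIV \<phi> \<and> (\<exists>b. \<forall>x. b \<le> \<phi> x) \<and>
     (\<exists>C>0. \<forall>x. \<bar>\<phi> x\<bar> \<le> C * (1 + (norm x)\<^sup>2))}"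

end

theory Submission
  imports Defs
begin

text \<open>
  All three assertions hold for every such \<open>f\<close>, so they are equivalent.  The reason is a duality
  formula for the cost of moving a Dirac mass: for \<open>p \<in> P2\<close>,
  \<open>G x p\<close> is the supremum of \<open>\<integral>\<psi> dp - \<psi> x\<close> over the functions \<open>\<psi>\<close> of class \<open>C\<^sup>2\<close> with bounded Hessian
  whose half Hessian \<open>D\<^sup>2\<psi>(y)/2\<close> lies, at every \<open>y\<close>, below \<open>f\<close> as a linear form (\<open>dual_fn\<close>, \<open>dual_cost\<close>,
  \<open>G_cost_eq_dual_cost\<close>).

  Weak duality (\<open>dual_cost_le_G_cost\<close>) is the equation tested with \<open>\<psi>\<close>.  For strong duality the dynamic
  problem is replaced by a static one.  A Dirac mass can be joined to \<open>\<nu>\<close> by the segment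
  \<open>(1-t) \<delta>\<^sub>x + t \<nu>\<close>, along which a constant matrix-valued measure \<open>V\<close> solves the equation as soon as
  \<open>\<integral> D\<^sup>2\<psi>/2 : dV = \<integral>\<psi> d\<nu> - \<psi> x\<close> for all \<open>\<psi>\<close> (\<open>G_cost_le_static\<close>); the starting point being a single point
  is what makes the time direction harmless.  A measure \<open>V\<close> of cost at most the dual value is
  obtained by compactness (\<open>static_minimiser\<close>): finitely many test functions and a quadratic
  penalisation give measures with finitely many atoms whose optimality condition is itself a dual
  function (\<open>approximate_solution\<close>), and these converge on the one-point compactification of space.
  No mass escapes to infinity, since testing with \<open>|y|\<^sup>2\<close> fixes the total trace.

  Once \<open>G\<close> is a supremum of expressions \<open>\<integral>\<psi> dp - \<psi> x\<close>, the gluing inequality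
  \<open>G x (\<integral>\<gamma>\<^sup>y dp) \<le> G x p + \<integral> G y \<gamma>\<^sup>y dp\<close> is immediate (\<open>dual_cost_gluing\<close>): it holds for every single
  \<open>\<psi>\<close> with equality, by telescoping.  This is assertion (ii), after the kernel has been seen to be
  measurable for the completion of \<open>p\<close> (\<open>analytic_kernel_measurable\<close>).  Assertion (i) follows by composing
  the kernels of two couplings (\<open>H_cost_triangle\<close>).

  Assertion (iii) needs nearly optimal measures for \<open>\<phi>\<^sup>G(y)\<close> chosen measurably in \<open>y\<close>.  No selection theorem is
  involved: the cost does not increase under translations, so \<open>\<phi>\<^sup>G\<close> is an infimum of functions that are
  continuous in \<open>y\<close>, one for each measure \<open>\<gamma>\<close> of finite cost from the origin, and by the Lindeloef
  property countably many of them suffice (\<open>countable_infimum\<close>, \<open>shift_selection\<close>).  Gluing these nearly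
  optimal kernels to an arbitrary \<open>p\<close> gives \<open>\<phi>\<^sup>G(x) \<le> \<integral>\<phi>\<^sup>G dp + G x p\<close> (\<open>GG_transform_eq\<close>).
\<close>

section \<open>Nonnegative matrices\<close>

lemma quad_form: "v \<bullet> (A *v v) = (\<Sum>i\<in>UNIV. \<Sum>j\<in>UNIV. v$i * A$i$j * v$j)" for A :: "real^'d^'d"
  by (simp add: inner_vec_def matrix_vector_mult_def sum_distrib_left mult.assoc)

lemma sym_mats_iff: "A \<in> sym_mats \<longleftrightarrow> (\<forall>i j. A$i$j = A$j$i)"
  by (auto simp: sym_mats_def transpose_def vec_eq_iff)

lemma closed_sym_mats: "closed (sym_mats :: (real^'d^'d) set)"
proof -
  have eq: "sym_mats = (\<Inter>i. \<Inter>j. {A::real^'d^'d. A$i$j = A$j$i})"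
    by (auto simp: sym_mats_iff)
  show ?thesis
    unfolding eq by (intro closed_INT ballI closed_Collect_eq continuous_intros)
qed

lemma closed_psd_mats: "closed (psd_mats :: (real^'d^'d) set)"
proof -
  have eq: "psd_mats = sym_mats \<inter> (\<Inter>v. {A::real^'d^'d. 0 \<le> v \<bullet> (A *v v)})"
    by (auto simp: psd_mats_def)
  show ?thesis
    unfolding eq quad_form by (intro closed_Int closed_sym_mats closed_INT ballI closed_Collect_le continuous_intros)
qed

lemma psd_imp_sym: "A \<in> psd_mats \<Longrightarrow> A \<in> sym_mats"
  by (simp add: psd_mats_def)

lemma zero_psd [simp]: "0 \<in> psd_mats"
  by (auto simp: psd_mats_def sym_mats_iff)

lemma psd_scale: "A \<in> psd_mats \<Longrightarrow> 0 \<le> c \<Longrightarrow> c *\<^sub>R A \<in> psd_mats"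
  by (auto simp: psd_mats_def sym_mats_iff scaleR_matrix_vector_assoc[symmetric])

lemma sym_scale: "A \<in> sym_mats \<Longrightarrow> c *\<^sub>R A \<in> sym_mats"
  by (auto simp: sym_mats_iff)

lemma sym_add: "A \<in> sym_mats \<Longrightarrow> B \<in> sym_mats \<Longrightarrow> A + B \<in> sym_mats"
  by (auto simp: sym_mats_iff)

lemma psd_diag_nonneg: "A \<in> psd_mats \<Longrightarrow> 0 \<le> A$i$i" for A :: "real^'d^'d"
proof -
  assume "A \<in> psd_mats"
  then have "0 \<le> axis i 1 \<bullet> (A *v axis i 1)" by (auto simp: psd_mats_def)
  then show ?thesis
    by (simp add: matrix_vector_mult_basis inner_axis' column_def)
qed

lemma psd_trace_nonneg: "A \<in> psd_mats \<Longrightarrow> 0 \<le> trace A"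
  by (simp add: trace_def sum_nonneg psd_diag_nonneg)

lemma psd_diag_le_trace: "A \<in> psd_mats \<Longrightarrow> A$i$i \<le> trace A" for A :: "real^'d^'d"
  unfolding trace_def by (rule member_le_sum) (auto simp: psd_diag_nonneg)

text \<open>
  The quadratic form at \<open>e\<^sub>i + e\<^sub>j\<close> and \<open>e\<^sub>i - e\<^sub>j\<close> is nonnegative, which bounds the off-diagonal entry by
  the mean of two diagonal ones.
\<close>

lemma psd_entry_le_trace:
  fixes A :: "real^'d^'d"
  assumes A: "A \<in> psd_mats"
  shows "\<bar>A$i$j\<bar> \<le> trace A"
proof (cases "i = j")
  case True
  then show ?thesis using psd_diag_nonneg[OF A] psd_diag_le_trace[OF A] by simp
next
  case False
  have s: "A$j$i = A$i$j" using A by (auto simp: psd_mats_def sym_mats_iff)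
  have "0 \<le> (axis i 1 + c *\<^sub>R axis j 1) \<bullet> (A *v (axis i 1 + c *\<^sub>R axis j 1))" for c :: real
    using A by (auto simp: psd_mats_def)
  then have q: "0 \<le> A$i$i + 2 * c * A$i$j + c * c * A$j$j" for c
    using s by (simp add: matrix_vector_right_distrib matrix_vector_mult_scaleR
        matrix_vector_mult_basis inner_add_left inner_add_right inner_axis' column_def algebra_simps)
  have "A$i$i + A$j$j \<le> 2 * trace A"
    using psd_diag_le_trace[OF A, of i] psd_diag_le_trace[OF A, of j] by simp
  with q[of 1] q[of "-1"] show ?thesis by (simp add: abs_le_iff)
qed

lemma norm_psd_le:
  fixes A :: "real^'d^'d"
  assumes A: "A \<in> psd_mats"
  shows "norm A \<le> real CARD('d) * real CARD('d) * trace A"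
proof -
  have "norm A \<le> (\<Sum>i\<in>UNIV. norm (A$i))" unfolding norm_vec_def by (rule L2_set_le_sum) simp
  also have "\<dots> \<le> (\<Sum>i\<in>UNIV. \<Sum>j\<in>UNIV. \<bar>A$i$j\<bar>)"
    by (intro sum_mono norm_le_l1_cart)
  also have "\<dots> \<le> (\<Sum>i\<in>(UNIV::'d set). \<Sum>j\<in>(UNIV::'d set). trace A)"
    by (intro sum_mono psd_entry_le_trace[OF A])
  finally show ?thesis by (simp add: mult.assoc)
qed

lemma mat_1_inner: "mat 1 \<bullet> A = trace A" for A :: "real^'d^'d"
proof -
  have "mat 1 \<bullet> A = (\<Sum>i\<in>UNIV. \<Sum>j\<in>UNIV. (if i = j then A$i$j else 0))"
    unfolding inner_vec_def mat_def by (intro sum.cong refl) (auto simp: inner_vec_def if_distrib cong: if_cong)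
  also have "\<dots> = trace A" by (simp add: trace_def)
  finally show ?thesis .
qed

section \<open>Linear minorants\<close>

text \<open>
  The matrices \<open>B\<close> whose linear form \<open>A \<mapsto> B : A\<close> lies below \<open>f\<close>.  Negative values of the form
  become \<open>0\<close> under \<open>ennreal\<close>, which is harmless as \<open>f \<ge> 0\<close>.
\<close>

definition minorants :: "(real^'d^'d \<Rightarrow> ennreal) \<Rightarrow> (real^'d^'d) set" where
  "minorants f = {B. \<forall>A\<in>sym_mats. ennreal (B \<bullet> A) \<le> f A}"

lemma closed_epigraph:
  fixes f :: "real^'d^'d \<Rightarrow> ennreal"
  assumes lsc: "lower_semicont f"
  shows "closed {(A, r). A \<in> sym_mats \<and> 0 \<le> r \<and> f A \<le> ennreal r}"
  unfolding closed_sequential_limits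
proof (intro allI impI, elim conjE)
  fix z :: "nat \<Rightarrow> (real^'d^'d) \<times> real" and l
  assume z: "\<forall>n. z n \<in> {(A, r). A \<in> sym_mats \<and> 0 \<le> r \<and> f A \<le> ennreal r}" and lim: "z \<longlonglongrightarrow> l"
  obtain A r where l: "l = (A, r)" by (cases l)
  have zA: "(\<lambda>n. fst (z n)) \<longlonglongrightarrow> A" using tendsto_fst[OF lim] l by simp
  have zr: "(\<lambda>n. snd (z n)) \<longlonglongrightarrow> r" using tendsto_snd[OF lim] l by simp
  have zz: "fst (z n) \<in> sym_mats" "0 \<le> snd (z n)" "f (fst (z n)) \<le> ennreal (snd (z n))" for n
    using z[rule_format, of n] by (simp_all add: case_prod_beta)
  have A: "A \<in> sym_mats" by (rule closed_sequentially[OF closed_sym_mats _ zA]) (rule zz(1))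
  have r: "0 \<le> r" by (rule LIMSEQ_le_const[OF zr]) (use zz(2) in blast)
  have "f A \<le> ennreal r"
  proof (rule ccontr)
    assume "\<not> f A \<le> ennreal r"
    then obtain y where y: "ennreal r < y" "y < f A" using dense not_le by metis
    have "y < Liminf (at A within sym_mats) f"
      using y(2) lsc A by (auto simp: lower_semicont_def intro: less_le_trans)
    then have ev: "eventually (\<lambda>B. y < f B) (at A within sym_mats)" by (rule less_LiminfD)
    then obtain U where U: "open U" "A \<in> U" "\<And>B. B \<in> U \<Longrightarrow> B \<noteq> A \<Longrightarrow> B \<in> sym_mats \<Longrightarrow> y < f B"
      unfolding eventually_at_topological by blast
    have "eventually (\<lambda>n. fst (z n) \<in> U) sequentially" using topological_tendstoD[OF zA U(1,2)] .
    moreover have "eventually (\<lambda>n. ennreal (snd (z n)) < y) sequentially"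
      using order_tendstoD(2)[OF tendsto_ennrealI[OF zr] y(1)] .
    ultimately have "eventually (\<lambda>n. False) sequentially"
    proof eventually_elim
      case (elim n)
      have "y < f (fst (z n))"
        using U(3)[of "fst (z n)"] zz(1)[of n] y(2) elim(1) by (cases "fst (z n) = A") auto
      also have "\<dots> \<le> ennreal (snd (z n))" by (rule zz(3))
      also have "\<dots> < y" by (rule elim(2))
      finally have "y < y" .
      then show ?case by simp
    qed
    then show False by simp
  qed
  with A r l show "l \<in> {(A, r). A \<in> sym_mats \<and> 0 \<le> r \<and> f A \<le> ennreal r}" by simp
qed

text \<open>
  The epigraph of \<open>f\<close> is a closed convex cone; a hyperplane that strictly separates a point below the
  graph from it passes, by homogeneity, through the origin, and is the graph of a linear minorant.
\<close>

lemma minorant_above: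
  fixes f :: "real^'d^'d \<Rightarrow> ennreal"
  assumes conv: "convex_fun f" and hom: "pos_1_homogeneous f" and lsc: "lower_semicont f"
    and A: "A \<in> sym_mats" "f A < \<infinity>" and c: "ennreal c < f A" "0 \<le> c"
  shows "\<exists>B\<in>minorants f. c < B \<bullet> A"
proof -
  let ?E = "{(A, r). A \<in> sym_mats \<and> 0 \<le> r \<and> f A \<le> ennreal r}"
  have f0: "f 0 = 0"
    using hom A(1) by (simp add: pos_1_homogeneous_def) (metis scaleR_zero_left order_refl ennreal_0 mult_zero_left)
  have cE: "convex ?E"
    unfolding convex_def
  proof (intro ballI allI impI)
    fix x y and u v :: real
    assume xE: "x \<in> ?E" and yE: "y \<in> ?E" and uv: "0 \<le> u" "0 \<le> v" "u + v = 1"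
    obtain A1 r1 where x: "x = (A1, r1)" by (cases x)
    obtain A2 r2 where y: "y = (A2, r2)" by (cases y)
    have h: "A1 \<in> sym_mats" "0 \<le> r1" "f A1 \<le> ennreal r1" "A2 \<in> sym_mats" "0 \<le> r2" "f A2 \<le> ennreal r2"
      using xE yE x y by auto
    have "f (u *\<^sub>R A1 + v *\<^sub>R A2) \<le> ennreal u * f A1 + ennreal v * f A2"
      using conv h uv by (auto simp: convex_fun_def)
    also have "\<dots> \<le> ennreal u * ennreal r1 + ennreal v * ennreal r2"
      using h uv by (intro add_mono mult_left_mono) auto
    also have "\<dots> = ennreal (u * r1 + v * r2)"
      using h uv by (simp add: ennreal_mult[symmetric] ennreal_plus[symmetric] del: ennreal_plus)
    finally show "u *\<^sub>R x + v *\<^sub>R y \<in> ?E"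
      using h uv by (auto simp: x y intro!: sym_add sym_scale)
  qed
  have "(A, c) \<notin> ?E" using c by auto
  from separating_hyperplane_closed_point[OF cE closed_epigraph[OF lsc] this]
  obtain w b where w: "w \<bullet> (A, c) < b" "\<forall>x\<in>?E. b < w \<bullet> x" by blast
  obtain P \<alpha> where P: "w = (P, \<alpha>)" by (cases w)
  have s1: "P \<bullet> A + \<alpha> * c < b" using w(1) by (simp add: P)
  have s2: "b < P \<bullet> X + \<alpha> * r" if "X \<in> sym_mats" "0 \<le> r" "f X \<le> ennreal r" for X r
    using bspec[OF w(2), of "(X, r)"] that by (simp add: P)
  have b: "b < 0" using s2[of 0 0] f0 by (auto simp: sym_mats_iff)
  have s3: "0 \<le> P \<bullet> X + \<alpha> * r" if "X \<in> sym_mats" "0 \<le> r" "f X \<le> ennreal r" for X r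
  proof (rule ccontr)
    assume neg: "\<not> ?thesis"
    define t where "t = b / (P \<bullet> X + \<alpha> * r)"
    have t: "0 \<le> t" using neg b by (simp add: t_def divide_nonpos_neg)
    have "f (t *\<^sub>R X) \<le> ennreal (t * r)"
      using hom that t by (simp add: pos_1_homogeneous_def ennreal_mult mult_left_mono)
    from s2[OF sym_scale[OF that(1)] _ this] t that have "b < t * (P \<bullet> X + \<alpha> * r)"
      by (simp add: algebra_simps)
    also have "\<dots> = b" using neg by (simp add: t_def)
    finally show False by simp
  qed
  obtain a where a: "f A = ennreal a" "0 \<le> a" using A(2) by (cases "f A") auto
  have "\<alpha> > 0"
  proof (rule ccontr)
    assume "\<not> \<alpha> > 0"
    moreover have "c \<le> a" using c a by (simp add: ennreal_less_iff)
    ultimately have "\<alpha> * a \<le> \<alpha> * c" by (simp add: mult_left_mono_neg)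
    then show False using s3[of A a] A a s1 b by simp
  qed
  define B where "B = - (P /\<^sub>R \<alpha>)"
  have "B \<in> minorants f"
    unfolding minorants_def
  proof (intro CollectI ballI)
    fix X :: "real^'d^'d" assume X: "X \<in> sym_mats"
    show "ennreal (B \<bullet> X) \<le> f X"
    proof (cases "f X")
      case (real r)
      then have "0 \<le> P \<bullet> X + \<alpha> * r" using s3[OF X] by simp
      then have "B \<bullet> X \<le> r" using \<open>\<alpha> > 0\<close> by (simp add: B_def divide_simps mult.commute)
      then show ?thesis using real by (simp add: ennreal_leI)
    qed simp
  qed
  moreover have "c < B \<bullet> A"
    using s1 b \<open>\<alpha> > 0\<close> by (simp add: B_def divide_simps mult.commute)
  ultimately show ?thesis by blast
qed

text \<open>
  The set of minorants is separable, so the supremum of all linear minorants, which is \<open>f\<close>, is already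
  attained by a dense sequence.  Starting the sequence at \<open>0\<close> keeps the finite maxima nonnegative.
\<close>

lemma minorants_sup:
  fixes f :: "real^'d^'d \<Rightarrow> ennreal"
  assumes conv: "convex_fun f" and hom: "pos_1_homogeneous f" and lsc: "lower_semicont f"
    and dom: "fin_dom f = psd_mats"
  obtains B :: "nat \<Rightarrow> real^'d^'d" where "B 0 = 0" "range B \<subseteq> minorants f"
    "\<And>A. A \<in> psd_mats \<Longrightarrow> f A = (SUP i. ennreal (B i \<bullet> A))"
proof -
  obtain T where T: "countable T" "T \<subseteq> minorants f" "minorants f \<subseteq> closure T"
    using separable[of "minorants f"] by blast
  have 0: "0 \<in> minorants f" by (simp add: minorants_def)
  define B where "B = from_nat_into (insert 0 T)"
  define B' where "B' = case_nat 0 B"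
  have rB: "range B = insert 0 T" using T(1) by (simp add: B_def)
  have rB': "range B' = insert 0 T"
  proof -
    have "range B' = insert (B' 0) (range (\<lambda>n. B' (Suc n)))" by (metis UNIV_nat_eq image_insert image_image)
    then show ?thesis using rB by (simp add: B'_def)
  qed
  show thesis
  proof
    show "B' 0 = 0" by (simp add: B'_def)
    show "range B' \<subseteq> minorants f" using rB' T(2) 0 by auto
    fix A :: "real^'d^'d" assume A: "A \<in> psd_mats"
    have As: "A \<in> sym_mats" using A by (rule psd_imp_sym)
    have fA: "f A < \<infinity>" using A dom by (auto simp: fin_dom_def)
    show "f A = (SUP i. ennreal (B' i \<bullet> A))"
    proof (rule antisym)
      show "(SUP i. ennreal (B' i \<bullet> A)) \<le> f A"
        using \<open>range B' \<subseteq> minorants f\<close> As by (auto intro!: SUP_least simp: minorants_def)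
      show "f A \<le> (SUP i. ennreal (B' i \<bullet> A))"
      proof (rule ccontr)
        assume "\<not> ?thesis"
        then have lt: "(SUP i. ennreal (B' i \<bullet> A)) < f A" by simp
        then obtain c where c: "0 \<le> c" "(SUP i. ennreal (B' i \<bullet> A)) = ennreal c"
          by (cases "SUP i. ennreal (B' i \<bullet> A)") auto
        obtain C where C: "C \<in> minorants f" "c < C \<bullet> A"
          using minorant_above[OF conv hom lsc As fA] lt c by auto
        have "open {C. c < C \<bullet> A}" by (intro open_Collect_less continuous_intros)
        moreover have "C \<in> closure T" using C(1) T(3) by auto
        ultimately obtain C' where "C' \<in> T" "c < C' \<bullet> A"
          using C(2) open_Int_closure_eq_empty[of "{C. c < C \<bullet> A}" T] by auto
        then obtain i where "c < B' i \<bullet> A" using rB' by (metis insert_iff rangeE)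
        then have "ennreal c < ennreal (B' i \<bullet> A)" using c(1) by (simp add: ennreal_lessI)
        also have "\<dots> \<le> (SUP i. ennreal (B' i \<bullet> A))" by (rule SUP_upper) simp
        finally show False using c by simp
      qed
    qed
  qed
qed

section \<open>Measures with values in the nonnegative matrices\<close>

lemma psd_measures_in_psd: "V \<in> psd_measures M \<Longrightarrow> E \<in> sets M \<Longrightarrow> V E \<in> psd_mats"
  by (simp add: psd_measures_def)

lemma psd_measures_sums:
  "V \<in> psd_measures M \<Longrightarrow> range A \<subseteq> sets M \<Longrightarrow> disjoint_family A \<Longrightarrow> (\<lambda>i::nat. V (A i)) sums V (\<Union>i. A i)"
  by (simp add: psd_measures_def)

lemma measure_of_nonneg_set_function:
  fixes h :: "'a set \<Rightarrow> real"
  assumes nn: "\<And>E. E \<in> sets M \<Longrightarrow> 0 \<le> h E"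
    and sums: "\<And>A. range A \<subseteq> sets M \<Longrightarrow> disjoint_family A \<Longrightarrow> (\<lambda>i::nat. h (A i)) sums h (\<Union>i. A i)"
  obtains N where "finite_measure N" "sets N = sets M" "\<And>E. E \<in> sets M \<Longrightarrow> emeasure N E = ennreal (h E)"
proof -
  define N where "N = measure_of (space M) (sets M) (\<lambda>E. ennreal (h E))"
  have sN: "sets N = sets M" "space N = space M" by (simp_all add: N_def)
  have "(\<lambda>i::nat. h {}) sums h {}"
    using sums[of "\<lambda>i. {}"] by (simp add: disjoint_family_on_def)
  then have h0: "h {} = 0" by (simp add: sums_iff summable_const_iff)
  have em: "emeasure N E = ennreal (h E)" if "E \<in> sets M" for E
    unfolding N_def
  proof (rule emeasure_measure_of_sigma)
    show "positive (sets M) (\<lambda>E. ennreal (h E))" by (simp add: positive_def h0)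
    show "countably_additive (sets M) (\<lambda>E. ennreal (h E))"
    proof (rule countably_additiveI)
      fix A :: "nat \<Rightarrow> 'a set" assume A: "range A \<subseteq> sets M" "disjoint_family A"
      show "(\<Sum>i. ennreal (h (A i))) = ennreal (h (\<Union>i. A i))"
        using A(1) by (intro suminf_ennreal_eq sums[OF A]) (auto intro: nn)
    qed
  qed (use that in \<open>auto simp: sets.sigma_algebra_axioms\<close>)
  have "finite_measure N" by (rule finite_measureI) (simp add: sN em)
  then show thesis using that sN em by blast
qed

lemma inner_psd_measure_sums:
  assumes V: "V \<in> psd_measures M" and "range A \<subseteq> sets M" "disjoint_family A"
  shows "(\<lambda>i::nat. B \<bullet> V (A i)) sums (B \<bullet> V (\<Union>i. A i))"
  using bounded_linear.sums[OF bounded_linear_inner_right psd_measures_sums[OF assms]] .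

lemma inner_axis_axis: "axis i (axis j 1) \<bullet> A = A $ i $ j" for A :: "real^'d^'d"
  by (simp add: inner_axis')

lemma matrix_axis_sum: "A = (\<Sum>i\<in>UNIV. \<Sum>j\<in>UNIV. (A $ i $ j) *\<^sub>R axis i (axis j 1))" for A :: "real^'d^'d"
proof -
  have "(\<Sum>i\<in>UNIV. \<Sum>j\<in>UNIV. (A $ i $ j) *\<^sub>R (axis i (axis j 1) :: real^'d^'d)) $ k $ l = A $ k $ l" for k l
  proof -
    have "(\<Sum>i\<in>UNIV. \<Sum>j\<in>UNIV. (A $ i $ j) *\<^sub>R (axis i (axis j 1) :: real^'d^'d)) $ k $ l
      = (\<Sum>i\<in>UNIV. \<Sum>j\<in>UNIV. if i = k then (if j = l then A $ i $ j else 0) else 0)"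
      unfolding sum_component by (intro sum.cong refl) (auto simp: axis_def)
    also have "\<dots> = (\<Sum>i\<in>UNIV. if i = k then A $ k $ l else 0)"
      by (intro sum.cong refl) auto
    finally show ?thesis by simp
  qed
  then show ?thesis by (simp add: vec_eq_iff)
qed

text \<open>
  The trace of a nonnegative matrix measure is a finite scalar measure that dominates every entry,
  so Radon-Nikodym applies entrywise.  That the density takes values in the nonnegative matrices
  with bounded norm follows from the same property of all its averages.
\<close>

lemma psd_measure_density:
  fixes V :: "'a set \<Rightarrow> real^'d^'d"
  assumes V: "V \<in> psd_measures M"
  obtains \<tau> g where "finite_measure \<tau>" "sets \<tau> = sets M"
    "\<And>E. E \<in> sets M \<Longrightarrow> emeasure \<tau> E = ennreal (trace (V E))"
    "g \<in> borel_measurable M" "\<And>x. g x \<in> psd_mats"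
    "\<And>x. norm (g x) \<le> real CARD('d) * real CARD('d)" "integrable \<tau> g"
    "\<And>E. E \<in> sets M \<Longrightarrow> V E = (LINT x:E|\<tau>. g x)"
proof -
  let ?K = "real CARD('d) * real CARD('d)"
  obtain \<tau> where \<tau>: "finite_measure \<tau>" "sets \<tau> = sets M"
    and em: "\<And>E. E \<in> sets M \<Longrightarrow> emeasure \<tau> E = ennreal (mat 1 \<bullet> V E)"
  proof (rule measure_of_nonneg_set_function[of M "\<lambda>E. mat 1 \<bullet> V E"])
    show "0 \<le> mat 1 \<bullet> V E" if "E \<in> sets M" for E
      by (simp add: mat_1_inner psd_trace_nonneg psd_measures_in_psd[OF V that])
  qed (use inner_psd_measure_sums[OF V] in auto)
  interpret \<tau>: finite_measure \<tau> by fact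
  have sp: "space \<tau> = space M" using \<tau>(2) by (rule sets_eq_imp_space_eq)
  have em': "emeasure \<tau> E = ennreal (trace (V E))" if "E \<in> sets M" for E
    using em[OF that] by (simp add: mat_1_inner)
  have m': "measure \<tau> E = trace (V E)" if "E \<in> sets M" for E
    using em'[OF that] psd_trace_nonneg[OF psd_measures_in_psd[OF V that]] by (simp add: measure_def)
  have "\<exists>u. integrable \<tau> u \<and> (\<forall>E\<in>sets M. V E $ i $ j = (LINT x:E|\<tau>. u x))" for i j
  proof -
    let ?h = "\<lambda>E. (axis i (axis j 1) + mat 1) \<bullet> V E"
    have h: "?h E = V E $ i $ j + trace (V E)" for E
      by (simp add: inner_add_left inner_axis_axis mat_1_inner)
    have hE: "0 \<le> ?h E" "?h E \<le> 2 * trace (V E)" if "E \<in> sets M" for E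
      using psd_entry_le_trace[OF psd_measures_in_psd[OF V that], of i j] unfolding h by linarith+
    obtain N where N: "finite_measure N" "sets N = sets M" and
      emN: "\<And>E. E \<in> sets M \<Longrightarrow> emeasure N E = ennreal (?h E)"
      using measure_of_nonneg_set_function[of M ?h] hE(1) inner_psd_measure_sums[OF V] by metis
    have "absolutely_continuous \<tau> N"
      unfolding absolutely_continuous_def
    proof
      fix E assume "E \<in> null_sets \<tau>"
      then have E: "E \<in> sets M" "emeasure \<tau> E = 0" using \<tau>(2) by auto
      then have "trace (V E) \<le> 0" using em'[OF E(1)] by (simp add: ennreal_eq_0_iff)
      then have "?h E \<le> 0" using hE[OF E(1)] by linarith
      then show "E \<in> null_sets N" using E emN[OF E(1)] N(2) by (auto simp: ennreal_eq_0_iff)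
    qed
    then obtain f where f: "f \<in> borel_measurable \<tau>" "density \<tau> f = N"
      using \<tau>.Radon_Nikodym_finite_measure[OF N(1)] N(2) \<tau>(2) by auto
    have fin: "(\<integral>\<^sup>+x. f x \<partial>\<tau>) < \<infinity>"
    proof -
      have "(\<integral>\<^sup>+x. f x \<partial>\<tau>) = emeasure N (space M)"
        using f \<tau>(2) sp by (auto simp: f(2)[symmetric] emeasure_density intro!: nn_integral_cong)
      then show ?thesis using emN[of "space M"] by simp
    qed
    then have ae: "AE x in \<tau>. f x \<noteq> \<infinity>" using nn_integral_PInf_AE[OF f(1)] by auto
    define u where "u x = enn2real (f x) - 1" for x
    have f': "(\<lambda>x. enn2real (f x)) \<in> borel_measurable \<tau>" using f(1) by measurable
    have nf: "(\<integral>\<^sup>+x. ennreal (enn2real (f x)) * indicator E x \<partial>\<tau>) = emeasure N E" if "E \<in> sets M" for E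
      unfolding f(2)[symmetric] using that \<tau>(2) f(1)
      by (subst emeasure_density) (auto intro!: nn_integral_cong_AE intro: AE_mp[OF ae] simp: less_top)
    have if': "integrable \<tau> (\<lambda>x. enn2real (f x))"
    proof (rule integrableI_nonneg)
      have "(\<integral>\<^sup>+x. ennreal (enn2real (f x)) \<partial>\<tau>) = (\<integral>\<^sup>+x. f x \<partial>\<tau>)"
        by (rule nn_integral_cong_AE, rule AE_mp[OF ae], rule AE_I2) (auto simp: less_top)
      then show "(\<integral>\<^sup>+x. ennreal (enn2real (f x)) \<partial>\<tau>) < \<infinity>" using fin by simp
    qed (use f' in auto)
    have iu: "integrable \<tau> u" unfolding u_def using if' by (intro Bochner_Integration.integrable_diff) auto
    moreover have "V E $ i $ j = (LINT x:E|\<tau>. u x)" if E: "E \<in> sets M" for E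
    proof -
      have E': "E \<in> sets \<tau>" using E \<tau>(2) by simp
      have "(LINT x|\<tau>. enn2real (f x) * indicator E x) = enn2real (emeasure N E)"
        using nf[OF E] by (subst integral_eq_nn_integral) (use f' E' in \<open>auto simp: ennreal_mult ennreal_indicator\<close>)
      then have 1: "(LINT x:E|\<tau>. enn2real (f x)) = ?h E"
        using emN[OF E] hE[OF E] by (simp add: set_lebesgue_integral_def mult.commute)
      have "(LINT x:E|\<tau>. u x) = (LINT x:E|\<tau>. enn2real (f x)) - (LINT x:E|\<tau>. 1)"
        unfolding u_def using if' E' 
        by (intro set_integral_diff) (simp_all add: set_integrable_def integrable_mult_indicator if' del: real_scaleR_def)
      also have "(LINT x:E|\<tau>. (1::real)) = trace (V E)"
        using E' m'[OF E] by (simp add: set_lebesgue_integral_def Int_absorb2 sets.sets_into_space)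
      finally show ?thesis using 1 by (simp add: h)
    qed
    ultimately show ?thesis by blast
  qed
  then have "\<forall>i j. \<exists>u. integrable \<tau> u \<and> (\<forall>E\<in>sets M. V E $ i $ j = (LINT x:E|\<tau>. u x))" by blast
  then obtain u where "\<forall>i j. integrable \<tau> (u i j) \<and> (\<forall>E\<in>sets M. V E $ i $ j = (LINT x:E|\<tau>. u i j x))"
    unfolding choice_iff by blast
  then have iu: "\<And>i j. integrable \<tau> (u i j)"
    and u: "\<And>i j E. E \<in> sets M \<Longrightarrow> V E $ i $ j = (LINT x:E|\<tau>. u i j x)" by blast+
  define g0 where "g0 x = (\<Sum>i\<in>UNIV. \<Sum>j\<in>UNIV. u i j x *\<^sub>R (axis i (axis j 1) :: real^'d^'d))" for x
  have ig0: "integrable \<tau> g0" unfolding g0_def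
    by (intro Bochner_Integration.integrable_sum integrable_scaleR_left iu)
  have g0: "V E = (LINT x:E|\<tau>. g0 x)" if E: "E \<in> sets M" for E
  proof -
    have E': "E \<in> sets \<tau>" using E \<tau>(2) by simp
    have ind: "integrable \<tau> (\<lambda>x. indicator E x * u i j x)" for i j
      using integrable_mult_indicator[OF E' iu[of i j]] by simp
    have "(LINT x:E|\<tau>. g0 x) = (LINT x|\<tau>. (\<Sum>i\<in>UNIV. \<Sum>j\<in>UNIV. (indicator E x * u i j x) *\<^sub>R (axis i (axis j 1) :: real^'d^'d)))"
      unfolding set_lebesgue_integral_def g0_def by (simp add: scaleR_sum_right)
    also have "\<dots> = (\<Sum>i\<in>UNIV. \<Sum>j\<in>UNIV. (LINT x|\<tau>. indicator E x * u i j x) *\<^sub>R axis i (axis j 1))"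
      using ind by (subst Bochner_Integration.integral_sum | intro Bochner_Integration.integrable_sum integrable_scaleR_left sum.cong refl | simp)+
    also have "\<dots> = V E"
      using u[OF E] by (subst (2) matrix_axis_sum) (simp add: set_lebesgue_integral_def)
    finally show ?thesis by simp
  qed
  let ?S = "psd_mats \<inter> cball 0 ?K :: (real^'d^'d) set"
  have ae: "AE x in \<tau>. g0 x \<in> ?S"
  proof (rule \<tau>.averaging_theorem[OF ig0])
    show "closed ?S" by (intro closed_Int closed_psd_mats closed_cball)
    fix A assume A: "A \<in> sets \<tau>" "0 < measure \<tau> A"
    have AM: "A \<in> sets M" using A \<tau>(2) by simp
    let ?X = "(1 / measure \<tau> A) *\<^sub>R V A"
    have X: "?X \<in> psd_mats" by (intro psd_scale psd_measures_in_psd[OF V AM]) simp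
    moreover have "norm ?X \<le> ?K"
    proof -
      have "trace ?X = 1" using m'[OF AM] A(2)
        by (simp add: mat_1_inner[symmetric])
      then show ?thesis using norm_psd_le[OF X] by simp
    qed
    ultimately show "(1 / measure \<tau> A) *\<^sub>R set_lebesgue_integral \<tau> A g0 \<in> ?S"
      using g0[OF AM] by simp
  qed
  define g where "g x = (if g0 x \<in> ?S then g0 x else 0)" for x
  have mg0: "g0 \<in> borel_measurable \<tau>" using ig0 by auto
  have "?S \<in> sets borel" by (intro borel_closed closed_Int closed_psd_mats closed_cball)
  then have "(\<lambda>y. if y \<in> ?S then y else 0) \<in> borel_measurable borel"
    by (intro measurable_If_set) auto
  from measurable_compose[OF mg0 this] have mg: "g \<in> borel_measurable \<tau>" unfolding g_def .
  have aeg: "AE x in \<tau>. g x = g0 x" using ae by eventually_elim (simp add: g_def)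
  show thesis
  proof
    show "g \<in> borel_measurable M" using mg \<tau>(2) by (simp cong: measurable_cong_sets)
    show "integrable \<tau> g" using ig0 aeg mg mg0 by (subst integrable_cong_AE[of g \<tau> g0]) auto
    show "V E = (LINT x:E|\<tau>. g x)" if "E \<in> sets M" for E
      unfolding g0[OF that] set_lebesgue_integral_def
      using aeg mg mg0 that \<tau>(2) by (intro integral_cong_AE) (auto intro!: borel_measurable_scaleR)
    show "g x \<in> psd_mats" "norm (g x) \<le> ?K" for x by (auto simp: g_def)
  qed (use \<tau> em' in auto)
qed

text \<open>
  Partitions on which the density is nearly constant, taken from a countable dense set of matrices,
  show that the supremum over partitions reaches \<open>\<integral>|g| dN\<close>.
\<close>

lemma tot_var_eq_density:
  fixes V :: "'a set \<Rightarrow> real^'d^'d"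
  assumes N: "finite_measure N" "sets N = sets M" and g: "integrable N g"
    and V: "\<And>E. E \<in> sets M \<Longrightarrow> V E = (LINT x:E|N. g x)"
  shows "tot_var M V = density N (\<lambda>x. ennreal (norm (g x)))"
proof -
  interpret finite_measure N by fact
  let ?D = "density N (\<lambda>x. ennreal (norm (g x)))"
  have mg[measurable]: "g \<in> borel_measurable N" using g by auto
  have D: "emeasure ?D E = (\<integral>\<^sup>+x. ennreal (norm (g x)) * indicator E x \<partial>N)" if "E \<in> sets N" for E
    using that by (intro emeasure_density) auto
  have intE: "set_integrable N E g" if "E \<in> sets N" for E
    using integrable_mult_indicator[OF that g] by (simp add: set_integrable_def)
  have le: "(\<Sum>i. ennreal (norm (V (A i)))) \<le> emeasure ?D E"
    if A: "range A \<subseteq> sets M" "disjoint_family A" "(\<Union>i::nat. A i) = E" for A E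
  proof -
    have "ennreal (norm (V (A i))) \<le> emeasure ?D (A i)" for i
    proof -
      have Ai: "A i \<in> sets M" "A i \<in> sets N" using A N(2) by auto
      have "ennreal (norm (V (A i))) \<le> (\<integral>\<^sup>+x. ennreal (norm (indicator (A i) x *\<^sub>R g x)) \<partial>N)"
        unfolding V[OF Ai(1)] set_lebesgue_integral_def
        by (rule integral_norm_bound_ennreal) (use intE[OF Ai(2)] in \<open>simp add: set_integrable_def\<close>)
      also have "\<dots> = emeasure ?D (A i)" unfolding D[OF Ai(2)]
        by (intro nn_integral_cong) (auto simp: indicator_def)
      finally show ?thesis .
    qed
    then have "(\<Sum>i. ennreal (norm (V (A i)))) \<le> (\<Sum>i. emeasure ?D (A i))"
      by (intro suminf_le) auto
    also have "\<dots> = emeasure ?D E" using A N(2) by (subst suminf_emeasure) auto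
    finally show ?thesis .
  qed
  have ge: "emeasure ?D E \<le> (SUP A \<in> {A. range A \<subseteq> sets M \<and> disjoint_family A \<and> (\<Union>i. A i) = E}.
        \<Sum>i::nat. ennreal (norm (V (A i))))" (is "_ \<le> ?S") if E: "E \<in> sets M" for E
  proof (rule ennreal_le_epsilon)
    fix e :: real assume e: "0 < e"
    have E': "E \<in> sets N" using E N(2) by simp
    define \<epsilon> where "\<epsilon> = e / (2 * (measure N E + 1))"
    have \<epsilon>: "0 < \<epsilon>" "2 * \<epsilon> * measure N E \<le> e"
      using e by (auto simp: \<epsilon>_def field_simps add_pos_nonneg)
    obtain Q :: "(real^'d^'d) set" where Q: "countable Q" "\<And>X. open X \<Longrightarrow> X \<noteq> {} \<Longrightarrow> \<exists>d\<in>Q. d \<in> X"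
      using countable_dense_setE by blast
    have Qne: "Q \<noteq> {}" using Q(2)[of UNIV] by auto
    define q where "q = from_nat_into Q"
    have q: "\<exists>k. dist (q k) y < \<epsilon>" for y
    proof -
      obtain d where "d \<in> Q" "d \<in> ball y \<epsilon>" using Q(2)[of "ball y \<epsilon>"] \<epsilon>(1) by auto
      moreover have "range q = Q" unfolding q_def using Q(1) Qne by (simp add: range_from_nat_into)
      ultimately show ?thesis by (metis dist_commute imageE mem_ball)
    qed
    define A where "A k = E \<inter> (g -` disjointed (\<lambda>k. ball (q k) \<epsilon>) k \<inter> space N)" for k
    have B: "disjointed (\<lambda>k. ball (q k) \<epsilon>) k \<in> sets borel" for k
    proof -
      have "range (\<lambda>k. ball (q k) \<epsilon>) \<subseteq> sets borel" by auto
      then have "range (disjointed (\<lambda>k. ball (q k) \<epsilon>)) \<subseteq> sets borel"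
        by (rule sets.range_disjointed_sets)
      then show ?thesis by auto
    qed
    have AN: "A k \<in> sets N" for k unfolding A_def using E' B measurable_sets[OF mg B] by auto
    then have A1: "range A \<subseteq> sets M" using N(2) by auto
    have A2: "disjoint_family A"
      using disjoint_family_disjointed[of "\<lambda>k. ball (q k) \<epsilon>"] unfolding A_def disjoint_family_on_def by blast
    have A3: "(\<Union>k. A k) = E"
    proof -
      have "(\<Union>k. disjointed (\<lambda>k. ball (q k) \<epsilon>) k) = UNIV" unfolding UN_disjointed_eq using q by auto
      then have "\<exists>k. g x \<in> disjointed (\<lambda>k. ball (q k) \<epsilon>) k" for x by blast
      then show ?thesis unfolding A_def using sets.sets_into_space[OF E'] by auto
    qed
    have near: "dist (q k) (g x) < \<epsilon>" if "x \<in> A k" for x k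
      using that disjointed_subset[of "\<lambda>k. ball (q k) \<epsilon>" k] by (auto simp: A_def)
    have step: "emeasure ?D (A k) \<le> ennreal (norm (V (A k))) + ennreal (2 * \<epsilon>) * emeasure N (A k)" for k
    proof -
      let ?I = "\<lambda>x. indicator (A k) x :: real"
      have i1: "integrable N (\<lambda>x. ?I x *\<^sub>R g x)" using intE[OF AN] by (simp add: set_integrable_def)
      have i4: "integrable N ?I" using AN by (intro integrable_real_indicator) (auto simp: less_top[symmetric])
      have q_int: "(LINT x|N. ?I x *\<^sub>R q k) = measure N (A k) *\<^sub>R q k"
        using i4 AN by (subst integral_scaleR_left) (auto simp: Int_absorb2 sets.sets_into_space)
      have i3: "integrable N (\<lambda>x. ?I x * norm (g x))" using integrable_norm[OF i1] by simp
      have i2: "integrable N (\<lambda>x. ?I x *\<^sub>R q k)" using i4 by (intro integrable_scaleR_left)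
      have "norm ((LINT x|N. ?I x *\<^sub>R g x) - (LINT x|N. ?I x *\<^sub>R q k)) \<le> (LINT x|N. norm (?I x *\<^sub>R g x - ?I x *\<^sub>R q k))"
        unfolding Bochner_Integration.integral_diff[OF i1 i2, symmetric] by (rule integral_norm_bound)
      also have "\<dots> \<le> (LINT x|N. ?I x * \<epsilon>)"
        using i1 i2 i4 by (intro integral_mono integrable_norm Bochner_Integration.integrable_diff integrable_mult_left)
           (auto simp: indicator_def dist_norm norm_minus_commute dest!: near)
      also have "\<dots> = \<epsilon> * measure N (A k)" using AN by (simp add: Int_absorb2 sets.sets_into_space)
      finally have 1: "norm (V (A k) - measure N (A k) *\<^sub>R q k) \<le> \<epsilon> * measure N (A k)"
        using A1 by (simp add: V set_lebesgue_integral_def image_subset_iff q_int)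
      have "(LINT x|N. ?I x * norm (g x)) \<le> (LINT x|N. ?I x * (norm (q k) + \<epsilon>))"
        using i3 i4 
        by (intro integral_mono integrable_mult_left) 
           (auto simp: indicator_def dist_norm dest!: near intro: order_trans[OF norm_triangle_sub add_mono] simp: norm_minus_commute)
      also have "\<dots> = measure N (A k) * (norm (q k) + \<epsilon>)"
        using AN by (simp add: Int_absorb2 sets.sets_into_space)
      also have "\<dots> = measure N (A k) * norm (q k) + \<epsilon> * measure N (A k)"
        by (simp add: algebra_simps)
      also have "measure N (A k) * norm (q k) = norm (measure N (A k) *\<^sub>R q k)" by simp
      also have "norm (measure N (A k) *\<^sub>R q k) \<le> norm (V (A k)) + \<epsilon> * measure N (A k)"
        using 1 norm_triangle_sub[of "measure N (A k) *\<^sub>R q k" "V (A k)"] by (simp add: norm_minus_commute)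
      finally have 2: "(LINT x|N. ?I x * norm (g x)) \<le> norm (V (A k)) + 2 * \<epsilon> * measure N (A k)" by simp
      have "emeasure ?D (A k) = (\<integral>\<^sup>+x. ennreal (?I x * norm (g x)) \<partial>N)"
        unfolding D[OF AN] by (intro nn_integral_cong) (auto simp: indicator_def)
      also have "\<dots> = ennreal (LINT x|N. ?I x * norm (g x))"
        by (rule nn_integral_eq_integral[OF i3]) auto
      also have "\<dots> \<le> ennreal (norm (V (A k)) + 2 * \<epsilon> * measure N (A k))" using 2 by (rule ennreal_leI)
      also have "\<dots> = ennreal (norm (V (A k))) + ennreal (2 * \<epsilon>) * emeasure N (A k)"
        using \<epsilon>(1) by (simp add: emeasure_eq_measure ennreal_mult)
      finally show ?thesis .
    qed
    have "emeasure ?D E = (\<Sum>k. emeasure ?D (A k))"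
      using AN A2 A3 by (subst suminf_emeasure) auto
    also have "\<dots> \<le> (\<Sum>k. ennreal (norm (V (A k))) + ennreal (2 * \<epsilon>) * emeasure N (A k))"
      by (intro suminf_le step) auto
    also have "\<dots> = (\<Sum>k. ennreal (norm (V (A k)))) + ennreal (2 * \<epsilon>) * emeasure N E"
      using AN A2 A3 by (subst suminf_add[symmetric], simp, simp) (subst ennreal_suminf_cmult, subst suminf_emeasure, auto)
    also have "\<dots> \<le> ?S + ennreal e"
    proof (intro add_mono)
      show "(\<Sum>k. ennreal (norm (V (A k)))) \<le> ?S" using A1 A2 A3 by (intro SUP_upper) auto
      show "ennreal (2 * \<epsilon>) * emeasure N E \<le> ennreal e"
        using \<epsilon> by (simp add: emeasure_eq_measure ennreal_mult[symmetric] ennreal_leI)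
    qed
    finally show "emeasure ?D E \<le> ?S + ennreal e" .
  qed
  have sp: "space N = space M" using N(2) by (rule sets_eq_imp_space_eq)
  have "tot_var M V = measure_of (space M) (sets M) (emeasure ?D)"
    unfolding tot_var_def
  proof (rule measure_of_eq)
    show "sets M \<subseteq> Pow (space M)" by (rule sets.space_closed)
    fix E assume "E \<in> sigma_sets (space M) (sets M)"
    then have E: "E \<in> sets M" by (simp add: sets.sigma_sets_eq)
    show "(SUP A \<in> {A. range A \<subseteq> sets M \<and> disjoint_family A \<and> (\<Union>i. A i) = E}.
        \<Sum>i::nat. ennreal (norm (V (A i)))) = emeasure ?D E"
      by (intro antisym SUP_least ge[OF E]) (auto intro!: le)
  qed
  also have "\<dots> = measure_of (space ?D) (sets ?D) (emeasure ?D)" using N(2) sp by simp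
  also have "\<dots> = ?D" by (rule measure_of_of_measure)
  finally show ?thesis .
qed

lemma finite_tot_var:
  assumes V: "V \<in> psd_measures M"
  shows "finite_measure (tot_var M V)" "sets (tot_var M V) = sets M" "space (tot_var M V) = space M"
proof -
  obtain \<tau> g where \<tau>: "finite_measure \<tau>" "sets \<tau> = sets M" and g: "integrable \<tau> g"
    and Vg: "\<And>E. E \<in> sets M \<Longrightarrow> V E = (LINT x:E|\<tau>. g x)"
    using psd_measure_density[OF V] by metis
  have T: "tot_var M V = density \<tau> (\<lambda>x. ennreal (norm (g x)))"
    by (rule tot_var_eq_density[OF \<tau> g Vg])
  show s: "sets (tot_var M V) = sets M" "space (tot_var M V) = space M"
    using \<tau>(2) sets_eq_imp_space_eq[OF \<tau>(2)] by (simp_all add: T)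
  have "emeasure (tot_var M V) (space (tot_var M V)) = (\<integral>\<^sup>+x. ennreal (norm (g x)) \<partial>\<tau>)"
    using g by (auto simp: T emeasure_density intro!: nn_integral_cong)
  also have "\<dots> < \<infinity>" using g by (simp add: integrable_iff_bounded)
  finally show "finite_measure (tot_var M V)" by (intro finite_measureI) auto
qed

lemma tot_var_le_trace:
  fixes V :: "'a set \<Rightarrow> real^'d^'d"
  assumes V: "V \<in> psd_measures M" and E: "E \<in> sets M"
  shows "measure (tot_var M V) E \<le> real CARD('d) * real CARD('d) * trace (V E)"
proof -
  let ?K = "real CARD('d) * real CARD('d)"
  obtain \<tau> g where \<tau>: "finite_measure \<tau>" "sets \<tau> = sets M" and g: "integrable \<tau> g"
    and em: "\<And>E. E \<in> sets M \<Longrightarrow> emeasure \<tau> E = ennreal (trace (V E))"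
    and gK: "\<And>x. norm (g x) \<le> ?K"
    and Vg: "\<And>E. E \<in> sets M \<Longrightarrow> V E = (LINT x:E|\<tau>. g x)"
    using psd_measure_density[OF V] by metis
  have T: "tot_var M V = density \<tau> (\<lambda>x. ennreal (norm (g x)))"
    by (rule tot_var_eq_density[OF \<tau> g Vg])
  have tr: "0 \<le> trace (V E)" by (rule psd_trace_nonneg[OF psd_measures_in_psd[OF V E]])
  have "emeasure (tot_var M V) E = (\<integral>\<^sup>+x. ennreal (norm (g x)) * indicator E x \<partial>\<tau>)"
    using g E \<tau>(2) unfolding T by (intro emeasure_density) auto
  also have "\<dots> \<le> (\<integral>\<^sup>+x. ennreal ?K * indicator E x \<partial>\<tau>)"
    by (intro nn_integral_mono mult_right_mono ennreal_leI gK) simp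
  also have "\<dots> = ennreal ?K * emeasure \<tau> E"
    using E \<tau>(2) by (intro nn_integral_cmult_indicator) auto
  also have "\<dots> = ennreal (?K * trace (V E))" using em[OF E] by (simp only: ennreal_mult''[OF tr])
  finally show ?thesis
    using finite_measure.emeasure_eq_measure[OF finite_tot_var(1)[OF V], of E] tr by simp
qed

lemma polar_density:
  fixes V :: "'a set \<Rightarrow> real^'d^'d"
  assumes V: "V \<in> psd_measures M"
  shows "polar_density M V \<in> borel_measurable M" "polar_density M V x \<in> sym_mats"
    "integrable (tot_var M V) (polar_density M V)"
    "E \<in> sets M \<Longrightarrow> V E = (LINT x:E|tot_var M V. polar_density M V x)"
proof -
  let ?T = "tot_var M V"
  obtain \<tau> g where \<tau>: "finite_measure \<tau>" "sets \<tau> = sets M" and g: "integrable \<tau> g"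
    and psd: "\<And>x. g x \<in> psd_mats"
    and Vg: "\<And>E. E \<in> sets M \<Longrightarrow> V E = (LINT x:E|\<tau>. g x)"
    using psd_measure_density[OF V] by metis
  have T: "?T = density \<tau> (\<lambda>x. ennreal (norm (g x)))"
    by (rule tot_var_eq_density[OF \<tau> g Vg])
  have gm: "g \<in> borel_measurable \<tau>" using g by auto
  have gM: "g \<in> borel_measurable M" using gm \<tau>(2) by (simp cong: measurable_cong_sets)
  define p where "p x = (1 / norm (g x)) *\<^sub>R g x" for x
  have pm: "p \<in> borel_measurable \<tau>" unfolding p_def using gm by measurable
  have sc: "norm (g x) *\<^sub>R p x = g x" for x by (simp add: p_def)
  have ip: "integrable ?T p"
    unfolding T using g gm pm by (subst integrable_density) (auto simp: sc)
  have Vp: "V E = (LINT x:E|?T. p x)" if E: "E \<in> sets M" for E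
  proof -
    have "(LINT x:E|?T. p x) = (LINT x|\<tau>. norm (g x) *\<^sub>R (indicator E x *\<^sub>R p x))"
      unfolding set_lebesgue_integral_def T using E \<tau>(2) gm pm
      by (intro integral_density) (auto intro!: borel_measurable_scaleR)
    also have "\<dots> = (LINT x|\<tau>. indicator E x *\<^sub>R g x)"
      by (intro Bochner_Integration.integral_cong refl) (metis sc scaleR_left_commute)
    finally show ?thesis using Vg[OF E] by (simp add: set_lebesgue_integral_def)
  qed
  have "\<exists>p. p \<in> borel_measurable M \<and> (\<forall>x. p x \<in> sym_mats) \<and>
     integrable ?T p \<and> (\<forall>E\<in>sets M. V E = (LINT x:E|?T. p x))"
  proof (intro exI conjI allI ballI)
    show "p \<in> borel_measurable M" using pm \<tau>(2) by (simp cong: measurable_cong_sets)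
    show "p x \<in> sym_mats" for x unfolding p_def by (intro sym_scale psd_imp_sym psd)
  qed (use ip Vp in auto)
  from someI_ex[OF this]
  show "polar_density M V \<in> borel_measurable M" "polar_density M V x \<in> sym_mats"
    "integrable ?T (polar_density M V)"
    "E \<in> sets M \<Longrightarrow> V E = (LINT x:E|?T. polar_density M V x)"
    unfolding polar_density_def[symmetric] by blast+
qed

lemma polar_density_psd:
  fixes V :: "'a set \<Rightarrow> real^'d^'d"
  assumes V: "V \<in> psd_measures M"
  shows "AE x in tot_var M V. polar_density M V x \<in> psd_mats"
proof -
  interpret T: finite_measure "tot_var M V" by (rule finite_tot_var[OF V])
  show ?thesis
  proof (rule T.averaging_theorem[OF polar_density(3)[OF V] closed_psd_mats])
    fix A assume "A \<in> sets (tot_var M V)" "0 < measure (tot_var M V) A"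
    then show "(1 / measure (tot_var M V) A) *\<^sub>R (LINT x:A|tot_var M V. polar_density M V x) \<in> psd_mats"
      using psd_measures_in_psd[OF V] finite_tot_var(2)[OF V]
      by (auto simp: polar_density(4)[OF V, symmetric] intro!: psd_scale)
  qed
qed

lemma abs_mat_integral_le:
  fixes V :: "'a set \<Rightarrow> real^'d^'d"
  assumes V: "V \<in> psd_measures M" and \<Phi>: "\<Phi> \<in> borel_measurable M" "\<And>x. x \<in> space M \<Longrightarrow> norm (\<Phi> x) \<le> C"
    and C: "0 \<le> C"
  shows "integrable (tot_var M V) (\<lambda>x. \<Phi> x \<bullet> polar_density M V x)"
    "\<bar>mat_integral M \<Phi> V\<bar> \<le> C * measure (tot_var M V) (space M)"
proof -
  let ?T = "tot_var M V" and ?p = "polar_density M V"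
  interpret T: finite_measure ?T by (rule finite_tot_var[OF V])
  note p = polar_density[OF V] and s = finite_tot_var[OF V]
  have pm: "?p \<in> borel_measurable ?T" using p(3) by auto
  have \<Phi>m: "\<Phi> \<in> borel_measurable ?T" using \<Phi>(1) s(2) by (simp cong: measurable_cong_sets)
  have bd: "norm (\<Phi> x \<bullet> ?p x) \<le> C * norm (?p x)" if "x \<in> space ?T" for x
    using Cauchy_Schwarz_ineq2[of "\<Phi> x" "?p x"] mult_right_mono[OF \<Phi>(2)[of x], of "norm (?p x)"] that s(3)
    by auto
  show i: "integrable ?T (\<lambda>x. \<Phi> x \<bullet> ?p x)"
    by (rule Bochner_Integration.integrable_bound[of _ "\<lambda>x. C * norm (?p x)"])
      (use bd C pm \<Phi>m p(3) in \<open>auto intro!: AE_I2 borel_measurable_inner integrable_mult_right integrable_norm\<close>)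
  have np: "(LINT x|?T. norm (?p x)) = measure ?T (space M)"
  proof -
    have eq: "?T = density ?T (\<lambda>x. ennreal (norm (?p x)))"
      by (rule tot_var_eq_density[OF T.finite_measure_axioms s(2) p(3)]) (rule p(4))
    have "emeasure (density ?T (\<lambda>x. ennreal (norm (?p x)))) (space ?T)
        = (\<integral>\<^sup>+x. ennreal (norm (?p x)) * indicator (space ?T) x \<partial>?T)"
      by (rule emeasure_density) (use pm in measurable)
    then have "emeasure ?T (space ?T) = (\<integral>\<^sup>+x. ennreal (norm (?p x)) * indicator (space ?T) x \<partial>?T)"
      unfolding eq[symmetric] .
    also have "\<dots> = (\<integral>\<^sup>+x. ennreal (norm (?p x)) \<partial>?T)" by (intro nn_integral_cong) auto
    also have "\<dots> = ennreal (LINT x|?T. norm (?p x))"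
      by (rule nn_integral_eq_integral) (use p(3) in auto)
    finally show ?thesis using s(3) by (simp add: T.emeasure_eq_measure)
  qed
  have "\<bar>mat_integral M \<Phi> V\<bar> \<le> (LINT x|?T. norm (\<Phi> x \<bullet> ?p x))"
    unfolding mat_integral_def using integral_norm_bound[of ?T "\<lambda>x. \<Phi> x \<bullet> ?p x"] by simp
  also have "\<dots> \<le> (LINT x|?T. C * norm (?p x))"
    using i p(3) bd by (intro integral_mono integrable_norm integrable_mult_right) auto
  also have "\<dots> = C * measure ?T (space M)" using np by simp
  finally show "\<bar>mat_integral M \<Phi> V\<bar> \<le> C * measure ?T (space M)" .
qed

lemma simple_integral_limit:
  fixes V :: "'a set \<Rightarrow> real^'d^'d" and F :: "nat \<Rightarrow> 'a \<Rightarrow> real^'d^'d"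
  assumes F: "\<And>n. simple_function M (F n)" "\<And>x. x \<in> space M \<Longrightarrow> (\<lambda>n. F n x) \<longlonglongrightarrow> \<Phi> x"
      "\<And>n x. x \<in> space M \<Longrightarrow> norm (F n x) \<le> K"
    and Y: "Y \<in> N \<rightarrow>\<^sub>M M" and A: "integrable N A"
    and V: "\<And>E. E \<in> sets M \<Longrightarrow> V E = (LINT s:(Y -` E \<inter> space N)|N. A s)"
  shows "(\<lambda>n. \<Sum>c\<in>F n ` space M. c \<bullet> V (F n -` {c} \<inter> space M)) \<longlonglongrightarrow> (LINT s|N. \<Phi> (Y s) \<bullet> A s)"
proof -
  have Ys: "s \<in> space N \<Longrightarrow> Y s \<in> space M" for s using Y by (auto dest: measurable_space)
  have Am: "A \<in> borel_measurable N" using A by auto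
  have eq: "(\<Sum>c\<in>F n ` space M. c \<bullet> V (F n -` {c} \<inter> space M)) = (LINT s|N. F n (Y s) \<bullet> A s)" for n
  proof -
    have fin: "finite (F n ` space M)" using F(1)[of n] by (simp add: simple_function_def)
    let ?E = "\<lambda>c. Y -` (F n -` {c} \<inter> space M) \<inter> space N"
    have E: "c \<in> F n ` space M \<Longrightarrow> F n -` {c} \<inter> space M \<in> sets M" for c
      by (rule simple_functionD(2)[OF F(1)])
    then have E': "c \<in> F n ` space M \<Longrightarrow> ?E c \<in> sets N" for c by (intro measurable_sets[OF Y])
    have i: "c \<in> F n ` space M \<Longrightarrow> integrable N (\<lambda>s. indicator (?E c) s *\<^sub>R A s)" for c
      by (rule integrable_mult_indicator[OF E' A])
    have "(\<Sum>c\<in>F n ` space M. c \<bullet> V (F n -` {c} \<inter> space M))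
       = (\<Sum>c\<in>F n ` space M. (LINT s|N. c \<bullet> (indicator (?E c) s *\<^sub>R A s)))"
      using E i by (intro sum.cong refl) (simp add: V set_lebesgue_integral_def del: inner_scaleR_right)
    also have "\<dots> = (LINT s|N. (\<Sum>c\<in>F n ` space M. c \<bullet> (indicator (?E c) s *\<^sub>R A s)))"
      using i by (intro Bochner_Integration.integral_sum[symmetric] integrable_inner_right) auto
    also have "\<dots> = (LINT s|N. F n (Y s) \<bullet> A s)"
    proof (intro Bochner_Integration.integral_cong refl)
      fix s assume s: "s \<in> space N"
      have "(\<Sum>c\<in>F n ` space M. c \<bullet> (indicator (?E c) s *\<^sub>R A s)) = (\<Sum>c\<in>F n ` space M. if c = F n (Y s) then c \<bullet> A s else 0)"
        using s Ys[OF s] by (intro sum.cong refl) (auto simp: indicator_def)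
      also have "\<dots> = F n (Y s) \<bullet> A s" using fin Ys[OF s] by (subst sum.delta) auto
      finally show "(\<Sum>c\<in>F n ` space M. c \<bullet> (indicator (?E c) s *\<^sub>R A s)) = F n (Y s) \<bullet> A s" .
    qed
    finally show ?thesis .
  qed
  have Fm: "F n \<in> borel_measurable M" for n using F(1) by (rule borel_measurable_simple_function)
  have FY: "(\<lambda>s. F n (Y s)) \<in> borel_measurable N" for n by (rule measurable_compose[OF Y Fm])
  have \<Phi>Y: "(\<lambda>s. \<Phi> (Y s)) \<in> borel_measurable N"
    by (rule borel_measurable_LIMSEQ_metric[where f = "\<lambda>n s. F n (Y s)", OF FY]) (use F(2) Ys in auto)
  show ?thesis unfolding eq
  proof (rule integral_dominated_convergence[where w = "\<lambda>s. K * norm (A s)"])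
    show "integrable N (\<lambda>s. K * norm (A s))" using A by auto
    show "AE s in N. (\<lambda>n. F n (Y s) \<bullet> A s) \<longlonglongrightarrow> \<Phi> (Y s) \<bullet> A s"
      using F(2) Ys by (intro AE_I2 tendsto_intros) auto
    show "AE s in N. norm (F n (Y s) \<bullet> A s) \<le> K * norm (A s)" for n
    proof (rule AE_I2)
      fix s assume "s \<in> space N"
      then have "norm (F n (Y s)) * norm (A s) \<le> K * norm (A s)" using F(3) Ys by (intro mult_right_mono) auto
      then show "norm (F n (Y s) \<bullet> A s) \<le> K * norm (A s)"
        using Cauchy_Schwarz_ineq2[of "F n (Y s)" "A s"] by simp
    qed
  qed (use \<Phi>Y FY Am in \<open>auto intro!: borel_measurable_inner\<close>)
qed

lemma bounded_simple_approximation: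
  fixes \<Phi> :: "'a \<Rightarrow> real^'d^'d"
  assumes "\<Phi> \<in> borel_measurable M" "\<And>x. x \<in> space M \<Longrightarrow> norm (\<Phi> x) \<le> C"
  obtains F where "\<And>n. simple_function M (F n)" "\<And>x. x \<in> space M \<Longrightarrow> (\<lambda>n. F n x) \<longlonglongrightarrow> \<Phi> x"
      "\<And>n x. x \<in> space M \<Longrightarrow> norm (F n x) \<le> 2 * C"
proof -
  obtain F where F: "\<And>n. simple_function M (F n)" "\<And>x. x \<in> space M \<Longrightarrow> (\<lambda>n. F n x) \<longlonglongrightarrow> \<Phi> x"
      "\<And>n x. x \<in> space M \<Longrightarrow> dist (F n x) 0 \<le> 2 * dist (\<Phi> x) 0"
    using borel_measurable_implies_sequence_metric[OF assms(1), of 0] by metis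
  have "norm (F n x) \<le> 2 * C" if "x \<in> space M" for n x
    using F(3)[OF that, of n] assms(2)[OF that] by (simp add: dist_norm)
  then show thesis using that F by blast
qed

lemma mat_integral_simple_limit:
  fixes V :: "'a set \<Rightarrow> real^'d^'d" and F :: "nat \<Rightarrow> 'a \<Rightarrow> real^'d^'d"
  assumes F: "\<And>n. simple_function M (F n)" "\<And>x. x \<in> space M \<Longrightarrow> (\<lambda>n. F n x) \<longlonglongrightarrow> \<Phi> x"
      "\<And>n x. x \<in> space M \<Longrightarrow> norm (F n x) \<le> K"
    and V: "V \<in> psd_measures M"
  shows "(\<lambda>n. \<Sum>c\<in>F n ` space M. c \<bullet> V (F n -` {c} \<inter> space M)) \<longlonglongrightarrow> mat_integral M \<Phi> V"
  unfolding mat_integral_def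
proof (rule simple_integral_limit[OF F, where Y = "\<lambda>x. x"])
  note s = finite_tot_var[OF V]
  show "(\<lambda>x. x) \<in> tot_var M V \<rightarrow>\<^sub>M M" using s(2) by (simp cong: measurable_cong_sets)
  show "V E = (LINT s:((\<lambda>x. x) -` E \<inter> space (tot_var M V))|tot_var M V. polar_density M V s)" if "E \<in> sets M" for E
    using polar_density(4)[OF V that] sets.sets_into_space[OF that] s(3) by (simp add: Int_absorb2 vimage_def)
qed (use polar_density(3)[OF V] in auto)

lemma mat_integral_eq:
  fixes V :: "'a set \<Rightarrow> real^'d^'d"
  assumes V: "V \<in> psd_measures M"
    and Y: "Y \<in> N \<rightarrow>\<^sub>M M" and A: "integrable N A"
    and VA: "\<And>E. E \<in> sets M \<Longrightarrow> V E = (LINT s:(Y -` E \<inter> space N)|N. A s)"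
    and \<Phi>: "\<Phi> \<in> borel_measurable M" "\<And>x. x \<in> space M \<Longrightarrow> norm (\<Phi> x) \<le> C"
  shows "mat_integral M \<Phi> V = (LINT s|N. \<Phi> (Y s) \<bullet> A s)"
proof -
  obtain F where F: "\<And>n. simple_function M (F n)" "\<And>x. x \<in> space M \<Longrightarrow> (\<lambda>n. F n x) \<longlonglongrightarrow> \<Phi> x"
      "\<And>n x. x \<in> space M \<Longrightarrow> norm (F n x) \<le> 2 * C"
    using bounded_simple_approximation[OF \<Phi>] by metis
  show ?thesis
    using mat_integral_simple_limit[OF F V] simple_integral_limit[OF F Y A VA] by (rule LIMSEQ_unique)
qed

lemma psd_measure_of_density:
  fixes A :: "'b \<Rightarrow> real^'d^'d"
  assumes Y: "Y \<in> N \<rightarrow>\<^sub>M M" and A: "integrable N A" and psd: "\<And>s. A s \<in> psd_mats"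
  shows "(\<lambda>E. LINT s:(Y -` E \<inter> space N)|N. A s) \<in> psd_measures M"
  unfolding psd_measures_def
proof (intro CollectI conjI ballI allI impI)
  fix E assume E: "E \<in> sets M"
  let ?E = "Y -` E \<inter> space N"
  have E': "?E \<in> sets N" using E Y by (auto intro: measurable_sets)
  have i: "integrable N (\<lambda>s. indicator ?E s *\<^sub>R A s)" by (rule integrable_mult_indicator[OF E' A])
  have inner: "B \<bullet> (LINT s:?E|N. A s) = (LINT s|N. B \<bullet> (indicator ?E s *\<^sub>R A s))" for B
    unfolding set_lebesgue_integral_def using i by (rule integral_inner_right[symmetric])
  have entry: "(LINT s:?E|N. A s) $ i $ j = (LINT s|N. indicator ?E s * A s $ i $ j)" for i j
    using inner[of "axis i (axis j 1)"] by (simp add: inner_axis_axis)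
  have q: "v \<bullet> (X *v v) = (\<chi> i j. v $ i * v $ j) \<bullet> X" for v and X :: "real^'d^'d"
    unfolding quad_form by (simp add: inner_vec_def mult_ac)
  show "(LINT s:?E|N. A s) \<in> psd_mats"
    unfolding psd_mats_def
  proof (intro CollectI conjI allI)
    show "(LINT s:?E|N. A s) \<in> sym_mats"
      unfolding sym_mats_iff entry
      using psd by (auto simp: psd_mats_def sym_mats_iff intro!: Bochner_Integration.integral_cong)
    fix v :: "real^'d"
    show "0 \<le> v \<bullet> ((LINT s:?E|N. A s) *v v)"
      unfolding q inner
    proof (rule integral_nonneg_AE, rule AE_I2)
      fix s
      have "0 \<le> v \<bullet> (A s *v v)" using psd[of s] by (simp add: psd_mats_def)
      then show "0 \<le> (\<chi> i j. v $ i * v $ j) \<bullet> (indicator ?E s *\<^sub>R A s)" unfolding q by simp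
    qed
  qed
next
  fix B :: "nat \<Rightarrow> 'a set" assume B: "range B \<subseteq> sets M" "disjoint_family B"
  let ?B = "\<lambda>i. Y -` B i \<inter> space N"
  have mB: "?B i \<in> sets N" for i using B(1) Y by (auto intro: measurable_sets)
  have un: "Y -` (\<Union>i. B i) \<inter> space N = (\<Union>i. ?B i)" by auto
  show "(\<lambda>i. LINT s:?B i|N. A s) sums (LINT s:(Y -` (\<Union>i. B i) \<inter> space N)|N. A s)"
    unfolding un set_lebesgue_integral_def
  proof (subst sums_cong)
    show "(LINT s|N. indicator (?B i) s *\<^sub>R A s) = (LINT s|N. indicator (?B i) s *\<^sub>R A s)" for i ..
    have dis: "disjoint_family ?B" using B(2) by (auto simp: disjoint_family_on_def)
    have ind: "indicator (\<Union>i. ?B i) s *\<^sub>R A s = (\<Sum>i. indicator (?B i) s *\<^sub>R A s)"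
      "summable (\<lambda>i. norm (indicator (?B i) s *\<^sub>R A s))" 
      "(\<Sum>i. norm (indicator (?B i) s *\<^sub>R A s)) = indicator (\<Union>i. ?B i) s * norm (A s)" for s
    proof -
      have s1: "(\<lambda>i. indicat_real (?B i) s) sums indicat_real (\<Union>i. ?B i) s" by (rule indicator_sums) (use dis in \<open>auto simp: disjoint_family_on_def\<close>)
      have s2: "(\<lambda>i. indicator (?B i) s *\<^sub>R A s) sums (indicator (\<Union>i. ?B i) s *\<^sub>R A s)"
        by (rule bounded_linear.sums[OF bounded_linear_scaleR_left s1])
      have s3: "(\<lambda>i. indicator (?B i) s * norm (A s)) sums (indicator (\<Union>i. ?B i) s * norm (A s))"
        by (rule sums_mult2[OF s1])
      have n: "norm (indicator (?B i) s *\<^sub>R A s) = indicator (?B i) s * norm (A s)" for i by simp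
      show "indicator (\<Union>i. ?B i) s *\<^sub>R A s = (\<Sum>i. indicator (?B i) s *\<^sub>R A s)" using s2 by (rule sums_unique)
      show "summable (\<lambda>i. norm (indicator (?B i) s *\<^sub>R A s))"
        "(\<Sum>i. norm (indicator (?B i) s *\<^sub>R A s)) = indicator (\<Union>i. ?B i) s * norm (A s)"
        unfolding n using s3 by (auto simp: sums_iff)
    qed
    have i: "integrable N (\<lambda>s. indicator (?B i) s *\<^sub>R A s)" for i by (rule integrable_mult_indicator[OF mB A])
    have sums: "summable (\<lambda>i. LINT s|N. norm (indicator (?B i) s *\<^sub>R A s))"
    proof (rule summableI_nonneg_bounded)
      fix n
      have "(\<Sum>i<n. LINT s|N. norm (indicator (?B i) s *\<^sub>R A s)) = (LINT s|N. (\<Sum>i<n. norm (indicator (?B i) s *\<^sub>R A s)))"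
        by (intro Bochner_Integration.integral_sum[symmetric] integrable_norm i)
      also have "\<dots> \<le> (LINT s|N. norm (A s))"
      proof (intro integral_mono Bochner_Integration.integrable_sum integrable_norm i A)
        fix s
        have "(\<Sum>i<n. norm (indicator (?B i) s *\<^sub>R A s)) \<le> (\<Sum>i. norm (indicator (?B i) s *\<^sub>R A s))"
          by (rule sum_le_suminf[OF ind(2)]) auto
        also have "\<dots> \<le> norm (A s)" unfolding ind(3) by (auto simp: indicator_def)
        finally show "(\<Sum>i<n. norm (indicator (?B i) s *\<^sub>R A s)) \<le> norm (A s)" .
      qed
      finally show "(\<Sum>i<n. LINT s|N. norm (indicator (?B i) s *\<^sub>R A s)) \<le> (LINT s|N. norm (A s))" .
    qed auto
    show "(\<lambda>i. LINT s|N. indicator (?B i) s *\<^sub>R A s) sums (LINT s|N. indicator (\<Union>i. ?B i) s *\<^sub>R A s)"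
      unfolding ind(1) by (rule sums_integral[OF i AE_I2[OF ind(2)] sums])
  qed
qed

text \<open>
  Jensen's inequality for the homogeneous function \<open>f\<close>: pushing a matrix-valued density forward can only
  lower its cost.  It is proved by writing \<open>f\<close> as a supremum of countably many linear forms, for each of
  which the two integrals agree.
\<close>

lemma polar_integral_le:
  fixes V :: "'a set \<Rightarrow> real^'d^'d" and f :: "real^'d^'d \<Rightarrow> ennreal"
  assumes conv: "convex_fun f" and hom: "pos_1_homogeneous f" and lsc: "lower_semicont f"
    and dom: "fin_dom f = psd_mats"
    and V: "V \<in> psd_measures M"
    and Y: "Y \<in> N \<rightarrow>\<^sub>M M" and A: "integrable N A" "\<And>s. A s \<in> psd_mats"
    and VA: "\<And>E. E \<in> sets M \<Longrightarrow> V E = (LINT s:(Y -` E \<inter> space N)|N. A s)"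
  shows "(\<integral>\<^sup>+x. f (polar_density M V x) \<partial>tot_var M V) \<le> (\<integral>\<^sup>+s. f (A s) \<partial>N)"
proof -
  obtain B :: "nat \<Rightarrow> real^'d^'d" where B0: "B 0 = 0" and Bm: "range B \<subseteq> minorants f"
    and B: "\<And>A. A \<in> psd_mats \<Longrightarrow> f A = (SUP i. ennreal (B i \<bullet> A))"
    by (rule minorants_sup[OF conv hom lsc dom]) blast
  let ?T = "tot_var M V" and ?p = "polar_density M V"
  note s = finite_tot_var[OF V] and p = polar_density[OF V]
  define m where "m k X = Max ((\<lambda>i. B i \<bullet> X) ` {..k})" for k and X :: "real^'d^'d"
  have mi: "B i \<bullet> X \<le> m k X" if "i \<le> k" for i k X unfolding m_def using that by (intro Max_ge) auto
  have m_ex: "\<exists>i. i \<le> k \<and> B i \<bullet> X = m k X" for k X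
  proof -
    have "m k X \<in> (\<lambda>i. B i \<bullet> X) ` {..k}" unfolding m_def by (intro Max_in) auto
    then show ?thesis by auto
  qed
  have m0: "0 \<le> m k X" for k X using mi[of 0 k X] B0 by simp
  have mSUP: "f X = (SUP k. ennreal (m k X))" if "X \<in> psd_mats" for X
    unfolding B[OF that]
  proof (rule antisym)
    show "(SUP i. ennreal (B i \<bullet> X)) \<le> (SUP k. ennreal (m k X))"
      by (intro SUP_mono) (use mi in \<open>auto intro!: ennreal_leI\<close>)
    show "(SUP k. ennreal (m k X)) \<le> (SUP i. ennreal (B i \<bullet> X))"
    proof (rule SUP_least)
      fix k obtain i where "B i \<bullet> X = m k X" using m_ex by blast
      then show "ennreal (m k X) \<le> (SUP i. ennreal (B i \<bullet> X))" by (metis SUP_upper UNIV_I)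
    qed
  qed
  have mmono: "m k X \<le> m l X" if "k \<le> l" for k l X unfolding m_def using that by (intro Max_mono) auto
  define J where "J k X = (LEAST i. B i \<bullet> X = m k X)" for k X
  have J: "B (J k X) \<bullet> X = m k X" "J k X \<le> k" for k X
  proof -
    obtain i where i: "i \<le> k" "B i \<bullet> X = m k X" using m_ex by blast
    show "B (J k X) \<bullet> X = m k X" unfolding J_def by (rule LeastI) (rule i(2))
    show "J k X \<le> k" unfolding J_def using i by (meson Least_le order_trans)
  qed
  have mm: "m k \<in> borel_measurable borel" for k unfolding m_def by measurable
  have Jm: "J k \<in> borel \<rightarrow>\<^sub>M count_space UNIV" for k
    unfolding J_def using mm by measurable
  have pm: "?p \<in> borel_measurable ?T" using p(3) by auto
  have bound: "(\<integral>\<^sup>+x. ennreal (m k (?p x)) \<partial>?T) \<le> (\<integral>\<^sup>+s. f (A s) \<partial>N)" for k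
  proof -
    define \<Phi> where "\<Phi> x = B (J k (?p x))" for x
    have \<Phi>m: "\<Phi> \<in> borel_measurable M" unfolding \<Phi>_def
      by (rule measurable_compose[OF measurable_compose[OF p(1) Jm]]) simp
    define C where "C = Max ((\<lambda>i. norm (B i)) ` {..k})"
    have C: "norm (\<Phi> x) \<le> C" for x unfolding C_def \<Phi>_def using J(2) by (intro Max_ge) auto
    have C0: "0 \<le> C" using C[of undefined] norm_ge_zero order_trans by blast
    have i: "integrable ?T (\<lambda>x. m k (?p x))"
      using abs_mat_integral_le(1)[OF V \<Phi>m C C0] by (simp add: \<Phi>_def J)
    have "(LINT x|?T. m k (?p x)) = mat_integral M \<Phi> V"
      unfolding mat_integral_def by (simp add: \<Phi>_def J)
    also have "\<dots> = (LINT s|N. \<Phi> (Y s) \<bullet> A s)" by (rule mat_integral_eq[OF V Y A(1) VA \<Phi>m C])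
    finally have eq: "(LINT x|?T. m k (?p x)) = (LINT s|N. \<Phi> (Y s) \<bullet> A s)" .
    have "(\<integral>\<^sup>+x. ennreal (m k (?p x)) \<partial>?T) = ennreal (LINT x|?T. m k (?p x))"
      by (rule nn_integral_eq_integral[OF i]) (use m0 in auto)
    also have "\<dots> = ennreal (LINT s|N. \<Phi> (Y s) \<bullet> A s)" by (simp add: eq)
    also have "\<dots> \<le> (\<integral>\<^sup>+s. ennreal (\<Phi> (Y s) \<bullet> A s) \<partial>N)"
    proof (cases "integrable N (\<lambda>s. \<Phi> (Y s) \<bullet> A s)")
      case True
      have "ennreal (LINT s|N. \<Phi> (Y s) \<bullet> A s) \<le> ennreal (LINT s|N. max 0 (\<Phi> (Y s) \<bullet> A s))"
        using True by (intro ennreal_leI integral_mono) auto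
      also have "\<dots> = (\<integral>\<^sup>+s. ennreal (max 0 (\<Phi> (Y s) \<bullet> A s)) \<partial>N)"
        using True by (intro nn_integral_eq_integral[symmetric]) auto
      also have "\<dots> = (\<integral>\<^sup>+s. ennreal (\<Phi> (Y s) \<bullet> A s) \<partial>N)"
        by (intro nn_integral_cong) (auto simp: max_def ennreal_neg)
      finally show ?thesis .
    qed (simp add: not_integrable_integral_eq)
    also have "\<dots> \<le> (\<integral>\<^sup>+s. f (A s) \<partial>N)"
    proof (intro nn_integral_mono)
      fix s
      have "\<Phi> (Y s) \<in> minorants f" unfolding \<Phi>_def using Bm by auto
      then show "ennreal (\<Phi> (Y s) \<bullet> A s) \<le> f (A s)" using psd_imp_sym[OF A(2)] by (auto simp: minorants_def)
    qed
    finally show ?thesis .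
  qed
  have "(\<integral>\<^sup>+x. f (?p x) \<partial>?T) = (\<integral>\<^sup>+x. (SUP k. ennreal (m k (?p x))) \<partial>?T)"
    using polar_density_psd[OF V] by (intro nn_integral_cong_AE) (auto simp: mSUP)
  also have "\<dots> = (SUP k. \<integral>\<^sup>+x. ennreal (m k (?p x)) \<partial>?T)"
  proof (rule nn_integral_monotone_convergence_SUP)
    show "incseq (\<lambda>k x. ennreal (m k (?p x)))" by (auto intro!: incseq_SucI le_funI ennreal_leI mmono)
    show "(\<lambda>x. ennreal (m k (?p x))) \<in> borel_measurable ?T" for k
      using measurable_compose[OF pm mm] by measurable
  qed
  also have "\<dots> \<le> (\<integral>\<^sup>+s. f (A s) \<partial>N)" by (intro SUP_least bound)
  finally show ?thesis .
qed

section \<open>Twice differentiable functions with bounded Hessian\<close>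

text \<open>
  Functions of class \<open>C\<^sup>2\<close> with bounded Hessian, together with gradient and Hessian.  They grow at most
  quadratically, and so are integrable for all measures in \<open>P2\<close>.
\<close>

definition c2b :: "(real^'d \<Rightarrow> real) \<Rightarrow> (real^'d \<Rightarrow> real^'d) \<Rightarrow> (real^'d \<Rightarrow> real^'d^'d) \<Rightarrow> bool" where
  "c2b \<psi> D D2 \<longleftrightarrow> (\<forall>x. (\<psi> has_derivative (\<lambda>h. D x \<bullet> h)) (at x)) \<and>
     (\<forall>x. (D has_derivative (\<lambda>h. D2 x *v h)) (at x)) \<and>
     continuous_on UNIV D2 \<and> bounded (range D2)"

lemma c2b_D:
  assumes "c2b \<psi> D D2"
  shows "(\<psi> has_derivative (\<lambda>h. D x \<bullet> h)) (at x)" "(D has_derivative (\<lambda>h. D2 x *v h)) (at x)"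
    "continuous_on UNIV D2" "bounded (range D2)" "continuous_on UNIV \<psi>" "continuous_on UNIV D"
proof -
  note c = assms[unfolded c2b_def]
  show "(\<psi> has_derivative (\<lambda>h. D x \<bullet> h)) (at x)" "(D has_derivative (\<lambda>h. D2 x *v h)) (at x)"
    "continuous_on UNIV D2" "bounded (range D2)" using c by blast+
  show "continuous_on UNIV \<psi>" by (rule has_derivative_continuous_on) (use c in blast)
  show "continuous_on UNIV D" by (rule has_derivative_continuous_on) (use c in blast)
qed

lemma c2b_bound:
  fixes \<psi> :: "real^'d \<Rightarrow> real"
  assumes "c2b \<psi> D D2"
  obtains K where "0 \<le> K" "\<And>x. norm (D2 x) \<le> K"
proof -
  obtain K where "\<forall>y\<in>range D2. norm y \<le> K" using c2b_D(4)[OF assms] unfolding bounded_iff by blast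
  then have "norm (D2 x) \<le> K" for x by blast
  moreover from this[of 0] have "0 \<le> K" using norm_ge_zero[of "D2 0"] by linarith
  ultimately show thesis using that by blast
qed

lemma norm_matrix_vector_le: "norm (A *v h) \<le> norm A * norm h" for A :: "real^'d^'d"
proof -
  have "(norm (A *v h))\<^sup>2 = (\<Sum>i\<in>UNIV. (A $ i \<bullet> h)\<^sup>2)"
  proof -
    have "(norm v)\<^sup>2 = (\<Sum>i\<in>UNIV. (v $ i)\<^sup>2)" for v :: "real^'d"
      by (simp add: norm_vec_def L2_set_def sum_nonneg)
    moreover have "(A *v h) $ i = A $ i \<bullet> h" for i by (simp add: matrix_vector_mult_def inner_vec_def)
    ultimately show ?thesis by simp
  qed
  also have "\<dots> \<le> (\<Sum>i\<in>UNIV. (norm (A $ i))\<^sup>2 * (norm h)\<^sup>2)"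
    using Cauchy_Schwarz_ineq[of "A $ i" h for i] by (intro sum_mono) (simp add: power2_norm_eq_inner)
  also have "\<dots> = (norm A)\<^sup>2 * (norm h)\<^sup>2"
    by (simp add: sum_distrib_right[symmetric] norm_vec_def L2_set_def real_sqrt_pow2 sum_nonneg)
  also have "\<dots> = (norm A * norm h)\<^sup>2" by (simp add: power_mult_distrib)
  finally show ?thesis by (rule power2_le_imp_le) simp
qed

lemma c2b_growth:
  fixes \<psi> :: "real^'d \<Rightarrow> real"
  assumes c: "c2b \<psi> D D2"
  obtains C where "0 \<le> C" "\<And>x. norm (D x) \<le> C * (1 + norm x)" "\<And>x. \<bar>\<psi> x\<bar> \<le> C * (1 + (norm x)\<^sup>2)"
proof -
  obtain K where K: "0 \<le> K" "\<And>x. norm (D2 x) \<le> K" using c2b_bound[OF c] by blast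
  define C1 where "C1 = K + norm (D 0)"
  have C1: "0 \<le> C1" "norm (D x) \<le> C1 * (1 + norm x)" for x
  proof -
    show "0 \<le> C1" using K by (simp add: C1_def)
    have "norm (D x - D 0) \<le> K * norm (x - 0)"
    proof (rule differentiable_bound[of UNIV D "\<lambda>x h. D2 x *v h"])
      show "onorm (\<lambda>h. D2 x *v h) \<le> K" for x
        by (rule onorm_le) (metis K(2) mult_right_mono norm_ge_zero norm_matrix_vector_le order_trans)
    qed (use c2b_D[OF c] in auto)
    then have "norm (D x) \<le> norm (D 0) + K * norm x"
      using norm_triangle_ineq2[of "D x" "D 0"] by simp
    also have "\<dots> \<le> C1 * (1 + norm x)" using K(1) by (simp add: C1_def algebra_simps)
    finally show "norm (D x) \<le> C1 * (1 + norm x)" .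
  qed
  define C where "C = 2 * C1 + \<bar>\<psi> 0\<bar>"
  have psi: "\<bar>\<psi> x\<bar> \<le> C * (1 + (norm x)\<^sup>2)" for x
  proof -
    have "norm (\<psi> x - \<psi> 0) \<le> (C1 * (1 + norm x)) * norm (x - 0)"
    proof (rule differentiable_bound[of "cball 0 (norm x)" \<psi> "\<lambda>x h. D x \<bullet> h"])
      fix y :: "real^'d" assume "y \<in> cball 0 (norm x)"
      then have "C1 * (1 + norm y) \<le> C1 * (1 + norm x)" using C1(1) by (intro mult_left_mono) auto
      then have "norm (D y) \<le> C1 * (1 + norm x)" using C1(2)[of y] by linarith
      then show "onorm (\<lambda>h. D y \<bullet> h) \<le> C1 * (1 + norm x)"
        by (intro onorm_le) (metis Cauchy_Schwarz_ineq2 mult_right_mono norm_ge_zero order_trans real_norm_def)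
    qed (use c2b_D[OF c] in \<open>auto intro: has_derivative_at_withinI\<close>)
    then have "\<bar>\<psi> x\<bar> \<le> \<bar>\<psi> 0\<bar> + C1 * ((1 + norm x) * norm x)" by (simp add: mult.assoc)
    also have "(1 + norm x) * norm x \<le> 2 * (1 + (norm x)\<^sup>2)"
    proof -
      have "2 * norm x \<le> 1 + norm x * norm x" using sum_squares_bound[of 1 "norm x"] by (simp add: power2_eq_square)
      moreover have "0 \<le> norm x * norm x" by simp
      ultimately show ?thesis unfolding power2_eq_square ring_distribs by linarith
    qed
    also have "\<bar>\<psi> 0\<bar> + C1 * (2 * (1 + (norm x)\<^sup>2)) \<le> C * (1 + (norm x)\<^sup>2)"
      by (simp add: C_def algebra_simps)
    finally show ?thesis using C1(1) by (simp add: mult_left_mono)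
  qed
  show thesis
  proof (rule that[of C, OF _ _ psi])
    show C: "0 \<le> C" using C1 by (simp add: C_def)
    show "norm (D x) \<le> C * (1 + norm x)" for x
    proof -
      have "C1 * (1 + norm x) \<le> C * (1 + norm x)" using C1(1) by (intro mult_right_mono) (auto simp: C_def)
      then show ?thesis using C1(2)[of x] by linarith
    qed
  qed
qed

lemma c2b_add:
  assumes "c2b \<psi> D D2" "c2b \<phi> E E2"
  shows "c2b (\<lambda>x. \<psi> x + \<phi> x) (\<lambda>x. D x + E x) (\<lambda>x. D2 x + E2 x)"
  unfolding c2b_def
proof (intro conjI allI)
  fix x
  show "((\<lambda>x. \<psi> x + \<phi> x) has_derivative (\<lambda>h. (D x + E x) \<bullet> h)) (at x)"
    using has_derivative_add[OF c2b_D(1)[OF assms(1)] c2b_D(1)[OF assms(2)]] by (simp add: inner_add_left)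
  show "((\<lambda>x. D x + E x) has_derivative (\<lambda>h. (D2 x + E2 x) *v h)) (at x)"
    using has_derivative_add[OF c2b_D(2)[OF assms(1)] c2b_D(2)[OF assms(2)]]
    by (simp add: matrix_vector_mult_add_rdistrib)
qed (use c2b_D[OF assms(1)] c2b_D[OF assms(2)] in \<open>auto intro!: continuous_intros bounded_plus_comp\<close>)

lemma c2b_scale:
  assumes "c2b \<psi> D D2"
  shows "c2b (\<lambda>x. c * \<psi> x) (\<lambda>x. c *\<^sub>R D x) (\<lambda>x. c *\<^sub>R D2 x)"
  unfolding c2b_def
proof (intro conjI allI)
  fix x
  show "((\<lambda>x. c * \<psi> x) has_derivative (\<lambda>h. (c *\<^sub>R D x) \<bullet> h)) (at x)"
    using has_derivative_scaleR_right[OF c2b_D(1)[OF assms], of c] by simp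
  show "((\<lambda>x. c *\<^sub>R D x) has_derivative (\<lambda>h. (c *\<^sub>R D2 x) *v h)) (at x)"
    using has_derivative_scaleR_right[OF c2b_D(2)[OF assms], of c]
    by (simp add: scaleR_matrix_vector_assoc)
qed (use c2b_D[OF assms] in \<open>auto intro!: continuous_intros bounded_scaleR_comp\<close>)

lemma c2b_const: "c2b (\<lambda>x. c) (\<lambda>x. 0) (\<lambda>x. 0)"
  by (simp add: c2b_def)

lemma c2b_sum:
  assumes "\<And>i. i \<in> I \<Longrightarrow> c2b (\<psi> i) (D i) (D2 i)"
  shows "c2b (\<lambda>x. \<Sum>i\<in>I. c i * \<psi> i x) (\<lambda>x. \<Sum>i\<in>I. c i *\<^sub>R D i x) (\<lambda>x. \<Sum>i\<in>I. c i *\<^sub>R D2 i x)"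
  using assms
  by (induction I rule: infinite_finite_induct) (auto simp: c2b_const intro!: c2b_add c2b_scale)

lemma c2b_translate:
  fixes \<psi> :: "real^'d \<Rightarrow> real"
  assumes "c2b \<psi> D D2"
  shows "c2b (\<lambda>x. \<psi> (x + a)) (\<lambda>x. D (x + a)) (\<lambda>x. D2 (x + a))"
  unfolding c2b_def
proof (intro conjI allI)
  have t: "((\<lambda>x. x + a) has_derivative (\<lambda>h. h)) (at x)" for x :: "real^'d"
    by (auto intro!: derivative_eq_intros)
  show "((\<lambda>x. \<psi> (x + a)) has_derivative (\<lambda>h. D (x + a) \<bullet> h)) (at x)" for x
    using has_derivative_compose[OF t c2b_D(1)[OF assms]] by simp
  show "((\<lambda>x. D (x + a)) has_derivative (\<lambda>h. D2 (x + a) *v h)) (at x)" for x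
    using has_derivative_compose[OF t c2b_D(2)[OF assms]] by simp
  show "continuous_on UNIV (\<lambda>x. D2 (x + a))"
    by (rule continuous_on_compose2[OF c2b_D(3)[OF assms]]) (auto intro!: continuous_intros)
  show "bounded (range (\<lambda>x. D2 (x + a)))"
    using c2b_D(4)[OF assms] by (rule bounded_subset) auto
qed

lemma has_derivative_norm_square: "((\<lambda>x::real^'d. x \<bullet> x) has_derivative (\<lambda>h. 2 * (x \<bullet> h))) (at x)"
  by (auto intro!: derivative_eq_intros simp: inner_commute)

lemma c2b_norm_square: "c2b (\<lambda>x. (norm x)\<^sup>2) (\<lambda>x. 2 *\<^sub>R x) (\<lambda>x. 2 *\<^sub>R mat 1)"
  unfolding c2b_def
proof (intro conjI allI)
  fix x :: "real^'d"
  show "((\<lambda>x. (norm x)\<^sup>2) has_derivative (\<lambda>h. (2 *\<^sub>R x) \<bullet> h)) (at x)"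
    using has_derivative_norm_square[of x] by (simp add: power2_norm_eq_inner)
  show "((\<lambda>x. 2 *\<^sub>R x) has_derivative (\<lambda>h. (2 *\<^sub>R mat 1) *v h)) (at x)"
    by (auto intro!: derivative_eq_intros simp: scaleR_matrix_vector_assoc[symmetric])
qed (auto intro: bounded_subset[of "{2 *\<^sub>R mat 1}"])

definition outer :: "real^'d \<Rightarrow> real^'d \<Rightarrow> real^'d^'d" where
  "outer a b = (\<chi> i j. a $ i * b $ j)"

lemma outer_mult: "outer a b *v h = (b \<bullet> h) *\<^sub>R a"
  by (simp add: outer_def vec_eq_iff matrix_vector_mult_def inner_vec_def sum_distrib_left sum_distrib_right mult_ac)

lemma norm_outer: "norm (outer a b) = norm a * norm b"
proof -
  have "norm (outer a b) = L2_set (\<lambda>i. \<bar>a $ i\<bar> * norm b) UNIV"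
    unfolding norm_vec_def[of "outer a b"]
  proof (rule L2_set_cong[OF refl])
    fix i
    have "outer a b $ i = a $ i *\<^sub>R b" by (simp add: outer_def vec_eq_iff)
    then show "norm (outer a b $ i) = \<bar>a $ i\<bar> * norm b" by simp
  qed
  then show ?thesis
    by (simp add: L2_set_right_distrib norm_vec_def[of a] mult.commute)
qed

lemma continuous_on_outer [continuous_intros]:
  "continuous_on S f \<Longrightarrow> continuous_on S g \<Longrightarrow> continuous_on S (\<lambda>x. outer (f x) (g x))"
  unfolding outer_def by (intro continuous_on_vec_lambda continuous_intros)

lemma tendsto_outer:
  "(f \<longlongrightarrow> a) F \<Longrightarrow> (g \<longlongrightarrow> b) F \<Longrightarrow> ((\<lambda>x. outer (f x) (g x)) \<longlongrightarrow> outer a b) F"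
  unfolding outer_def by (intro tendsto_vec_lambda tendsto_intros)

lemma c2b_times_cutoff:
  fixes \<psi> :: "real^'d \<Rightarrow> real" and R :: real
  assumes c: "c2b \<psi> D D2" and R: "1 \<le> R"
    and K: "\<And>x. norm (D2 x) \<le> K"
    and C: "0 \<le> C" "\<And>x. norm (D x) \<le> C * (1 + norm x)" "\<And>x. \<bar>\<psi> x\<bar> \<le> C * (1 + (norm x)\<^sup>2)"
  defines "v \<equiv> \<lambda>x. R + x \<bullet> x"
  defines "ct \<equiv> \<lambda>x. R / v x" and "G \<equiv> \<lambda>x. (- (2 * R / (v x)^2)) *\<^sub>R x"
    and "H \<equiv> \<lambda>x. (- (2 * R / (v x)^2)) *\<^sub>R mat 1 + (8 * R / (v x)^3) *\<^sub>R outer x x"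
  defines "H' \<equiv> \<lambda>x. ct x *\<^sub>R D2 x + outer (D x) (G x) + outer (G x) (D x) + \<psi> x *\<^sub>R H x"
  shows "c2b (\<lambda>x. ct x * \<psi> x) (\<lambda>x. ct x *\<^sub>R D x + \<psi> x *\<^sub>R G x) H'"
    and "norm (H' x) \<le> (K + C * (16 + 2 * norm (mat 1 :: real^'d^'d))) * ct x"
    and "\<bar>ct x * \<psi> x\<bar> \<le> C * R"
    and "0 \<le> ct x" "ct x \<le> 1"
proof -
  have v: "0 < v x" "1 \<le> v x" "R \<le> v x" "x \<bullet> x \<le> v x" for x
    using R inner_ge_zero[of x] unfolding v_def by (auto intro: add_pos_nonneg simp: add_increasing2)
  have nv: "v x \<noteq> 0" for x using v(1)[of x] by simp
  show ct: "0 \<le> ct x" "ct x \<le> 1" for x using v(1)[of x] v(3)[of x] R by (auto simp: ct_def)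
  have dv: "(v has_derivative (\<lambda>h. 2 * (x \<bullet> h))) (at x)" for x
    unfolding v_def
    by (rule has_derivative_eq_rhs[OF has_derivative_add[OF has_derivative_const has_derivative_norm_square]]) simp
  have dct: "(ct has_derivative (\<lambda>h. G x \<bullet> h)) (at x)" for x
  proof -
    have "((\<lambda>t. R / t) has_real_derivative (- (R / (v x)^2))) (at (v x))"
      using nv[of x] by (auto intro!: derivative_eq_intros simp: power2_eq_square)
    from DERIV_compose_FDERIV[OF this dv[of x]] show ?thesis
      by (simp add: ct_def G_def algebra_simps)
  qed
  have dG: "(G has_derivative (\<lambda>h. H x *v h)) (at x)" for x
  proof -
    have "((\<lambda>t. - (2 * R / t^2)) has_real_derivative (4 * R / (v x)^3)) (at (v x))"
      using nv[of x] by (auto intro!: derivative_eq_intros simp: power2_eq_square power3_eq_cube field_simps)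
    from DERIV_compose_FDERIV[OF this dv[of x]]
    have dc: "((\<lambda>x. - (2 * R / (v x)^2)) has_derivative (\<lambda>h. 2 * (x \<bullet> h) * (4 * R / (v x)^3))) (at x)" .
    from has_derivative_scaleR[OF dc has_derivative_ident]
    show ?thesis unfolding G_def H_def
      by (rule has_derivative_eq_rhs)
        (simp add: fun_eq_iff matrix_vector_mult_add_rdistrib matrix_vector_mult_diff_rdistrib scaleR_matrix_vector_assoc[symmetric] outer_mult)
  qed
  have b1: "norm (G x) * norm (D x) \<le> 4 * C * ct x" for x
  proof -
    have "norm x * (1 + norm x) \<le> 2 * v x"
    proof -
      have "2 * norm x \<le> 1 + norm x * norm x" using sum_squares_bound[of 1 "norm x"] by (simp add: power2_eq_square)
      moreover have "0 \<le> norm x * norm x" by simp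
      ultimately show ?thesis using R
        unfolding v_def power2_norm_eq_inner[symmetric] power2_eq_square ring_distribs by linarith
    qed
    then have "norm x * norm (D x) \<le> C * (2 * v x)"
      using mult_left_mono[OF C(2)[of x], of "norm x"] mult_left_mono[OF _ C(1), of "norm x * (1 + norm x)" "2 * v x"] by (simp add: algebra_simps)
    then have "(2 * R / (v x)^2) * (norm x * norm (D x)) \<le> (2 * R / (v x)^2) * (C * (2 * v x))"
      using R by (intro mult_left_mono) auto
    also have "\<dots> = 4 * C * ct x" using nv[of x] by (simp add: ct_def power2_eq_square field_simps)
    finally show ?thesis using R by (simp add: G_def)
  qed
  let ?N = "norm (mat 1 :: real^'d^'d)"
  have b2: "\<bar>\<psi> x\<bar> * norm (H x) \<le> C * (8 + 2 * ?N) * ct x" for x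
  proof -
    have "norm (H x) \<le> norm ((- (2 * R / (v x)^2)) *\<^sub>R (mat 1 :: real^'d^'d)) + norm ((8 * R / (v x)^3) *\<^sub>R outer x x)"
      unfolding H_def by (rule norm_triangle_ineq)
    also have "\<dots> = 2 * R / (v x)^2 * ?N + 8 * R / (v x)^3 * (x \<bullet> x)"
      using R v(1)[of x] by (simp add: norm_outer power2_norm_eq_inner[symmetric] power2_eq_square)
    also have "8 * R / (v x)^3 * (x \<bullet> x) \<le> 8 * R / (v x)^3 * v x"
      using R v(1)[of x] v(4)[of x] by (intro mult_left_mono) auto
    also have "8 * R / (v x)^3 * v x = 8 * R / (v x)^2"
      using nv[of x] by (simp add: power2_eq_square power3_eq_cube)
    finally have h: "norm (H x) \<le> (8 + 2 * ?N) * R / (v x)^2" by (simp add: algebra_simps add_divide_distrib)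
    have p: "\<bar>\<psi> x\<bar> \<le> C * v x"
      using C(3)[of x] mult_left_mono[of "1 + (norm x)\<^sup>2" "v x" C] C(1) R by (simp add: v_def power2_norm_eq_inner)
    have "\<bar>\<psi> x\<bar> * norm (H x) \<le> (C * v x) * ((8 + 2 * ?N) * R / (v x)^2)"
      using h p C(1) v(1)[of x] by (intro mult_mono) auto
    also have "\<dots> = C * (8 + 2 * ?N) * ct x" using nv[of x] by (simp add: ct_def power2_eq_square field_simps)
    finally show ?thesis .
  qed
  show bound: "norm (H' x) \<le> (K + C * (16 + 2 * ?N)) * ct x" for x
  proof -
    have "norm (H' x) \<le> norm (ct x *\<^sub>R D2 x) + norm (outer (D x) (G x)) + norm (outer (G x) (D x)) + norm (\<psi> x *\<^sub>R H x)"
      unfolding H'_def by (intro norm_triangle_le add_mono norm_triangle_ineq order_refl)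
    also have "\<dots> \<le> K * ct x + 4 * C * ct x + 4 * C * ct x + C * (8 + 2 * ?N) * ct x"
    proof (intro add_mono)
      show "norm (ct x *\<^sub>R D2 x) \<le> K * ct x" using mult_right_mono[OF K ct(1)[of x], of x] ct(1)[of x] by (simp add: mult.commute)
      show "norm (outer (D x) (G x)) \<le> 4 * C * ct x" "norm (outer (G x) (D x)) \<le> 4 * C * ct x"
        using b1[of x] by (simp_all add: norm_outer mult.commute)
      show "norm (\<psi> x *\<^sub>R H x) \<le> C * (8 + 2 * ?N) * ct x" using b2[of x] by simp
    qed
    also have "\<dots> = (K + C * (16 + 2 * ?N)) * ct x" by (simp add: algebra_simps)
    finally show ?thesis .
  qed
  show "\<bar>ct x * \<psi> x\<bar> \<le> C * R" for x
  proof -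
    have "\<bar>\<psi> x\<bar> \<le> C * v x"
      using C(3)[of x] mult_left_mono[of "1 + (norm x)\<^sup>2" "v x" C] C(1) R by (simp add: v_def power2_norm_eq_inner)
    then have "ct x * \<bar>\<psi> x\<bar> \<le> ct x * (C * v x)" using ct(1) by (rule mult_left_mono)
    also have "\<dots> = C * R" using nv[of x] by (simp add: ct_def)
    finally show ?thesis using ct(1)[of x] by (simp add: abs_mult)
  qed
  have cv: "continuous_on UNIV v" unfolding v_def by (intro continuous_intros)
  have cH: "continuous_on UNIV H" and cG: "continuous_on UNIV G" and cct: "continuous_on UNIV ct"
    unfolding H_def G_def ct_def using nv by (auto intro!: continuous_intros cv)
  show "c2b (\<lambda>x. ct x * \<psi> x) (\<lambda>x. ct x *\<^sub>R D x + \<psi> x *\<^sub>R G x) H'"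
    unfolding c2b_def
  proof (intro conjI allI)
    fix x
    show "((\<lambda>x. ct x * \<psi> x) has_derivative (\<lambda>h. (ct x *\<^sub>R D x + \<psi> x *\<^sub>R G x) \<bullet> h)) (at x)"
      by (rule has_derivative_eq_rhs[OF has_derivative_mult[OF dct c2b_D(1)[OF c]]])
        (simp add: fun_eq_iff inner_add_left algebra_simps)
    show "((\<lambda>x. ct x *\<^sub>R D x + \<psi> x *\<^sub>R G x) has_derivative (\<lambda>h. H' x *v h)) (at x)"
      by (rule has_derivative_eq_rhs[OF has_derivative_add[OF
            has_derivative_scaleR[OF dct c2b_D(2)[OF c]] has_derivative_scaleR[OF c2b_D(1)[OF c] dG]]])
        (simp add: fun_eq_iff H'_def matrix_vector_mult_add_rdistrib scaleR_matrix_vector_assoc[symmetric] outer_mult)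
    show "continuous_on UNIV H'" unfolding H'_def
      by (intro continuous_intros cH cG cct c2b_D[OF c])
    have "norm (H' x) \<le> K + C * (16 + 2 * ?N)" for x
    proof -
      have "0 \<le> K + C * (16 + 2 * ?N)" using K[of 0] C(1) norm_ge_zero[of "D2 0"] by (intro add_nonneg_nonneg mult_nonneg_nonneg norm_ge_zero) linarith+
      from mult_left_mono[OF ct(2)[of x] this] show ?thesis using bound[of x] by simp
    qed
    then show "bounded (range H')" by (auto simp: bounded_iff)
  qed
qed

text \<open>
  Multiplying by the rational cutoff \<open>R / (R + |x|\<^sup>2)\<close> makes a function of quadratic growth bounded, while
  its Hessian stays bounded uniformly in \<open>R\<close>: the growth of the function and of its gradient is
  compensated by the decay of the derivatives of the cutoff.
\<close>

lemma c2b_cutoff: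
  fixes \<psi> :: "real^'d \<Rightarrow> real"
  assumes c: "c2b \<psi> D D2"
  obtains \<psi>' D' D2' C where "\<And>n::nat. c2b (\<psi>' n) (D' n) (D2' n)" "\<And>n. bounded (range (\<psi>' n))"
    "\<And>n. ((D2' n) \<longlongrightarrow> 0) at_infinity" "0 \<le> C" "\<And>n x. norm (D2' n x) \<le> C"
    "\<And>n x. \<bar>\<psi>' n x\<bar> \<le> C * (1 + (norm x)\<^sup>2)"
    "\<And>x. (\<lambda>n. \<psi>' n x) \<longlonglongrightarrow> \<psi> x" "\<And>x. (\<lambda>n. D2' n x) \<longlonglongrightarrow> D2 x"
proof -
  obtain K where K: "0 \<le> K" "\<And>x. norm (D2 x) \<le> K" using c2b_bound[OF c] by blast
  obtain C where C: "0 \<le> C" "\<And>x. norm (D x) \<le> C * (1 + norm x)" "\<And>x. \<bar>\<psi> x\<bar> \<le> C * (1 + (norm x)\<^sup>2)"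
    using c2b_growth[OF c] by blast
  define r where "r n = real n + 1" for n :: nat
  have r: "1 \<le> r n" for n by (simp add: r_def)
  define ct where "ct n x = r n / (r n + x \<bullet> x)" for n and x :: "real^'d"
  define G where "G n x = (- (2 * r n / (r n + x \<bullet> x)^2)) *\<^sub>R x" for n and x :: "real^'d"
  define H where "H n x = (- (2 * r n / (r n + x \<bullet> x)^2)) *\<^sub>R mat 1 + (8 * r n / (r n + x \<bullet> x)^3) *\<^sub>R outer x x" for n and x :: "real^'d"
  define H' where "H' n x = ct n x *\<^sub>R D2 x + outer (D x) (G n x) + outer (G n x) (D x) + \<psi> x *\<^sub>R H n x" for n x
  define C' where "C' = C + (K + C * (16 + 2 * norm (mat 1 :: real^'d^'d)))"
  have co: "c2b (\<lambda>x. ct n x * \<psi> x) (\<lambda>x. ct n x *\<^sub>R D x + \<psi> x *\<^sub>R G n x) (H' n)"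
    "norm (H' n x) \<le> (K + C * (16 + 2 * norm (mat 1 :: real^'d^'d))) * ct n x"
    "\<bar>ct n x * \<psi> x\<bar> \<le> C * r n" "0 \<le> ct n x" "ct n x \<le> 1" for n x
    using c2b_times_cutoff[OF c r[of n] K(2) C, folded ct_def G_def H_def, folded H'_def]
    by blast+
  have Cp: "0 \<le> K + C * (16 + 2 * norm (mat 1 :: real^'d^'d))" using K C by (intro add_nonneg_nonneg mult_nonneg_nonneg) auto
  have l0: "(\<lambda>n. inverse (r n + s)) \<longlonglongrightarrow> 0" for s
  proof -
    have "filterlim (\<lambda>n. r n + s) at_top sequentially" unfolding r_def
      using filterlim_tendsto_add_at_top[OF tendsto_const[of "1 + s"] filterlim_real_sequentially] by (simp add: add_ac)
    then show ?thesis by (rule tendsto_inverse_0_at_top)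
  qed
  have pos: "0 < r n + x \<bullet> x" for n and x :: "real^'d" using r[of n] inner_ge_zero[of x] by linarith
  have l1: "(\<lambda>n. ct n x) \<longlonglongrightarrow> 1" for x
  proof -
    have "ct n x = 1 - (x \<bullet> x) * inverse (r n + x \<bullet> x)" for n
      using pos[of n x] by (simp add: ct_def field_simps)
    moreover have "(\<lambda>n. 1 - (x \<bullet> x) * inverse (r n + x \<bullet> x)) \<longlonglongrightarrow> 1 - (x \<bullet> x) * 0"
      by (intro tendsto_intros l0)
    ultimately show ?thesis by simp
  qed
  have l2: "(\<lambda>n. 2 * r n / (r n + x \<bullet> x)^2) \<longlonglongrightarrow> 0" for x :: "real^'d"
  proof -
    have "2 * r n / (r n + x \<bullet> x)^2 = 2 * (ct n x * inverse (r n + x \<bullet> x))" for n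
      by (simp add: ct_def power2_eq_square divide_inverse)
    moreover have "(\<lambda>n. 2 * (ct n x * inverse (r n + x \<bullet> x))) \<longlonglongrightarrow> 2 * (1 * 0)"
      by (intro tendsto_intros l0 l1)
    ultimately show ?thesis by simp
  qed
  have l3: "(\<lambda>n. 8 * r n / (r n + x \<bullet> x)^3) \<longlonglongrightarrow> 0" for x :: "real^'d"
  proof -
    have "8 * r n / (r n + x \<bullet> x)^3 = 8 * (ct n x * inverse (r n + x \<bullet> x) * inverse (r n + x \<bullet> x))" for n
      by (simp add: ct_def power3_eq_cube divide_inverse)
    moreover have "(\<lambda>n. 8 * (ct n x * inverse (r n + x \<bullet> x) * inverse (r n + x \<bullet> x))) \<longlonglongrightarrow> 8 * (1 * 0 * 0)"
      by (intro tendsto_intros l0 l1)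
    ultimately show ?thesis by simp
  qed
  have lG: "(\<lambda>n. G n x) \<longlonglongrightarrow> 0" for x
    using tendsto_scaleR[OF tendsto_minus[OF l2[of x]] tendsto_const[of x]] by (simp add: G_def)
  have lH: "(\<lambda>n. H n x) \<longlonglongrightarrow> 0" for x
    using tendsto_add[OF tendsto_scaleR[OF tendsto_minus[OF l2[of x]] tendsto_const[of "mat 1"]]
      tendsto_scaleR[OF l3[of x] tendsto_const[of "outer x x"]]] by (simp add: H_def)
  have outer0: "outer a 0 = 0" "outer 0 a = 0" for a :: "real^'d" by (simp_all add: outer_def vec_eq_iff)
  show thesis
  proof (rule that[where \<psi>' = "\<lambda>n x. ct n x * \<psi> x" and D' = "\<lambda>n x. ct n x *\<^sub>R D x + \<psi> x *\<^sub>R G n x" and D2' = H' and C = C'])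
    show "c2b (\<lambda>x. ct n x * \<psi> x) (\<lambda>x. ct n x *\<^sub>R D x + \<psi> x *\<^sub>R G n x) (H' n)" for n by (rule co(1))
    show "bounded (range (\<lambda>x. ct n x * \<psi> x))" for n using co(3)[of n] by (auto simp: bounded_iff)
    show "0 \<le> C'" using Cp C(1) by (simp add: C'_def)
    show "norm (H' n x) \<le> C'" for n x
    proof -
      have "norm (H' n x) \<le> (K + C * (16 + 2 * norm (mat 1 :: real^'d^'d))) * 1"
        using co(2)[of n x] mult_left_mono[OF co(5)[of n x] Cp] by linarith
      then show ?thesis using C(1) by (simp add: C'_def)
    qed
    show "\<bar>ct n x * \<psi> x\<bar> \<le> C' * (1 + (norm x)\<^sup>2)" for n x
    proof -
      have "\<bar>ct n x * \<psi> x\<bar> \<le> 1 * \<bar>\<psi> x\<bar>" unfolding abs_mult using co(4,5)[of n x] by (intro mult_right_mono) auto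
      also have "\<dots> \<le> C * (1 + (norm x)\<^sup>2)" using C(3) by simp
      also have "\<dots> \<le> C' * (1 + (norm x)\<^sup>2)" using Cp by (intro mult_right_mono) (auto simp: C'_def)
      finally show ?thesis .
    qed
    show "(\<lambda>n. ct n x * \<psi> x) \<longlonglongrightarrow> \<psi> x" for x using tendsto_mult[OF l1[of x] tendsto_const[of "\<psi> x"]] by simp
    show "(\<lambda>n. H' n x) \<longlonglongrightarrow> D2 x" for x
    proof -
      have "(\<lambda>n. H' n x) \<longlonglongrightarrow> 1 *\<^sub>R D2 x + outer (D x) 0 + outer 0 (D x) + \<psi> x *\<^sub>R 0"
        unfolding H'_def by (intro tendsto_intros tendsto_outer l1 lG lH)
      then show ?thesis by (simp add: outer0)
    qed
    show "((H' n) \<longlongrightarrow> 0) at_infinity" for n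
    proof (rule Lim_null_comparison)
      show "\<forall>\<^sub>F x in at_infinity. norm (H' n x) \<le> (K + C * (16 + 2 * norm (mat 1 :: real^'d^'d))) * ct n x"
        using co(2) by (intro always_eventually) auto
      have "filterlim (\<lambda>x::real^'d. r n + (norm x)^2) at_top at_infinity"
        by (intro filterlim_tendsto_add_at_top[OF tendsto_const] filterlim_pow_at_top filterlim_norm_at_top) auto
      then have "((\<lambda>x::real^'d. r n / (r n + (norm x)^2)) \<longlongrightarrow> 0) at_infinity"
        by (rule tendsto_divide_0[OF tendsto_const filterlim_at_top_imp_at_infinity])
      then have "((ct n) \<longlongrightarrow> 0) at_infinity" unfolding ct_def by (simp add: power2_norm_eq_inner)
      from tendsto_mult[OF tendsto_const this]
      show "((\<lambda>x. (K + C * (16 + 2 * norm (mat 1 :: real^'d^'d))) * ct n x) \<longlongrightarrow> 0) at_infinity" by simp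
    qed
  qed
qed

section \<open>Weak duality\<close>

lemma DERIV_pos_part_square: "((\<lambda>u::real. (max 0 u)\<^sup>2) has_real_derivative 2 * max 0 u) (at u)"
proof -
  consider "u > 0" | "u < 0" | "u = 0" by linarith
  then show ?thesis
  proof cases
    case 1
    have "((\<lambda>u::real. u\<^sup>2) has_real_derivative 2 * max 0 u) (at u)"
      using 1 by (auto intro!: derivative_eq_intros)
    then show ?thesis
      by (rule has_field_derivative_transform_within_open[where S = "{0<..}"]) (use 1 in auto)
  next
    case 2
    have "((\<lambda>u::real. 0) has_real_derivative 2 * max 0 u) (at u)" using 2 by auto
    then show ?thesis
      by (rule has_field_derivative_transform_within_open[where S = "{..<0}"]) (use 2 in auto)
  next
    case 3
    have "((\<lambda>h::real. (max 0 h)\<^sup>2 / h) \<longlongrightarrow> 0) (at 0)"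
    proof (rule Lim_null_comparison)
      show "\<forall>\<^sub>F h in at 0. norm ((max 0 h)\<^sup>2 / h) \<le> \<bar>h\<bar>"
        by (intro always_eventually allI) (auto simp: max_def power2_eq_square)
      show "((\<lambda>h::real. \<bar>h\<bar>) \<longlongrightarrow> 0) (at 0)" using tendsto_rabs_zero[OF tendsto_ident_at] .
    qed
    then show ?thesis using 3 by (simp add: DERIV_def)
  qed
qed

text \<open>
  An explicit \<open>C\<^sup>1\<close> transition from \<open>0\<close> to \<open>1\<close> on the unit interval; \<open>tent\<close> is its derivative.  Rescaled,
  they localise the equation near the two end times.
\<close>

definition step :: "real \<Rightarrow> real" where
  "step u = 2 * (max 0 u)\<^sup>2 - 4 * (max 0 (u - 1/2))\<^sup>2 + 2 * (max 0 (u - 1))\<^sup>2"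

definition tent :: "real \<Rightarrow> real" where
  "tent u = 4 * max 0 u - 8 * max 0 (u - 1/2) + 4 * max 0 (u - 1)"

lemma DERIV_step: "(step has_real_derivative tent u) (at u)"
proof -
  have sh: "((\<lambda>u::real. (max 0 (u - c))\<^sup>2) has_real_derivative 2 * max 0 (u - c)) (at u)" for c
  proof -
    have "((\<lambda>u. u - c) has_real_derivative 1) (at u)" by (auto intro!: derivative_eq_intros)
    from DERIV_chain2[where f = "\<lambda>u. (max 0 u)\<^sup>2" and g = "\<lambda>u. u - c", OF DERIV_pos_part_square this]
    show ?thesis by simp
  qed
  show ?thesis unfolding step_def[abs_def]
    by (rule derivative_eq_intros DERIV_pos_part_square sh refl)+ (simp add: tent_def)
qed

lemma step_0: "u \<le> 0 \<Longrightarrow> step u = 0" by (simp add: step_def max_def)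

lemma step_1: "1 \<le> u \<Longrightarrow> step u = 1" by (simp add: step_def max_def power2_eq_square algebra_simps)

lemma step_bound: "\<bar>step u\<bar> \<le> 9"
proof -
  consider "u \<le> 0" | "1 \<le> u" | "0 < u" "u < 1" by linarith
  then show ?thesis
  proof cases
    case 3
    have "(max 0 u)\<^sup>2 \<le> 1\<^sup>2" "(max 0 (u - 1/2))\<^sup>2 \<le> 1\<^sup>2" "(max 0 (u - 1))\<^sup>2 \<le> 1\<^sup>2"
      using 3 by (intro power_mono; simp)+
    moreover have "0 \<le> (max 0 u)\<^sup>2" "0 \<le> (max 0 (u - 1/2))\<^sup>2" "0 \<le> (max 0 (u - 1))\<^sup>2" by simp_all
    ultimately show ?thesis unfolding step_def abs_le_iff one_power2 by linarith
  qed (auto simp: step_0 step_1)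
qed

lemma tent_0: "u \<le> 0 \<or> 1 \<le> u \<Longrightarrow> tent u = 0" by (auto simp: tent_def max_def)

lemma tent_bound: "\<bar>tent u\<bar> \<le> 16"
proof (cases "u \<le> 0 \<or> 1 \<le> u")
  case False
  then show ?thesis by (auto simp: tent_def max_def abs_le_iff)
qed (simp add: tent_0)

lemma continuous_on_tent: "continuous_on S tent"
  unfolding tent_def[abs_def] by (intro continuous_intros)

lemma tent_integral: "integrable lborel tent" "(LINT u|lborel. tent u) = 1"
proof -
  have eq: "tent = (\<lambda>u. indicator {0..1} u *\<^sub>R tent u)"
  proof
    show "tent u = indicator {0..1} u *\<^sub>R tent u" for u using tent_0[of u] by (cases "u \<in> {0..1}") auto
  qed
  show "integrable lborel tent"
    using borel_integrable_atLeastAtMost'[OF continuous_on_tent, of 0 1] eq by (simp add: set_integrable_def)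
  have "(LINT u|lborel. indicator {0..1} u *\<^sub>R tent u) = step 1 - step 0"
    by (rule integral_FTC_atLeastAtMost)
      (auto intro!: continuous_on_tent has_field_derivative_at_within DERIV_step simp: has_real_derivative_iff_has_vector_derivative[symmetric])
  then show "(LINT u|lborel. tent u) = 1" using eq by (simp add: step_0 step_1)
qed

lemma set_borel_measurable_restrict_iff:
  "set_borel_measurable lborel {0<..<1::real} f \<longleftrightarrow> f \<in> borel_measurable (restrict_space borel {0<..<1})"
  for f :: "real \<Rightarrow> 'b::real_normed_vector"
  by (simp add: set_borel_measurable_def borel_measurable_restrict_space_iff)

lemma mat_integral_measurable:
  fixes l :: "real \<Rightarrow> (real^'d) set \<Rightarrow> real^'d^'d"
  assumes l: "time_disint_mat \<Lambda> l" and \<Phi>: "\<Phi> \<in> borel_measurable borel" "\<And>x. norm (\<Phi> x) \<le> C"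
  shows "(\<lambda>t. mat_integral borel \<Phi> (l t)) \<in> borel_measurable (restrict_space borel {0<..<1})"
proof -
  obtain F where F: "\<And>n. simple_function borel (F n)" "\<And>x. x \<in> space borel \<Longrightarrow> (\<lambda>n. F n x) \<longlonglongrightarrow> \<Phi> x"
      "\<And>n x. x \<in> space borel \<Longrightarrow> norm (F n x) \<le> 2 * C"
    using bounded_simple_approximation[OF \<Phi>] by metis
  have lB: "(\<lambda>t. l t B) \<in> borel_measurable (restrict_space borel {0<..<1})" if "B \<in> sets borel" for B
    using l that by (simp add: time_disint_mat_def)
  have sets: "F n -` {c} \<inter> space borel \<in> sets borel" for n c
    by (rule simple_functionD(2)[OF F(1)])
  show ?thesis
  proof (rule borel_measurable_LIMSEQ_real[where u = "\<lambda>n t. \<Sum>c\<in>F n ` space borel. c \<bullet> l t (F n -` {c} \<inter> space borel)"])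
    fix t assume "t \<in> space (restrict_space borel {0<..<1::real})"
    then have "l t \<in> psd_measures borel" using l by (auto simp: time_disint_mat_def)
    from mat_integral_simple_limit[where M = borel and F = F and \<Phi> = \<Phi>, OF F this]
    show "(\<lambda>n. \<Sum>c\<in>F n ` space borel. c \<bullet> l t (F n -` {c} \<inter> space borel)) \<longlonglongrightarrow> mat_integral borel \<Phi> (l t)" .
  next
    show "(\<lambda>t. \<Sum>c\<in>F n ` space borel. c \<bullet> l t (F n -` {c} \<inter> space borel)) \<in> borel_measurable (restrict_space borel {0<..<1})" for n
      by (intro borel_measurable_sum borel_measurable_inner borel_measurable_const lB sets)
  qed
qed

lemma trace_le_tot_var:
  fixes V :: "'a set \<Rightarrow> real^'d^'d"
  assumes V: "V \<in> psd_measures M"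
  shows "trace (V (space M)) \<le> norm (mat 1 :: real^'d^'d) * measure (tot_var M V) (space M)"
proof -
  note p = polar_density[OF V] and s = finite_tot_var[OF V]
  have "V (space M) = (LINT x|tot_var M V. polar_density M V x)"
    using p(4)[of "space M"] s(3) set_integral_space[OF p(3)] by simp
  then have "trace (V (space M)) = mat_integral M (\<lambda>_. mat 1) V"
    unfolding mat_integral_def using p(3) by (simp add: mat_1_inner[symmetric])
  also have "\<dots> \<le> norm (mat 1 :: real^'d^'d) * measure (tot_var M V) (space M)"
    using abs_mat_integral_le(2)[OF V, of "\<lambda>_. mat 1" "norm (mat 1 :: real^'d^'d)"] by simp
  finally show ?thesis .
qed

lemma fokker_planck_integrable:
  fixes l :: "real \<Rightarrow> (real^'d) set \<Rightarrow> real^'d^'d"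
  assumes fp: "fokker_planck \<rho> \<Lambda> r l"
  shows "set_integrable lborel {0<..<1} (\<lambda>t. trace (l t UNIV))"
    "\<And>\<Phi> C. \<Phi> \<in> borel_measurable borel \<Longrightarrow> (\<And>x. norm (\<Phi> x) \<le> C) \<Longrightarrow>
       set_integrable lborel {0<..<1} (\<lambda>t. mat_integral borel \<Phi> (l t))"
    "\<And>\<Phi> C t. \<Phi> \<in> borel_measurable borel \<Longrightarrow> (\<And>x. norm (\<Phi> x) \<le> C) \<Longrightarrow> 0 < t \<Longrightarrow> t < 1 \<Longrightarrow>
       \<bar>mat_integral borel \<Phi> (l t)\<bar> \<le> C * (real CARD('d) * real CARD('d)) * trace (l t UNIV)"
proof -
  let ?N = "norm (mat 1 :: real^'d^'d)" and ?K = "real CARD('d) * real CARD('d)"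
  have l: "time_disint_mat \<Lambda> l" and fin: "(\<integral>\<^sup>+ t\<in>{0<..<1}. emeasure (tot_var borel (l t)) UNIV \<partial>lborel) < \<infinity>"
    using fp by (auto simp: fokker_planck_def)
  have psd: "l t \<in> psd_measures borel" if "0 < t" "t < 1" for t
    using l that by (simp add: time_disint_mat_def)
  have lU: "(\<lambda>t. l t UNIV) \<in> borel_measurable (restrict_space borel {0<..<1})"
    using l by (simp add: time_disint_mat_def)
  have m: "set_borel_measurable lborel {0<..<1} (\<lambda>t. trace (l t UNIV))"
    unfolding set_borel_measurable_restrict_iff mat_1_inner[symmetric] using lU by measurable
  have tr0: "0 \<le> trace (l t UNIV)" if "0 < t" "t < 1" for t
    using psd_trace_nonneg[OF psd_measures_in_psd[OF psd[OF that], of UNIV]] by simp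
  show tr: "set_integrable lborel {0<..<1} (\<lambda>t. trace (l t UNIV))"
    unfolding set_integrable_def
  proof (rule integrableI_bounded)
    show "(\<lambda>t. indicator {0<..<1} t *\<^sub>R trace (l t UNIV)) \<in> borel_measurable lborel"
      using m by (simp add: set_borel_measurable_def)
    let ?g = "\<lambda>t. ennreal (norm (indicator {0<..<1} t *\<^sub>R trace (l t UNIV)))"
    have N: "0 < ?N" by (simp add: mat_def vec_eq_iff)
    have gm: "?g \<in> borel_measurable lborel" using m by (auto simp: set_borel_measurable_def)
    have "(\<integral>\<^sup>+t. ennreal (1 / ?N) * ?g t \<partial>lborel)
        \<le> (\<integral>\<^sup>+ t\<in>{0<..<1}. emeasure (tot_var borel (l t)) UNIV \<partial>lborel)"
    proof (intro nn_integral_mono)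
      fix t :: real
      show "ennreal (1 / ?N) * ?g t \<le> emeasure (tot_var borel (l t)) UNIV * indicator {0<..<1} t"
      proof (cases "0 < t \<and> t < 1")
        case True
        then have V: "l t \<in> psd_measures borel" using psd by auto
        have "trace (l t UNIV) / ?N \<le> measure (tot_var borel (l t)) UNIV"
          using trace_le_tot_var[OF V] N by (simp add: field_simps)
        then show ?thesis using True tr0[of t] N
          by (simp add: finite_measure.emeasure_eq_measure[OF finite_tot_var(1)[OF V]] ennreal_mult[symmetric] ennreal_leI)
      qed auto
    qed
    also have "\<dots> < \<infinity>" by (rule fin)
    finally have fin': "ennreal (1 / ?N) * (\<integral>\<^sup>+t. ?g t \<partial>lborel) < \<infinity>" using gm by (simp add: nn_integral_cmult)
    have "(\<integral>\<^sup>+t. ?g t \<partial>lborel) = ennreal ?N * (ennreal (1 / ?N) * (\<integral>\<^sup>+t. ?g t \<partial>lborel))"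
      using N by (simp add: mult.assoc[symmetric] ennreal_mult[symmetric])
    also have "\<dots> < \<infinity>" using fin' by (simp add: ennreal_mult_less_top)
    finally show "(\<integral>\<^sup>+t. ennreal (norm (indicator {0<..<1} t *\<^sub>R trace (l t UNIV))) \<partial>lborel) < \<infinity>" .
  qed
  show bd: "\<bar>mat_integral borel \<Phi> (l t)\<bar> \<le> C * ?K * trace (l t UNIV)"
    if "\<Phi> \<in> borel_measurable borel" "\<And>x. norm (\<Phi> x) \<le> C" "0 < t" "t < 1" for \<Phi> C t
  proof -
    have C: "0 \<le> C" using that(2)[of 0] norm_ge_zero order_trans by blast
    have "\<bar>mat_integral borel \<Phi> (l t)\<bar> \<le> C * measure (tot_var borel (l t)) UNIV"
      using abs_mat_integral_le(2)[OF psd[OF that(3,4)] that(1,2) C] by simp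
    also have "\<dots> \<le> C * (?K * trace (l t UNIV))"
      using tot_var_le_trace[OF psd[OF that(3,4)], of UNIV] C by (intro mult_left_mono) auto
    finally show ?thesis by (simp add: mult.assoc)
  qed
  show "set_integrable lborel {0<..<1} (\<lambda>t. mat_integral borel \<Phi> (l t))"
    if \<Phi>: "\<Phi> \<in> borel_measurable borel" "\<And>x. norm (\<Phi> x) \<le> C" for \<Phi> C
    unfolding set_integrable_def
  proof (rule Bochner_Integration.integrable_bound)
    show "integrable lborel (\<lambda>t. C * ?K * (indicator {0<..<1} t *\<^sub>R trace (l t UNIV)))"
      using tr unfolding set_integrable_def by (intro integrable_mult_right)
    show "(\<lambda>t. indicator {0<..<1} t *\<^sub>R mat_integral borel \<Phi> (l t)) \<in> borel_measurable lborel"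
      using mat_integral_measurable[OF l \<Phi>]
      unfolding set_borel_measurable_restrict_iff[symmetric] set_borel_measurable_def .
    show "AE t in lborel. norm (indicator {0<..<1} t *\<^sub>R mat_integral borel \<Phi> (l t))
       \<le> norm (C * ?K * (indicator {0<..<1} t *\<^sub>R trace (l t UNIV)))"
      using bd[OF \<Phi>] by (intro AE_I2) (auto simp: indicator_def intro: order_trans[OF _ abs_ge_self])
  qed
qed

text \<open>
  The equation is tested with \<open>\<eta>(t) \<psi>(x)\<close>, where \<open>\<eta>\<close> is \<open>1\<close> except near the end times.  As the
  transition layers shrink, \<open>\<eta>'\<close> concentrates at \<open>0\<close> and \<open>1\<close>, and narrow continuity gives the endpoint
  values.  Boundedness of \<open>\<psi>\<close> is needed since the time derivative of a test function is bounded.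
\<close>

lemma bounded_test_identity:
  fixes \<psi> :: "real^'d \<Rightarrow> real"
  assumes fp: "fokker_planck \<rho> \<Lambda> r l" and nc: "narrowly_continuous r" and rP: "\<forall>t\<in>{0..1}. r t \<in> P2"
    and c: "c2b \<psi> D D2" and b\<psi>: "bounded (range \<psi>)"
  shows "(LINT x|r 1. \<psi> x) - (LINT x|r 0. \<psi> x)
    = (LINT t:{0<..<1}|lborel. mat_integral borel (\<lambda>x. (1/2) *\<^sub>R D2 x) (l t))"
proof -
  define b where "b t = mat_integral borel (\<lambda>x. (1/2) *\<^sub>R D2 x) (l t)" for t
  define a where "a t = (LINT x|r (max 0 (min 1 t)). \<psi> x)" for t
  obtain B where B: "\<And>x. \<bar>\<psi> x\<bar> \<le> B" using b\<psi> by (auto simp: bounded_iff)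
  obtain K where K: "0 \<le> K" "\<And>x. norm (D2 x) \<le> K" using c2b_bound[OF c] by blast
  have ca: "continuous_on UNIV a"
  proof -
    have "continuous_on {0..1} (\<lambda>t. LINT x|r t. \<psi> x)"
      using nc b\<psi> c2b_D(5)[OF c] by (simp add: narrowly_continuous_def)
    then show ?thesis unfolding a_def
      by (rule continuous_on_compose2) (auto intro!: continuous_intros)
  qed
  have ba: "\<bar>a t\<bar> \<le> B" for t
  proof -
    have "r (max 0 (min 1 t)) \<in> P2" using rP by auto
    then have p: "prob_space (r (max 0 (min 1 t)))" by (simp add: P2_def)
    interpret prob_space "r (max 0 (min 1 t))" by fact
    have B0: "0 \<le> B" using B[of 0] by linarith
    have "norm (LINT x|r (max 0 (min 1 t)). \<psi> x) \<le> (LINT x|r (max 0 (min 1 t)). norm (\<psi> x))"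
      by (rule integral_norm_bound)
    also have "\<dots> \<le> B"
    proof (cases "integrable (r (max 0 (min 1 t))) (\<lambda>x. norm (\<psi> x))")
      case True
      then show ?thesis using B by (intro integral_le_const) auto
    qed (simp add: not_integrable_integral_eq B0)
    finally show ?thesis by (simp add: a_def)
  qed
  have D2m: "D2 \<in> borel_measurable borel" using c2b_D(3)[OF c] by (rule borel_measurable_continuous_onI)
  have ib: "set_integrable lborel {0<..<1} b"
    unfolding b_def by (rule fokker_planck_integrable(2)[OF fp, of _ "K/2"]) (use D2m K in auto)
  define h where "h n = 1 / (real n + 4)" for n :: nat
  have h: "0 < h n" "4 * h n \<le> 1" for n by (auto simp: h_def field_simps)
  have hl: "h \<longlonglongrightarrow> 0"
    unfolding h_def
    using tendsto_divide_0[OF tendsto_const filterlim_at_top_imp_at_infinity[OF filterlim_tendsto_add_at_top[OF tendsto_const[of 4] filterlim_real_sequentially]], of 1]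
    by (simp add: add.commute)
  define \<eta> where "\<eta> n t = step ((t - h n) / h n) - step ((t - (1 - 2 * h n)) / h n)" for n t
  define \<eta>' where "\<eta>' n t = tent ((t - h n) / h n) / h n - tent ((t - (1 - 2 * h n)) / h n) / h n" for n t
  have d\<eta>: "(\<eta> n has_real_derivative \<eta>' n t) (at t)" for n t
  proof -
    have "((\<lambda>t. step ((t - c) / h n)) has_real_derivative tent ((t - c) / h n) / h n) (at t)" for c
    proof -
      have "((\<lambda>t. (t - c) / h n) has_real_derivative 1 / h n) (at t)"
        using h(1)[of n] by (auto intro!: derivative_eq_intros)
      from DERIV_chain2[where f = step and g = "\<lambda>t. (t - c) / h n", OF DERIV_step this]
      show ?thesis by simp
    qed
    then show ?thesis unfolding \<eta>_def[abs_def] \<eta>'_def by (intro DERIV_diff)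
  qed
  have c\<eta>: "continuous_on S (\<eta> n)" for S n
    using d\<eta> by (meson DERIV_continuous_on has_field_derivative_at_within)
  have c\<eta>': "continuous_on S (\<eta>' n)" for S n
    unfolding \<eta>'_def[abs_def] using h(1)[of n]
    by (intro continuous_intros continuous_on_compose2[OF continuous_on_tent[of UNIV]]) auto
  have out: "\<eta> n t = 0" "\<eta>' n t = 0" if "t \<le> h n \<or> 1 - h n \<le> t" for n t
  proof -
    have "(t - h n) / h n \<le> 0 \<and> (t - (1 - 2 * h n)) / h n \<le> 0 \<or>
        1 \<le> (t - h n) / h n \<and> 1 \<le> (t - (1 - 2 * h n)) / h n"
      using that h[of n] by (auto simp: field_simps)
    then show "\<eta> n t = 0" "\<eta>' n t = 0" by (auto simp: \<eta>_def \<eta>'_def step_0 step_1 tent_0)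
  qed
  have b\<eta>: "\<bar>\<eta> n t\<bar> \<le> 18" for n t
    unfolding \<eta>_def using step_bound[of "(t - h n) / h n"] step_bound[of "(t - (1 - 2 * h n)) / h n"] by linarith
  have b\<eta>': "\<bar>\<eta>' n t\<bar> \<le> 32 / h n" for n t
  proof -
    have "\<bar>tent u / h n\<bar> \<le> 16 / h n" for u using tent_bound[of u] h(1)[of n] by (simp add: divide_right_mono)
    from this[of "(t - h n) / h n"] this[of "(t - (1 - 2 * h n)) / h n"] show ?thesis unfolding \<eta>'_def by linarith
  qed
  have tf: "test_function (\<lambda>t x. \<eta> n t * \<psi> x) (\<lambda>t x. \<eta>' n t * \<psi> x) (\<lambda>t x. \<eta> n t *\<^sub>R D2 x)" for n
    unfolding test_function_def
  proof (intro conjI exI[of _ "\<lambda>t x. \<eta> n t *\<^sub>R D x"] ballI allI)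
    fix t x
    show "((\<lambda>s. \<eta> n s * \<psi> x) has_real_derivative \<eta>' n t * \<psi> x) (at t)" by (rule DERIV_cmult_right[OF d\<eta>])
    show "((\<lambda>x. \<eta> n t * \<psi> x) has_derivative (\<lambda>h. (\<eta> n t *\<^sub>R D x) \<bullet> h)) (at x)"
      by (rule c2b_D(1)[OF c2b_scale[OF c]])
    show "((\<lambda>x. \<eta> n t *\<^sub>R D x) has_derivative (\<lambda>h. (\<eta> n t *\<^sub>R D2 x) *v h)) (at x)"
      by (rule c2b_D(2)[OF c2b_scale[OF c]])
  next
    have f: "continuous_on S (\<lambda>z. \<eta> n (fst z))" "continuous_on S (\<lambda>z. \<eta>' n (fst z))" for S :: "(real \<times> (real^'d)) set"
      by (rule continuous_on_compose2[OF c\<eta>[of UNIV]] continuous_on_compose2[OF c\<eta>'[of UNIV]]; auto intro!: continuous_intros)+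
    have g: "continuous_on S (\<lambda>z. \<psi> (snd z))" "continuous_on S (\<lambda>z. D (snd z))" "continuous_on S (\<lambda>z. D2 (snd z))" for S :: "(real \<times> (real^'d)) set"
      by (rule continuous_on_compose2[OF c2b_D(5)[OF c]] continuous_on_compose2[OF c2b_D(6)[OF c]] continuous_on_compose2[OF c2b_D(3)[OF c]]; auto intro!: continuous_intros)+
    show "continuous_on ({0<..<1} \<times> UNIV) (\<lambda>(t, x). \<eta> n t * \<psi> x)"
      "continuous_on ({0<..<1} \<times> UNIV) (\<lambda>(t, x). \<eta>' n t * \<psi> x)"
      "continuous_on ({0<..<1} \<times> UNIV) (\<lambda>(t, x). \<eta> n t *\<^sub>R D x)"
      "continuous_on ({0<..<1} \<times> UNIV) (\<lambda>(t, x). \<eta> n t *\<^sub>R D2 x)"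
      unfolding split_beta by (intro continuous_intros f g)+
  next
    have "norm (\<eta>' n t * \<psi> x) \<le> 32 / h n * B" for t x
      unfolding real_norm_def abs_mult using b\<eta>'[of n t] B[of x] h(1)[of n] by (intro mult_mono) auto
    then show "bounded ((\<lambda>(t, x). \<eta>' n t * \<psi> x) ` ({0<..<1} \<times> UNIV))"
      unfolding bounded_iff by auto
    have "norm (\<eta> n t *\<^sub>R D2 x) \<le> 18 * K" for t x
      unfolding norm_scaleR using b\<eta>[of n t] K(2)[of x] by (intro mult_mono) auto
    then show "bounded ((\<lambda>(t, x). \<eta> n t *\<^sub>R D2 x) ` ({0<..<1} \<times> UNIV))"
      unfolding bounded_iff by auto
    have "closure {(t, x). t \<in> {0<..<1} \<and> \<eta> n t * \<psi> x \<noteq> 0} \<subseteq> {h n .. 1 - h n} \<times> UNIV"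
    proof (rule closure_minimal)
      show "{(t, x). t \<in> {0<..<1} \<and> \<eta> n t * \<psi> x \<noteq> 0} \<subseteq> {h n .. 1 - h n} \<times> UNIV"
      proof clarify
        fix t x assume "\<eta> n t * \<psi> x \<noteq> 0"
        then have "\<not> (t \<le> h n \<or> 1 - h n \<le> t)" using out(1)[of t n] by auto
        then show "t \<in> {h n .. 1 - h n} \<and> x \<in> UNIV" by auto
      qed
    qed (intro closed_Times closed_atLeastAtMost closed_UNIV)
    also have "\<dots> \<subseteq> {0<..<1} \<times> UNIV" using h[of n] by auto
    finally show "closure {(t, x). t \<in> {0<..<1} \<and> \<eta> n t * \<psi> x \<noteq> 0} \<subseteq> {0<..<1} \<times> UNIV" .
  qed
  have eq: "(LINT t|lborel. \<eta>' n t * a t) = - (LINT t:{0<..<1}|lborel. \<eta> n t * b t)" for n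
  proof -
    have 1: "(LINT t:{0<..<1}|lborel. (LINT x|r t. \<eta>' n t * \<psi> x)) =
        - (LINT t:{0<..<1}|lborel. mat_integral borel (\<lambda>x. (1/2) *\<^sub>R (\<eta> n t *\<^sub>R D2 x)) (l t))"
      using fp tf[of n] unfolding fokker_planck_def by blast
    have 2: "mat_integral borel (\<lambda>x. (1/2) *\<^sub>R (\<eta> n t *\<^sub>R D2 x)) (l t) = \<eta> n t * b t" for t
      unfolding b_def mat_integral_def by (simp flip: integral_mult_right_zero add: mult_ac)
    have 3: "(LINT t:{0<..<1}|lborel. (LINT x|r t. \<eta>' n t * \<psi> x)) = (LINT t|lborel. \<eta>' n t * a t)"
      unfolding set_lebesgue_integral_def
    proof (intro Bochner_Integration.integral_cong refl)
      fix t :: real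
      show "indicator {0<..<1} t *\<^sub>R (LINT x|r t. \<eta>' n t * \<psi> x) = \<eta>' n t * a t"
      proof (cases "0 < t \<and> t < 1")
        case False
        then have "t \<le> h n \<or> 1 - h n \<le> t" using h(1)[of n] by auto
        then show ?thesis using out(2) False by auto
      qed (auto simp: a_def)
    qed
    show ?thesis using 1 unfolding 2 3 .
  qed
  have lim1: "(\<lambda>n. LINT t|lborel. \<eta>' n t * a t) \<longlonglongrightarrow> a 0 - a 1"
  proof -
    have sub: "(LINT t|lborel. tent ((t - c) / h n) / h n * a t) = (LINT u|lborel. tent u * a (c + h n * u))" for n c
      using lborel_integral_real_affine[of "h n" "\<lambda>t. tent ((t - c) / h n) / h n * a t" c] h(1)[of n] by simp
    have am: "a \<in> borel_measurable borel" and tm: "tent \<in> borel_measurable borel"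
      using ca continuous_on_tent by (auto intro: borel_measurable_continuous_onI)
    have lim: "(\<lambda>n. LINT u|lborel. tent u * a (c n + h n * u)) \<longlonglongrightarrow> a c0" if "c \<longlonglongrightarrow> c0" for c c0
    proof -
      have "(\<lambda>n. LINT u|lborel. tent u * a (c n + h n * u)) \<longlonglongrightarrow> (LINT u|lborel. tent u * a c0)"
      proof (rule integral_dominated_convergence[where w = "\<lambda>u. B * norm (tent u)"])
        show "AE u in lborel. (\<lambda>n. tent u * a (c n + h n * u)) \<longlonglongrightarrow> tent u * a c0"
        proof (rule AE_I2)
          fix u
          have "(\<lambda>n. c n + h n * u) \<longlonglongrightarrow> c0 + 0 * u" by (intro tendsto_intros that hl)
          then have "(\<lambda>n. a (c n + h n * u)) \<longlonglongrightarrow> a c0"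
            using ca by (intro continuous_on_tendsto_compose[OF ca]) auto
          then show "(\<lambda>n. tent u * a (c n + h n * u)) \<longlonglongrightarrow> tent u * a c0" by (intro tendsto_intros)
        qed
        show "AE u in lborel. norm (tent u * a (c n + h n * u)) \<le> B * norm (tent u)" for n
          using mult_right_mono[OF ba abs_ge_zero] by (intro AE_I2) (simp add: abs_mult mult.commute)
        show "integrable lborel (\<lambda>u. B * norm (tent u))" using tent_integral(1) by auto
      qed (use am tm in auto)
      then show ?thesis using tent_integral(2) by simp
    qed
    have i: "integrable lborel (\<lambda>t. tent ((t - c) / h n) / h n * a t)" for n c
    proof (rule Bochner_Integration.integrable_bound)
      have "integrable lborel (\<lambda>t. tent (- c / h n + (1 / h n) * t))"
        using lborel_integrable_real_affine[OF tent_integral(1), of "1 / h n" "- c / h n"] h(1)[of n] by simp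
      then show "integrable lborel (\<lambda>t. B / h n * tent ((t - c) / h n))"
        by (intro integrable_mult_right) (simp add: diff_divide_distrib)
      show "(\<lambda>t. tent ((t - c) / h n) / h n * a t) \<in> borel_measurable lborel" using am tm by measurable
      show "AE t in lborel. norm (tent ((t - c) / h n) / h n * a t) \<le> norm (B / h n * tent ((t - c) / h n))"
        using ba h(1)[of n] order_trans[OF abs_ge_zero ba[of 0]]
        by (intro AE_I2) (auto simp: abs_mult field_simps intro!: mult_right_mono[OF ba abs_ge_zero])
    qed
    have "(LINT t|lborel. \<eta>' n t * a t) = (LINT u|lborel. tent u * a (h n + h n * u)) - (LINT u|lborel. tent u * a (1 - 2 * h n + h n * u))" for n
      unfolding \<eta>'_def left_diff_distrib by (subst Bochner_Integration.integral_diff) (use i sub in auto)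
    moreover have "(\<lambda>n. (LINT u|lborel. tent u * a (h n + h n * u)) - (LINT u|lborel. tent u * a (1 - 2 * h n + h n * u))) \<longlonglongrightarrow> a 0 - a 1"
      using tendsto_diff[OF tendsto_const[of 1] tendsto_mult[OF tendsto_const[of 2] hl]]
      by (intro tendsto_diff lim hl) auto
    ultimately show ?thesis by simp
  qed
  have lim2: "(\<lambda>n. LINT t:{0<..<1}|lborel. \<eta> n t * b t) \<longlonglongrightarrow> (LINT t:{0<..<1}|lborel. b t)"
    unfolding set_lebesgue_integral_def
  proof (rule integral_dominated_convergence[where w = "\<lambda>t. 18 * norm (indicator {0<..<1} t *\<^sub>R b t)"])
    show "integrable lborel (\<lambda>t. 18 * norm (indicator {0<..<1} t *\<^sub>R b t))"
      using ib unfolding set_integrable_def by (intro integrable_mult_right integrable_norm)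
    have bm: "(\<lambda>t. indicator {0<..<1} t *\<^sub>R b t) \<in> borel_measurable lborel"
      using ib unfolding set_integrable_def by auto
    then show "(\<lambda>t. indicator {0<..<1} t *\<^sub>R b t) \<in> borel_measurable lborel" .
    have "\<eta> n \<in> borel_measurable borel" for n using c\<eta> by (rule borel_measurable_continuous_onI)
    then have "(\<lambda>t. \<eta> n t * (indicator {0<..<1} t *\<^sub>R b t)) \<in> borel_measurable lborel" for n using bm by simp
    then show "(\<lambda>t. indicator {0<..<1} t *\<^sub>R (\<eta> n t * b t)) \<in> borel_measurable lborel" for n
      by (simp add: mult.left_commute)
    show "AE t in lborel. norm (indicator {0<..<1} t *\<^sub>R (\<eta> n t * b t)) \<le> 18 * norm (indicator {0<..<1} t *\<^sub>R b t)" for n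
      using b\<eta>[of n] by (intro AE_I2) (auto simp: abs_mult indicator_def intro!: mult_right_mono)
    show "AE t in lborel. (\<lambda>n. indicator {0<..<1} t *\<^sub>R (\<eta> n t * b t)) \<longlonglongrightarrow> indicator {0<..<1} t *\<^sub>R b t"
    proof (rule AE_I2)
      fix t :: real
      show "(\<lambda>n. indicator {0<..<1} t *\<^sub>R (\<eta> n t * b t)) \<longlonglongrightarrow> indicator {0<..<1} t *\<^sub>R b t"
      proof (cases "0 < t \<and> t < 1")
        case True
        have "eventually (\<lambda>n. h n < t / 2) sequentially" "eventually (\<lambda>n. h n < (1 - t) / 2) sequentially"
          using True by (intro order_tendstoD(2)[OF hl]; simp)+
        then have "eventually (\<lambda>n. indicator {0<..<1} t *\<^sub>R (\<eta> n t * b t) = indicator {0<..<1} t *\<^sub>R b t) sequentially"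
        proof eventually_elim
          case (elim n)
          have "1 \<le> (t - h n) / h n" "(t - (1 - 2 * h n)) / h n \<le> 0"
            using elim h(1)[of n] by (auto simp: field_simps)
          then show ?case by (simp add: \<eta>_def step_0 step_1)
        qed
        then show ?thesis by (rule tendsto_eventually)
      qed auto
    qed
  qed
  have "a 0 - a 1 = - (LINT t:{0<..<1}|lborel. b t)"
    using lim1 tendsto_minus[OF lim2] unfolding eq by (rule LIMSEQ_unique)
  then show ?thesis by (simp add: a_def b_def)
qed

lemma ennreal_integral_le_nn_integral:
  fixes g :: "'a \<Rightarrow> real"
  shows "ennreal (LINT x|M. g x) \<le> (\<integral>\<^sup>+x. ennreal (g x) \<partial>M)"
proof (cases "integrable M g")
  case True
  have "ennreal (LINT x|M. g x) \<le> ennreal (LINT x|M. max 0 (g x))"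
    using True by (intro ennreal_leI integral_mono) auto
  also have "\<dots> = (\<integral>\<^sup>+x. ennreal (max 0 (g x)) \<partial>M)"
    using True by (intro nn_integral_eq_integral[symmetric]) auto
  also have "\<dots> = (\<integral>\<^sup>+x. ennreal (g x) \<partial>M)"
    by (intro nn_integral_cong) (auto simp: max_def ennreal_neg)
  finally show ?thesis .
qed (simp add: not_integrable_integral_eq)

lemma P2_D:
  assumes "\<mu> \<in> P2"
  shows "sets \<mu> = sets borel" "prob_space \<mu>" "space \<mu> = UNIV" "integrable \<mu> (\<lambda>x. (norm x)\<^sup>2)"
proof -
  show s: "sets \<mu> = sets borel" "prob_space \<mu>" using assms by (auto simp: P2_def)
  show "space \<mu> = UNIV" using sets_eq_imp_space_eq[OF s(1)] by simp
  have m: "(\<lambda>x. (norm x)\<^sup>2) \<in> borel_measurable \<mu>"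
    unfolding measurable_cong_sets[OF s(1) refl] by measurable
  show "integrable \<mu> (\<lambda>x. (norm x)\<^sup>2)"
    using assms m by (intro integrableI_nonneg) (auto simp: P2_def)
qed

lemma P2_integrable:
  fixes g :: "real^'d \<Rightarrow> real"
  assumes \<mu>: "\<mu> \<in> P2" and g: "g \<in> borel_measurable borel" "\<And>x. \<bar>g x\<bar> \<le> C * (1 + (norm x)\<^sup>2)"
  shows "integrable \<mu> g"
proof (rule Bochner_Integration.integrable_bound)
  note P = P2_D[OF \<mu>]
  interpret prob_space \<mu> by (rule P(2))
  show "integrable \<mu> (\<lambda>x. C * (1 + (norm x)\<^sup>2))" using P(4) by auto
  show "g \<in> borel_measurable \<mu>" using g(1) P(1) by (simp cong: measurable_cong_sets)
  show "AE x in \<mu>. norm (g x) \<le> norm (C * (1 + (norm x)\<^sup>2))"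
    using g(2) by (intro AE_I2) (auto intro: order_trans[OF _ abs_ge_self])
qed

lemma return_P2: "return borel x \<in> P2"
  by (auto simp: P2_def nn_integral_return intro!: prob_space_return)

lemma c2b_integrable:
  fixes \<psi> :: "real^'d \<Rightarrow> real"
  assumes "\<mu> \<in> P2" "c2b \<psi> D D2"
  shows "integrable \<mu> \<psi>"
proof -
  obtain C where "\<And>x. \<bar>\<psi> x\<bar> \<le> C * (1 + (norm x)\<^sup>2)" by (rule c2b_growth[OF assms(2)]) (rule that)
  then show ?thesis
    by (rule P2_integrable[OF assms(1) borel_measurable_continuous_onI[OF c2b_D(5)[OF assms(2)]]])
qed

text \<open>
  The cutoffs are bounded and converge with uniformly bounded Hessians, so both sides pass to the limit by
  dominated convergence, with the second moment as majorant on the left.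
\<close>

lemma test_identity:
  fixes \<psi> :: "real^'d \<Rightarrow> real"
  assumes fp: "fokker_planck \<rho> \<Lambda> r l" and nc: "narrowly_continuous r" and rP: "\<forall>t\<in>{0..1}. r t \<in> P2"
    and c: "c2b \<psi> D D2"
  shows "(LINT x|r 1. \<psi> x) - (LINT x|r 0. \<psi> x)
    = (LINT t:{0<..<1}|lborel. mat_integral borel (\<lambda>x. (1/2) *\<^sub>R D2 x) (l t))"
proof -
  let ?K = "real CARD('d) * real CARD('d)"
  obtain \<psi>' D' D2' C where co: "\<And>n::nat. c2b (\<psi>' n) (D' n) (D2' n)" "\<And>n. bounded (range (\<psi>' n))"
    and C: "0 \<le> C" "\<And>n x. norm (D2' n x) \<le> C" "\<And>n x. \<bar>\<psi>' n x\<bar> \<le> C * (1 + (norm x)\<^sup>2)"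
    and lim: "\<And>x. (\<lambda>n. \<psi>' n x) \<longlonglongrightarrow> \<psi> x" "\<And>x. (\<lambda>n. D2' n x) \<longlonglongrightarrow> D2 x"
    by (rule c2b_cutoff[OF c]) blast
  have eq: "(LINT x|r 1. \<psi>' n x) - (LINT x|r 0. \<psi>' n x)
    = (LINT t:{0<..<1}|lborel. mat_integral borel (\<lambda>x. (1/2) *\<^sub>R D2' n x) (l t))" for n
    by (rule bounded_test_identity[OF fp nc rP co])
  have m: "\<psi>' n \<in> borel_measurable borel" "\<psi> \<in> borel_measurable borel"
    "D2' n \<in> borel_measurable borel" "D2 \<in> borel_measurable borel" for n
    using c2b_D(3,5)[OF co(1)] c2b_D(3,5)[OF c] by (auto intro: borel_measurable_continuous_onI)
  have l1: "(\<lambda>n. LINT x|\<mu>. \<psi>' n x) \<longlonglongrightarrow> (LINT x|\<mu>. \<psi> x)" if \<mu>: "\<mu> \<in> P2" for \<mu>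
  proof (rule integral_dominated_convergence[where w = "\<lambda>x. C * (1 + (norm x)\<^sup>2)"])
    show "integrable \<mu> (\<lambda>x. C * (1 + (norm x)\<^sup>2))"
      using P2_D[OF \<mu>] by (intro P2_integrable[OF \<mu>, of _ C]) (use C in \<open>auto simp: abs_mult\<close>)
  qed (use C(3) lim m P2_D(1)[OF \<mu>] in \<open>auto cong: measurable_cong_sets\<close>)
  have psd: "l t \<in> psd_measures borel" if "0 < t" "t < 1" for t
    using fp that by (auto simp: fokker_planck_def time_disint_mat_def)
  have hb: "norm ((1/2) *\<^sub>R D2' n x) \<le> C" for n x using C(1) C(2)[of n x] by simp
  have hb': "norm ((1/2) *\<^sub>R D2 x) \<le> C" for x
    by (rule LIMSEQ_le_const2[OF tendsto_norm[OF tendsto_scaleR[OF tendsto_const lim(2)]]]) (use hb in auto)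
  have hm: "(\<lambda>x. (1/2) *\<^sub>R D2' n x) \<in> borel_measurable borel" "(\<lambda>x. (1/2) *\<^sub>R D2 x) \<in> borel_measurable borel" for n
    using m by auto
  note int = fokker_planck_integrable[OF fp]
  have l2: "(\<lambda>n. LINT t:{0<..<1}|lborel. mat_integral borel (\<lambda>x. (1/2) *\<^sub>R D2' n x) (l t))
     \<longlonglongrightarrow> (LINT t:{0<..<1}|lborel. mat_integral borel (\<lambda>x. (1/2) *\<^sub>R D2 x) (l t))"
    unfolding set_lebesgue_integral_def
  proof (rule integral_dominated_convergence[where w = "\<lambda>t. C * ?K * (indicator {0<..<1} t *\<^sub>R trace (l t UNIV))"])
    show "integrable lborel (\<lambda>t. C * ?K * (indicator {0<..<1} t *\<^sub>R trace (l t UNIV)))"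
      using int(1) unfolding set_integrable_def by (intro integrable_mult_right)
    show "(\<lambda>t. indicator {0<..<1} t *\<^sub>R mat_integral borel (\<lambda>x. (1/2) *\<^sub>R D2 x) (l t)) \<in> borel_measurable lborel"
      using int(2)[OF hm(2) hb'] unfolding set_integrable_def by auto
    show "(\<lambda>t. indicator {0<..<1} t *\<^sub>R mat_integral borel (\<lambda>x. (1/2) *\<^sub>R D2' n x) (l t)) \<in> borel_measurable lborel" for n
      using int(2)[OF hm(1) hb] unfolding set_integrable_def by auto
    show "AE t in lborel. norm (indicator {0<..<1} t *\<^sub>R mat_integral borel (\<lambda>x. (1/2) *\<^sub>R D2' n x) (l t))
       \<le> C * ?K * (indicator {0<..<1} t *\<^sub>R trace (l t UNIV))" for n
      using int(3)[OF hm(1) hb] by (intro AE_I2) (auto simp: indicator_def)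
    show "AE t in lborel. (\<lambda>n. indicator {0<..<1} t *\<^sub>R mat_integral borel (\<lambda>x. (1/2) *\<^sub>R D2' n x) (l t))
       \<longlonglongrightarrow> indicator {0<..<1} t *\<^sub>R mat_integral borel (\<lambda>x. (1/2) *\<^sub>R D2 x) (l t)"
    proof (rule AE_I2)
      fix t :: real
      show "(\<lambda>n. indicator {0<..<1} t *\<^sub>R mat_integral borel (\<lambda>x. (1/2) *\<^sub>R D2' n x) (l t))
       \<longlonglongrightarrow> indicator {0<..<1} t *\<^sub>R mat_integral borel (\<lambda>x. (1/2) *\<^sub>R D2 x) (l t)"
      proof (cases "0 < t \<and> t < 1")
        case True
        then have V: "l t \<in> psd_measures borel" using psd by auto
        let ?T = "tot_var borel (l t)" and ?p = "polar_density borel (l t)"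
        note p = polar_density[OF V] and s = finite_tot_var[OF V]
        have pm: "?p \<in> borel_measurable ?T" using p(3) by auto
        have "(\<lambda>n. LINT x|?T. ((1/2) *\<^sub>R D2' n x) \<bullet> ?p x) \<longlonglongrightarrow> (LINT x|?T. ((1/2) *\<^sub>R D2 x) \<bullet> ?p x)"
        proof (rule integral_dominated_convergence[where w = "\<lambda>x. C * norm (?p x)"])
          show "integrable ?T (\<lambda>x. C * norm (?p x))" using p(3) by auto
          show "AE x in ?T. (\<lambda>n. ((1/2) *\<^sub>R D2' n x) \<bullet> ?p x) \<longlonglongrightarrow> ((1/2) *\<^sub>R D2 x) \<bullet> ?p x"
            by (intro AE_I2 tendsto_intros lim)
          show "AE x in ?T. norm (((1/2) *\<^sub>R D2' n x) \<bullet> ?p x) \<le> C * norm (?p x)" for n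
          proof (rule AE_I2)
            fix x
            show "norm (((1/2) *\<^sub>R D2' n x) \<bullet> ?p x) \<le> C * norm (?p x)"
              using Cauchy_Schwarz_ineq2[of "(1/2) *\<^sub>R D2' n x" "?p x"] mult_right_mono[OF hb[of n x] norm_ge_zero[of "?p x"]]
              unfolding real_norm_def by linarith
          qed
          have "borel_measurable ?T = borel_measurable borel" by (rule measurable_cong_sets[OF s(2) refl])
          then have hT: "(\<lambda>x. (1/2) *\<^sub>R D2 x) \<in> borel_measurable ?T" "(\<lambda>x. (1/2) *\<^sub>R D2' n x) \<in> borel_measurable ?T" for n
            using hm by blast+
          show "(\<lambda>x. ((1/2) *\<^sub>R D2 x) \<bullet> ?p x) \<in> borel_measurable ?T"
            "(\<lambda>x. ((1/2) *\<^sub>R D2' n x) \<bullet> ?p x) \<in> borel_measurable ?T" for n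
            by (intro borel_measurable_inner hT pm)+
        qed
        then show ?thesis using True by (simp add: mat_integral_def del: inner_scaleR_left)
      qed auto
    qed
  qed
  have "r 1 \<in> P2" "r 0 \<in> P2" using rP by auto
  from tendsto_diff[OF l1[OF this(1)] l1[OF this(2)]] show ?thesis
    unfolding eq using l2 by (rule LIMSEQ_unique)
qed

definition dual_fn :: "(real^'d^'d \<Rightarrow> ennreal) \<Rightarrow> (real^'d \<Rightarrow> real) \<Rightarrow> bool" where
  "dual_fn f \<psi> \<longleftrightarrow> (\<exists>D D2. c2b \<psi> D D2 \<and> (\<forall>y. (1/2) *\<^sub>R D2 y \<in> minorants f))"

definition dual_cost :: "(real^'d^'d \<Rightarrow> ennreal) \<Rightarrow> real^'d \<Rightarrow> (real^'d) measure \<Rightarrow> ennreal" where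
  "dual_cost f x p = (SUP \<psi>\<in>{\<psi>. dual_fn f \<psi>}. ennreal ((LINT y|p. \<psi> y) - \<psi> x))"

text \<open>
  Testing the equation with a dual function \<open>\<psi>\<close> bounds \<open>\<integral>\<psi> dp - \<psi> x\<close> by the action, because the half
  Hessian of \<open>\<psi>\<close> is a linear minorant of \<open>f\<close>.
\<close>

lemma dual_cost_le_G_cost:
  fixes f :: "real^'d^'d \<Rightarrow> ennreal"
  shows "dual_cost f x p \<le> G_cost f x p"
  unfolding dual_cost_def
proof (rule SUP_least, clarify)
  fix \<psi> assume "dual_fn f \<psi>"
  then obtain D D2 where c: "c2b \<psi> D D2" and B: "\<And>y. (1/2) *\<^sub>R D2 y \<in> minorants f" by (auto simp: dual_fn_def)
  obtain K where K: "0 \<le> K" "\<And>x. norm (D2 x) \<le> K" using c2b_bound[OF c] by blast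
  show "ennreal ((LINT y|p. \<psi> y) - \<psi> x) \<le> G_cost f x p"
    unfolding G_cost_def F_cost_def
  proof (rule INF_greatest, clarify)
    fix \<rho> \<Lambda> r l
    assume fp: "fokker_planck \<rho> \<Lambda> r l" and nc: "narrowly_continuous r" and rP: "\<forall>t\<in>{0..1}. r t \<in> P2"
      and r0: "r 0 = return borel x" and p: "p = r 1"
    let ?b = "\<lambda>t. mat_integral borel (\<lambda>x. (1/2) *\<^sub>R D2 x) (l t)"
    have "(LINT y|return borel x. \<psi> y) = \<psi> x"
      using borel_measurable_continuous_onI[OF c2b_D(5)[OF c]] by (simp add: integral_return)
    then have "ennreal ((LINT y|r 1. \<psi> y) - \<psi> x) = ennreal (LINT t:{0<..<1}|lborel. ?b t)"
      using test_identity[OF fp nc rP c] r0 by simp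
    also have "\<dots> \<le> (\<integral>\<^sup>+t. ennreal (indicator {0<..<1} t *\<^sub>R ?b t) \<partial>lborel)"
      unfolding set_lebesgue_integral_def by (rule ennreal_integral_le_nn_integral)
    also have "\<dots> \<le> (\<integral>\<^sup>+ t\<in>{0<..<1}. (\<integral>\<^sup>+ x. f (polar_density borel (l t) x) \<partial>tot_var borel (l t)) \<partial>lborel)"
    proof (intro nn_integral_mono)
      fix t :: real
      show "ennreal (indicator {0<..<1} t *\<^sub>R ?b t)
        \<le> (\<integral>\<^sup>+ x. f (polar_density borel (l t) x) \<partial>tot_var borel (l t)) * indicator {0<..<1} t"
      proof (cases "0 < t \<and> t < 1")
        case True
        then have V: "l t \<in> psd_measures borel" using fp by (auto simp: fokker_planck_def time_disint_mat_def)
        have "ennreal (?b t) \<le> (\<integral>\<^sup>+x. ennreal (((1/2) *\<^sub>R D2 x) \<bullet> polar_density borel (l t) x) \<partial>tot_var borel (l t))"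
          unfolding mat_integral_def by (rule ennreal_integral_le_nn_integral)
        also have "\<dots> \<le> (\<integral>\<^sup>+ x. f (polar_density borel (l t) x) \<partial>tot_var borel (l t))"
        proof (intro nn_integral_mono)
          fix x
          show "ennreal (((1/2) *\<^sub>R D2 x) \<bullet> polar_density borel (l t) x) \<le> f (polar_density borel (l t) x)"
            using B[of x] polar_density(2)[OF V, of x] unfolding minorants_def by blast
        qed
        finally show ?thesis using True by simp
      qed auto
    qed
    finally show "ennreal ((LINT y|r 1. \<psi> y) - \<psi> x)
      \<le> (\<integral>\<^sup>+ t\<in>{0<..<1}. (\<integral>\<^sup>+ x. f (polar_density borel (l t) x) \<partial>tot_var borel (l t)) \<partial>lborel)" .
  qed
qed

section \<open>A space-filling curve\<close>

text \<open>
  A continuous periodic function that reads off a ternary digit: it is \<open>0\<close> on the first and \<open>1\<close> on the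
  last third of the unit interval.  The base-three expansion leaves the middle third for interpolation.
\<close>

definition clamp_cos :: "real \<Rightarrow> real" where
  "clamp_cos t = max 0 (min 1 (1/2 - cos (pi * t)))"

lemma clamp_cos_range: "0 \<le> clamp_cos t" "clamp_cos t \<le> 1"
  by (auto simp: clamp_cos_def)

lemma continuous_on_clamp_cos: "continuous_on S clamp_cos"
  unfolding clamp_cos_def[abs_def] by (intro continuous_intros)

lemma clamp_cos_periodic: "clamp_cos (2 * real m + s) = clamp_cos s"
proof -
  have "cos (pi * (2 * real m + s)) = cos (2 * real m * pi + pi * s)" by (simp add: algebra_simps)
  also have "\<dots> = cos (pi * s)" unfolding cos_add by simp
  finally show ?thesis by (simp add: clamp_cos_def)
qed

lemma clamp_cos_eq_0: "0 \<le> s \<Longrightarrow> s \<le> 1/3 \<Longrightarrow> clamp_cos s = 0"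
proof -
  assume s: "0 \<le> s" "s \<le> 1/3"
  have "cos (pi / 3) \<le> cos (pi * s)" using s by (intro cos_monotone_0_pi_le) (auto simp: field_simps)
  then show ?thesis by (simp add: clamp_cos_def cos_60)
qed

lemma clamp_cos_eq_1: "2/3 \<le> s \<Longrightarrow> s \<le> 1 \<Longrightarrow> clamp_cos s = 1"
proof -
  assume s: "2/3 \<le> s" "s \<le> 1"
  have "cos (pi / 3) \<le> cos (pi - pi * s)"
  proof (rule cos_monotone_0_pi_le)
    show "0 \<le> pi - pi * s" using s mult_left_mono[of s 1 pi] by simp
    show "pi - pi * s \<le> pi / 3" using mult_left_mono[OF s(1), of pi] by simp
  qed simp
  moreover have "cos (pi - pi * s) = - cos (pi * s)" by (simp add: cos_diff)
  ultimately show ?thesis by (simp add: clamp_cos_def cos_60)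
qed

lemma ternary_digits:
  fixes d :: "nat \<Rightarrow> real"
  assumes d: "\<And>j. d j = 0 \<or> d j = 1"
  obtains t where "0 \<le> t" "t \<le> 1" "\<And>j. clamp_cos (3 ^ j * t) = d j"
proof -
  define T where "T j = (\<Sum>i. 2 * d (j + i) / 3 ^ Suc i)" for j
  have d01: "0 \<le> d j" "d j \<le> 1" for j using d[of j] by auto
  have g: "(\<lambda>i. 2 / 3 ^ Suc i :: real) sums 1"
    using sums_mult[OF geometric_sums[of "1/3::real"], of "2/3"] by (simp add: power_divide field_simps)
  have sm: "summable (\<lambda>i. 2 * d (j + i) / 3 ^ Suc i)" for j
    by (rule summable_comparison_test'[OF sums_summable[OF g], of 0]) (use d01 in \<open>auto simp: divide_simps\<close>)
  have T01: "0 \<le> T j" "T j \<le> 1" for j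
  proof -
    show "0 \<le> T j" unfolding T_def by (intro suminf_nonneg sm) (use d01 in auto)
    have "T j \<le> (\<Sum>i. 2 / 3 ^ Suc i)" unfolding T_def
      by (intro suminf_le sm sums_summable[OF g]) (use d01 in \<open>auto simp: divide_simps\<close>)
    then show "T j \<le> 1" using g by (simp add: sums_iff)
  qed
  have rec: "3 * T j = 2 * d j + T (Suc j)" for j
  proof -
    have "T j = 2 * d j / 3 + (\<Sum>i. 2 * d (j + Suc i) / 3 ^ Suc (Suc i))"
      unfolding T_def using suminf_split_head[OF sm[of j]] by simp
    also have "(\<Sum>i. 2 * d (j + Suc i) / 3 ^ Suc (Suc i)) = (\<Sum>i. (2 * d (Suc j + i) / 3 ^ Suc i) / 3)"
      by (intro suminf_cong) simp
    also have "\<dots> = T (Suc j) / 3" unfolding T_def by (rule suminf_divide[OF sm])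
    finally show ?thesis by simp
  qed
  have "\<exists>m. 3 ^ j * T 0 = 2 * real m + T j" for j
  proof (induction j)
    case 0 show ?case by (rule exI[of _ 0]) simp
  next
    case (Suc j)
    then obtain m where m: "3 ^ j * T 0 = 2 * real m + T j" by blast
    obtain e :: nat where e: "d j = real e" using d[of j] by (metis of_nat_0 of_nat_1)
    have "3 ^ Suc j * T 0 = 3 * (3 ^ j * T 0)" by simp
    also have "\<dots> = 2 * real (3 * m + e) + T (Suc j)" unfolding m using rec[of j] by (simp add: e algebra_simps)
    finally show ?case by blast
  qed
  then have "clamp_cos (3 ^ j * T 0) = d j" for j
  proof -
    obtain m where "3 ^ j * T 0 = 2 * real m + T j" using \<open>\<And>j. \<exists>m. 3 ^ j * T 0 = 2 * real m + T j\<close> by blast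
    then have "clamp_cos (3 ^ j * T 0) = clamp_cos (T j)" by (simp add: clamp_cos_periodic)
    also have "\<dots> = d j"
      using d[of j] rec[of j] T01[of j] T01[of "Suc j"] by (auto intro!: clamp_cos_eq_0 clamp_cos_eq_1)
    finally show ?thesis .
  qed
  then show thesis using that T01[of 0] by blast
qed

lemma binary_digits:
  fixes y :: real
  assumes "0 \<le> y" "y \<le> 1"
  obtains a :: "nat \<Rightarrow> real" where "\<And>k. a k = 0 \<or> a k = 1" "(\<lambda>k. a k / 2 ^ Suc k) sums y"
proof -
  define R where "R = rec_nat y (\<lambda>_ r. 2 * r - (if r \<ge> 1/2 then 1 else 0))"
  define a where "a k = (if R k \<ge> 1/2 then 1 else 0 :: real)" for k
  have R0: "R 0 = y" and RS: "R (Suc k) = 2 * R k - a k" for k by (simp_all add: R_def a_def)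
  have R01: "0 \<le> R k \<and> R k \<le> 1" for k
    by (induction k) (use assms in \<open>auto simp: R0 RS a_def\<close>)
  have part: "(\<Sum>k<n. a k / 2 ^ Suc k) = y - R n / 2 ^ n" for n
    by (induction n) (auto simp: R0 RS field_simps)
  have "(\<lambda>n. y - R n / 2 ^ n) \<longlonglongrightarrow> y - 0"
  proof (intro tendsto_diff tendsto_const)
    show "(\<lambda>n. R n / 2 ^ n) \<longlonglongrightarrow> 0"
    proof (rule Lim_null_comparison)
      show "\<forall>\<^sub>F n in sequentially. norm (R n / 2 ^ n) \<le> (1/2) ^ n"
        using R01 by (intro always_eventually) (auto simp: power_divide divide_right_mono)
    qed (rule LIMSEQ_power_zero, simp)
  qed
  then have "(\<lambda>k. a k / 2 ^ Suc k) sums y" unfolding sums_def part by simp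
  moreover have "a k = 0 \<or> a k = 1" for k by (simp add: a_def)
  ultimately show thesis using that by blast
qed

text \<open>
  Schoenberg's curve: the binary digits of the coordinates are interleaved into the ternary digits of the
  parameter.  It lets measures on a compact subset of Euclidean space be represented by measures on
  the unit interval, for which sequential compactness is at hand.
\<close>

lemma space_filling_curve:
  obtains c :: "real \<Rightarrow> 'e::euclidean_space" where "continuous_on UNIV c"
    "\<And>s b. b \<in> Basis \<Longrightarrow> \<bar>c s \<bullet> b\<bar> \<le> 1"
    "\<And>v. (\<And>b. b \<in> Basis \<Longrightarrow> \<bar>v \<bullet> b\<bar> \<le> 1) \<Longrightarrow> \<exists>s\<in>{0..1}. c s = v"
proof -
  let ?N = "DIM('e)"
  obtain idx where idx: "bij_betw idx (Basis :: 'e set) {0..<?N}"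
    using ex_bij_betw_finite_nat[OF finite_Basis] by blast
  define x where "x b t = (\<Sum>k. clamp_cos (3 ^ (?N * k + idx b) * t) / 2 ^ Suc k)" for b and t :: real
  have g: "(\<lambda>k. 1 / 2 ^ Suc k :: real) sums 1" using power_half_series by (simp add: power_divide)
  have cs: "norm (clamp_cos u / 2 ^ Suc k) \<le> 1 / 2 ^ Suc k" for u k
    using clamp_cos_range[of u] by (simp add: divide_right_mono)
  have sm: "summable (\<lambda>k. clamp_cos (3 ^ (?N * k + idx b) * t) / 2 ^ Suc k)" for b t
    by (rule summable_comparison_test'[OF sums_summable[OF g], of 0]) (rule cs)
  have x01: "0 \<le> x b t" "x b t \<le> 1" for b t
  proof -
    show "0 \<le> x b t" unfolding x_def by (intro suminf_nonneg sm) (use clamp_cos_range in auto)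
    have "x b t \<le> (\<Sum>k. 1 / 2 ^ Suc k)" unfolding x_def
      by (intro suminf_le sm sums_summable[OF g] divide_right_mono clamp_cos_range) auto
    then show "x b t \<le> 1" using g by (simp add: sums_iff)
  qed
  have cx: "continuous_on UNIV (x b)" for b
  proof (rule uniform_limit_theorem)
    show "uniform_limit UNIV (\<lambda>n t. \<Sum>k<n. clamp_cos (3 ^ (?N * k + idx b) * t) / 2 ^ Suc k) (x b) sequentially"
      unfolding x_def[abs_def] by (rule Weierstrass_m_test[OF _ sums_summable[OF g]]) (rule cs)
    show "\<forall>\<^sub>F n in sequentially. continuous_on UNIV (\<lambda>t. \<Sum>k<n. clamp_cos (3 ^ (?N * k + idx b) * t) / 2 ^ Suc k)"
      by (intro always_eventually allI continuous_intros continuous_on_compose2[OF continuous_on_clamp_cos[of UNIV]]) auto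
  qed simp
  define c where "c t = (\<Sum>b\<in>Basis. (2 * x b t - 1) *\<^sub>R b)" for t :: real
  have cb: "c t \<bullet> b = 2 * x b t - 1" if "b \<in> Basis" for t and b :: 'e
    unfolding c_def using that by simp
  show thesis
  proof
    show "continuous_on UNIV c" unfolding c_def[abs_def] by (intro continuous_intros cx)
    show "\<bar>c s \<bullet> b\<bar> \<le> 1" if "b \<in> Basis" for s b
      using x01[of b s] by (simp add: cb[OF that] abs_le_iff)
    fix v :: 'e assume v: "\<And>b. b \<in> Basis \<Longrightarrow> \<bar>v \<bullet> b\<bar> \<le> 1"
    have "\<exists>a. (\<forall>k. a k = 0 \<or> a k = (1::real)) \<and> (b \<in> Basis \<longrightarrow> (\<lambda>k. a k / 2 ^ Suc k) sums ((1 + v \<bullet> b) / 2))" for b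
    proof (cases "b \<in> Basis")
      case True
      have "0 \<le> (1 + v \<bullet> b) / 2" "(1 + v \<bullet> b) / 2 \<le> 1" using v[OF True] by (auto simp: abs_le_iff)
      then show ?thesis by (rule binary_digits) blast
    qed (auto intro: exI[of _ "\<lambda>_. 0"])
    then have "\<forall>b. \<exists>a. (\<forall>k. a k = 0 \<or> a k = (1::real)) \<and> (b \<in> Basis \<longrightarrow> (\<lambda>k. a k / 2 ^ Suc k) sums ((1 + v \<bullet> b) / 2))"
      by blast
    then obtain a where
      "\<forall>b. (\<forall>k. a b k = 0 \<or> a b k = (1::real)) \<and> (b \<in> Basis \<longrightarrow> (\<lambda>k. a b k / 2 ^ Suc k) sums ((1 + v \<bullet> b) / 2))"
      unfolding choice_iff by blast
    then have a: "\<And>b k. a b k = 0 \<or> a b k = (1::real)"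
      and av: "\<And>b. b \<in> Basis \<Longrightarrow> (\<lambda>k. a b k / 2 ^ Suc k) sums ((1 + v \<bullet> b) / 2)" by blast+
    define d where "d j = a (inv_into Basis idx (j mod ?N)) (j div ?N)" for j
    obtain t where t: "0 \<le> t" "t \<le> 1" "\<And>j. clamp_cos (3 ^ j * t) = d j"
      by (rule ternary_digits[of d]) (use a in \<open>auto simp: d_def\<close>)
    have xb: "x b t = (1 + v \<bullet> b) / 2" if b: "b \<in> Basis" for b
    proof -
      have i: "idx b < ?N" "inv_into Basis idx (idx b) = b"
        using bspec[OF bij_betwE[OF idx] b] bij_betw_inv_into_left[OF idx b] by simp_all
      have "d (?N * k + idx b) = a b k" for k using i by (simp add: d_def)
      then have "x b t = (\<Sum>k. a b k / 2 ^ Suc k)" by (simp add: x_def t(3))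
      then show ?thesis using av[OF b] by (simp add: sums_iff)
    qed
    have "c t = v" by (rule euclidean_eqI) (simp add: cb xb add_divide_distrib)
    then show "\<exists>s\<in>{0..1}. c s = v" using t by auto
  qed
qed

section \<open>Compactness\<close>

text \<open>
  Measures carried by the unit interval are tight, so Helly's selection theorem gives a weakly convergent
  subsequence.
\<close>

lemma unit_interval_compactness:
  fixes P :: "nat \<Rightarrow> real measure"
  assumes P: "\<And>n. real_distribution (P n)" and sup: "\<And>n. measure (P n) {0..1} = 1"
  obtains r M where "strict_mono (r :: nat \<Rightarrow> nat)" "real_distribution M"
    "\<And>g :: real \<Rightarrow> real. continuous_on UNIV g \<Longrightarrow> bounded (range g) \<Longrightarrow>
       (\<lambda>n. LINT s|P (r n). g s) \<longlonglongrightarrow> (LINT s|M. g s)"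
proof -
  have t: "tight P"
    unfolding tight_def
  proof (intro conjI allI impI)
    fix \<epsilon> :: real assume "0 < \<epsilon>"
    have "1 - \<epsilon> < measure (P n) {-1<..1}" for n
    proof -
      interpret real_distribution "P n" by (rule P)
      have "measure (P n) {0..1} \<le> measure (P n) {-1<..1}" by (intro finite_measure_mono) auto
      then show ?thesis using sup[of n] \<open>0 < \<epsilon>\<close> by simp
    qed
    then show "\<exists>a b. a < b \<and> (\<forall>n. 1 - \<epsilon> < measure (P n) {a<..b})" by (intro exI[of _ "-1"] exI[of _ 1]) auto
  qed (rule P)
  obtain r M where r: "strict_mono (r :: nat \<Rightarrow> nat)" and M: "real_distribution M" and w: "weak_conv_m (P \<circ> id \<circ> r) M"
    using tight_imp_convergent_subsubsequence[OF t strict_mono_id] by auto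
  show thesis
  proof (rule that[OF r M])
    fix g :: "real \<Rightarrow> real" assume g: "continuous_on UNIV g" "bounded (range g)"
    obtain B where B: "\<And>x. norm (g x) \<le> B" using g(2) by (auto simp: bounded_iff)
    interpret M: real_distribution M by (rule M)
    interpret Pr: real_distribution "(P \<circ> id \<circ> r) n" for n using P by simp
    have "(\<lambda>n. integral\<^sup>L ((P \<circ> id \<circ> r) n) g) \<longlonglongrightarrow> integral\<^sup>L M g"
      by (rule weak_conv_imp_integral_bdd_continuous_conv[OF _ M w])
        (use P g B in \<open>auto simp: continuous_on_eq_continuous_at\<close>)
    then show "(\<lambda>n. LINT s|P (r n). g s) \<longlonglongrightarrow> (LINT s|M. g s)" by simp
  qed
qed

text \<open>
  A compact metric space has a finite net at every scale.  For each scale and each assignment of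
  rational values to the net, one member of the family that matches them is kept, if there is one; by
  uniform continuity these countably many members are uniformly dense.
\<close>

lemma uniformly_dense_sequence:
  fixes F :: "'i \<Rightarrow> 'a::metric_space \<Rightarrow> real"
  assumes K: "compact K" and F: "\<And>i. i \<in> I \<Longrightarrow> continuous_on K (F i)" and I: "i0 \<in> I"
  obtains J :: "nat \<Rightarrow> 'i" where "range J \<subseteq> I"
    "\<And>i \<epsilon>. i \<in> I \<Longrightarrow> 0 < \<epsilon> \<Longrightarrow> \<exists>n. \<forall>x\<in>K. \<bar>F i x - F (J n) x\<bar> \<le> \<epsilon>"
proof -
  have "\<exists>L. set L \<subseteq> K \<and> K \<subseteq> (\<Union>x\<in>set L. ball x (1 / real (Suc m)))" for m
  proof -
    have "K \<subseteq> (\<Union>x\<in>K. ball x (1 / real (Suc m)))" by force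
    then obtain k where k: "k \<subseteq> K" "finite k" "K \<subseteq> (\<Union>x\<in>k. ball x (1 / real (Suc m)))"
      by (rule compactE_image[OF K, rotated]) auto
    from finite_list[OF k(2)] obtain L where "set L = k" by blast
    then show ?thesis using k by auto
  qed
  then have "\<forall>m. \<exists>L. set L \<subseteq> K \<and> K \<subseteq> (\<Union>x\<in>set L. ball x (1 / real (Suc m)))" by blast
  then obtain L where "\<forall>m. set (L m) \<subseteq> K \<and> K \<subseteq> (\<Union>x\<in>set (L m). ball x (1 / real (Suc m)))"
    unfolding choice_iff by blast
  then have L: "\<And>m. set (L m) \<subseteq> K" "\<And>m. K \<subseteq> (\<Union>x\<in>set (L m). ball x (1 / real (Suc m)))" by blast+
  define good where "good m k i \<longleftrightarrow> i \<in> I \<and>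
    (\<forall>x\<in>K. \<forall>y\<in>K. dist y x < 1 / real (Suc m) \<longrightarrow> \<bar>F i y - F i x\<bar> < 1 / real (Suc k))" for m k i
  define code where "code m k i = map (\<lambda>x. \<lfloor>real (Suc k) * F i x\<rfloor>) (L m)" for m k i
  define sel where "sel = (\<lambda>(m, k, c). if \<exists>i. good m k i \<and> code m k i = c then SOME i. good m k i \<and> code m k i = c else i0)"
  define J where "J n = sel (from_nat n)" for n
  show thesis
  proof
    have selI: "sel z \<in> I" for z
    proof -
      obtain m k c where z: "z = (m, k, c)" by (cases z) auto
      show ?thesis
      proof (cases "\<exists>i. good m k i \<and> code m k i = c")
        case True
        from someI_ex[OF this] show ?thesis using True unfolding z sel_def by (auto simp: good_def)
      qed (use I in \<open>auto simp: z sel_def\<close>)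
    qed
    show "range J \<subseteq> I" unfolding J_def[abs_def] by (rule image_subsetI) (rule selI)
    fix i :: 'i and \<epsilon> :: real assume i: "i \<in> I" and \<epsilon>: "0 < \<epsilon>"
    obtain k where k: "3 / real (Suc k) < \<epsilon>"
      using reals_Archimedean[of "\<epsilon> / 3"] \<epsilon> by (auto simp: field_simps)
    have "uniformly_continuous_on K (F i)" by (rule compact_uniformly_continuous[OF F[OF i] K])
    then have uc: "\<forall>e>0. \<exists>d>0. \<forall>x\<in>K. \<forall>y\<in>K. dist y x < d \<longrightarrow> dist (F i y) (F i x) < e"
      unfolding uniformly_continuous_on_def .
    have "\<exists>d>0. \<forall>x\<in>K. \<forall>y\<in>K. dist y x < d \<longrightarrow> dist (F i y) (F i x) < 1 / real (Suc k)"
      by (rule mp[OF spec[where x = "1 / real (Suc k)", OF uc]]) simp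
    then obtain \<delta> where \<delta>: "0 < \<delta>" "\<And>x y. x \<in> K \<Longrightarrow> y \<in> K \<Longrightarrow> dist y x < \<delta> \<Longrightarrow> dist (F i y) (F i x) < 1 / real (Suc k)"
      by blast
    obtain m where m: "1 / real (Suc m) < \<delta>" using reals_Archimedean[OF \<delta>(1)] by (auto simp: inverse_eq_divide)
    have gi: "good m k i" unfolding good_def using i \<delta>(2) m by (auto simp: dist_real_def)
    define j where "j = sel (m, k, code m k i)"
    have "\<exists>i'. good m k i' \<and> code m k i' = code m k i" using gi by blast
    from someI_ex[OF this] this have j: "good m k j" "code m k j = code m k i"
      unfolding j_def sel_def by auto
    have "\<bar>F i x - F j x\<bar> \<le> \<epsilon>" if x: "x \<in> K" for x
    proof -
      obtain u where u: "u \<in> set (L m)" "dist u x < 1 / real (Suc m)" using L(2)[of m] x by auto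
      have uK: "u \<in> K" using u(1) L(1) by auto
      have "\<lfloor>real (Suc k) * F i u\<rfloor> = \<lfloor>real (Suc k) * F j u\<rfloor>"
        using j(2) u(1) by (auto simp: code_def)
      then have "\<bar>real (Suc k) * F i u - real (Suc k) * F j u\<bar> < 1"
        using floor_correct[of "real (Suc k) * F i u"] floor_correct[of "real (Suc k) * F j u"] by linarith
      then have "real (Suc k) * \<bar>F i u - F j u\<bar> < 1"
        by (simp add: right_diff_distrib[symmetric] abs_mult del: of_nat_Suc)
      then have 1: "\<bar>F i u - F j u\<bar> < 1 / real (Suc k)" by (simp add: field_simps del: of_nat_Suc)
      have 2: "\<bar>F i u - F i x\<bar> < 1 / real (Suc k)" "\<bar>F j u - F j x\<bar> < 1 / real (Suc k)"
        using gi j(1) x uK u(2) by (auto simp: good_def)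
      have "3 / real (Suc k) = 1 / real (Suc k) + 1 / real (Suc k) + 1 / real (Suc k)" by simp
      then show ?thesis using 1 2 k by linarith
    qed
    moreover have "J (to_nat (m, k, code m k i)) = j" by (simp add: J_def j_def)
    ultimately show "\<exists>n. \<forall>x\<in>K. \<bar>F i x - F (J n) x\<bar> \<le> \<epsilon>" by metis
  qed
qed

section \<open>Penalised minimisation\<close>

text \<open>
  A list of weighted points stands for a measure with finitely many atoms; \<open>wsum\<close> is its integral.
\<close>

definition wsum :: "('p \<times> real) list \<Rightarrow> ('p \<Rightarrow> real) \<Rightarrow> real" where
  "wsum xs g = (\<Sum>(p, w)\<leftarrow>xs. w * g p)"

lemma wsum_Cons: "wsum ((p, w) # xs) g = w * g p + wsum xs g" by (simp add: wsum_def)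

lemma wsum_scale: "wsum (map (\<lambda>(p, w). (p, c * w)) xs) g = c * wsum xs g"
  by (induction xs) (auto simp: wsum_def algebra_simps)

lemma wsum_nonneg: "(\<And>p w. (p, w) \<in> set xs \<Longrightarrow> 0 \<le> w \<and> 0 \<le> g p) \<Longrightarrow> 0 \<le> wsum xs g"
  unfolding wsum_def by (intro sum_list_nonneg) auto

text \<open>
  An almost minimiser of \<open>N/2 \<Sum>(\<integral>h\<^sub>i - \<tau>\<^sub>i)\<^sup>2 + \<integral>(F + 1)\<close> over measures with finitely many atoms.  The first
  inequality is stationarity under adding a small atom at \<open>p\<close>, the second one stationarity under
  scaling the measure.  The summand \<open>1\<close> controls the mass.
\<close>

lemma penalised_minimiser:
  fixes h :: "nat \<Rightarrow> 'p \<Rightarrow> real" and F :: "'p \<Rightarrow> real" and N :: nat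
  assumes F: "\<And>p. p \<in> X \<Longrightarrow> 0 \<le> F p" and h: "\<And>i p. i < N \<Longrightarrow> p \<in> X \<Longrightarrow> \<bar>h i p\<bar> \<le> C"
    and \<theta>: "0 < \<theta>"
  obtains xs where "\<And>p w. (p, w) \<in> set xs \<Longrightarrow> p \<in> X \<and> 0 \<le> w"
    "\<And>p. p \<in> X \<Longrightarrow> - \<theta> \<le> N * (\<Sum>i<N. (wsum xs (h i) - \<tau> i) * h i p) + F p + 1"
    "N * (\<Sum>i<N. (wsum xs (h i) - \<tau> i) * wsum xs (h i)) + wsum xs F + wsum xs (\<lambda>_. 1) \<le> \<theta>"
proof -
  define adm where "adm xs \<longleftrightarrow> (\<forall>p w. (p, w) \<in> set xs \<longrightarrow> p \<in> X \<and> 0 \<le> w)" for xs :: "('p \<times> real) list"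
  define J where "J xs = N / 2 * (\<Sum>i<N. (wsum xs (h i) - \<tau> i)\<^sup>2) + wsum xs F + wsum xs (\<lambda>_. 1)" for xs
  have J0: "N / 2 * (\<Sum>i<N. (wsum xs (h i) - \<tau> i)\<^sup>2) \<le> J xs" "0 \<le> J xs" if "adm xs" for xs
  proof -
    have "0 \<le> wsum xs F" "0 \<le> wsum xs (\<lambda>_. 1)"
      using that F by (intro wsum_nonneg; auto simp: adm_def)+
    moreover have "0 \<le> N / 2 * (\<Sum>i<N. (wsum xs (h i) - \<tau> i)\<^sup>2)" by (intro mult_nonneg_nonneg sum_nonneg) auto
    ultimately show "N / 2 * (\<Sum>i<N. (wsum xs (h i) - \<tau> i)\<^sup>2) \<le> J xs" "0 \<le> J xs" unfolding J_def by linarith+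
  qed
  define j where "j = Inf (J ` Collect adm)"
  have bb: "bdd_below (J ` Collect adm)" using J0(2) by (intro bdd_belowI[of _ 0]) auto
  have jle: "j \<le> J xs" if "adm xs" for xs unfolding j_def using that by (intro cInf_lower bb) auto
  have adm0: "adm []" by (simp add: adm_def)
  have Jnil: "J [] = N / 2 * (\<Sum>i<N. (\<tau> i)\<^sup>2)" by (simp add: J_def wsum_def)
  have j0: "0 \<le> J []" by (rule J0(2)[OF adm0])
  define M1 where "M1 = 1 + N / 2 * (\<Sum>i<N. C\<^sup>2)"
  define M2 where "M2 = 4 * J [] + 3"
  have M1: "1 \<le> M1" unfolding M1_def by (simp add: sum_nonneg)
  have M2: "3 \<le> M2" using j0 by (simp add: M2_def)
  define \<delta> where "\<delta> = min (1/2) (\<theta> / (M1 + M2))"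
  have \<delta>: "0 < \<delta>" using M1 M2 \<theta> by (auto simp: \<delta>_def)
  have \<delta>: "0 < \<delta>" "\<delta> \<le> 1/2" using \<delta> unfolding \<delta>_def by (simp_all only: min.cobounded1)
  have "\<delta> \<le> \<theta> / (M1 + M2)" by (simp add: \<delta>_def)
  then have "\<delta> * (M1 + M2) \<le> \<theta>" using M1 M2 by (simp add: field_simps)
  moreover have "0 \<le> \<delta> * M1" "0 \<le> \<delta> * M2" using \<delta>(1) M1 M2 by simp_all
  ultimately have \<delta>M: "\<delta> * M1 \<le> \<theta>" "\<delta> * M2 \<le> \<theta>" unfolding ring_distribs by linarith+
  have "j < j + \<delta>\<^sup>2" using \<delta>(1) by simp
  then obtain xs where xs: "adm xs" "J xs < j + \<delta>\<^sup>2"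
    unfolding j_def using cInf_lessD[of "J ` Collect adm"] adm0 by blast
  have d2: "\<delta>\<^sup>2 \<le> 1" using \<delta> power_mono[of \<delta> 1 2] by simp
  define q where "q i = wsum xs (h i) - \<tau> i" for i
  show thesis
  proof
    show "(p, w) \<in> set xs \<Longrightarrow> p \<in> X \<and> 0 \<le> w" for p w using xs(1) by (auto simp: adm_def)
    fix p assume p: "p \<in> X"
    have "adm ((p, \<delta>) # xs)" using xs(1) p \<delta>(1) by (auto simp: adm_def)
    then have "J xs - \<delta>\<^sup>2 \<le> J ((p, \<delta>) # xs)" using jle xs(2) by fastforce
    also have "J ((p, \<delta>) # xs) = N / 2 * (\<Sum>i<N. (q i + \<delta> * h i p)\<^sup>2) + (\<delta> * F p + wsum xs F) + (\<delta> + wsum xs (\<lambda>_. 1))"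
      by (simp add: J_def wsum_Cons q_def algebra_simps)
    also have "(\<Sum>i<N. (q i + \<delta> * h i p)\<^sup>2) = (\<Sum>i<N. (q i)\<^sup>2) + 2 * \<delta> * (\<Sum>i<N. q i * h i p) + \<delta>\<^sup>2 * (\<Sum>i<N. (h i p)\<^sup>2)"
      by (simp add: power2_sum sum.distrib sum_distrib_left power_mult_distrib algebra_simps)
    finally have "0 \<le> \<delta> * (N * (\<Sum>i<N. q i * h i p) + F p + 1 + \<delta> * (1 + N / 2 * (\<Sum>i<N. (h i p)\<^sup>2)))"
      unfolding J_def q_def[symmetric] by (simp add: algebra_simps power2_eq_square)
    then have 1: "0 \<le> N * (\<Sum>i<N. q i * h i p) + F p + 1 + \<delta> * (1 + N / 2 * (\<Sum>i<N. (h i p)\<^sup>2))"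
      using \<delta>(1) by (simp add: zero_le_mult_iff)
    have "(\<Sum>i<N. (h i p)\<^sup>2) \<le> (\<Sum>i<N. C\<^sup>2)"
      using h p by (intro sum_mono) (auto intro: abs_le_square_iff[THEN iffD1] order_trans[OF _ abs_ge_self])
    then have "1 + N / 2 * (\<Sum>i<N. (h i p)\<^sup>2) \<le> M1"
      unfolding M1_def by (intro add_left_mono mult_left_mono) auto
    then have "\<delta> * (1 + N / 2 * (\<Sum>i<N. (h i p)\<^sup>2)) \<le> \<delta> * M1" using \<delta>(1) by (intro mult_left_mono) auto
    then show "- \<theta> \<le> N * (\<Sum>i<N. (wsum xs (h i) - \<tau> i) * h i p) + F p + 1"
      using 1 \<delta>M(1) unfolding q_def by linarith
  next
    let ?ys = "map (\<lambda>(p, w). (p, (1 - \<delta>) * w)) xs"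
    have "adm ?ys" using xs(1) \<delta> by (auto simp: adm_def)
    then have "J xs - \<delta>\<^sup>2 \<le> J ?ys" using jle xs(2) by fastforce
    also have "J ?ys = N / 2 * (\<Sum>i<N. (q i - \<delta> * wsum xs (h i))\<^sup>2) + (1 - \<delta>) * wsum xs F + (1 - \<delta>) * wsum xs (\<lambda>_. 1)"
      unfolding J_def wsum_scale q_def by (simp add: algebra_simps)
    also have "(\<Sum>i<N. (q i - \<delta> * wsum xs (h i))\<^sup>2)
        = (\<Sum>i<N. (q i)\<^sup>2) - 2 * \<delta> * (\<Sum>i<N. q i * wsum xs (h i)) + \<delta>\<^sup>2 * (\<Sum>i<N. (wsum xs (h i))\<^sup>2)"
      by (simp add: power2_diff sum.distrib sum_subtractf sum_distrib_left power_mult_distrib algebra_simps)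
    finally have "\<delta> * (N * (\<Sum>i<N. q i * wsum xs (h i)) + wsum xs F + wsum xs (\<lambda>_. 1))
        \<le> \<delta> * (\<delta> * (1 + N / 2 * (\<Sum>i<N. (wsum xs (h i))\<^sup>2)))"
      unfolding J_def q_def[symmetric] by (simp add: algebra_simps power2_eq_square)
    then have 1: "N * (\<Sum>i<N. q i * wsum xs (h i)) + wsum xs F + wsum xs (\<lambda>_. 1)
        \<le> \<delta> * (1 + N / 2 * (\<Sum>i<N. (wsum xs (h i))\<^sup>2))"
      using \<delta>(1) by simp
    have "(wsum xs (h i))\<^sup>2 \<le> 2 * (q i)\<^sup>2 + 2 * (\<tau> i)\<^sup>2" for i
      using zero_le_power2[of "q i - \<tau> i"] by (simp add: q_def power2_eq_square algebra_simps)
    then have "(\<Sum>i<N. (wsum xs (h i))\<^sup>2) \<le> (\<Sum>i<N. 2 * (q i)\<^sup>2 + 2 * (\<tau> i)\<^sup>2)" by (intro sum_mono)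
    then have "N / 2 * (\<Sum>i<N. (wsum xs (h i))\<^sup>2) \<le> N / 2 * (\<Sum>i<N. 2 * (q i)\<^sup>2 + 2 * (\<tau> i)\<^sup>2)"
      by (intro mult_left_mono) auto
    also have "\<dots> = 2 * (N / 2 * (\<Sum>i<N. (q i)\<^sup>2)) + 2 * J []"
      unfolding Jnil by (simp add: sum.distrib sum_distrib_left[symmetric] algebra_simps)
    also have "\<dots> \<le> 2 * J xs + 2 * J []" using J0(1)[OF xs(1)] by (simp add: q_def)
    also have "\<dots> \<le> 4 * J [] + 2" using xs(2) jle[OF adm0] d2 by simp
    finally have "1 + N / 2 * (\<Sum>i<N. (wsum xs (h i))\<^sup>2) \<le> M2" by (simp add: M2_def)
    then have "\<delta> * (1 + N / 2 * (\<Sum>i<N. (wsum xs (h i))\<^sup>2)) \<le> \<delta> * M2" using \<delta>(1) by (intro mult_left_mono) auto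
    then show "N * (\<Sum>i<N. (wsum xs (h i) - \<tau> i) * wsum xs (h i)) + wsum xs F + wsum xs (\<lambda>_. 1) \<le> \<theta>"
      using 1 \<delta>M(2) unfolding q_def by linarith
  qed
qed

section \<open>Strong duality: a minimising matrix-valued measure\<close>

lemma SUP_ennreal_Max:
  fixes a :: "nat \<Rightarrow> real"
  shows "(SUP i. ennreal (a i)) = (SUP k. ennreal (Max (a ` {..k})))"
proof (rule antisym)
  show "(SUP i. ennreal (a i)) \<le> (SUP k. ennreal (Max (a ` {..k})))"
    by (intro SUP_mono) (auto intro!: ennreal_leI Max_ge)
  show "(SUP k. ennreal (Max (a ` {..k}))) \<le> (SUP i. ennreal (a i))"
  proof (rule SUP_least)
    fix k
    have "Max (a ` {..k}) \<in> a ` {..k}" by (intro Max_in) auto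
    then obtain i where "Max (a ` {..k}) = a i" by (rule imageE)
    then show "ennreal (Max (a ` {..k})) \<le> (SUP i. ennreal (a i))" by (auto intro: SUP_upper)
  qed
qed

lemma wsum_nth: "wsum xs g = (\<Sum>i<length xs. snd (xs ! i) * g (fst (xs ! i)))"
  unfolding wsum_def by (simp add: sum_list_sum_nth case_prod_beta atLeast0LessThan)

lemma wsum_mono: "(\<And>p w. (p, w) \<in> set xs \<Longrightarrow> 0 \<le> w \<and> g p \<le> h p) \<Longrightarrow> wsum xs g \<le> wsum xs h"
  unfolding wsum_def by (intro sum_list_mono) (auto intro: mult_left_mono)

lemma wsum_cong: "(\<And>p w. (p, w) \<in> set xs \<Longrightarrow> g p = h p) \<Longrightarrow> wsum xs g = wsum xs h"
  unfolding wsum_def by (intro arg_cong[where f = sum_list] map_cong refl) auto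

text \<open>
  After normalisation the weighted list is a finitely supported probability distribution of the real
  parameter \<open>s\<close>.  An empty or weightless list is represented by any distribution, as both sides vanish.
\<close>

lemma weighted_list_distribution:
  fixes s :: "'p \<Rightarrow> real"
  assumes xs: "\<And>p w. (p, w) \<in> set xs \<Longrightarrow> 0 \<le> w \<and> s p \<in> {0..1}"
  obtains P where "real_distribution P" "measure P {0..1} = 1"
    "\<And>g :: real \<Rightarrow> real. g \<in> borel_measurable borel \<Longrightarrow> wsum xs (\<lambda>_. 1) * (LINT u|P. g u) = wsum xs (\<lambda>p. g (s p))"
proof -
  define W where "W = wsum xs (\<lambda>_. 1)"
  let ?n = "length xs" and ?w = "\<lambda>i. snd (xs ! i)" and ?p = "\<lambda>i. fst (xs ! i)"
  have nth: "0 \<le> ?w i" "s (?p i) \<in> {0..1}" if "i < ?n" for i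
    using xs[of "?p i" "?w i"] nth_mem[OF that] by auto
  have W: "W = (\<Sum>i<?n. ?w i)" by (simp add: W_def wsum_nth)
  have W0: "0 \<le> W" unfolding W by (intro sum_nonneg) (use nth in auto)
  show thesis
  proof (cases "W = 0")
    case True
    have w0: "?w i = 0" if "i < ?n" for i
      using True nth that unfolding W by (subst (asm) sum_nonneg_eq_0_iff) auto
    have "real_distribution (return borel (0::real))"
      by (intro real_distribution.intro prob_space_return) (auto simp: real_distribution_axioms_def)
    moreover have "measure (return borel (0::real)) {0..1} = 1"
      by (simp add: measure_return)
    ultimately show ?thesis
      by (rule that) (use True w0 in \<open>simp add: W_def[symmetric] wsum_nth[of xs "\<lambda>p. _ (s p)"]\<close>)
  next
    case False
    then have Wp: "0 < W" using W0 by simp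
    let ?M = "point_measure {..<?n} (\<lambda>i. ?w i / W)"
    define P where "P = distr ?M borel (\<lambda>i. s (?p i))"
    have sm: "(\<lambda>i. s (?p i)) \<in> ?M \<rightarrow>\<^sub>M borel" by simp
    have int: "(LINT u|P. g u) = (\<Sum>i<?n. ?w i / W * g (s (?p i)))" if "g \<in> borel_measurable borel" for g :: "real \<Rightarrow> real"
      unfolding P_def using that nth Wp
      by (subst integral_distr[OF sm that]) (subst lebesgue_integral_point_measure_finite, auto)
    have emM: "emeasure ?M {..<?n} = 1"
    proof -
      have "emeasure ?M {..<?n} = (\<Sum>i<?n. ennreal (?w i / W))"
        by (rule emeasure_point_measure_finite) auto
      also have "\<dots> = ennreal (\<Sum>i<?n. ?w i / W)" by (rule sum_ennreal) (use nth Wp in auto)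
      also have "(\<Sum>i<?n. ?w i / W) = 1" using Wp by (simp add: sum_divide_distrib[symmetric] W[symmetric])
      finally show ?thesis by simp
    qed
    have pM: "prob_space ?M" by (rule prob_spaceI) (use emM in \<open>simp add: space_point_measure\<close>)
    have pP: "prob_space P" unfolding P_def by (rule prob_space.prob_space_distr[OF pM sm])
    have rd: "real_distribution P"
      by (intro real_distribution.intro pP) (auto simp: real_distribution_axioms_def P_def)
    have "(\<lambda>i. s (?p i)) -` {0..1} \<inter> space ?M = {..<?n}"
      using nth by (auto simp: space_point_measure)
    then have "emeasure P {0..1} = 1" unfolding P_def using emM by (subst emeasure_distr[OF sm]) auto
    then have m1: "measure P {0..1} = 1" by (simp add: measure_def)
    show ?thesis
    proof (rule that[OF rd m1])
      fix g :: "real \<Rightarrow> real" assume "g \<in> borel_measurable borel"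
      then show "wsum xs (\<lambda>_. 1) * (LINT u|P. g u) = wsum xs (\<lambda>p. g (s p))"
        using Wp by (simp add: int W_def[symmetric] wsum_nth[of xs "\<lambda>p. g (s p)"] sum_distrib_left)
    qed
  qed
qed

text \<open>
  The radial homeomorphism from the open unit ball onto the whole space, with inverse \<open>toball\<close>.  The
  closed ball is the compactification on which limits are taken.
\<close>

definition unball :: "real^'d \<Rightarrow> real^'d" where
  "unball z = (1 / (1 - norm z)) *\<^sub>R z"

definition toball :: "real^'d \<Rightarrow> real^'d" where
  "toball y = (1 / (1 + norm y)) *\<^sub>R y"

lemma norm_toball: "norm (toball y) = norm y / (1 + norm y)"
  unfolding toball_def by (simp add: add_nonneg_nonneg)

lemma toball_less: "norm (toball y) < 1"
  unfolding norm_toball by (simp add: add_pos_nonneg divide_less_eq)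

lemma one_minus_toball: "1 - norm (toball y) = 1 / (1 + norm y)"
  unfolding norm_toball by (simp add: field_simps add_pos_nonneg add_nonneg_eq_0_iff)

lemma unball_toball: "unball (toball y) = y"
proof -
  have "1 + norm y \<noteq> 0" using norm_ge_zero[of y] by linarith
  then show ?thesis unfolding unball_def one_minus_toball by (simp add: toball_def)
qed

definition ball_ext :: "(real^'d \<Rightarrow> 'b::real_normed_vector) \<Rightarrow> real^'d \<Rightarrow> 'b" where
  "ball_ext g z = (if norm z < 1 then g (unball z) else 0)"

lemma ball_ext_toball: "ball_ext g (toball y) = g y"
  by (simp add: ball_ext_def toball_less unball_toball)

lemma continuous_on_ball_ext:
  fixes g :: "real^'d \<Rightarrow> 'b::real_normed_vector"
  assumes g: "continuous_on UNIV g" and lim: "(g \<longlongrightarrow> 0) at_infinity"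
  shows "continuous_on UNIV (ball_ext g)"
proof -
  have "isCont (ball_ext g) z" for z
  proof (cases "norm z < 1")
    case True
    have "continuous_on (ball 0 1) (\<lambda>z. g (unball z))"
      unfolding unball_def
      by (intro continuous_on_compose2[OF g] continuous_intros) auto
    moreover have "continuous_on (ball 0 1) (ball_ext g) \<longleftrightarrow> continuous_on (ball 0 1) (\<lambda>z. g (unball z))"
      by (intro continuous_on_cong) (auto simp: ball_ext_def)
    ultimately show ?thesis using True continuous_on_interior[of "ball 0 1" "ball_ext g" z] by auto
  next
    case False
    have "(ball_ext g \<longlongrightarrow> 0) (at z)"
    proof (rule tendstoI)
      fix e :: real assume e: "0 < e"
      obtain B where B: "\<And>y. B \<le> norm y \<Longrightarrow> dist (g y) 0 < e"
        using tendstoD[OF lim e] unfolding eventually_at_infinity by blast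
      define b where "b = max B 0"
      have b: "0 \<le> b" "B \<le> b" by (auto simp: b_def)
      have "b / (1 + b) < 1" using b(1) by simp
      then have "b / (1 + b) < norm z" using False by linarith
      then have "eventually (\<lambda>w. b / (1 + b) < norm w) (at z)"
        by (intro order_tendstoD(1)[OF tendsto_norm[OF tendsto_ident_at]])
      then show "eventually (\<lambda>w. dist (ball_ext g w) 0 < e) (at z)"
      proof eventually_elim
        case (elim w)
        show ?case
        proof (cases "norm w < 1")
          case True
          have "b \<le> norm w / (1 - norm w)" using elim True b(1) by (simp add: field_simps)
          also have "\<dots> = norm (unball w)" using True by (simp add: unball_def)
          finally show ?thesis using B[of "unball w"] b(2) True by (simp add: ball_ext_def)
        qed (use e in \<open>simp add: ball_ext_def\<close>)
      qed
    qed
    then show ?thesis using False by (simp add: isCont_def ball_ext_def)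
  qed
  then show ?thesis by (simp add: continuous_on_eq_continuous_at)
qed

lemma Basis_matrix_inner:
  fixes A :: "real^'d^'d"
  assumes "b \<in> Basis"
  obtains i j where "A \<bullet> b = A $ i $ j"
proof -
  obtain i u where b: "b = axis i u" "u \<in> Basis" using assms by (auto simp: Basis_vec_def)
  then obtain j where "u = axis j 1" by (auto simp: Basis_vec_def)
  then have "A \<bullet> b = A $ i $ j" using b by (simp add: inner_axis)
  then show thesis by (rule that)
qed

lemma trace_zero_imp_zero:
  fixes A :: "real^'d^'d"
  assumes "A \<in> psd_mats" "trace A = 0"
  shows "A = 0"
  using norm_psd_le[OF assms(1)] assms(2) by simp

lemma trace_scale: "trace (c *\<^sub>R A) = c * trace A" for A :: "real^'d^'d"
  unfolding mat_1_inner[symmetric] by simp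

lemma dual_fn_bound:
  assumes "dual_fn f \<psi>" "dual_cost f x p = ennreal d" "0 \<le> d"
  shows "(LINT y|p. \<psi> y) - \<psi> x \<le> d"
proof -
  have "ennreal ((LINT y|p. \<psi> y) - \<psi> x) \<le> ennreal d"
    unfolding assms(2)[symmetric] dual_cost_def using assms(1) by (intro SUP_upper) auto
  then show ?thesis using assms(3) by (simp add: ennreal_le_iff)
qed

text \<open>
  Let \<open>r\<^sub>i\<close> be the residuals of an almost minimiser of the penalised problem.  Its first-order condition
  says that \<open>- N \<Sum> r\<^sub>i \<psi>\<^sub>i - (1 + \<theta>) |y|\<^sup>2\<close> is a dual function, because the half Hessian of \<open>|y|\<^sup>2\<close> is the
  identity, which pairs to \<open>1\<close> with a matrix of trace one.  The dual value \<open>d\<close> therefore bounds its gain,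
  and together with the scaling condition this bounds penalty, cost and mass.
\<close>

lemma approximate_solution:
  fixes f :: "real^'d^'d \<Rightarrow> ennreal" and \<psi> :: "nat \<Rightarrow> real^'d \<Rightarrow> real"
  assumes hom: "pos_1_homogeneous f" and dom: "fin_dom f = psd_mats"
    and \<nu>: "\<nu> \<in> P2" and d: "dual_cost f x \<nu> = ennreal d" "0 \<le> d"
    and c: "\<And>i. c2b (\<psi> i) (D i) (D2 i)"
  defines "\<tau> \<equiv> \<lambda>\<psi>. (LINT y|\<nu>. \<psi> y) - \<psi> x"
  defines "M \<equiv> \<tau> (\<lambda>y. (norm y)\<^sup>2)"
  obtains xs :: "(((real^'d) \<times> (real^'d^'d)) \<times> real) list" where
    "\<And>y A w. ((y, A), w) \<in> set xs \<Longrightarrow> A \<in> psd_mats \<and> trace A = 1 \<and> 0 \<le> w"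
    "N * (\<Sum>i<N. (wsum xs (\<lambda>(y, A). ((1/2) *\<^sub>R D2 i y) \<bullet> A) - \<tau> (\<psi> i))\<^sup>2)
       + wsum xs (\<lambda>(y, A). enn2real (f A)) + wsum xs (\<lambda>_. 1) \<le> d + M + (1 + \<bar>M\<bar>) / real (Suc N)"
proof -
  let ?R = "real CARD('d) * real CARD('d)"
  define X :: "((real^'d) \<times> (real^'d^'d)) set" where "X = {(y, A). A \<in> psd_mats \<and> trace A = 1}"
  define h where "h i = (\<lambda>(y, A). ((1/2) *\<^sub>R D2 i y) \<bullet> A)" for i
  define F where "F = (\<lambda>(y::real^'d, A). enn2real (f A))"
  define \<theta> where "\<theta> = 1 / real (Suc N)"
  have \<theta>: "0 < \<theta>" by (simp add: \<theta>_def)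
  have "\<exists>K. 0 \<le> K \<and> (\<forall>y. norm (D2 i y) \<le> K)" for i by (rule c2b_bound[OF c[of i]]) blast
  then have "\<forall>i. \<exists>K. 0 \<le> K \<and> (\<forall>y. norm (D2 i y) \<le> K)" by blast
  then obtain K where "\<forall>i. 0 \<le> K i \<and> (\<forall>y. norm (D2 i y) \<le> K i)" unfolding choice_iff by blast
  then have K: "0 \<le> K i" "norm (D2 i y) \<le> K i" for i y by blast+
  define C where "C = (\<Sum>i<N. K i * ?R)"
  have hC: "\<bar>h i p\<bar> \<le> C" if i: "i < N" and p: "p \<in> X" for i p
  proof -
    obtain y A where pA: "p = (y, A)" "A \<in> psd_mats" "trace A = 1" using p by (auto simp: X_def)
    have "\<bar>((1/2) *\<^sub>R D2 i y) \<bullet> A\<bar> \<le> norm ((1/2) *\<^sub>R D2 i y) * norm A" by (rule Cauchy_Schwarz_ineq2)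
    also have "\<dots> \<le> K i * ?R"
      using K(1)[of i] K(2)[of i y] norm_psd_le[OF pA(2)] pA(3) by (intro mult_mono) auto
    also have "\<dots> \<le> C" unfolding C_def using i K(1) by (intro member_le_sum) auto
    finally show ?thesis by (simp add: h_def pA)
  qed
  have F0: "0 \<le> F p" if "p \<in> X" for p by (simp add: F_def case_prod_beta)
  from penalised_minimiser[where X = X and F = F and h = h and N = N and C = C and \<theta> = \<theta> and \<tau> = "\<lambda>i. \<tau> (\<psi> i)", OF F0 hC \<theta>]
  obtain xs where xs: "\<And>p w. (p, w) \<in> set xs \<Longrightarrow> p \<in> X \<and> 0 \<le> w"
    and lower: "\<And>p. p \<in> X \<Longrightarrow> - \<theta> \<le> N * (\<Sum>i<N. (wsum xs (h i) - \<tau> (\<psi> i)) * h i p) + F p + 1"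
    and scale: "N * (\<Sum>i<N. (wsum xs (h i) - \<tau> (\<psi> i)) * wsum xs (h i)) + wsum xs F + wsum xs (\<lambda>_. 1) \<le> \<theta>"
    by blast
  define q where "q i = wsum xs (h i) - \<tau> (\<psi> i)" for i
  define \<phi> where "\<phi> y = (\<Sum>i<N. (- real N * q i) * \<psi> i y) + (- (1 + \<theta>)) * (norm y)\<^sup>2" for y
  define E where "E y = (\<Sum>i<N. (- real N * q i) *\<^sub>R D2 i y) + (- (1 + \<theta>)) *\<^sub>R (2 *\<^sub>R mat 1)" for y
  have c\<phi>: "c2b \<phi> (\<lambda>y. (\<Sum>i<N. (- real N * q i) *\<^sub>R D i y) + (- (1 + \<theta>)) *\<^sub>R (2 *\<^sub>R y)) E"
    unfolding \<phi>_def E_def by (intro c2b_add c2b_sum c2b_scale[OF c2b_norm_square] c)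
  have "(1/2) *\<^sub>R E y \<in> minorants f" for y
    unfolding minorants_def
  proof (intro CollectI ballI)
    fix A :: "real^'d^'d" assume A: "A \<in> sym_mats"
    show "ennreal ((1/2) *\<^sub>R E y \<bullet> A) \<le> f A"
    proof (cases "A \<in> psd_mats")
      case False
      then have "f A = \<infinity>" using A dom by (auto simp: fin_dom_def less_top[symmetric])
      then show ?thesis by simp
    next
      case psd: True
      show ?thesis
      proof (cases "trace A = 0")
        case True
        then show ?thesis using trace_zero_imp_zero[OF psd] by simp
      next
        case False
        define t where "t = trace A"
        have t: "0 < t" using psd_trace_nonneg[OF psd] False by (simp add: t_def)
        define A' where "A' = (1 / t) *\<^sub>R A"
        have A': "A' \<in> psd_mats" "trace A' = 1" "A = t *\<^sub>R A'"
          using t psd_scale[OF psd, of "1 / t"] by (auto simp: A'_def trace_scale t_def)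
        have fA': "f A' < \<infinity>" using A'(1) dom by (auto simp: fin_dom_def)
        have "(1/2) *\<^sub>R E y \<bullet> A' = (\<Sum>i<N. (- real N * q i) * h i (y, A')) - (1 + \<theta>)"
          unfolding E_def h_def
          by (simp add: inner_add_left inner_sum_left scaleR_right_distrib mat_1_inner A'(2) sum_distrib_left scaleR_sum_right algebra_simps)
        also have "(\<Sum>i<N. (- real N * q i) * h i (y, A')) = - (N * (\<Sum>i<N. q i * h i (y, A')))"
          by (simp add: sum_distrib_left sum_negf mult.assoc)
        finally have e: "(1/2) *\<^sub>R E y \<bullet> A' = - (N * (\<Sum>i<N. q i * h i (y, A'))) - (1 + \<theta>)" .
        have "(y, A') \<in> X" using A' by (simp add: X_def)
        from lower[OF this] have "(1/2) *\<^sub>R E y \<bullet> A' \<le> enn2real (f A')"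
          unfolding e by (simp add: q_def F_def)
        then have "(1/2) *\<^sub>R E y \<bullet> A \<le> t * enn2real (f A')"
          unfolding A'(3) using t by simp
        then have "ennreal ((1/2) *\<^sub>R E y \<bullet> A) \<le> ennreal (t * enn2real (f A'))" by (rule ennreal_leI)
        also have "\<dots> = ennreal t * f A'" using t fA' by (simp add: ennreal_mult)
        also have "\<dots> = f A" using hom t psd_imp_sym[OF A'(1)] unfolding A'(3) by (simp add: pos_1_homogeneous_def)
        finally show ?thesis .
      qed
    qed
  qed
  then have "dual_fn f \<phi>" using c\<phi> unfolding dual_fn_def by blast
  from dual_fn_bound[OF this d] have "\<tau> \<phi> \<le> d" by (simp add: \<tau>_def)
  moreover have "\<tau> \<phi> = (\<Sum>i<N. (- real N * q i) * \<tau> (\<psi> i)) - (1 + \<theta>) * M"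
  proof -
    have i: "integrable \<nu> (\<psi> i)" for i by (rule c2b_integrable[OF \<nu> c])
    have i2: "integrable \<nu> (\<lambda>y. (norm y)\<^sup>2)" by (rule P2_D(4)[OF \<nu>])
    have eq: "(LINT y|\<nu>. \<phi> y) = (\<Sum>i<N. (- real N * q i) * (LINT y|\<nu>. \<psi> i y)) + (- (1 + \<theta>)) * (LINT y|\<nu>. (norm y)\<^sup>2)"
      unfolding \<phi>_def using i i2
      by (subst Bochner_Integration.integral_add) (auto simp: Bochner_Integration.integral_sum intro!: Bochner_Integration.integrable_sum)
    have "\<tau> \<phi> = ((\<Sum>i<N. (- real N * q i) * (LINT y|\<nu>. \<psi> i y)) + (- (1 + \<theta>)) * (LINT y|\<nu>. (norm y)\<^sup>2))
        - ((\<Sum>i<N. (- real N * q i) * \<psi> i x) + (- (1 + \<theta>)) * (norm x)\<^sup>2)"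
      unfolding \<tau>_def eq[symmetric] by (simp only: \<phi>_def[of x])
    also have "\<dots> = ((\<Sum>i<N. (- real N * q i) * (LINT y|\<nu>. \<psi> i y)) - (\<Sum>i<N. (- real N * q i) * \<psi> i x)) - (1 + \<theta>) * M"
    proof -
      have "(a + - t * b) - (c + - t * e) = (a - c) - t * (b - e)" for a b c e t :: real
        by (simp add: algebra_simps)
      then show ?thesis unfolding M_def \<tau>_def by this
    qed
    also have "(\<Sum>i<N. (- real N * q i) * (LINT y|\<nu>. \<psi> i y)) - (\<Sum>i<N. (- real N * q i) * \<psi> i x) = (\<Sum>i<N. (- real N * q i) * \<tau> (\<psi> i))"
      unfolding \<tau>_def by (simp only: right_diff_distrib sum_subtractf)
    finally show ?thesis .
  qed
  ultimately have "- (N * (\<Sum>i<N. q i * \<tau> (\<psi> i))) - (1 + \<theta>) * M \<le> d"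
    by (simp add: sum_distrib_left sum_negf mult.assoc)
  moreover have "(\<Sum>i<N. q i * wsum xs (h i)) = (\<Sum>i<N. (q i)\<^sup>2) + (\<Sum>i<N. q i * \<tau> (\<psi> i))"
    by (simp add: q_def sum.distrib[symmetric] power2_eq_square algebra_simps)
  ultimately have "N * (\<Sum>i<N. (q i)\<^sup>2) + wsum xs F + wsum xs (\<lambda>_. 1) \<le> d + M + \<theta> * (1 + M)"
    using scale unfolding q_def[symmetric] by (simp add: algebra_simps)
  also have "\<dots> \<le> d + M + \<theta> * (1 + \<bar>M\<bar>)" using \<theta> by (intro add_left_mono mult_left_mono) auto
  finally have "N * (\<Sum>i<N. (q i)\<^sup>2) + wsum xs F + wsum xs (\<lambda>_. 1) \<le> d + M + (1 + \<bar>M\<bar>) / real (Suc N)"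
    by (simp add: \<theta>_def)
  then show thesis
    by (intro that[of xs]) (use xs in \<open>auto simp: q_def h_def F_def X_def\<close>)
qed

text \<open>
  The test functions that extend continuously to the compactified space; boundedness of \<open>\<psi>\<close> is used
  after division by \<open>1 + |y|\<close>.
\<close>

definition decaying_test :: "(real^'d \<Rightarrow> real) \<Rightarrow> (real^'d \<Rightarrow> real^'d) \<Rightarrow> (real^'d \<Rightarrow> real^'d^'d) \<Rightarrow> bool" where
  "decaying_test \<psi> D D2 \<longleftrightarrow> c2b \<psi> D D2 \<and> bounded (range \<psi>) \<and> (D2 \<longlongrightarrow> 0) at_infinity"

lemma continuous_on_ball_ext_decaying:
  fixes \<psi> :: "real^'d \<Rightarrow> real"
  assumes "decaying_test \<psi> D D2"
  shows "continuous_on UNIV (ball_ext (\<lambda>y. (1/2) *\<^sub>R D2 y))"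
    and "continuous_on UNIV (ball_ext (\<lambda>y. \<psi> y / (1 + norm y)))"
proof -
  have c: "c2b \<psi> D D2" and b: "bounded (range \<psi>)" and l: "(D2 \<longlongrightarrow> 0) at_infinity"
    using assms by (auto simp: decaying_test_def)
  show "continuous_on UNIV (ball_ext (\<lambda>y. (1/2) *\<^sub>R D2 y))"
    by (rule continuous_on_ball_ext) (use tendsto_scaleR[OF tendsto_const[of "1/2"] l] c2b_D(3)[OF c] in \<open>auto intro!: continuous_intros\<close>)
  obtain B where B: "\<And>y. norm (\<psi> y) \<le> B" using b by (auto simp: bounded_iff)
  have pos: "0 < 1 + norm y" for y :: "real^'d" by (simp add: add_pos_nonneg)
  show "continuous_on UNIV (ball_ext (\<lambda>y. \<psi> y / (1 + norm y)))"
  proof (rule continuous_on_ball_ext)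
    show "continuous_on UNIV (\<lambda>y. \<psi> y / (1 + norm y))"
      by (intro continuous_intros c2b_D(5)[OF c]) (metis add_pos_nonneg less_numeral_extra(3) norm_ge_zero zero_less_one)
    show "((\<lambda>y. \<psi> y / (1 + norm y)) \<longlongrightarrow> 0) at_infinity"
    proof (rule Lim_null_comparison)
      show "\<forall>\<^sub>F y in at_infinity. norm (\<psi> y / (1 + norm y)) \<le> B / (1 + norm y)"
        using B by (intro always_eventually allI) (auto simp: divide_right_mono)
      have "filterlim (\<lambda>y. 1 + norm y) at_top at_infinity"
        by (intro filterlim_tendsto_add_at_top[OF tendsto_const] filterlim_norm_at_top)
      then show "((\<lambda>y. B / (1 + norm y)) \<longlongrightarrow> 0) at_infinity"
        by (rule tendsto_divide_0[OF tendsto_const filterlim_at_top_imp_at_infinity])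
    qed
  qed
qed

text \<open>
  The approximate solutions are lifted along the space-filling curve to the unit interval, where a
  subsequence converges.  The penalty forces the equation for the decaying test functions; cost plus
  mass stays below \<open>d\<close> plus the second-moment gain \<open>M\<close>.  Restricting the limit to the part over the open
  ball removes the mass at infinity, and the equation for \<open>|y|\<^sup>2\<close> then shows that the remaining mass is
  \<open>M\<close>, so that the cost alone is at most \<open>d\<close>.
\<close>

lemma static_minimiser:
  fixes f :: "real^'d^'d \<Rightarrow> ennreal"
  assumes conv: "convex_fun f" and hom: "pos_1_homogeneous f" and lsc: "lower_semicont f"
    and dom: "fin_dom f = psd_mats"
    and \<nu>: "\<nu> \<in> P2" and d: "dual_cost f x \<nu> = ennreal d" "0 \<le> d"
  obtains \<sigma> :: "real measure" and Y A B where "finite_measure \<sigma>" "sets \<sigma> = sets borel"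
    "Y \<in> borel_measurable borel" "A \<in> borel_measurable borel" "\<And>s. A s \<in> psd_mats" "\<And>s. norm (A s) \<le> B"
    "\<And>\<psi> D D2. c2b \<psi> D D2 \<Longrightarrow> (LINT s|\<sigma>. ((1/2) *\<^sub>R D2 (Y s)) \<bullet> A s) = (LINT y|\<nu>. \<psi> y) - \<psi> x"
    "(\<integral>\<^sup>+s. f (A s) \<partial>\<sigma>) \<le> ennreal d"
proof -
  define \<tau> :: "(real^'d \<Rightarrow> real) \<Rightarrow> real" where "\<tau> = (\<lambda>\<psi>. (LINT y|\<nu>. \<psi> y) - \<psi> x)"
  define M where "M = \<tau> (\<lambda>y. (norm y)\<^sup>2)"
  obtain c :: "real \<Rightarrow> (real^'d) \<times> (real^'d^'d)" where cc: "continuous_on UNIV c"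
    and cb: "\<And>s b. b \<in> Basis \<Longrightarrow> \<bar>c s \<bullet> b\<bar> \<le> 1"
    and cs: "\<And>v. (\<And>b. b \<in> Basis \<Longrightarrow> \<bar>v \<bullet> b\<bar> \<le> 1) \<Longrightarrow> \<exists>s\<in>{0..1}. c s = v"
    by (rule space_filling_curve) blast
  define Z where "Z s = fst (c s)" for s
  define A0 where "A0 s = snd (c s)" for s
  have cZ: "continuous_on UNIV Z" and cA: "continuous_on UNIV A0"
    unfolding Z_def[abs_def] A0_def[abs_def] using cc by (auto intro!: continuous_intros)
  define R where "R = real DIM((real^'d) \<times> (real^'d^'d))"
  have nc: "norm (c s) \<le> R" for s
  proof -
    have "norm (c s) \<le> (\<Sum>b\<in>Basis. \<bar>c s \<bullet> b\<bar>)" by (rule norm_le_l1)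
    also have "\<dots> \<le> (\<Sum>b\<in>(Basis :: ((real^'d) \<times> (real^'d^'d)) set). 1)" by (intro sum_mono cb)
    finally show ?thesis by (simp add: R_def)
  qed
  have nA: "norm (A0 s) \<le> R" for s using norm_snd_le[of "snd (c s)" "fst (c s)"] nc[of s] by (simp add: A0_def)
  have R0: "0 \<le> R" by (simp add: R_def)
  \<comment> \<open>a uniformly dense sequence of decaying test functions\<close>
  define I where "I = {(\<psi> :: real^'d \<Rightarrow> real, D, D2). decaying_test \<psi> D D2}"
  define H where "H = (\<lambda>(\<psi> :: real^'d \<Rightarrow> real, D :: real^'d \<Rightarrow> real^'d, D2). \<lambda>(z, A :: real^'d^'d, t :: real).
     ball_ext (\<lambda>y. (1/2) *\<^sub>R D2 y) z \<bullet> A + t * ball_ext (\<lambda>y. \<psi> y / (1 + norm y)) z)"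
  let ?K = "cball (0::real^'d) 1 \<times> cball (0::real^'d^'d) R \<times> {0..1::real}"
  have cH: "continuous_on ?K (H i)" if i: "i \<in> I" for i
  proof -
    obtain \<psi> D D2 where i': "i = (\<psi>, D, D2)" "decaying_test \<psi> D D2" using i by (auto simp: I_def)
    note e = continuous_on_ball_ext_decaying[OF i'(2)]
    have "continuous_on ?K (\<lambda>u. ball_ext (\<lambda>y. (1/2) *\<^sub>R D2 y) (fst u) \<bullet> fst (snd u) + snd (snd u) * ball_ext (\<lambda>y. \<psi> y / (1 + norm y)) (fst u))"
      by (intro continuous_intros continuous_on_compose2[OF e(1)] continuous_on_compose2[OF e(2)]) auto
    then show ?thesis by (simp add: H_def i' case_prod_beta)
  qed
  have "decaying_test (\<lambda>_::real^'d. 0) (\<lambda>_. 0) (\<lambda>_. 0)" by (auto simp: decaying_test_def c2b_const)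
  then have I0: "(\<lambda>_. 0, \<lambda>_. 0, \<lambda>_. 0) \<in> I" by (simp add: I_def)
  have cK: "compact ?K" by (intro compact_Times compact_cball compact_Icc)
  obtain J :: "nat \<Rightarrow> _" where J: "range J \<subseteq> I"
    "\<And>i \<epsilon>. i \<in> I \<Longrightarrow> 0 < \<epsilon> \<Longrightarrow> \<exists>n. \<forall>x\<in>?K. \<bar>H i x - H (J n) x\<bar> \<le> \<epsilon>"
    using uniformly_dense_sequence[where F = H and I = I, OF cK cH I0] by blast
  define \<psi> where "\<psi> n = fst (J n)" for n
  define D where "D n = fst (snd (J n))" for n
  define D2 where "D2 n = snd (snd (J n))" for n
  have dt: "decaying_test (\<psi> n) (D n) (D2 n)" for n
  proof -
    have "J n \<in> I" using J(1) by blast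
    then show ?thesis by (simp add: I_def \<psi>_def D_def D2_def case_prod_beta)
  qed
  have Jn: "J n = (\<psi> n, D n, D2 n)" for n by (simp add: \<psi>_def D_def D2_def)
  have cn: "c2b (\<psi> n) (D n) (D2 n)" for n using dt by (simp add: decaying_test_def)
  \<comment> \<open>approximate solutions, supported by finitely many atoms\<close>
  have "\<exists>xs :: (((real^'d) \<times> (real^'d^'d)) \<times> real) list. (\<forall>y A w. ((y, A), w) \<in> set xs \<longrightarrow> A \<in> psd_mats \<and> trace A = 1 \<and> 0 \<le> w) \<and>
    N * (\<Sum>i<N. (wsum xs (\<lambda>(y, A). ((1/2) *\<^sub>R D2 i y) \<bullet> A) - \<tau> (\<psi> i))\<^sup>2)
       + wsum xs (\<lambda>(y, A). enn2real (f A)) + wsum xs (\<lambda>_. 1) \<le> d + M + (1 + \<bar>M\<bar>) / real (Suc N)" for N :: nat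
    unfolding M_def \<tau>_def
    by (rule approximate_solution[OF hom dom \<nu> d, of \<psi> D D2 N, OF cn]) blast
  then have "\<forall>N. \<exists>xs :: (((real^'d) \<times> (real^'d^'d)) \<times> real) list. (\<forall>y A w. ((y, A), w) \<in> set xs \<longrightarrow> A \<in> psd_mats \<and> trace A = 1 \<and> 0 \<le> w) \<and>
    N * (\<Sum>i<N. (wsum xs (\<lambda>(y, A). ((1/2) *\<^sub>R D2 i y) \<bullet> A) - \<tau> (\<psi> i))\<^sup>2)
       + wsum xs (\<lambda>(y, A). enn2real (f A)) + wsum xs (\<lambda>_. 1) \<le> d + M + (1 + \<bar>M\<bar>) / real (Suc N)" by blast
  then obtain xs :: "nat \<Rightarrow> (((real^'d) \<times> (real^'d^'d)) \<times> real) list" where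
    xs0: "\<forall>N. (\<forall>y A w. ((y, A), w) \<in> set (xs N) \<longrightarrow> A \<in> psd_mats \<and> trace A = 1 \<and> 0 \<le> w) \<and>
    N * (\<Sum>i<N. (wsum (xs N) (\<lambda>(y, A). ((1/2) *\<^sub>R D2 i y) \<bullet> A) - \<tau> (\<psi> i))\<^sup>2)
       + wsum (xs N) (\<lambda>(y, A). enn2real (f A)) + wsum (xs N) (\<lambda>_. 1) \<le> d + M + (1 + \<bar>M\<bar>) / real (Suc N)"
    unfolding choice_iff by blast
  have xs: "A \<in> psd_mats" "trace A = 1" "0 \<le> w" if "((y, A), w) \<in> set (xs N)" for y A w N
    using xs0 that by blast+
  define S where "S N g = wsum (xs N) g" for N g
  define h where "h i = (\<lambda>(y, A). ((1/2) *\<^sub>R D2 i y) \<bullet> A)" for i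
  define F where "F = (\<lambda>(y::real^'d, A). enn2real (f A))"
  have Sbd: "N * (\<Sum>i<N. (S N (h i) - \<tau> (\<psi> i))\<^sup>2) + S N F + S N (\<lambda>_. 1) \<le> d + M + (1 + \<bar>M\<bar>) / real (Suc N)" for N
    using xs0 unfolding S_def h_def F_def by blast
  have S0: "0 \<le> S N F" "0 \<le> S N (\<lambda>_. 1)" for N
    unfolding S_def F_def by (rule wsum_nonneg; use xs in \<open>force simp: case_prod_beta\<close>)+
  have Q0: "0 \<le> N * (\<Sum>i<N. (S N (h i) - \<tau> (\<psi> i))\<^sup>2)" for N by (intro mult_nonneg_nonneg sum_nonneg) auto
  have eps: "(1 + \<bar>M\<bar>) / real (Suc N) \<le> 1 + \<bar>M\<bar>" for N
    using divide_left_mono[of 1 "real (Suc N)" "1 + \<bar>M\<bar>"] by simp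
  define Bd where "Bd = d + M + (1 + \<bar>M\<bar>)"
  have SB: "S N (\<lambda>_. 1) \<le> Bd" "N * (\<Sum>i<N. (S N (h i) - \<tau> (\<psi> i))\<^sup>2) \<le> Bd" for N
    using Sbd[of N] S0[of N] Q0[of N] eps[of N] by (auto simp: Bd_def)
  \<comment> \<open>the atoms are lifted to the parameter interval of the curve\<close>
  have "\<exists>s\<in>{0..1}. c s = (toball y, A)" if "A \<in> psd_mats" "trace A = 1" for y A
  proof (rule cs)
    fix b :: "(real^'d) \<times> (real^'d^'d)" assume "b \<in> Basis"
    then consider u where "b = (u, 0)" "u \<in> Basis" | u where "b = (0, u)" "u \<in> Basis"
      unfolding Basis_prod_def by auto
    then show "\<bar>(toball y, A) \<bullet> b\<bar> \<le> 1"
    proof cases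
      case 1
      then show ?thesis using Basis_le_norm[OF 1(2), of "toball y"] toball_less[of y] by (simp add: inner_Pair)
    next
      case 2
      obtain i j where "A \<bullet> u = A $ i $ j" by (rule Basis_matrix_inner[OF 2(2)])
      then show ?thesis using psd_entry_le_trace[OF that(1), of i j] that(2) 2 by (simp add: inner_Pair)
    qed
  qed
  then have "\<forall>p :: (real^'d) \<times> (real^'d^'d). \<exists>s. snd p \<in> psd_mats \<and> trace (snd p) = 1 \<longrightarrow> s \<in> {0..1} \<and> c s = (toball (fst p), snd p)"
    by blast
  then obtain sp where sp0: "\<forall>p :: (real^'d) \<times> (real^'d^'d). snd p \<in> psd_mats \<and> trace (snd p) = 1 \<longrightarrow> sp p \<in> {0..1} \<and> c (sp p) = (toball (fst p), snd p)"
    unfolding choice_iff by blast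
  have sp: "sp (y, A) \<in> {0..1}" "Z (sp (y, A)) = toball y" "A0 (sp (y, A)) = A" if "A \<in> psd_mats" "trace A = 1" for y A
    using sp0[rule_format, of "(y, A)"] that by (auto simp: Z_def A0_def)
  have "\<exists>P. real_distribution P \<and> measure P {0..1} = 1 \<and>
    (\<forall>g :: real \<Rightarrow> real. g \<in> borel_measurable borel \<longrightarrow> S N (\<lambda>_. 1) * (LINT u|P. g u) = S N (\<lambda>p. g (sp p)))" for N
    unfolding S_def
    by (rule weighted_list_distribution[of "xs N" sp]) (use xs sp(1) in \<open>auto 4 3\<close>)
  then have "\<forall>N. \<exists>P. real_distribution P \<and> measure P {0..1} = 1 \<and>
    (\<forall>g :: real \<Rightarrow> real. g \<in> borel_measurable borel \<longrightarrow> S N (\<lambda>_. 1) * (LINT u|P. g u) = S N (\<lambda>p. g (sp p)))" by blast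
  then obtain P where P0: "\<forall>N. real_distribution (P N) \<and> measure (P N) {0..1} = 1 \<and>
    (\<forall>g :: real \<Rightarrow> real. g \<in> borel_measurable borel \<longrightarrow> S N (\<lambda>_. 1) * (LINT u|P N. g u) = S N (\<lambda>p. g (sp p)))"
    unfolding choice_iff by blast
  then have P: "real_distribution (P N)" "measure (P N) {0..1} = 1"
    "\<And>g :: real \<Rightarrow> real. g \<in> borel_measurable borel \<Longrightarrow> S N (\<lambda>_. 1) * (LINT u|P N. g u) = S N (\<lambda>p. g (sp p))" for N by blast+
  have "\<forall>n. S n (\<lambda>_. 1) \<in> {0..Bd}" using S0(2) SB(1) by auto
  then obtain W r1 where W: "W \<in> {0..Bd}" "strict_mono (r1 :: nat \<Rightarrow> nat)" "((\<lambda>n. S n (\<lambda>_. 1)) \<circ> r1) \<longlonglongrightarrow> W"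
    using compact_imp_seq_compact[OF compact_Icc[of 0 Bd]] unfolding seq_compact_def by metis
  obtain r2 Q where r2: "strict_mono (r2 :: nat \<Rightarrow> nat)" and Q: "real_distribution Q"
    and Qlim: "\<And>g :: real \<Rightarrow> real. continuous_on UNIV g \<Longrightarrow> bounded (range g) \<Longrightarrow>
       (\<lambda>n. LINT s|P (r1 (r2 n)). g s) \<longlonglongrightarrow> (LINT s|Q. g s)"
    using unit_interval_compactness[of "\<lambda>n. P (r1 n)"] P(1,2) by blast
  interpret Q: real_distribution Q by (rule Q)
  define r where "r n = r1 (r2 n)" for n
  have r: "strict_mono r" using strict_mono_o[OF W(2) r2] by (simp add: r_def[abs_def] comp_def)
  have rn: "n \<le> r n" for n by (rule strict_mono_imp_increasing[OF r])
  have Wlim: "(\<lambda>n. S (r n) (\<lambda>_. 1)) \<longlonglongrightarrow> W"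
    using LIMSEQ_subseq_LIMSEQ[OF W(3) r2] by (simp add: comp_def r_def)
  have W0: "0 \<le> W" using W(1) by simp
  have lim: "(\<lambda>n. S (r n) (\<lambda>p. g (sp p))) \<longlonglongrightarrow> W * (LINT s|Q. g s)"
    if g: "continuous_on UNIV g" "bounded (range g)" for g :: "real \<Rightarrow> real"
  proof -
    have "(\<lambda>n. S (r n) (\<lambda>_. 1) * (LINT u|P (r n). g u)) \<longlonglongrightarrow> W * (LINT s|Q. g s)"
      using Qlim[OF g] by (intro tendsto_mult Wlim) (simp add: r_def)
    then show ?thesis using P(3)[OF borel_measurable_continuous_onI[OF g(1)]] by simp
  qed
  have Scong: "S N g = S N g'" if "\<And>y A. A \<in> psd_mats \<Longrightarrow> trace A = 1 \<Longrightarrow> g (y, A) = g' (y, A)" for N g g'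
    unfolding S_def by (rule wsum_cong) (use that xs in \<open>auto simp: split_paired_all\<close>)
  define \<sigma> where "\<sigma> = density Q (\<lambda>s. ennreal (W * indicator {s. norm (Z s) < 1} s))"
  define Y where "Y s = unball (Z s)" for s
  define A where "A s = (if A0 s \<in> psd_mats then A0 s else 0)" for s
  have Zm: "Z \<in> borel_measurable borel" and Am0: "A0 \<in> borel_measurable borel"
    using cZ cA by (auto intro: borel_measurable_continuous_onI)
  have ind: "(\<lambda>s. W * indicator {s. norm (Z s) < 1} s :: real) \<in> borel_measurable borel"
    using Zm by measurable
  have fs: "finite_measure \<sigma>" and ss: "sets \<sigma> = sets borel"
  proof -
    show "sets \<sigma> = sets borel" by (simp add: \<sigma>_def)
    have "emeasure \<sigma> (space \<sigma>) = (\<integral>\<^sup>+s. ennreal (W * indicator {s. norm (Z s) < 1} s) * indicator (space \<sigma>) s \<partial>Q)"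
      unfolding \<sigma>_def using ind by (subst emeasure_density) (auto simp: measurable_cong_sets[OF Q.events_eq_borel refl])
    also have "\<dots> \<le> (\<integral>\<^sup>+s. ennreal W \<partial>Q)"
      by (rule nn_integral_mono) (use W0 in \<open>auto simp: indicator_def\<close>)
    also have "\<dots> < \<infinity>" using Q.emeasure_space_1 by (simp add: ennreal_mult_less_top)
    finally show "finite_measure \<sigma>" by (intro finite_measureI) auto
  qed
  interpret \<sigma>: finite_measure \<sigma> by (rule fs)
  have Ym: "Y \<in> borel_measurable borel" unfolding Y_def[abs_def] unball_def using Zm by measurable
  have Am: "A \<in> borel_measurable borel"
  proof -
    have "(psd_mats :: (real^'d^'d) set) \<in> sets borel" by (intro borel_closed closed_psd_mats)
    then have "(\<lambda>X :: real^'d^'d. if X \<in> psd_mats then X else 0) \<in> borel_measurable borel"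
      by (intro measurable_If_set) auto
    from measurable_compose[OF Am0 this] show ?thesis unfolding A_def[abs_def] .
  qed
  have Apsd: "A s \<in> psd_mats" for s by (simp add: A_def)
  have AR: "norm (A s) \<le> R" for s using nA[of s] R0 by (simp add: A_def)
  have int\<sigma>: "(LINT s|\<sigma>. g s) = (LINT s|Q. (W * indicator {s. norm (Z s) < 1} s) * g s)"
    if "g \<in> borel_measurable borel" for g :: "real \<Rightarrow> real"
  proof -
    have gQ: "g \<in> borel_measurable Q" unfolding measurable_cong_sets[OF Q.events_eq_borel refl] by (rule that)
    have iQ: "(\<lambda>s. W * indicator {s. norm (Z s) < 1} s :: real) \<in> borel_measurable Q"
      unfolding measurable_cong_sets[OF Q.events_eq_borel refl] by (rule ind)
    have ae: "AE s in Q. 0 \<le> W * indicator {s. norm (Z s) < 1} s" using W0 by (intro AE_I2) (simp add: indicator_def)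
    from integral_density[OF gQ iQ ae] show ?thesis unfolding \<sigma>_def by (simp only: real_scaleR_def)
  qed
  \<comment> \<open>the limit only charges matrices of trace one\<close>
  define T where "T = psd_mats \<inter> {X :: real^'d^'d. mat 1 \<bullet> X = 1}"
  have cT: "closed T" unfolding T_def by (intro closed_Int closed_psd_mats closed_Collect_eq continuous_intros)
  have Tne: "T \<noteq> {}"
  proof -
    let ?X = "(1 / real CARD('d)) *\<^sub>R (mat 1 :: real^'d^'d)"
    have "?X \<in> psd_mats" by (intro psd_scale) (auto simp: psd_mats_def sym_mats_def transpose_mat)
    moreover have "mat 1 \<bullet> ?X = 1" by (simp add: mat_1_inner trace_scale trace_I)
    ultimately have "?X \<in> T" unfolding T_def by blast
    then show ?thesis by blast
  qed
  have AE_Q: "AE s in Q. W \<noteq> 0 \<longrightarrow> A0 s \<in> T"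
  proof (cases "W = 0")
    case False
    define g where "g s = min 1 (infdist (A0 s) T)" for s
    have cg: "continuous_on UNIV g" unfolding g_def[abs_def] by (intro continuous_intros cA)
    have bg: "bounded (range g)" by (auto simp: bounded_iff g_def infdist_nonneg intro!: exI[of _ 1])
    have "S (r n) (\<lambda>p. g (sp p)) = S (r n) (\<lambda>p. 0)" for n
      by (rule Scong) (simp add: g_def sp T_def mat_1_inner)
    moreover have "S (r n) (\<lambda>p. 0) = 0" for n 
      unfolding S_def wsum_nth by simp
    ultimately have "W * (LINT s|Q. g s) = 0"
      using lim[OF cg bg] by (simp add: LIMSEQ_const_iff)
    then have "(LINT s|Q. g s) = 0" using False by simp
    moreover have "integrable Q g"
      by (rule Q.integrable_const_bound[of _ 1])
        (use borel_measurable_continuous_onI[OF cg] in \<open>auto simp: g_def infdist_nonneg measurable_cong_sets[OF Q.events_eq_borel refl]\<close>)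
    moreover have "AE s in Q. 0 \<le> g s" by (simp add: g_def infdist_nonneg)
    ultimately have "AE s in Q. g s = 0" using integral_nonneg_eq_0_iff_AE[of Q g] by blast
    then show ?thesis
      by eventually_elim (use in_closed_iff_infdist_zero[OF cT Tne] in \<open>auto simp: g_def min_def split: if_splits\<close>)
  qed auto
  have AE_\<sigma>: "AE s in \<sigma>. A s = A0 s \<and> A s \<in> psd_mats \<and> trace (A s) = 1"
  proof -
    have iQ: "(\<lambda>s. ennreal (W * indicator {s. norm (Z s) < 1} s)) \<in> borel_measurable Q"
      unfolding measurable_cong_sets[OF Q.events_eq_borel refl] using ind by measurable
    have "AE s in Q. 0 < ennreal (W * indicator {s. norm (Z s) < 1} s) \<longrightarrow> A0 s \<in> T"
      using AE_Q by eventually_elim auto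
    then have "AE s in \<sigma>. A0 s \<in> T" unfolding \<sigma>_def by (simp only: AE_density[OF iQ])
    then show ?thesis by eventually_elim (auto simp: A_def T_def mat_1_inner)
  qed
  \<comment> \<open>the equation passes to the limit\<close>
  define G where "G E s = ball_ext (\<lambda>y. (1/2) *\<^sub>R E y) (Z s) \<bullet> A0 s" for E :: "real^'d \<Rightarrow> real^'d^'d" and s
  have G: "continuous_on UNIV (G E)" "bounded (range (G E))" if dec: "decaying_test \<phi> D' E" for \<phi> D' E
  proof -
    show "continuous_on UNIV (G E)" unfolding G_def[abs_def]
      by (intro continuous_intros cA continuous_on_compose2[OF continuous_on_ball_ext_decaying(1)[OF dec] cZ]) auto
    have "c2b \<phi> D' E" using dec by (simp add: decaying_test_def)
    then obtain K where K: "0 \<le> K" "\<And>y. norm (E y) \<le> K" by (rule c2b_bound) (rule that)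
    have "norm (G E s) \<le> K * R" for s
    proof -
      have "norm (ball_ext (\<lambda>y. (1/2) *\<^sub>R E y) (Z s)) \<le> K"
        using K(1) K(2)[of "unball (Z s)"] by (simp add: ball_ext_def)
      then have "norm (ball_ext (\<lambda>y. (1/2) *\<^sub>R E y) (Z s)) * norm (A0 s) \<le> K * R"
        using nA[of s] K(1) by (intro mult_mono) auto
      then show ?thesis unfolding G_def real_norm_def using Cauchy_Schwarz_ineq2 order_trans by blast
    qed
    then show "bounded (range (G E))" by (auto simp: bounded_iff)
  qed
  have iQ: "integrable Q g" if cg: "continuous_on UNIV g" and bg: "bounded (range g)" for g :: "real \<Rightarrow> real"
  proof -
    obtain B where "\<And>s. norm (g s) \<le> B" using bg by (auto simp: bounded_iff)
    then show ?thesis using borel_measurable_continuous_onI[OF cg]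
      by (intro Q.integrable_const_bound[of _ B]) (auto simp: measurable_cong_sets[OF Q.events_eq_borel refl])
  qed
  have eq_n: "W * (LINT s|Q. G (D2 i) s) = \<tau> (\<psi> i)" for i
  proof -
    have "S (r n) (\<lambda>p. G (D2 i) (sp p)) = S (r n) (h i)" for n
      by (rule Scong) (simp add: G_def h_def sp ball_ext_toball)
    then have 1: "(\<lambda>n. S (r n) (h i)) \<longlonglongrightarrow> W * (LINT s|Q. G (D2 i) s)"
      using lim[OF G[OF dt[of i]]] by simp
    have "(\<lambda>n. (S (r n) (h i) - \<tau> (\<psi> i))\<^sup>2) \<longlonglongrightarrow> 0"
    proof (rule Lim_null_comparison)
      show "\<forall>\<^sub>F n in sequentially. norm ((S (r n) (h i) - \<tau> (\<psi> i))\<^sup>2) \<le> Bd * inverse (real n)"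
        unfolding eventually_sequentially
      proof (intro exI[of _ "Suc i"] allI impI)
        fix n assume n: "Suc i \<le> n"
        have ir: "i < r n" using n rn[of n] by simp
        have "(S (r n) (h i) - \<tau> (\<psi> i))\<^sup>2 \<le> (\<Sum>j<r n. (S (r n) (h j) - \<tau> (\<psi> j))\<^sup>2)"
          using ir by (intro member_le_sum[where f = "\<lambda>j. (S (r n) (h j) - \<tau> (\<psi> j))\<^sup>2"]) auto
        then have "real n * (S (r n) (h i) - \<tau> (\<psi> i))\<^sup>2 \<le> r n * (\<Sum>j<r n. (S (r n) (h j) - \<tau> (\<psi> j))\<^sup>2)"
          using rn[of n] by (intro mult_mono) auto
        also have "\<dots> \<le> Bd" by (rule SB(2))
        finally show "norm ((S (r n) (h i) - \<tau> (\<psi> i))\<^sup>2) \<le> Bd * inverse (real n)"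
          using n by (simp add: field_simps)
      qed
      show "(\<lambda>n. Bd * inverse (real n)) \<longlonglongrightarrow> 0"
        using tendsto_mult[OF tendsto_const[of Bd] lim_inverse_n] by simp
    qed
    from tendsto_real_sqrt[OF this] have "(\<lambda>n. S (r n) (h i) - \<tau> (\<psi> i)) \<longlonglongrightarrow> 0"
      by (simp add: tendsto_rabs_zero_iff)
    then have "(\<lambda>n. S (r n) (h i)) \<longlonglongrightarrow> \<tau> (\<psi> i)" by (simp add: LIM_zero_iff)
    with 1 show ?thesis by (rule LIMSEQ_unique)
  qed
  have P: "sets \<nu> = sets borel" "prob_space \<nu>" "integrable \<nu> (\<lambda>x. (norm x)\<^sup>2)" using P2_D[OF \<nu>] by auto
  interpret \<nu>: prob_space \<nu> by (rule P(2))
  have in1: "integrable \<nu> (\<lambda>y. 1 + norm y)"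
  proof (rule P2_integrable[OF \<nu>, of _ 2])
    fix y :: "real^'d"
    have "2 * norm y \<le> 1 + (norm y)\<^sup>2" using sum_squares_bound[of 1 "norm y"] by simp
    moreover have "\<bar>1 + norm y\<bar> = 1 + norm y" by simp
    ultimately show "\<bar>1 + norm y\<bar> \<le> 2 * (1 + (norm y)\<^sup>2)" using zero_le_power2[of "norm y"] by argo
  qed simp
  have eq_dec: "W * (LINT s|Q. G E s) = \<tau> \<phi>" if dec: "decaying_test \<phi> D' E" for \<phi> D' E
  proof -
    have c\<phi>: "c2b \<phi> D' E" using dec by (simp add: decaying_test_def)
    define C where "C = W + (LINT y|\<nu>. 1 + norm y) + (1 + norm x)"
    have Cp: "0 < C"
    proof -
      have "0 \<le> (LINT y|\<nu>. 1 + norm y)" by (rule integral_nonneg_AE) auto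
      then show ?thesis using W0 norm_ge_zero[of x] unfolding C_def by linarith
    qed
    have close: "\<bar>W * (LINT s|Q. G E s) - \<tau> \<phi>\<bar> \<le> \<epsilon> * C" if e: "0 < \<epsilon>" for \<epsilon>
    proof -
      have "(\<phi>, D', E) \<in> I" using dec by (simp add: I_def)
      from J(2)[OF this e] obtain n where n: "\<forall>u\<in>?K. \<bar>H (\<phi>, D', E) u - H (J n) u\<bar> \<le> \<epsilon>" by blast
      have g: "\<bar>G E s - G (D2 n) s\<bar> \<le> \<epsilon>" for s
      proof (cases "norm (Z s) < 1")
        case True
        then have "(Z s, A0 s, 0) \<in> ?K" using nA[of s] by auto
        from bspec[OF n this] show ?thesis by (simp add: H_def Jn G_def)
      qed (use e in \<open>simp add: G_def ball_ext_def\<close>)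
      have p: "\<bar>\<phi> y - \<psi> n y\<bar> \<le> \<epsilon> * (1 + norm y)" for y
      proof -
        have "(toball y, 0, 1) \<in> ?K" using toball_less[of y] R0 by auto
        from bspec[OF n this] have "\<bar>\<phi> y / (1 + norm y) - \<psi> n y / (1 + norm y)\<bar> \<le> \<epsilon>"
          by (simp add: H_def Jn ball_ext_toball)
        moreover have pos: "0 < 1 + norm y" by (simp add: add_pos_nonneg)
        ultimately show ?thesis
          by (simp add: diff_divide_distrib[symmetric] abs_divide pos_divide_le_eq)
      qed
      have 1: "\<bar>(LINT s|Q. G E s) - (LINT s|Q. G (D2 n) s)\<bar> \<le> \<epsilon>"
      proof -
        have i: "integrable Q (G E)" "integrable Q (G (D2 n))" using iQ[OF G[OF dec]] iQ[OF G[OF dt]] by auto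
        have "\<bar>LINT s|Q. G E s - G (D2 n) s\<bar> \<le> (LINT s|Q. \<bar>G E s - G (D2 n) s\<bar>)"
          using integral_norm_bound[of Q "\<lambda>s. G E s - G (D2 n) s"] by simp
        also have "\<dots> \<le> \<epsilon>" using i g by (intro Q.integral_le_const) auto
        finally show ?thesis using i by simp
      qed
      have 2: "\<bar>(LINT y|\<nu>. \<phi> y) - (LINT y|\<nu>. \<psi> n y)\<bar> \<le> \<epsilon> * (LINT y|\<nu>. 1 + norm y)"
      proof -
        have i: "integrable \<nu> \<phi>" "integrable \<nu> (\<psi> n)" using c2b_integrable[OF \<nu> c\<phi>] c2b_integrable[OF \<nu> cn] by auto
        have "\<bar>LINT y|\<nu>. \<phi> y - \<psi> n y\<bar> \<le> (LINT y|\<nu>. \<bar>\<phi> y - \<psi> n y\<bar>)"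
          using integral_norm_bound[of \<nu> "\<lambda>y. \<phi> y - \<psi> n y"] by simp
        also have "\<dots> \<le> (LINT y|\<nu>. \<epsilon> * (1 + norm y))"
          using i p in1 by (intro integral_mono integrable_abs Bochner_Integration.integrable_diff integrable_mult_right) auto
        finally show ?thesis using i by simp
      qed
      have 3: "\<bar>W * (LINT s|Q. G E s) - W * (LINT s|Q. G (D2 n) s)\<bar> \<le> \<epsilon> * W"
        using mult_left_mono[OF 1 W0] W0 by (simp add: right_diff_distrib[symmetric] abs_mult mult.commute)
      have "W * (LINT s|Q. G E s) - \<tau> \<phi> = (W * (LINT s|Q. G E s) - W * (LINT s|Q. G (D2 n) s))
          - ((LINT y|\<nu>. \<phi> y) - (LINT y|\<nu>. \<psi> n y)) + (\<phi> x - \<psi> n x)"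
        using eq_n[of n] by (simp add: \<tau>_def)
      also have "\<bar>\<dots>\<bar> \<le> \<epsilon> * W + \<epsilon> * (LINT y|\<nu>. 1 + norm y) + \<epsilon> * (1 + norm x)"
        by (intro order_trans[OF abs_triangle_ineq] order_trans[OF abs_triangle_ineq4] add_mono 2 3 p)
      finally show ?thesis by (simp add: C_def algebra_simps)
    qed
    have "\<bar>W * (LINT s|Q. G E s) - \<tau> \<phi>\<bar> \<le> 0"
    proof (rule ccontr)
      assume n: "\<not> ?thesis"
      define a where "a = \<bar>W * (LINT s|Q. G E s) - \<tau> \<phi>\<bar>"
      have a: "0 < a" using n by (simp add: a_def)
      have "a \<le> a / (2 * C) * C" unfolding a_def by (rule close) (use a Cp in \<open>simp add: a_def\<close>)
      then show False using a Cp by simp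
    qed
    then show ?thesis by simp
  qed
  have meas: "(\<lambda>s. ((1/2) *\<^sub>R E (Y s)) \<bullet> A s) \<in> borel_measurable borel" if "continuous_on UNIV E" for E
    using measurable_compose[OF Ym borel_measurable_continuous_onI[OF that]] Am by measurable
  have eq_dec': "(LINT s|\<sigma>. ((1/2) *\<^sub>R E (Y s)) \<bullet> A s) = \<tau> \<phi>" if dec: "decaying_test \<phi> D' E" for \<phi> D' E
  proof -
    have cE: "continuous_on UNIV E" using dec c2b_D(3) by (auto simp: decaying_test_def)
    have "(LINT s|\<sigma>. ((1/2) *\<^sub>R E (Y s)) \<bullet> A s) = (LINT s|Q. (W * indicator {s. norm (Z s) < 1} s) * (((1/2) *\<^sub>R E (Y s)) \<bullet> A s))"
      by (rule int\<sigma>[OF meas[OF cE]])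
    also have "\<dots> = (LINT s|Q. W * G E s)"
    proof (rule integral_cong_AE)
      show "AE s in Q. (W * indicator {s. norm (Z s) < 1} s) * (((1/2) *\<^sub>R E (Y s)) \<bullet> A s) = W * G E s"
        using AE_Q by eventually_elim (auto simp: G_def ball_ext_def Y_def A_def T_def indicator_def)
      show "(\<lambda>s. (W * indicator {s. norm (Z s) < 1} s) * (((1/2) *\<^sub>R E (Y s)) \<bullet> A s)) \<in> borel_measurable Q"
        using ind meas[OF cE] unfolding measurable_cong_sets[OF Q.events_eq_borel refl] by (rule borel_measurable_times)
      show "(\<lambda>s. W * G E s) \<in> borel_measurable Q"
        using borel_measurable_continuous_onI[OF G(1)[OF dec]] unfolding measurable_cong_sets[OF Q.events_eq_borel refl] by simp
    qed
    also have "\<dots> = \<tau> \<phi>" using eq_dec[OF dec] by simp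
    finally show ?thesis .
  qed
  have equation: "(LINT s|\<sigma>. ((1/2) *\<^sub>R E (Y s)) \<bullet> A s) = \<tau> \<phi>" if c\<phi>: "c2b \<phi> D' E" for \<phi> D' E
  proof -
    obtain \<phi>' D'' E' C where co: "\<And>n::nat. c2b (\<phi>' n) (D'' n) (E' n)" "\<And>n. bounded (range (\<phi>' n))" "\<And>n. ((E' n) \<longlongrightarrow> 0) at_infinity"
      and C: "0 \<le> C" "\<And>n x. norm (E' n x) \<le> C" "\<And>n x. \<bar>\<phi>' n x\<bar> \<le> C * (1 + (norm x)\<^sup>2)"
      and li: "\<And>x. (\<lambda>n. \<phi>' n x) \<longlonglongrightarrow> \<phi> x" "\<And>x. (\<lambda>n. E' n x) \<longlonglongrightarrow> E x"
      by (rule c2b_cutoff[OF c\<phi>]) blast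
    have dn: "decaying_test (\<phi>' n) (D'' n) (E' n)" for n using co by (simp add: decaying_test_def)
    have "(\<lambda>n. LINT y|\<nu>. \<phi>' n y) \<longlonglongrightarrow> (LINT y|\<nu>. \<phi> y)"
    proof (rule integral_dominated_convergence[where w = "\<lambda>x. C * (1 + (norm x)\<^sup>2)"])
      show "integrable \<nu> (\<lambda>x. C * (1 + (norm x)\<^sup>2))" using P(3) by auto
      show "\<phi> \<in> borel_measurable \<nu>" "\<And>n. \<phi>' n \<in> borel_measurable \<nu>"
        unfolding measurable_cong_sets[OF P(1) refl]
        using c2b_D(5)[OF c\<phi>] c2b_D(5)[OF co(1)] by (auto intro: borel_measurable_continuous_onI)
    qed (use C(3) li in auto)
    then have 1: "(\<lambda>n. \<tau> (\<phi>' n)) \<longlonglongrightarrow> \<tau> \<phi>" unfolding \<tau>_def by (intro tendsto_diff li)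
    have "(\<lambda>n. LINT s|\<sigma>. ((1/2) *\<^sub>R E' n (Y s)) \<bullet> A s) \<longlonglongrightarrow> (LINT s|\<sigma>. ((1/2) *\<^sub>R E (Y s)) \<bullet> A s)"
    proof (rule integral_dominated_convergence[where w = "\<lambda>s. C * R"])
      show "AE s in \<sigma>. (\<lambda>n. ((1/2) *\<^sub>R E' n (Y s)) \<bullet> A s) \<longlonglongrightarrow> ((1/2) *\<^sub>R E (Y s)) \<bullet> A s"
        by (intro AE_I2 tendsto_intros li)
      show "AE s in \<sigma>. norm (((1/2) *\<^sub>R E' n (Y s)) \<bullet> A s) \<le> C * R" for n
      proof (rule AE_I2)
        fix s
        have "norm ((1/2) *\<^sub>R E' n (Y s)) * norm (A s) \<le> C * R"
          using C(1) C(2)[of n "Y s"] AR[of s] by (intro mult_mono) auto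
        then show "norm (((1/2) *\<^sub>R E' n (Y s)) \<bullet> A s) \<le> C * R"
          unfolding real_norm_def using Cauchy_Schwarz_ineq2 order_trans by blast
      qed
      show "(\<lambda>s. ((1/2) *\<^sub>R E (Y s)) \<bullet> A s) \<in> borel_measurable \<sigma>"
        "\<And>n. (\<lambda>s. ((1/2) *\<^sub>R E' n (Y s)) \<bullet> A s) \<in> borel_measurable \<sigma>"
        unfolding measurable_cong_sets[OF ss refl] by (rule meas, rule c2b_D(3)[OF c\<phi>] c2b_D(3)[OF co(1)])+
    qed simp
    then show ?thesis using 1 unfolding eq_dec'[OF dn] by (rule LIMSEQ_unique)
  qed
  \<comment> \<open>testing with the square norm identifies the mass, hence no mass is lost\<close>
  have mass: "measure \<sigma> (space \<sigma>) = M"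
  proof -
    have "M = (LINT s|\<sigma>. ((1/2) *\<^sub>R (2 *\<^sub>R mat 1)) \<bullet> A s)"
      using equation[OF c2b_norm_square] by (simp add: M_def)
    also have "\<dots> = (LINT s|\<sigma>. 1)"
    proof (rule integral_cong_AE)
      show "(\<lambda>s. ((1/2) *\<^sub>R (2 *\<^sub>R mat 1)) \<bullet> A s) \<in> borel_measurable \<sigma>"
        unfolding measurable_cong_sets[OF ss refl] using Am by measurable
      show "AE s in \<sigma>. ((1/2) *\<^sub>R (2 *\<^sub>R mat 1)) \<bullet> A s = 1"
        using AE_\<sigma> by eventually_elim (auto simp: mat_1_inner)
    qed simp
    finally show ?thesis by simp
  qed
  have MW: "M \<le> W"
  proof -
    have "M = (LINT s|\<sigma>. 1)" using mass by simp
    also have "\<dots> = (LINT s|Q. W * indicator {s. norm (Z s) < 1} s)" by (subst int\<sigma>) auto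
    also have "\<dots> \<le> W"
    proof (rule Q.integral_le_const)
      show "integrable Q (\<lambda>s. W * indicator {s. norm (Z s) < 1} s)"
        using ind W0 by (intro Q.integrable_const_bound[of _ W]) (auto simp: indicator_def measurable_cong_sets[OF Q.events_eq_borel refl])
    qed (use W0 in \<open>auto simp: indicator_def\<close>)
    finally show ?thesis .
  qed
  obtain B :: "nat \<Rightarrow> real^'d^'d" where B0: "B 0 = 0" and Bm: "range B \<subseteq> minorants f"
    and B: "\<And>A. A \<in> psd_mats \<Longrightarrow> f A = (SUP i. ennreal (B i \<bullet> A))"
    by (rule minorants_sup[OF conv hom lsc dom]) blast
  define m where "m k s = Max ((\<lambda>i. B i \<bullet> A0 s) ` {..k})" for k s
  have m0: "0 \<le> m k s" for k s
  proof -
    have "B 0 \<bullet> A0 s \<le> m k s" unfolding m_def by (intro Max_ge) auto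
    then show ?thesis by (simp add: B0)
  qed
  have m_ex: "\<exists>i\<le>k. m k s = B i \<bullet> A0 s" for k s
  proof -
    have "m k s \<in> (\<lambda>i. B i \<bullet> A0 s) ` {..k}" unfolding m_def by (intro Max_in) auto
    then show ?thesis by auto
  qed
  have mc: "continuous_on UNIV (m k)" for k
  proof (induction k)
    case 0 show ?case unfolding m_def[abs_def] by (simp add: B0)
  next
    case (Suc k)
    have "m (Suc k) s = max (B (Suc k) \<bullet> A0 s) (m k s)" for s
      unfolding m_def atMost_Suc image_insert by (rule Max_insert) auto
    then have "m (Suc k) = (\<lambda>s. max (B (Suc k) \<bullet> A0 s) (m k s))" by auto
    then show ?case using Suc cA by (simp add: continuous_on_max continuous_on_inner)
  qed
  have mb: "bounded (range (m k))" for k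
  proof -
    have "norm (m k s) \<le> (\<Sum>i\<le>k. norm (B i)) * R" for s
    proof -
      obtain i where i: "i \<le> k" "m k s = B i \<bullet> A0 s" using m_ex by blast
      have "norm (m k s) \<le> norm (B i) * norm (A0 s)" unfolding i(2) real_norm_def by (rule Cauchy_Schwarz_ineq2)
      also have "\<dots> \<le> (\<Sum>i\<le>k. norm (B i)) * R"
        using i(1) nA[of s] by (intro mult_mono member_le_sum sum_nonneg) auto
      finally show ?thesis .
    qed
    then show ?thesis by (auto simp: bounded_iff)
  qed
  have m_lim: "W * (LINT s|Q. m k s) \<le> d + M - W" for k
  proof (rule LIMSEQ_le[OF lim[OF mc mb]])
    show "(\<lambda>n. d + M + (1 + \<bar>M\<bar>) * inverse (real (Suc (r n))) - S (r n) (\<lambda>_. 1)) \<longlonglongrightarrow> d + M - W"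
      using tendsto_diff[OF tendsto_add[OF tendsto_const[of "d + M"]
          tendsto_mult[OF tendsto_const[of "1 + \<bar>M\<bar>"] LIMSEQ_subseq_LIMSEQ[OF LIMSEQ_inverse_real_of_nat r]]] Wlim]
      by (simp add: comp_def)
    have "S (r n) (\<lambda>p. m k (sp p)) \<le> d + M + (1 + \<bar>M\<bar>) * inverse (real (Suc (r n))) - S (r n) (\<lambda>_. 1)" for n
    proof -
      have "S (r n) (\<lambda>p. m k (sp p)) \<le> S (r n) F"
        unfolding S_def
      proof (rule wsum_mono)
        fix p w assume pw: "(p, w) \<in> set (xs (r n))"
        obtain y A' where p: "p = (y, A')" by (cases p)
        have A': "A' \<in> psd_mats" "trace A' = 1" "0 \<le> w" using xs pw p by auto
        obtain i where i: "m k (sp p) = B i \<bullet> A'" using m_ex[of k "sp p"] sp(3)[OF A'(1,2)] p by auto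
        have "B i \<in> minorants f" using Bm by auto
        then have "ennreal (B i \<bullet> A') \<le> f A'" using psd_imp_sym[OF A'(1)] by (auto simp: minorants_def)
        moreover have "f A' < \<infinity>" using A'(1) dom by (auto simp: fin_dom_def)
        ultimately have "B i \<bullet> A' \<le> enn2real (f A')"
          by (cases "f A'") (auto simp: ennreal_le_iff2)
        then show "0 \<le> w \<and> m k (sp p) \<le> F p" using A'(3) i by (simp add: F_def p)
      qed
      then show ?thesis using Sbd[of "r n"] Q0[of "r n"] by (simp add: divide_inverse)
    qed
    then show "\<exists>N. \<forall>n\<ge>N. S (r n) (\<lambda>p. m k (sp p)) \<le> d + M + (1 + \<bar>M\<bar>) * inverse (real (Suc (r n))) - S (r n) (\<lambda>_. 1)"
      by blast
  qed
  have m\<sigma>: "(\<integral>\<^sup>+s. ennreal (m k s) \<partial>\<sigma>) \<le> ennreal d" for k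
  proof -
    obtain C where C: "\<And>s. norm (m k s) \<le> C" using mb[of k] by (auto simp: bounded_iff)
    have mm: "m k \<in> borel_measurable borel" by (rule borel_measurable_continuous_onI[OF mc])
    have "integrable \<sigma> (m k)"
      using C mm by (intro \<sigma>.integrable_const_bound[of _ C]) (auto simp: measurable_cong_sets[OF ss refl])
    then have "(\<integral>\<^sup>+s. ennreal (m k s) \<partial>\<sigma>) = ennreal (LINT s|\<sigma>. m k s)"
      by (rule nn_integral_eq_integral) (use m0 in auto)
    also have "(LINT s|\<sigma>. m k s) = (LINT s|Q. (W * indicator {s. norm (Z s) < 1} s) * m k s)" by (rule int\<sigma>[OF mm])
    also have "\<dots> \<le> (LINT s|Q. W * m k s)"
    proof (rule integral_mono)
      show "integrable Q (\<lambda>s. W * m k s)" using iQ[OF mc mb] by auto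
      show "integrable Q (\<lambda>s. (W * indicator {s. norm (Z s) < 1} s) * m k s)"
      proof (rule Bochner_Integration.integrable_bound[OF \<open>integrable Q (\<lambda>s. W * m k s)\<close>])
        show "(\<lambda>s. (W * indicator {s. norm (Z s) < 1} s) * m k s) \<in> borel_measurable Q"
          using ind mm unfolding measurable_cong_sets[OF Q.events_eq_borel refl] by (rule borel_measurable_times)
      qed (auto simp: indicator_def)
      show "(W * indicator {s. norm (Z s) < 1} s) * m k s \<le> W * m k s" for s
        using m0[of k s] W0 by (auto simp: indicator_def)
    qed
    also have "\<dots> \<le> d" using m_lim[of k] MW by simp
    finally show ?thesis by (simp add: ennreal_leI)
  qed
  have cost: "(\<integral>\<^sup>+s. f (A s) \<partial>\<sigma>) \<le> ennreal d"
  proof -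
    have "(\<integral>\<^sup>+s. f (A s) \<partial>\<sigma>) = (\<integral>\<^sup>+s. (SUP k. ennreal (m k s)) \<partial>\<sigma>)"
      using AE_\<sigma> by (intro nn_integral_cong_AE) (auto simp: B SUP_ennreal_Max[of "\<lambda>i. B i \<bullet> _"] m_def)
    also have "\<dots> = (SUP k. \<integral>\<^sup>+s. ennreal (m k s) \<partial>\<sigma>)"
    proof (rule nn_integral_monotone_convergence_SUP)
      show "incseq (\<lambda>k s. ennreal (m k s))"
        unfolding m_def by (intro incseq_SucI le_funI ennreal_leI Max_mono) auto
      show "(\<lambda>s. ennreal (m k s)) \<in> borel_measurable \<sigma>" for k
        unfolding measurable_cong_sets[OF ss refl] using borel_measurable_continuous_onI[OF mc[of k]] by measurable
    qed
    also have "\<dots> \<le> ennreal d" by (intro SUP_least m\<sigma>)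
    finally show ?thesis .
  qed
  show thesis
    by (rule that[OF fs ss Ym Am Apsd AR _ cost]) (use equation in \<open>simp add: \<tau>_def\<close>)
qed

section \<open>From a static solution to a solution of the Fokker-Planck equation\<close>

definition unit_time :: "real measure" where
  "unit_time = restrict_space lborel {0<..<1}"

lemma unit_time: "sets unit_time = sets (restrict_space borel {0<..<1})" "space unit_time = {0<..<1}" "prob_space unit_time"
proof -
  show s: "sets unit_time = sets (restrict_space borel {0<..<1})" "space unit_time = {0<..<1}"
    by (auto simp: unit_time_def space_restrict_space intro!: sets_restrict_space_cong)
  show "prob_space unit_time"
  proof
    show "emeasure unit_time (space unit_time) = 1"
      unfolding s(2) by (simp add: unit_time_def emeasure_restrict_space)
  qed
qed

lemma unit_time_integral: "(LINT t|unit_time. g t) = (LINT t:{0<..<1}|lborel. g t)"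
  for g :: "real \<Rightarrow> 'b::{banach, second_countable_topology}"
  unfolding unit_time_def set_lebesgue_integral_def by (subst integral_restrict_space) auto

lemma unit_time_nn_integral: "(\<integral>\<^sup>+t. g t \<partial>unit_time) = (\<integral>\<^sup>+t\<in>{0<..<1}. g t \<partial>lborel)"
  unfolding unit_time_def by (subst nn_integral_restrict_space) auto

lemma unit_time_ident: "(\<lambda>t. t) \<in> unit_time \<rightarrow>\<^sub>M borel"
  unfolding unit_time_def by (intro measurable_restrict_space1) simp

text \<open>
  The segment \<open>(1 - t) \<delta>\<^sub>x + t \<nu>\<close>.  As a Bernoulli choice between the two measures it inherits the
  calculus of the Giry monad.
\<close>

definition mixture :: "'a \<Rightarrow> ('a::topological_space) measure \<Rightarrow> real \<Rightarrow> 'a measure" where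
  "mixture x \<nu> t = measure_pmf (bernoulli_pmf t) \<bind> (\<lambda>b. if b then \<nu> else return borel x)"

text \<open>
  The segment \<open>(1 - t) \<delta>\<^sub>x + t \<nu>\<close>.  As a Bernoulli choice between the two measures it inherits the
  calculus of the Giry monad.
\<close>

lemma mixture:
  fixes \<nu> :: "(real^'d) measure"
  assumes \<nu>: "prob_space \<nu>" "sets \<nu> = sets borel" and t: "0 \<le> t" "t \<le> 1"
  shows "sets (mixture x \<nu> t) = sets borel" "prob_space (mixture x \<nu> t)"
    "g \<in> borel_measurable borel \<Longrightarrow> (\<integral>\<^sup>+y. g y \<partial>mixture x \<nu> t) = ennreal t * (\<integral>\<^sup>+y. g y \<partial>\<nu>) + ennreal (1 - t) * g x"
    "E \<in> sets borel \<Longrightarrow> emeasure (mixture x \<nu> t) E = ennreal t * emeasure \<nu> E + ennreal (1 - t) * indicator E x"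
    "\<phi> \<in> borel_measurable borel \<Longrightarrow> (\<And>y. \<bar>\<phi> y\<bar> \<le> C) \<Longrightarrow> (LINT y|mixture x \<nu> t. \<phi> y) = t * (LINT y|\<nu>. \<phi> y) + (1 - t) * \<phi> x"
proof -
  let ?M = "measure_pmf (bernoulli_pmf t)" and ?K = "\<lambda>b. if b then \<nu> else return borel x"
  have Kp: "prob_space (?K b)" "sets (?K b) = sets borel" for b
    using \<nu> by (auto intro: prob_space_return)
  then have K: "?K \<in> ?M \<rightarrow>\<^sub>M subprob_algebra borel"
    by (auto simp: space_subprob_algebra intro!: prob_space_imp_subprob_space)
  show s: "sets (mixture x \<nu> t) = sets borel"
    unfolding mixture_def by (rule sets_bind[where N = borel]) (use Kp in auto)
  show p: "prob_space (mixture x \<nu> t)"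
    unfolding mixture_def by (rule measure_pmf.prob_space_bind[OF _ K]) (use Kp(1) in auto)
  show n: "(\<integral>\<^sup>+y. g y \<partial>mixture x \<nu> t) = ennreal t * (\<integral>\<^sup>+y. g y \<partial>\<nu>) + ennreal (1 - t) * g x"
    if g: "g \<in> borel_measurable borel" for g
    unfolding mixture_def nn_integral_bind[OF g K]
    using t g by (subst nn_integral_bernoulli_pmf) (auto simp: nn_integral_return mult.commute)
  show "emeasure (mixture x \<nu> t) E = ennreal t * emeasure \<nu> E + ennreal (1 - t) * indicator E x"
    if "E \<in> sets borel" for E
    using n[of "indicator E"] that s \<nu>(2) by simp
  show "(LINT y|mixture x \<nu> t. \<phi> y) = t * (LINT y|\<nu>. \<phi> y) + (1 - t) * \<phi> x"
    if \<phi>: "\<phi> \<in> borel_measurable borel" "\<And>y. \<bar>\<phi> y\<bar> \<le> C" for \<phi> C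
  proof -
    interpret m: prob_space "mixture x \<nu> t" by (rule p)
    interpret \<nu>: prob_space \<nu> by (rule \<nu>(1))
    have C: "0 \<le> C" using \<phi>(2)[of x] by linarith
    have i1: "integrable (mixture x \<nu> t) g" and i2: "integrable \<nu> g"
      if "g \<in> borel_measurable borel" "\<And>y. \<bar>g y\<bar> \<le> 2 * C" for g
      using that by (auto intro!: m.integrable_const_bound[of _ "2 * C"] \<nu>.integrable_const_bound[of _ "2 * C"]
          simp: measurable_cong_sets[OF s refl] measurable_cong_sets[OF \<nu>(2) refl])
    let ?g = "\<lambda>y. \<phi> y + C"
    have g: "?g \<in> borel_measurable borel" "0 \<le> ?g y" "\<bar>?g y\<bar> \<le> 2 * C" for y
      using \<phi>(1) \<phi>(2)[of y] by (auto simp: abs_le_iff)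
    have "ennreal (LINT y|mixture x \<nu> t. ?g y) = (\<integral>\<^sup>+y. ennreal (?g y) \<partial>mixture x \<nu> t)"
      by (rule nn_integral_eq_integral[symmetric]) (use i1[OF g(1,3)] g(2) in auto)
    also have "\<dots> = ennreal t * (\<integral>\<^sup>+y. ennreal (?g y) \<partial>\<nu>) + ennreal (1 - t) * ennreal (?g x)"
      by (rule n) (use g(1) in measurable)
    also have "(\<integral>\<^sup>+y. ennreal (?g y) \<partial>\<nu>) = ennreal (LINT y|\<nu>. ?g y)"
      by (rule nn_integral_eq_integral) (use i2[OF g(1,3)] g(2) in auto)
    also have "ennreal t * ennreal (LINT y|\<nu>. ?g y) + ennreal (1 - t) * ennreal (?g x) = ennreal (t * (LINT y|\<nu>. ?g y) + (1 - t) * ?g x)"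
      using t g(2) by (simp add: ennreal_mult[symmetric] integral_nonneg_AE ennreal_plus[symmetric] del: ennreal_plus)
    finally have "(LINT y|mixture x \<nu> t. ?g y) = t * (LINT y|\<nu>. ?g y) + (1 - t) * ?g x"
      using t g(2) by (simp add: ennreal_inj integral_nonneg_AE add_nonneg_nonneg del: ennreal_plus)
    moreover have b2: "\<bar>\<phi> y\<bar> \<le> 2 * C" for y using \<phi>(2)[of y] C by linarith
    have "integrable (mixture x \<nu> t) \<phi>" "integrable \<nu> \<phi>"
      by (rule i1[OF \<phi>(1) b2], rule i2[OF \<phi>(1) b2])
    then have "(LINT y|mixture x \<nu> t. ?g y) = (LINT y|mixture x \<nu> t. \<phi> y) + C" "(LINT y|\<nu>. ?g y) = (LINT y|\<nu>. \<phi> y) + C"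
      by (simp_all add: m.prob_space \<nu>.prob_space)
    ultimately show ?thesis by (simp add: algebra_simps)
  qed
qed

lemma mixture_ends:
  fixes \<nu> :: "(real^'d) measure"
  assumes "prob_space \<nu>" "sets \<nu> = sets borel"
  shows "mixture x \<nu> 0 = return borel x" "mixture x \<nu> 1 = \<nu>"
proof -
  note m0 = mixture[OF assms, where t = 0 and x = x] and m1 = mixture[OF assms, where t = 1 and x = x]
  show "mixture x \<nu> 0 = return borel x"
    by (rule measure_eqI) (use m0(1,4) in auto)
  show "mixture x \<nu> 1 = \<nu>"
    by (rule measure_eqI) (use m1(1,4) assms in auto)
qed

lemma psd_measures_cong:
  assumes "\<And>E. E \<in> sets M \<Longrightarrow> V E = V' E" "V' \<in> psd_measures M"
  shows "V \<in> psd_measures M"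
proof -
  have "(\<Union>i. A i) \<in> sets M" if "range A \<subseteq> sets M" for A :: "nat \<Rightarrow> _" using that by auto
  then show ?thesis using assms by (simp add: psd_measures_def image_subset_iff)
qed

lemma test_function_slice:
  assumes "test_function \<phi> pt D2" "0 < t" "t < 1"
  obtains D where "c2b (\<phi> t) D (D2 t)"
proof -
  from assms(1) obtain D where D: "\<forall>t\<in>{0<..<1}. \<forall>x.
        ((\<lambda>s. \<phi> s x) has_real_derivative pt t x) (at t) \<and>
        (\<phi> t has_derivative (\<lambda>h. D t x \<bullet> h)) (at x) \<and>
        (D t has_derivative (\<lambda>h. D2 t x *v h)) (at x)"
    and c: "continuous_on ({0<..<1} \<times> UNIV) (\<lambda>(t, x). D2 t x)"
    and b: "bounded ((\<lambda>(t, x). D2 t x) ` ({0<..<1} \<times> UNIV))"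
    unfolding test_function_def by blast
  have "continuous_on UNIV (\<lambda>x. (\<lambda>(t, x). D2 t x) (t, x))"
    by (rule continuous_on_compose2[OF c]) (use assms(2,3) in \<open>auto intro!: continuous_intros\<close>)
  moreover have "bounded (range (D2 t))"
    using b by (rule bounded_subset) (use assms(2,3) in force)
  ultimately have "c2b (\<phi> t) (D t) (D2 t)"
    using D assms(2,3) by (simp add: c2b_def)
  then show thesis by (rule that)
qed

text \<open>
  The support condition gives, for each \<open>y\<close> separately, a neighbourhood of the end times where the test
  function vanishes.  Hence integration by parts in time has no boundary terms, and the bound on the
  time derivative also bounds the function.
\<close>

lemma test_function_time:
  fixes \<phi> :: "real \<Rightarrow> real^'d \<Rightarrow> real"
  assumes tf: "test_function \<phi> pt D2"
  obtains C where "0 \<le> C" "\<And>t y. 0 < t \<Longrightarrow> t < 1 \<Longrightarrow> \<bar>pt t y\<bar> \<le> C" "\<And>t y. 0 < t \<Longrightarrow> t < 1 \<Longrightarrow> \<bar>\<phi> t y\<bar> \<le> C"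
    "\<And>\<alpha> \<beta> y. (LINT t|unit_time. \<beta> * \<phi> t y + (\<alpha> + \<beta> * t) * pt t y) = 0"
    "(\<lambda>(t, y). pt t y) \<in> borel_measurable (unit_time \<Otimes>\<^sub>M borel)"
    "(\<lambda>(t, y). \<phi> t y) \<in> borel_measurable (unit_time \<Otimes>\<^sub>M borel)"
proof -
  from tf have d: "\<And>t x. 0 < t \<Longrightarrow> t < 1 \<Longrightarrow> ((\<lambda>s. \<phi> s x) has_real_derivative pt t x) (at t)"
    and c\<phi>: "continuous_on ({0<..<1} \<times> UNIV) (\<lambda>(t, x). \<phi> t x)"
    and cpt: "continuous_on ({0<..<1} \<times> UNIV) (\<lambda>(t, x). pt t x)"
    and b: "bounded ((\<lambda>(t, x). pt t x) ` ({0<..<1} \<times> UNIV))"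
    and cl: "closure {(t, x). t \<in> {0<..<1} \<and> \<phi> t x \<noteq> 0} \<subseteq> {0<..<1} \<times> UNIV"
    unfolding test_function_def by auto
  obtain C where C: "\<forall>z\<in>(\<lambda>(t, x). pt t x) ` ({0<..<1} \<times> UNIV). norm z \<le> C"
    using b unfolding bounded_iff by blast
  have bpt: "\<bar>pt t y\<bar> \<le> C" if "0 < t" "t < 1" for t y
    using bspec[OF C, of "pt t y"] that by force
  have C0: "0 \<le> C" using bpt[of "1/2" 0] by simp
  let ?S = "closure {(t, x). t \<in> {0<..<1} \<and> \<phi> t x \<noteq> 0}"
  have cs: "closed {t. (t, y) \<in> ?S}" for y
  proof -
    have "closed ((\<lambda>t. (t, y)) -` ?S)"
      by (rule continuous_closed_vimage) (auto intro!: continuous_intros)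
    then show ?thesis by (simp add: vimage_def)
  qed
  have vanish: "\<exists>\<delta>. 0 < \<delta> \<and> \<delta> < 1/2 \<and> (\<forall>t. 0 < t \<longrightarrow> t < 1 \<longrightarrow> t \<le> \<delta> \<or> 1 - \<delta> \<le> t \<longrightarrow> \<phi> t y = 0 \<and> pt t y = 0)" for y
  proof -
    have o: "open (- {t. (t, y) \<in> ?S})" using cs by (rule open_Compl)
    have "0 \<in> - {t. (t, y) \<in> ?S}" "1 \<in> - {t. (t, y) \<in> ?S}" using cl by auto
    then obtain e0 e1 where e: "0 < e0" "ball 0 e0 \<subseteq> - {t. (t, y) \<in> ?S}" "0 < e1" "ball 1 e1 \<subseteq> - {t. (t, y) \<in> ?S}"
      using o by (meson open_contains_ball)
    define \<delta> where "\<delta> = min (1/4) (min e0 e1 / 2)"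
    have \<delta>: "0 < \<delta>" "\<delta> < 1/2" "\<delta> < e0" "\<delta> < e1" using e(1,3) by (auto simp: \<delta>_def min_def)
    have z: "\<phi> t y = 0" if "0 < t" "t < 1" "(t, y) \<notin> ?S" for t
      using that closure_subset[of "{(t, x). t \<in> {0<..<1} \<and> \<phi> t x \<noteq> 0}"] by auto
    have "\<phi> t y = 0 \<and> pt t y = 0" if t: "0 < t" "t < 1" "t \<le> \<delta> \<or> 1 - \<delta> \<le> t" for t
    proof -
      have "t \<in> ball 0 e0 \<or> t \<in> ball 1 e1" using t \<delta> by (auto simp: dist_real_def)
      then have tS: "(t, y) \<notin> ?S" using e(2,4) by auto
      let ?U = "{0<..<1} \<inter> - {t. (t, y) \<in> ?S}"
      have "((\<lambda>s. 0) has_real_derivative 0) (at t)" by simp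
      then have "((\<lambda>s. \<phi> s y) has_real_derivative 0) (at t)"
      proof (rule has_field_derivative_transform_within_open)
        show "open ?U" using o by (intro open_Int) auto
      qed (use t tS z in auto)
      then show ?thesis using DERIV_unique[OF d[OF t(1,2)]] z[OF t(1,2) tS] by auto
    qed
    then show ?thesis using \<delta> by blast
  qed
  have b\<phi>: "\<bar>\<phi> t y\<bar> \<le> C" if t: "0 < t" "t < 1" for t y
  proof -
    obtain \<delta> where \<delta>: "0 < \<delta>" "\<delta> < 1/2" "\<forall>t. 0 < t \<longrightarrow> t < 1 \<longrightarrow> t \<le> \<delta> \<or> 1 - \<delta> \<le> t \<longrightarrow> \<phi> t y = 0 \<and> pt t y = 0"
      using vanish by blast
    show ?thesis
    proof (cases "t \<le> \<delta>")
      case True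
      then show ?thesis using \<delta>(3) t C0 by auto
    next
      case False
      then have "\<delta> < t" by simp
      have "\<exists>z>\<delta>. z < t \<and> \<phi> t y - \<phi> \<delta> y = (t - \<delta>) * pt z y"
        by (rule MVT2[OF \<open>\<delta> < t\<close>]) (use d \<delta>(1) t in auto)
      then obtain z where z: "\<delta> < z" "z < t" "\<phi> t y - \<phi> \<delta> y = (t - \<delta>) * pt z y" by blast
      have "\<phi> \<delta> y = 0" using \<delta> by auto
      then have "\<bar>\<phi> t y\<bar> = (t - \<delta>) * \<bar>pt z y\<bar>" using z \<open>\<delta> < t\<close> by (simp add: abs_mult)
      also have "\<dots> \<le> 1 * C" using bpt[of z y] z t \<delta>(1) by (intro mult_mono) auto
      finally show ?thesis by simp
    qed
  qed
  have ibp: "(LINT t|unit_time. \<beta> * \<phi> t y + (\<alpha> + \<beta> * t) * pt t y) = 0" for \<alpha> \<beta> y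
  proof -
    obtain \<delta> where \<delta>: "0 < \<delta>" "\<delta> < 1/2" "\<And>t. 0 < t \<Longrightarrow> t < 1 \<Longrightarrow> t \<le> \<delta> \<or> 1 - \<delta> \<le> t \<Longrightarrow> \<phi> t y = 0 \<and> pt t y = 0"
      using vanish by blast
    let ?f = "\<lambda>t. \<beta> * \<phi> t y + (\<alpha> + \<beta> * t) * pt t y" and ?F = "\<lambda>t. (\<alpha> + \<beta> * t) * \<phi> t y"
    have sl: "continuous_on {\<delta>..1 - \<delta>} (\<lambda>t. \<phi> t y)" "continuous_on {\<delta>..1 - \<delta>} (\<lambda>t. pt t y)"
    proof -
      have "continuous_on {\<delta>..1 - \<delta>} (\<lambda>t. (\<lambda>(t, x). \<phi> t x) (t, y))" "continuous_on {\<delta>..1 - \<delta>} (\<lambda>t. (\<lambda>(t, x). pt t x) (t, y))"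
        by (rule continuous_on_compose2[OF c\<phi>] continuous_on_compose2[OF cpt]; use \<delta>(1,2) in \<open>auto intro!: continuous_intros\<close>)+
      then show "continuous_on {\<delta>..1 - \<delta>} (\<lambda>t. \<phi> t y)" "continuous_on {\<delta>..1 - \<delta>} (\<lambda>t. pt t y)" by simp_all
    qed
    have "(LINT t|unit_time. ?f t) = (LINT t|lborel. indicator {\<delta>..1 - \<delta>} t *\<^sub>R ?f t)"
      unfolding unit_time_integral set_lebesgue_integral_def
    proof (intro Bochner_Integration.integral_cong refl)
      fix t :: real
      show "indicator {0<..<1} t *\<^sub>R ?f t = indicator {\<delta>..1 - \<delta>} t *\<^sub>R ?f t"
        using \<delta>(3)[of t] \<delta>(1,2) by (auto simp: indicator_def)
    qed
    also have "\<dots> = ?F (1 - \<delta>) - ?F \<delta>"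
    proof (rule integral_FTC_atLeastAtMost)
      fix t assume t: "\<delta> \<le> t" "t \<le> 1 - \<delta>"
      have dt: "((\<lambda>s. \<phi> s y) has_real_derivative pt t y) (at t)" by (rule d) (use t \<delta>(1) in auto)
      have "(?F has_real_derivative ?f t) (at t)"
        by (rule derivative_eq_intros dt refl)+ (simp add: algebra_simps)
      then show "(?F has_vector_derivative ?f t) (at t within {\<delta>..1 - \<delta>})"
        by (auto simp: has_real_derivative_iff_has_vector_derivative intro: has_vector_derivative_at_within)
    qed (use \<delta> sl in \<open>auto intro!: continuous_intros\<close>)
    also have "\<dots> = 0" using \<delta> by simp
    finally show ?thesis .
  qed
  have meas: "(\<lambda>(t, y). u t y) \<in> borel_measurable (unit_time \<Otimes>\<^sub>M borel)"
    if u: "continuous_on ({0<..<1} \<times> UNIV) (\<lambda>(t, y). u t y)" for u :: "real \<Rightarrow> real^'d \<Rightarrow> real"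
  proof -
    have "{0<..<1::real} \<times> (UNIV :: (real^'d) set) \<in> sets borel"
      by (intro borel_open open_Times) auto
    then have 1: "(\<lambda>z. indicator ({0<..<1} \<times> UNIV) z *\<^sub>R (\<lambda>(t, y). u t y) z) \<in> borel_measurable borel"
      using u by (rule borel_measurable_continuous_on_indicator)
    have 2: "(\<lambda>z. z) \<in> unit_time \<Otimes>\<^sub>M (borel :: (real^'d) measure) \<rightarrow>\<^sub>M borel"
      unfolding borel_prod[symmetric]
      by (subst measurable_pair_iff) (auto intro!: measurable_compose[OF measurable_fst unit_time_ident] simp: comp_def)
    have 3: "(\<lambda>z. indicator ({0<..<1} \<times> UNIV) z *\<^sub>R (\<lambda>(t, y). u t y) z) \<in> borel_measurable (unit_time \<Otimes>\<^sub>M borel)"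
      by (rule measurable_compose[OF 2 1])
    show ?thesis
      by (rule measurable_cong[THEN iffD1, OF _ 3]) (auto simp: space_pair_measure unit_time(2))
  qed
  show thesis by (rule that[OF C0 bpt b\<phi> ibp meas[OF cpt] meas[OF c\<phi>]])
qed

text \<open>
  The measure moves along the segment from \<open>\<delta>\<^sub>x\<close> to \<open>\<nu>\<close> while the matrix measure stays constant in time.
  The weak equation reduces to an integration by parts in time, since \<open>\<integral>\<psi> d(r t)\<close> is affine in \<open>t\<close> with
  slope \<open>\<integral>\<psi> d\<nu> - \<psi> x\<close>.
\<close>

lemma G_cost_le_static:
  fixes f :: "real^'d^'d \<Rightarrow> ennreal" and \<sigma> :: "real measure"
  assumes conv: "convex_fun f" and hom: "pos_1_homogeneous f" and lsc: "lower_semicont f"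
    and dom: "fin_dom f = psd_mats" and \<nu>: "\<nu> \<in> P2"
    and \<sigma>: "finite_measure \<sigma>" "sets \<sigma> = sets borel"
    and Y: "Y \<in> borel_measurable borel" and A: "A \<in> borel_measurable borel" "\<And>s. A s \<in> psd_mats" "\<And>s. norm (A s) \<le> B"
    and eq: "\<And>\<psi> D D2. c2b \<psi> D D2 \<Longrightarrow> (LINT s|\<sigma>. ((1/2) *\<^sub>R D2 (Y s)) \<bullet> A s) = (LINT y|\<nu>. \<psi> y) - \<psi> x"
  shows "G_cost f x \<nu> \<le> (\<integral>\<^sup>+s. f (A s) \<partial>\<sigma>)"
proof -
  interpret \<sigma>: finite_measure \<sigma> by (rule \<sigma>(1))
  note P = P2_D[OF \<nu>]
  interpret \<nu>: prob_space \<nu> by (rule P(2))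
  interpret L: prob_space unit_time by (rule unit_time(3))
  have sp\<sigma>: "space \<sigma> = UNIV" using sets_eq_imp_space_eq[OF \<sigma>(2)] by simp
  have Y\<sigma>: "Y \<in> \<sigma> \<rightarrow>\<^sub>M borel" and A\<sigma>: "A \<in> borel_measurable \<sigma>"
    using Y A(1) by (simp_all cong: measurable_cong_sets add: measurable_cong_sets[OF \<sigma>(2) refl])
  have iA: "integrable \<sigma> A" by (rule \<sigma>.integrable_const_bound[of _ B]) (use A(3) A\<sigma> in auto)
  define V where "V E = (LINT s:(Y -` E \<inter> space \<sigma>)|\<sigma>. A s)" for E
  have Vpsd: "V \<in> psd_measures borel"
    unfolding V_def[abs_def] by (rule psd_measure_of_density[OF Y\<sigma> iA A(2)])
  define r where "r = mixture x \<nu>"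
  note mix = mixture[OF P(2,1), where x = x, folded r_def]
  have r_meas: "r \<in> restrict_space borel {0<..<1} \<rightarrow>\<^sub>M prob_algebra borel"
  proof (rule measurable_prob_algebra_generated[where \<Omega> = UNIV and G = "sets borel"])
    show "sets borel = sigma_sets UNIV (sets borel)" using sets.sigma_sets_eq[of borel] by (metis space_borel)
    show "(\<lambda>t. emeasure (r t) E) \<in> borel_measurable (restrict_space borel {0<..<1})" if "E \<in> sets borel" for E
    proof -
      have "(\<lambda>t. ennreal t * emeasure \<nu> E + ennreal (1 - t) * indicator E x) \<in> borel_measurable (restrict_space borel {0<..<1})"
        by (intro measurable_restrict_space1) measurable
      then show ?thesis
        by (rule measurable_cong[THEN iffD1, rotated]) (use mix(4) that in \<open>auto simp: space_restrict_space\<close>)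
    qed
  qed (use mix(1,2) in \<open>auto simp: space_restrict_space Int_stable_def\<close>)
  have r_unit: "r \<in> unit_time \<rightarrow>\<^sub>M prob_algebra borel"
    using r_meas by (simp cong: measurable_cong_sets add: measurable_cong_sets[OF unit_time(1) refl])
  have into_cyl: "g \<in> N \<rightarrow>\<^sub>M cyl" if "(\<lambda>z. fst (g z)) \<in> N \<rightarrow>\<^sub>M unit_time" "(\<lambda>z. snd (g z)) \<in> N \<rightarrow>\<^sub>M borel" for g and N :: "'n measure"
    unfolding cyl_def
  proof (rule measurable_restrict_space2)
    show "g \<in> space N \<rightarrow> {0<..<1} \<times> UNIV"
    proof
      fix z assume "z \<in> space N"
      then have "fst (g z) \<in> {0<..<1}" using measurable_space[OF that(1)] by (simp add: unit_time(2))
      then show "g z \<in> {0<..<1} \<times> UNIV" by (simp add: mem_Times_iff)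
    qed
    show "g \<in> borel_measurable N"
      unfolding borel_prod[symmetric] measurable_pair_iff comp_def
      using measurable_compose[OF that(1) unit_time_ident] that(2) by simp
  qed
  define k where "k t = distr (r t) cyl (Pair t)" for t
  have k: "k \<in> unit_time \<rightarrow>\<^sub>M prob_algebra cyl"
    unfolding k_def by (rule measurable_distr_prob_space2[OF r_unit]) (auto intro!: into_cyl simp: case_prod_beta)
  have PairM: "Pair t \<in> r t \<rightarrow>\<^sub>M cyl" if "0 < t" "t < 1" for t
  proof (rule into_cyl)
    have s: "sets (r t) = sets borel" using mix(1)[of t] that by simp
    show "(\<lambda>y. fst (t, y)) \<in> r t \<rightarrow>\<^sub>M unit_time" using that by (simp add: unit_time(2))
    show "(\<lambda>y. snd (t, y)) \<in> r t \<rightarrow>\<^sub>M borel" unfolding measurable_cong_sets[OF s refl] by simp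
  qed
  define \<rho> where "\<rho> = unit_time \<bind> k"
  have kS: "k \<in> unit_time \<rightarrow>\<^sub>M subprob_algebra cyl" by (rule measurable_prob_algebraD[OF k])
  have \<rho>_sets: "sets \<rho> = sets cyl"
    unfolding \<rho>_def by (rule sets_bind[where N = cyl]) (auto simp: k_def unit_time(2))
  have \<rho>_em: "emeasure \<rho> E = (\<integral>\<^sup>+ t\<in>{0<..<1}. emeasure (r t) (Pair t -` E) \<partial>lborel)" if E: "E \<in> sets cyl" for E
  proof -
    have "emeasure \<rho> E = (\<integral>\<^sup>+t. emeasure (k t) E \<partial>unit_time)"
      unfolding \<rho>_def by (rule emeasure_bind[OF _ kS E]) (simp add: unit_time(2))
    also have "\<dots> = (\<integral>\<^sup>+t. emeasure (r t) (Pair t -` E) \<partial>unit_time)"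
    proof (intro nn_integral_cong)
      fix t assume "t \<in> space unit_time"
      then have t: "0 < t" "t < 1" by (auto simp: unit_time(2))
      have "space (r t) = UNIV" using mix(1)[of t] t sets_eq_imp_space_eq[of "r t" borel] by simp
      then show "emeasure (k t) E = emeasure (r t) (Pair t -` E)"
        unfolding k_def using emeasure_distr[OF PairM[OF t] E] by simp
    qed
    finally show ?thesis by (simp add: unit_time_nn_integral)
  qed
  have \<rho>_P2: "\<rho> \<in> P2_cyl"
    unfolding P2_cyl_def
  proof (intro CollectI conjI)
    show "prob_space \<rho>" unfolding \<rho>_def
      by (rule L.prob_space_bind[OF _ kS]) (use measurable_space[OF k] in \<open>auto simp: space_prob_algebra\<close>)
    have sm: "(\<lambda>z :: real \<times> (real^'d). ennreal ((norm (snd z))\<^sup>2)) \<in> borel_measurable cyl"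
      unfolding cyl_def
      by (intro measurable_restrict_space1 measurable_compose[OF _ measurable_ennreal] borel_measurable_continuous_onI)
        (auto intro!: continuous_intros)
    have nm: "(\<lambda>y :: real^'d. ennreal ((norm y)\<^sup>2)) \<in> borel_measurable borel" by measurable
    have "(\<integral>\<^sup>+ z. ennreal ((norm (snd z))\<^sup>2) \<partial>\<rho>) = (\<integral>\<^sup>+t. \<integral>\<^sup>+z. ennreal ((norm (snd z))\<^sup>2) \<partial>k t \<partial>unit_time)"
      unfolding \<rho>_def by (rule nn_integral_bind[OF sm kS])
    also have "\<dots> \<le> (\<integral>\<^sup>+t. (\<integral>\<^sup>+y. ennreal ((norm y)\<^sup>2) \<partial>\<nu>) + ennreal ((norm x)\<^sup>2) \<partial>unit_time)"
    proof (intro nn_integral_mono)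
      fix t assume "t \<in> space unit_time"
      then have t: "0 < t" "t < 1" by (auto simp: unit_time(2))
      have "(\<integral>\<^sup>+z. ennreal ((norm (snd z))\<^sup>2) \<partial>k t) = (\<integral>\<^sup>+y. ennreal ((norm y)\<^sup>2) \<partial>r t)"
        unfolding k_def by (subst nn_integral_distr[OF PairM[OF t]]) (use sm in simp_all)
      also have "\<dots> = ennreal t * (\<integral>\<^sup>+y. ennreal ((norm y)\<^sup>2) \<partial>\<nu>) + ennreal (1 - t) * ennreal ((norm x)\<^sup>2)"
        by (rule mix(3)) (use t nm in auto)
      also have "\<dots> \<le> 1 * (\<integral>\<^sup>+y. ennreal ((norm y)\<^sup>2) \<partial>\<nu>) + 1 * ennreal ((norm x)\<^sup>2)"
        using t by (intro add_mono mult_right_mono) auto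
      finally show "(\<integral>\<^sup>+z. ennreal ((norm (snd z))\<^sup>2) \<partial>k t) \<le> (\<integral>\<^sup>+y. ennreal ((norm y)\<^sup>2) \<partial>\<nu>) + ennreal ((norm x)\<^sup>2)"
        by simp
    qed
    also have "\<dots> < \<infinity>" using \<nu> L.emeasure_space_1 by (simp add: P2_def)
    finally show "(\<integral>\<^sup>+ z. ennreal ((norm (snd z))\<^sup>2) \<partial>\<rho>) < \<infinity>" .
  qed (rule \<rho>_sets)
  define \<Lambda> where "\<Lambda> E = (LINT t:{0<..<1}|lborel. V (Pair t -` E))" for E :: "(real \<times> (real^'d)) set"
  interpret LS: pair_sigma_finite unit_time \<sigma> ..
  have \<Lambda>psd: "\<Lambda> \<in> psd_measures cyl"
  proof (rule psd_measures_cong)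
    let ?N = "unit_time \<Otimes>\<^sub>M \<sigma>" and ?Y = "\<lambda>z. (fst z, Y (snd z))"
    have Yc: "?Y \<in> ?N \<rightarrow>\<^sub>M cyl" by (rule into_cyl) (use measurable_compose[OF measurable_snd Y\<sigma>] in auto)
    interpret N: finite_measure ?N by (rule finite_measure_pair_measure; rule L.finite_measure_axioms \<sigma>(1))
    have Am: "(\<lambda>z. A (snd z)) \<in> borel_measurable ?N" by (rule measurable_compose[OF measurable_snd A\<sigma>])
    have iAN: "integrable ?N (\<lambda>z. A (snd z))" by (rule N.integrable_const_bound[of _ B]) (use A(3) Am in auto)
    show "(\<lambda>E. LINT z:(?Y -` E \<inter> space ?N)|?N. A (snd z)) \<in> psd_measures cyl"
      by (rule psd_measure_of_density[OF Yc iAN A(2)])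
    fix E :: "(real \<times> (real^'d)) set" assume E: "E \<in> sets cyl"
    have E': "?Y -` E \<inter> space ?N \<in> sets ?N" by (rule measurable_sets[OF Yc E])
    have "(LINT z:(?Y -` E \<inter> space ?N)|?N. A (snd z)) = (LINT t|unit_time. LINT s|\<sigma>. indicator (?Y -` E \<inter> space ?N) (t, s) *\<^sub>R A (snd (t, s)))"
      unfolding set_lebesgue_integral_def
      by (rule LS.integral_fst'[symmetric]) (rule integrable_mult_indicator[OF E' iAN])
    also have "\<dots> = (LINT t|unit_time. V (Pair t -` E))"
      unfolding V_def set_lebesgue_integral_def
      by (intro Bochner_Integration.integral_cong refl) (auto simp: space_pair_measure sp\<sigma> unit_time(2) indicator_def)
    finally show "\<Lambda> E = (LINT z:(?Y -` E \<inter> space ?N)|?N. A (snd z))"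
      by (simp add: \<Lambda>_def unit_time_integral)
  qed
  have tv: "emeasure (tot_var borel V) UNIV < \<infinity>"
  proof -
    interpret T: finite_measure "tot_var borel V" by (rule finite_tot_var[OF Vpsd])
    show ?thesis unfolding infinity_ennreal_def less_top[symmetric] by (rule T.emeasure_finite)
  qed
  have c1: "(\<integral>\<^sup>+ t::real\<in>{0<..<1}. c \<partial>lborel) = c" for c :: ennreal
  proof -
    have "(\<integral>\<^sup>+ t::real\<in>{0<..<1}. c \<partial>lborel) = (\<integral>\<^sup>+ t. c \<partial>unit_time)" by (rule unit_time_nn_integral[symmetric])
    then show ?thesis using L.emeasure_space_1 by simp
  qed
  have fp: "fokker_planck \<rho> \<Lambda> r (\<lambda>_. V)"
    unfolding fokker_planck_def
  proof (intro conjI allI impI)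
    show "\<rho> \<in> P2_cyl" "\<Lambda> \<in> psd_measures cyl" by (rule \<rho>_P2, rule \<Lambda>psd)
    show "time_disint \<rho> r" unfolding time_disint_def using r_meas \<rho>_em by blast
    show "time_disint_mat \<Lambda> (\<lambda>_. V)" unfolding time_disint_mat_def using Vpsd by (auto simp: \<Lambda>_def)
    show "(\<integral>\<^sup>+ t::real\<in>{0<..<1}. emeasure (tot_var borel V) UNIV \<partial>lborel) < \<infinity>" by (rule le_less_trans[OF eq_refl[OF c1] tv])
    fix \<phi> pt and D2 :: "real \<Rightarrow> real^'d \<Rightarrow> real^'d^'d" assume tf: "test_function \<phi> pt D2"
    obtain C where C: "0 \<le> C" "\<And>t y. 0 < t \<Longrightarrow> t < 1 \<Longrightarrow> \<bar>pt t y\<bar> \<le> C" "\<And>t y. 0 < t \<Longrightarrow> t < 1 \<Longrightarrow> \<bar>\<phi> t y\<bar> \<le> C"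
      and ibp: "\<And>\<alpha> \<beta> y. (LINT t|unit_time. \<beta> * \<phi> t y + (\<alpha> + \<beta> * t) * pt t y) = 0"
      and m: "(\<lambda>(t, y). pt t y) \<in> borel_measurable (unit_time \<Otimes>\<^sub>M borel)"
        "(\<lambda>(t, y). \<phi> t y) \<in> borel_measurable (unit_time \<Otimes>\<^sub>M borel)"
      by (rule test_function_time[OF tf]) (rule that)
    have mt: "pt t \<in> borel_measurable borel" "\<phi> t \<in> borel_measurable borel" if "0 < t" "t < 1" for t
      using measurable_Pair2[OF m(1), of t] measurable_Pair2[OF m(2), of t] that by (auto simp: unit_time(2))
    have my: "(\<lambda>t. pt t y) \<in> borel_measurable unit_time" "(\<lambda>t. \<phi> t y) \<in> borel_measurable unit_time" for y
      using measurable_Pair1[OF m(1), of y] measurable_Pair1[OF m(2), of y] by auto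
    have lhs: "(LINT y|r t. pt t y) = t * (LINT y|\<nu>. pt t y) + (1 - t) * pt t x" if "0 < t" "t < 1" for t
      by (rule mix(5)[OF _ _ mt(1)[OF that] C(2)[OF that]]) (use that in auto)
    have rhs: "mat_integral borel (\<lambda>y. (1/2) *\<^sub>R D2 t y) V = (LINT y|\<nu>. \<phi> t y) - \<phi> t x" if t: "0 < t" "t < 1" for t
    proof -
      obtain D where c: "c2b (\<phi> t) D (D2 t)" by (rule test_function_slice[OF tf t]) (rule that)
      obtain K where K: "0 \<le> K" "\<And>y. norm (D2 t y) \<le> K" by (rule c2b_bound[OF c]) (rule that)
      have "mat_integral borel (\<lambda>y. (1/2) *\<^sub>R D2 t y) V = (LINT s|\<sigma>. ((1/2) *\<^sub>R D2 t (Y s)) \<bullet> A s)"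
        by (rule mat_integral_eq[OF Vpsd Y\<sigma> iA, where C = "K / 2"])
          (use borel_measurable_continuous_onI[OF c2b_D(3)[OF c]] K in \<open>auto simp: V_def\<close>)
      then show ?thesis using eq[OF c] by simp
    qed
    interpret LN: pair_sigma_finite unit_time \<nu> ..
    interpret LNf: finite_measure "unit_time \<Otimes>\<^sub>M \<nu>" by (rule finite_measure_pair_measure; rule L.finite_measure_axioms \<nu>.finite_measure_axioms)
    have mN: "(\<lambda>(t, y). pt t y) \<in> borel_measurable (unit_time \<Otimes>\<^sub>M \<nu>)"
        "(\<lambda>(t, y). \<phi> t y) \<in> borel_measurable (unit_time \<Otimes>\<^sub>M \<nu>)"
      using m measurable_cong_sets[OF sets_pair_measure_cong[OF refl P(1)] refl] by blast+
    have tm: "(\<lambda>z. fst z) \<in> borel_measurable (unit_time \<Otimes>\<^sub>M \<nu>)" by (rule measurable_compose[OF measurable_fst unit_time_ident])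
    have iN: "integrable (unit_time \<Otimes>\<^sub>M \<nu>) (\<lambda>(t, y). \<phi> t y + t * pt t y)"
    proof (rule LNf.integrable_const_bound[of _ "2 * C"])
      show "AE z in unit_time \<Otimes>\<^sub>M \<nu>. norm (case z of (t, y) \<Rightarrow> \<phi> t y + t * pt t y) \<le> 2 * C"
      proof (rule AE_I2, clarify)
        fix t y assume "(t, y) \<in> space (unit_time \<Otimes>\<^sub>M \<nu>)"
        then have t: "0 < t" "t < 1" by (auto simp: space_pair_measure unit_time(2))
        have "\<bar>t * pt t y\<bar> \<le> 1 * C" unfolding abs_mult using t C(1,2) by (intro mult_mono) auto
        then show "norm (\<phi> t y + t * pt t y) \<le> 2 * C" using C(3)[OF t, of y] by (simp add: abs_le_iff)
      qed
      show "(\<lambda>(t, y). \<phi> t y + t * pt t y) \<in> borel_measurable (unit_time \<Otimes>\<^sub>M \<nu>)"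
        using borel_measurable_add[OF mN(2) borel_measurable_times[OF tm mN(1)]] by (simp add: case_prod_beta)
    qed
    have i\<nu>: "integrable \<nu> (pt t)" "integrable \<nu> (\<phi> t)" if t: "0 < t" "t < 1" for t
      using mt[OF t] C(2,3)[OF t] by (auto intro!: \<nu>.integrable_const_bound[of _ C] simp: measurable_cong_sets[OF P(1) refl])
    have iL: "integrable unit_time (\<lambda>t. (1 - t) * pt t x)" "integrable unit_time (\<lambda>t. \<phi> t x)"
    proof -
      have "\<bar>(1 - t) * pt t x\<bar> \<le> 1 * C" if "0 < t" "t < 1" for t
        unfolding abs_mult using that C(1,2) by (intro mult_mono) auto
      then show "integrable unit_time (\<lambda>t. (1 - t) * pt t x)"
        using my(1)[of x] unit_time_ident by (intro L.integrable_const_bound[of _ C] AE_I2) (auto simp: unit_time(2))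
      show "integrable unit_time (\<lambda>t. \<phi> t x)"
        using my(2)[of x] C(3) by (intro L.integrable_const_bound[of _ C] AE_I2) (auto simp: unit_time(2))
    qed
    have e1: "(LINT t|unit_time. (LINT y|\<nu>. \<phi> t y + t * pt t y)) = 0"
    proof -
      have "(LINT t|unit_time. (LINT y|\<nu>. \<phi> t y + t * pt t y)) = (LINT y|\<nu>. (LINT t|unit_time. \<phi> t y + t * pt t y))"
        by (rule LN.Fubini_integral[symmetric]) (rule iN)
      also have "\<dots> = 0" using ibp[of 1 _ 0] by simp
      finally show ?thesis .
    qed
    have e2: "(LINT t|unit_time. (1 - t) * pt t x - \<phi> t x) = 0"
      using ibp[of "-1" x 1] by (simp add: algebra_simps)
    have i1: "integrable unit_time (\<lambda>t. LINT y|\<nu>. \<phi> t y + t * pt t y)"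
      using LN.integrable_fst'[OF iN] by simp
    have "(LINT t|unit_time. (LINT y|r t. pt t y) + mat_integral borel (\<lambda>y. (1/2) *\<^sub>R D2 t y) V)
        = (LINT t|unit_time. (LINT y|\<nu>. \<phi> t y + t * pt t y) + ((1 - t) * pt t x - \<phi> t x))"
      by (intro Bochner_Integration.integral_cong refl) (auto simp: unit_time(2) lhs rhs i\<nu>)
    also have "\<dots> = 0" using i1 iL e1 e2 by simp
    finally have sum0: "(LINT t|unit_time. (LINT y|r t. pt t y) + mat_integral borel (\<lambda>y. (1/2) *\<^sub>R D2 t y) V) = 0" .
    have im: "integrable unit_time (\<lambda>t. mat_integral borel (\<lambda>y. (1/2) *\<^sub>R D2 t y) V)"
    proof -
      have "integrable unit_time (\<lambda>t. (LINT y|\<nu>. \<phi> t y))"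
      proof (rule L.integrable_const_bound[of _ C])
        show "(\<lambda>t. LINT y|\<nu>. \<phi> t y) \<in> borel_measurable unit_time"
          using \<nu>.borel_measurable_lebesgue_integral[OF mN(2)] by simp
        show "AE t in unit_time. norm (LINT y|\<nu>. \<phi> t y) \<le> C"
        proof (rule AE_I2)
          fix t assume "t \<in> space unit_time"
          then have t: "0 < t" "t < 1" by (auto simp: unit_time(2))
          have "norm (LINT y|\<nu>. \<phi> t y) \<le> (LINT y|\<nu>. norm (\<phi> t y))" by (rule integral_norm_bound)
          also have "\<dots> \<le> C" using i\<nu>(2)[OF t] C(3)[OF t] by (intro \<nu>.integral_le_const) auto
          finally show "norm (LINT y|\<nu>. \<phi> t y) \<le> C" .
        qed
      qed
      from Bochner_Integration.integrable_diff[OF this iL(2)] show ?thesis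
        by (rule Bochner_Integration.integrable_cong[THEN iffD1, rotated -1]) (auto simp: unit_time(2) rhs)
    qed
    have ir: "integrable unit_time (\<lambda>t. LINT y|r t. pt t y)"
    proof -
      have "integrable unit_time (\<lambda>t. ((LINT y|\<nu>. \<phi> t y + t * pt t y) + ((1 - t) * pt t x - \<phi> t x)) - mat_integral borel (\<lambda>y. (1/2) *\<^sub>R D2 t y) V)"
        using i1 iL im by (intro Bochner_Integration.integrable_diff Bochner_Integration.integrable_add)
      then show ?thesis
        by (rule Bochner_Integration.integrable_cong[THEN iffD1, rotated -1]) (auto simp: unit_time(2) lhs rhs i\<nu>)
    qed
    show "(LINT t:{0<..<1}|lborel. (LINT y|r t. pt t y)) =
        - (LINT t:{0<..<1}|lborel. mat_integral borel (\<lambda>x. (1/2) *\<^sub>R D2 t x) V)"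
      using sum0 ir im by (simp add: unit_time_integral[symmetric])
  qed
  have nc: "narrowly_continuous r"
    unfolding narrowly_continuous_def
  proof (intro allI impI)
    fix g :: "real^'d \<Rightarrow> real" assume g: "continuous_on UNIV g" "bounded (range g)"
    obtain C where C: "\<And>y. \<bar>g y\<bar> \<le> C" using g(2) by (auto simp: bounded_iff)
    have "continuous_on {0..1} (\<lambda>t. t * (LINT y|\<nu>. g y) + (1 - t) * g x)" by (intro continuous_intros)
    moreover have "(LINT y|r t. g y) = t * (LINT y|\<nu>. g y) + (1 - t) * g x" if "t \<in> {0..1}" for t
      by (rule mix(5)[OF _ _ borel_measurable_continuous_onI[OF g(1)] C]) (use that in auto)
    ultimately show "continuous_on {0..1} (\<lambda>t. LINT y|r t. g y)"
      using continuous_on_cong[of "{0..1}" "{0..1}" "\<lambda>t. LINT y|r t. g y" "\<lambda>t. t * (LINT y|\<nu>. g y) + (1 - t) * g x"] by simp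
  qed
  have rP: "r t \<in> P2" if "t \<in> {0..1}" for t
  proof -
    have t: "0 \<le> t" "t \<le> 1" using that by auto
    have "(\<integral>\<^sup>+y. ennreal ((norm y)\<^sup>2) \<partial>r t) = ennreal t * (\<integral>\<^sup>+y. ennreal ((norm y)\<^sup>2) \<partial>\<nu>) + ennreal (1 - t) * ennreal ((norm x)\<^sup>2)"
      by (rule mix(3)[OF t]) measurable
    also have "\<dots> < \<infinity>" using \<nu> by (auto simp: P2_def ennreal_mult_less_top)
    finally show ?thesis unfolding P2_def using mix(1,2)[OF t] by blast
  qed
  have r01: "r 0 = return borel x" "r 1 = \<nu>" unfolding r_def by (rule mixture_ends[OF P(2,1)])+
  have "G_cost f x \<nu> \<le> (\<integral>\<^sup>+ t::real\<in>{0<..<1}. (\<integral>\<^sup>+ y. f (polar_density borel V y) \<partial>tot_var borel V) \<partial>lborel)"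
    unfolding G_cost_def F_cost_def
    by (rule INF_lower2[of "(\<rho>, \<Lambda>, r, \<lambda>_. V)"]) (use fp nc rP r01 in auto)
  also have "\<dots> = (\<integral>\<^sup>+ y. f (polar_density borel V y) \<partial>tot_var borel V)" by (rule c1)
  also have "\<dots> \<le> (\<integral>\<^sup>+s. f (A s) \<partial>\<sigma>)"
    by (rule polar_integral_le[OF conv hom lsc dom Vpsd Y\<sigma> iA A(2)]) (simp add: V_def)
  finally show ?thesis .
qed

text \<open>
  Only a finite dual value requires a competitor, and the static minimiser provides it.
\<close>

theorem G_cost_eq_dual_cost:
  fixes f :: "real^'d^'d \<Rightarrow> ennreal"
  assumes conv: "convex_fun f" and hom: "pos_1_homogeneous f" and lsc: "lower_semicont f"
    and dom: "fin_dom f = psd_mats" and p: "p \<in> P2"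
  shows "G_cost f x p = dual_cost f x p"
proof (rule antisym)
  show "dual_cost f x p \<le> G_cost f x p" by (rule dual_cost_le_G_cost)
  show "G_cost f x p \<le> dual_cost f x p"
  proof (cases "dual_cost f x p")
    case (real d)
    obtain \<sigma> :: "real measure" and Y A B where \<sigma>: "finite_measure \<sigma>" "sets \<sigma> = sets borel"
      and YA: "Y \<in> borel_measurable borel" "A \<in> borel_measurable borel" "\<And>s. A s \<in> psd_mats" "\<And>s. norm (A s) \<le> B"
      and eq: "\<And>\<psi> D D2. c2b \<psi> D D2 \<Longrightarrow> (LINT s|\<sigma>. ((1/2) *\<^sub>R D2 (Y s)) \<bullet> A s) = (LINT y|p. \<psi> y) - \<psi> x"
      and cost: "(\<integral>\<^sup>+s. f (A s) \<partial>\<sigma>) \<le> ennreal d"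
      by (rule static_minimiser[OF conv hom lsc dom p real(2,1)]) blast
    have "G_cost f x p \<le> (\<integral>\<^sup>+s. f (A s) \<partial>\<sigma>)"
      by (rule G_cost_le_static[OF conv hom lsc dom p \<sigma> YA eq])
    then show ?thesis using cost real(2) by simp
  qed simp
qed

section \<open>Gluing kernels\<close>

lemma ennreal_add_le: "ennreal (a + b) \<le> ennreal a + ennreal b"
proof (cases "0 \<le> a \<and> 0 \<le> b")
  case False
  then have "ennreal (a + b) \<le> ennreal a \<or> ennreal (a + b) \<le> ennreal b"
    using ennreal_leI[of "a + b" a] ennreal_leI[of "a + b" b] by linarith
  then show ?thesis by (auto intro: order_trans add_increasing add_increasing2)
qed (simp add: ennreal_plus)

lemma kernel_P2:
  fixes K :: "'a \<Rightarrow> (real^'d) measure"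
  assumes K: "K \<in> M \<rightarrow>\<^sub>M prob_algebra borel"
  shows "(\<lambda>y. \<integral>\<^sup>+z. ennreal ((norm z)\<^sup>2) \<partial>K y) \<in> borel_measurable M"
    "y \<in> space M \<Longrightarrow> K y \<in> P2 \<longleftrightarrow> (\<integral>\<^sup>+z. ennreal ((norm z)\<^sup>2) \<partial>K y) \<noteq> \<infinity>"
    "Measurable.pred M (\<lambda>y. K y \<in> P2)"
proof -
  show m: "(\<lambda>y. \<integral>\<^sup>+z. ennreal ((norm z)\<^sup>2) \<partial>K y) \<in> borel_measurable M"
    by (rule measurable_compose[OF measurable_prob_algebraD[OF K] nn_integral_measurable_subprob_algebra]) measurable
  show iff: "K y \<in> P2 \<longleftrightarrow> (\<integral>\<^sup>+z. ennreal ((norm z)\<^sup>2) \<partial>K y) \<noteq> \<infinity>" if "y \<in> space M" for y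
    using measurable_space[OF K that] by (auto simp: P2_def space_prob_algebra less_top)
  have "Measurable.pred M (\<lambda>y. (\<integral>\<^sup>+z. ennreal ((norm z)\<^sup>2) \<partial>K y) \<noteq> \<infinity>)" using m by measurable
  then show "Measurable.pred M (\<lambda>y. K y \<in> P2)" by (rule measurable_cong[THEN iffD2, rotated]) (rule iff)
qed

lemma bind_P2_AE:
  fixes K :: "'a \<Rightarrow> (real^'d) measure"
  assumes K: "K \<in> M \<rightarrow>\<^sub>M prob_algebra borel" and P: "M \<bind> K \<in> P2"
  shows "AE y in M. K y \<in> P2"
proof -
  have nm: "(\<lambda>y :: real^'d. ennreal ((norm y)\<^sup>2)) \<in> borel_measurable borel" by measurable
  have "(\<integral>\<^sup>+y. \<integral>\<^sup>+z. ennreal ((norm z)\<^sup>2) \<partial>K y \<partial>M) \<noteq> \<infinity>"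
    using P nn_integral_bind[OF nm measurable_prob_algebraD[OF K]] by (auto simp: P2_def)
  from nn_integral_PInf_AE[OF kernel_P2(1)[OF K] this] AE_space show ?thesis
    by eventually_elim (simp add: kernel_P2(2)[OF K])
qed

text \<open>
  For nonnegative functions this is the defining property of the composed measure.  A function of quadratic
  growth becomes nonnegative by adding a multiple of \<open>1 + |z|\<^sup>2\<close>, whose integral against almost every kernel
  value is finite.
\<close>

lemma bind_integral:
  fixes K :: "'a \<Rightarrow> (real^'d) measure" and g :: "real^'d \<Rightarrow> real"
  assumes K: "K \<in> M \<rightarrow>\<^sub>M prob_algebra borel" and P: "M \<bind> K \<in> P2"
    and g: "g \<in> borel_measurable borel" "\<And>z. \<bar>g z\<bar> \<le> C * (1 + (norm z)\<^sup>2)"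
  shows "integrable M (\<lambda>y. LINT z|K y. g z)"
    "(LINT z|(M \<bind> K). g z) = (LINT y|M. LINT z|K y. g z)"
proof -
  note Ks = measurable_prob_algebraD[OF K] and ae = bind_P2_AE[OF K P]
  have meas: "(\<lambda>y. LINT z|K y. h z) \<in> borel_measurable M" if "h \<in> borel_measurable borel" for h :: "real^'d \<Rightarrow> real"
    by (rule measurable_compose[OF Ks integral_measurable_subprob_algebra[OF that]])
  have nonneg: "has_bochner_integral M (\<lambda>y. LINT z|K y. h z) (LINT z|(M \<bind> K). h z)"
    if h: "h \<in> borel_measurable borel" "\<And>z. 0 \<le> h z" "\<And>z. \<bar>h z\<bar> \<le> B * (1 + (norm z)\<^sup>2)" for h :: "real^'d \<Rightarrow> real" and B
  proof (rule has_bochner_integral_nn_integral)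
    have "AE y in M. ennreal (LINT z|K y. h z) = (\<integral>\<^sup>+z. ennreal (h z) \<partial>K y)"
      using ae by eventually_elim (auto intro!: nn_integral_eq_integral[symmetric] P2_integrable[OF _ h(1,3)] h(2))
    then have "(\<integral>\<^sup>+y. ennreal (LINT z|K y. h z) \<partial>M) = (\<integral>\<^sup>+y. \<integral>\<^sup>+z. ennreal (h z) \<partial>K y \<partial>M)"
      by (rule nn_integral_cong_AE)
    also have "\<dots> = (\<integral>\<^sup>+z. ennreal (h z) \<partial>(M \<bind> K))"
      by (rule nn_integral_bind[OF _ Ks, symmetric]) (use h(1) in measurable)
    also have "\<dots> = ennreal (LINT z|(M \<bind> K). h z)"
      by (rule nn_integral_eq_integral[OF P2_integrable[OF P h(1,3)]]) (use h(2) in auto)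
    finally show "(\<integral>\<^sup>+y. ennreal (LINT z|K y. h z) \<partial>M) = ennreal (LINT z|(M \<bind> K). h z)" .
  qed (use h meas[OF h(1)] in \<open>auto intro!: integral_nonneg_AE\<close>)
  have C: "0 \<le> C" using g(2)[of 0] by simp
  let ?q = "\<lambda>z :: real^'d. C * (1 + (norm z)\<^sup>2)"
  have q: "?q \<in> borel_measurable borel" "0 \<le> ?q z" "\<bar>?q z\<bar> \<le> C * (1 + (norm z)\<^sup>2)" for z using C by auto
  have lo: "0 \<le> g z + ?q z" "g z \<le> ?q z" for z using g(2)[of z] unfolding abs_le_iff by linarith+
  have h: "(\<lambda>z. g z + ?q z) \<in> borel_measurable borel" "0 \<le> g z + ?q z" "\<bar>g z + ?q z\<bar> \<le> (2 * C) * (1 + (norm z)\<^sup>2)" for z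
  proof -
    show "\<bar>g z + ?q z\<bar> \<le> (2 * C) * (1 + (norm z)\<^sup>2)"
      unfolding abs_of_nonneg[OF lo(1)] mult.assoc using lo(2)[of z] by linarith
  qed (use g(1) q(1) lo(1) in auto)
  note H = has_bochner_integral_diff[OF nonneg[OF h] nonneg[OF q]]
  have split: "(LINT z|\<kappa>. g z) = (LINT z|\<kappa>. g z + ?q z) - (LINT z|\<kappa>. ?q z)" if "\<kappa> \<in> P2" for \<kappa>
    using P2_integrable[OF that h(1,3)] P2_integrable[OF that q(1,3)] by (subst Bochner_Integration.integral_diff[symmetric]) auto
  have e: "AE y in M. (LINT z|K y. g z + ?q z) - (LINT z|K y. ?q z) = (LINT z|K y. g z)"
    using ae by eventually_elim (rule split[symmetric])
  have d: "(\<lambda>y. (LINT z|K y. g z + ?q z) - (LINT z|K y. ?q z)) \<in> borel_measurable M"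
    using meas[OF h(1)] meas[OF q(1)] by (rule borel_measurable_diff)
  show "integrable M (\<lambda>y. LINT z|K y. g z)"
    using integrable_cong_AE[OF d meas[OF g(1)] e] H by (auto dest: has_bochner_integral_iff[THEN iffD1])
  show "(LINT z|(M \<bind> K). g z) = (LINT y|M. LINT z|K y. g z)"
    unfolding split[OF P] integral_cong_AE[OF d meas[OF g(1)] e, symmetric]
    by (rule has_bochner_integral_integral_eq[OF H, symmetric])
qed

lemma dual_cost_upper: "dual_fn f \<psi> \<Longrightarrow> ennreal ((LINT y|p. \<psi> y) - \<psi> x) \<le> dual_cost f x p"
  unfolding dual_cost_def by (rule SUP_upper) simp

text \<open>
  For a single dual function, \<open>\<integral>\<psi> d\<nu> - \<psi> x\<close> telescopes into \<open>\<integral>\<psi> dp - \<psi> x\<close> and the integral over \<open>y\<close> of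
  \<open>\<integral>\<psi> d(K y) - \<psi> y\<close>.  The measure \<open>M\<close> is \<open>p\<close> or a completion of it.
\<close>

lemma dual_cost_gluing:
  fixes K :: "real^'d \<Rightarrow> (real^'d) measure"
  assumes id: "(\<lambda>y. y) \<in> M \<rightarrow>\<^sub>M borel" and p: "distr M borel (\<lambda>y. y) = p" "p \<in> P2"
    and K: "K \<in> M \<rightarrow>\<^sub>M prob_algebra borel" and \<nu>: "M \<bind> K \<in> P2"
  shows "dual_cost f x (M \<bind> K) \<le> dual_cost f x p + (\<integral>\<^sup>+y. dual_cost f y (K y) \<partial>M)"
  unfolding dual_cost_def[of f x "M \<bind> K"]
proof (rule SUP_least)
  fix \<psi> assume "\<psi> \<in> {\<psi>. dual_fn f \<psi>}"
  then have dual: "dual_fn f \<psi>" by simp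
  then obtain D D2 where c: "c2b \<psi> D D2" unfolding dual_fn_def by blast
  obtain C where C: "\<And>x. \<bar>\<psi> x\<bar> \<le> C * (1 + (norm x)\<^sup>2)" by (rule c2b_growth[OF c]) (rule that)
  have b: "\<psi> \<in> borel_measurable borel" by (rule borel_measurable_continuous_onI[OF c2b_D(5)[OF c]])
  note B = bind_integral[OF K \<nu> b C]
  have iM: "integrable M \<psi>" "(LINT y|M. \<psi> y) = (LINT y|p. \<psi> y)"
    using integral_distr[OF id b] integrable_distr_eq[OF id b] p c2b_integrable[OF p(2) c] by auto
  have "(LINT z|(M \<bind> K). \<psi> z) - \<psi> x = ((LINT y|p. \<psi> y) - \<psi> x) + (LINT y|M. (LINT z|K y. \<psi> z) - \<psi> y)"
    using B iM by simp
  then have "ennreal ((LINT z|(M \<bind> K). \<psi> z) - \<psi> x)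
      \<le> ennreal ((LINT y|p. \<psi> y) - \<psi> x) + ennreal (LINT y|M. (LINT z|K y. \<psi> z) - \<psi> y)"
    by (simp only: ennreal_add_le)
  also have "\<dots> \<le> dual_cost f x p + (\<integral>\<^sup>+y. ennreal ((LINT z|K y. \<psi> z) - \<psi> y) \<partial>M)"
    by (intro add_mono dual_cost_upper dual ennreal_integral_le_nn_integral)
  also have "\<dots> \<le> dual_cost f x p + (\<integral>\<^sup>+y. dual_cost f y (K y) \<partial>M)"
    by (intro add_mono order_refl nn_integral_mono dual_cost_upper dual)
  finally show "ennreal ((LINT z|(M \<bind> K). \<psi> z) - \<psi> x) \<le> dual_cost f x p + (\<integral>\<^sup>+y. dual_cost f y (K y) \<partial>M)" .
qed

section \<open>Countably many dual functions suffice\<close>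

text \<open>
  On functions bounded by \<open>m (1 + |y|\<^sup>2)\<close>, locally uniform convergence implies convergence of the integrals
  against every measure in \<open>P2\<close>.  So a family that is dense for uniform convergence on balls, for each \<open>m\<close>,
  realises all suprema at once.  This is what makes the cost of a kernel measurable in its base point.
\<close>

lemma countable_dual_family:
  fixes f :: "real^'d^'d \<Rightarrow> ennreal"
  obtains \<Psi> :: "nat \<Rightarrow> real^'d \<Rightarrow> real" where "\<And>n. dual_fn f (\<Psi> n)"
    "\<And>x p. p \<in> P2 \<Longrightarrow> dual_cost f x p = (SUP n. ennreal ((LINT y|p. \<Psi> n y) - \<Psi> n x))"
proof -
  define I where "I m = {\<psi> :: real^'d \<Rightarrow> real. dual_fn f \<psi> \<and> (\<forall>y. \<bar>\<psi> y\<bar> \<le> real m * (1 + (norm y)\<^sup>2))}" for m :: nat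
  have zero: "(\<lambda>_. 0) \<in> I m" for m
    unfolding I_def dual_fn_def minorants_def by (auto intro!: exI[of _ "\<lambda>x. 0"] c2b_const)
  have cont: "continuous_on A \<psi>" if "dual_fn f \<psi>" for \<psi> A
  proof -
    from that obtain D D2 where "c2b \<psi> D D2" unfolding dual_fn_def by blast
    from c2b_D(5)[OF this] show ?thesis by (rule continuous_on_subset) simp
  qed
  define Q where "Q mn J \<longleftrightarrow> range J \<subseteq> I (fst mn) \<and>
      (\<forall>\<psi>\<in>I (fst mn). \<forall>\<epsilon>>0. \<exists>k. \<forall>x\<in>cball 0 (real (snd mn)). \<bar>\<psi> x - J k x\<bar> \<le> \<epsilon>)"
    for mn :: "nat \<times> nat" and J :: "nat \<Rightarrow> real^'d \<Rightarrow> real"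
  have "\<exists>J. Q mn J" for mn
  proof (rule uniformly_dense_sequence[where F = "\<lambda>\<psi>. \<psi>" and I = "I (fst mn)", OF compact_cball[of "0 :: real^'d" "real (snd mn)"] _ zero])
    show "continuous_on (cball 0 (real (snd mn))) \<psi>" if "\<psi> \<in> I (fst mn)" for \<psi> using that by (simp add: I_def cont)
    fix J :: "nat \<Rightarrow> real^'d \<Rightarrow> real" assume J: "range J \<subseteq> I (fst mn)"
      "\<And>\<psi> \<epsilon>. \<psi> \<in> I (fst mn) \<Longrightarrow> 0 < \<epsilon> \<Longrightarrow> \<exists>k. \<forall>x\<in>cball 0 (real (snd mn)). \<bar>\<psi> x - J k x\<bar> \<le> \<epsilon>"
    show ?thesis unfolding Q_def by (rule exI[of _ J], intro conjI ballI allI impI J)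
  qed
  then have "\<forall>mn. \<exists>J. Q mn J" ..
  from choice[OF this] obtain J where "\<forall>mn. Q mn (J mn)" ..
  then have QJ: "Q mn (J mn)" for mn ..
  note J = QJ[unfolded Q_def, THEN conjunct1] QJ[unfolded Q_def, THEN conjunct2]
  define \<Psi> where "\<Psi> i = (case from_nat i of (mn, k) \<Rightarrow> J mn k)" for i
  have \<Psi>: "\<Psi> (to_nat (mn, k)) = J mn k" for mn k by (simp add: \<Psi>_def)
  have dual: "dual_fn f (\<Psi> n)" for n
  proof -
    obtain mn k where "from_nat n = ((mn, k) :: (nat \<times> nat) \<times> nat)" by (cases "from_nat n :: (nat \<times> nat) \<times> nat")
    then show ?thesis using J(1)[of mn] by (auto simp: \<Psi>_def I_def)
  qed
  have "dual_cost f x p = (SUP n. ennreal ((LINT y|p. \<Psi> n y) - \<Psi> n x))" if p: "p \<in> P2" for x p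
  proof (rule antisym)
    show "(SUP n. ennreal ((LINT y|p. \<Psi> n y) - \<Psi> n x)) \<le> dual_cost f x p"
      by (intro SUP_least dual_cost_upper dual)
    show "dual_cost f x p \<le> (SUP n. ennreal ((LINT y|p. \<Psi> n y) - \<Psi> n x))"
      unfolding dual_cost_def
    proof (rule SUP_least)
      fix \<psi> assume "\<psi> \<in> {\<psi>. dual_fn f \<psi>}"
      then have d: "dual_fn f \<psi>" by simp
      then obtain D D2 where c: "c2b \<psi> D D2" unfolding dual_fn_def by blast
      obtain C where C: "\<And>x. \<bar>\<psi> x\<bar> \<le> C * (1 + (norm x)\<^sup>2)" by (rule c2b_growth[OF c]) (rule that)
      obtain m where m: "C \<le> real m" using real_arch_simple by blast
      have "\<bar>\<psi> y\<bar> \<le> real m * (1 + (norm y)\<^sup>2)" for y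
        using C[of y] mult_right_mono[OF m, of "1 + (norm y)\<^sup>2"] by simp
      then have \<psi>: "\<psi> \<in> I m" using d by (simp add: I_def)
      have "\<forall>n. \<exists>k. \<forall>x\<in>cball 0 (real n). \<bar>\<psi> x - J (m, n) k x\<bar> \<le> 1 / real (Suc n)"
        using J(2)[of "(m, _)"] \<psi> by simp
      from choice[OF this] obtain k where
        k: "\<forall>n. \<forall>x\<in>cball 0 (real n). \<bar>\<psi> x - J (m, n) (k n) x\<bar> \<le> 1 / real (Suc n)" ..
      define \<phi> where "\<phi> n = J (m, n) (k n)" for n
      have \<phi>: "\<phi> n \<in> I m" for n using J(1)[of "(m, n)"] by (auto simp: \<phi>_def)
      have lim: "(\<lambda>n. \<phi> n y) \<longlonglongrightarrow> \<psi> y" for y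
      proof -
        have "\<forall>\<^sub>F n in sequentially. norm (\<phi> n y - \<psi> y) \<le> 1 / real (Suc n)"
          using eventually_ge_at_top[of "nat \<lceil>norm y\<rceil>"]
        proof eventually_elim
          case (elim n)
          then have "y \<in> cball 0 (real n)" by (simp add: nat_ceiling_le_eq)
          then show ?case using k by (simp add: \<phi>_def abs_minus_commute)
        qed
        from Lim_null_comparison[OF this LIMSEQ_Suc[OF lim_inverse_n']] show ?thesis
          by (simp add: LIM_zero_iff)
      qed
      have bm: "\<xi> \<in> borel_measurable p" if "dual_fn f \<xi>" for \<xi>
        unfolding measurable_cong_sets[OF P2_D(1)[OF p] refl] by (rule borel_measurable_continuous_onI[OF cont[OF that]])
      have "(\<lambda>n. LINT y|p. \<phi> n y) \<longlonglongrightarrow> (LINT y|p. \<psi> y)"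
      proof (rule integral_dominated_convergence[where w = "\<lambda>y. real m * (1 + (norm y)\<^sup>2)"])
        show "integrable p (\<lambda>y. real m * (1 + (norm y)\<^sup>2))"
          by (rule P2_integrable[OF p, of _ "real m"]) auto
      qed (use \<phi> d lim bm in \<open>auto simp: I_def\<close>)
      then have "(\<lambda>n. ennreal ((LINT y|p. \<phi> n y) - \<phi> n x)) \<longlonglongrightarrow> ennreal ((LINT y|p. \<psi> y) - \<psi> x)"
        using lim by (intro tendsto_ennrealI tendsto_diff)
      then show "ennreal ((LINT y|p. \<psi> y) - \<psi> x) \<le> (SUP n. ennreal ((LINT y|p. \<Psi> n y) - \<Psi> n x))"
      proof (rule LIMSEQ_le_const2)
        have "ennreal ((LINT y|p. \<phi> n y) - \<phi> n x) \<le> (SUP n. ennreal ((LINT y|p. \<Psi> n y) - \<Psi> n x))" for n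
          using SUP_upper[of "to_nat ((m, n), k n)" UNIV "\<lambda>i. ennreal ((LINT y|p. \<Psi> i y) - \<Psi> i x)"] by (simp add: \<phi>_def \<Psi>)
        then show "\<exists>N. \<forall>n\<ge>N. ennreal ((LINT y|p. \<phi> n y) - \<phi> n x) \<le> (SUP n. ennreal ((LINT y|p. \<Psi> n y) - \<Psi> n x))" by blast
      qed
    qed
  qed
  from that[OF dual this] show thesis .
qed

lemma measurable_dual_cost:
  fixes K :: "real^'d \<Rightarrow> (real^'d) measure"
  assumes K: "K \<in> borel \<rightarrow>\<^sub>M prob_algebra borel"
  obtains e where "e \<in> borel_measurable borel" "\<And>y. K y \<in> P2 \<Longrightarrow> dual_cost f y (K y) = e y"
proof -
  obtain \<Psi> :: "nat \<Rightarrow> real^'d \<Rightarrow> real" where \<Psi>: "\<And>n. dual_fn f (\<Psi> n)"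
    "\<And>x p. p \<in> P2 \<Longrightarrow> dual_cost f x p = (SUP n. ennreal ((LINT y|p. \<Psi> n y) - \<Psi> n x))"
    by (rule countable_dual_family) blast
  have b: "\<Psi> n \<in> borel_measurable borel" for n
  proof -
    from \<Psi>(1) obtain D D2 where "c2b (\<Psi> n) D D2" unfolding dual_fn_def by blast
    from c2b_D(5)[OF this] show ?thesis by (rule borel_measurable_continuous_onI)
  qed
  have "(\<lambda>y. LINT z|K y. \<Psi> n z) \<in> borel_measurable borel" for n
    by (rule measurable_compose[OF measurable_prob_algebraD[OF K] integral_measurable_subprob_algebra[OF b]])
  then have "(\<lambda>y. SUP n. ennreal ((LINT z|K y. \<Psi> n z) - \<Psi> n y)) \<in> borel_measurable borel"
    using b by (intro borel_measurable_SUP measurable_compose[OF borel_measurable_diff measurable_ennreal]) auto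
  then show thesis by (rule that) (rule \<Psi>(2))
qed

section \<open>Measurability of analytic kernels\<close>

text \<open>
  The integral of a function that need not be measurable is its lower integral, and a
  countable supremum of simple functions attains it.
\<close>

lemma nn_integral_attained:
  fixes h :: "'a \<Rightarrow> ennreal"
  obtains g where "g \<in> borel_measurable M" "\<And>x. g x \<le> h x" "(\<integral>\<^sup>+x. g x \<partial>M) = (\<integral>\<^sup>+x. h x \<partial>M)"
proof -
  have "\<exists>s::nat \<Rightarrow> ennreal. incseq s \<and> range s \<subseteq> integral\<^sup>S M ` {g. simple_function M g \<and> g \<le> h} \<and> integral\<^sup>N M h = (SUP i. s i)"
    unfolding nn_integral_def
  proof (rule ennreal_Sup_countable_SUP)
    have "(\<lambda>_. 0) \<in> {g. simple_function M g \<and> g \<le> h}" by (auto simp: le_fun_def)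
    then show "integral\<^sup>S M ` {g. simple_function M g \<and> g \<le> h} \<noteq> {}" by blast
  qed
  then obtain s :: "nat \<Rightarrow> ennreal" where s: "range s \<subseteq> integral\<^sup>S M ` {g. simple_function M g \<and> g \<le> h}" "integral\<^sup>N M h = (SUP i. s i)"
    by blast
  from s(1) have "\<forall>i. \<exists>g. simple_function M g \<and> g \<le> h \<and> s i = integral\<^sup>S M g" by blast
  then obtain G where G: "\<And>i. simple_function M (G i)" "\<And>i. G i \<le> h" "\<And>i. s i = integral\<^sup>S M (G i)"
    unfolding choice_iff by blast
  show thesis
  proof (rule that[of "\<lambda>x. SUP i. G i x"])
    show "(\<lambda>x. SUP i. G i x) \<in> borel_measurable M"
      using G(1) by (intro borel_measurable_SUP) (auto intro: borel_measurable_simple_function)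
    show le: "(SUP i. G i x) \<le> h x" for x using G(2) by (auto simp: le_fun_def intro: SUP_least)
    show "(\<integral>\<^sup>+x. (SUP i. G i x) \<partial>M) = (\<integral>\<^sup>+x. h x \<partial>M)"
    proof (rule antisym)
      show "(\<integral>\<^sup>+x. (SUP i. G i x) \<partial>M) \<le> (\<integral>\<^sup>+x. h x \<partial>M)" by (intro nn_integral_mono le)
      show "(\<integral>\<^sup>+x. h x \<partial>M) \<le> (\<integral>\<^sup>+x. (SUP i. G i x) \<partial>M)"
        unfolding s(2) G(3) nn_integral_eq_simple_integral[OF G(1), symmetric]
        by (intro SUP_least nn_integral_mono SUP_upper) auto
    qed
  qed
qed

text \<open>
  If the lower integrals of \<open>h\<close> and \<open>1 - h\<close> add up to one, then the measurable minorants that attain them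
  squeeze \<open>h\<close> almost everywhere.
\<close>

lemma measurable_of_lower_integrals:
  fixes h :: "'a \<Rightarrow> ennreal"
  assumes M: "prob_space M" and h: "\<And>x. h x \<le> 1"
    and sum: "(\<integral>\<^sup>+x. h x \<partial>M) + (\<integral>\<^sup>+x. 1 - h x \<partial>M) = 1"
  shows "h \<in> borel_measurable (completion M)"
proof -
  interpret prob_space M by (rule M)
  obtain g where g: "g \<in> borel_measurable M" "\<And>x. g x \<le> h x" "(\<integral>\<^sup>+x. g x \<partial>M) = (\<integral>\<^sup>+x. h x \<partial>M)"
    by (rule nn_integral_attained[of M h]) (rule that)
  obtain g' where g': "g' \<in> borel_measurable M" "\<And>x. g' x \<le> 1 - h x" "(\<integral>\<^sup>+x. g' x \<partial>M) = (\<integral>\<^sup>+x. 1 - h x \<partial>M)"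
    by (rule nn_integral_attained[of M "\<lambda>x. 1 - h x"]) (rule that)
  have le: "h x + g' x \<le> 1" for x
  proof -
    have "h x + g' x \<le> h x + (1 - h x)" by (intro add_left_mono g'(2))
    also have "\<dots> = 1" using h[of x] by (simp add: add_diff_inverse_ennreal)
    finally show ?thesis .
  qed
  have le': "g x + g' x \<le> 1" for x using le[of x] add_right_mono[OF g(2)[of x], of "g' x"] by (rule order_trans[rotated])
  have one: "(\<integral>\<^sup>+x. g x + g' x \<partial>M) = 1" using g g' sum by (simp add: nn_integral_add)
  have "(\<integral>\<^sup>+x. 1 - (g x + g' x) \<partial>M) = (\<integral>\<^sup>+x. 1 \<partial>M) - (\<integral>\<^sup>+x. g x + g' x \<partial>M)"
    by (rule nn_integral_diff) (use g(1) g'(1) le' one in auto)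
  also have "\<dots> = 0" using one by (simp add: emeasure_space_1)
  finally have "AE x in M. 1 - (g x + g' x) = 0"
    using g(1) g'(1) by (subst (asm) nn_integral_0_iff_AE) auto
  then have "AE x in M. h x = g x"
  proof eventually_elim
    case (elim x)
    then have "1 \<le> g x + g' x" by (simp add: diff_eq_0_iff_ennreal)
    with le[of x] have "h x + g' x \<le> g x + g' x" by (rule order_trans)
    then have "g' x + h x \<le> g' x + g x" unfolding add.commute[of "g' x"] .
    moreover have "g' x \<noteq> \<infinity>" using le[of x] by (auto simp: top_unique)
    ultimately have "h x \<le> g x" by (simp add: ennreal_add_left_cancel_le)
    then show ?case using g(2)[of x] by simp
  qed
  then obtain N where N: "{x \<in> space M. h x \<noteq> g x} \<subseteq> N" "N \<in> null_sets M" by (auto elim!: AE_E simp: null_sets_def)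
  show ?thesis
  proof (rule measurableI)
    fix A :: "ennreal set" assume A: "A \<in> sets borel"
    show "h -` A \<inter> space (completion M) \<in> sets (completion M)"
    proof (rule sets_completionI)
      show "h -` A \<inter> space (completion M) = ((g -` A \<inter> space M) - N) \<union> (h -` A \<inter> space M \<inter> N)"
        using N(1) by auto
      show "(g -` A \<inter> space M) - N \<in> sets M" using measurable_sets[OF g(1) A] N(2) by auto
      show "h -` A \<inter> space M \<inter> N \<subseteq> N" by blast
    qed (rule N(2))
  qed simp
qed

text \<open>
  The hypothesis on \<open>\<nu>\<close> for a Borel set and for its complement says that two complementary lower integrals
  add up to one, which forces measurability for the completion of \<open>p\<close>.  This avoids the comparison of the
  \<open>\<sigma>\<close>-algebra of analytic sets with the universally measurable sets; of the analytic
  measurability only the fact that \<open>\<gamma> y \<in> P2\<close> is drawn on.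
\<close>

lemma analytic_kernel_measurable:
  fixes \<gamma> :: "real^'d \<Rightarrow> (real^'d) measure"
  assumes \<gamma>: "\<gamma> \<in> analytic_kernels" and p: "p \<in> P2" and \<nu>: "\<nu> \<in> P2"
    and eq: "\<forall>B\<in>sets borel. emeasure \<nu> B = (\<integral>\<^sup>+ y. emeasure (\<gamma> y) B \<partial>completion p)"
  shows "\<gamma> y \<in> P2" "\<gamma> \<in> completion p \<rightarrow>\<^sub>M prob_algebra borel" "completion p \<bind> \<gamma> = \<nu>"
proof -
  have "{U. W2_open U} \<subseteq> Pow (P2 :: (real^'d) measure set)" by (auto simp: W2_open_def)
  then have "space (sigma P2 {U :: (real^'d) measure set. W2_open U}) = P2" by (rule space_measure_of)
  then show \<gamma>P: "\<gamma> y \<in> P2" for y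
    using measurable_space[OF \<gamma>[unfolded analytic_kernels_def], of y] by (simp add: space_measure_of_conv)
  have ms: "emeasure (\<gamma> y) (- B) = 1 - emeasure (\<gamma> y) B" "emeasure (\<gamma> y) B \<le> 1" if "B \<in> sets borel" for y B
  proof -
    interpret g: prob_space "\<gamma> y" by (rule P2_D(2)[OF \<gamma>P])
    show "emeasure (\<gamma> y) B \<le> 1" by (rule g.emeasure_le_1)
    have "B \<in> sets (\<gamma> y)" using that P2_D(1)[OF \<gamma>P, of y] by simp
    from emeasure_compl[OF this g.emeasure_finite[folded infinity_ennreal_def]] show "emeasure (\<gamma> y) (- B) = 1 - emeasure (\<gamma> y) B"
      using g.emeasure_space_1 by (simp add: P2_D(3)[OF \<gamma>P] Compl_eq_Diff_UNIV)
  qed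
  interpret \<nu>: prob_space \<nu> by (rule P2_D(2)[OF \<nu>])
  have m: "(\<lambda>y. emeasure (\<gamma> y) B) \<in> borel_measurable (completion p)" if B: "B \<in> sets borel" for B
  proof (rule measurable_of_lower_integrals[OF P2_D(2)[OF p]])
    have B': "B \<in> sets \<nu>" "- B \<in> sets borel" using B P2_D(1)[OF \<nu>] by auto
    have "(\<integral>\<^sup>+ y. emeasure (\<gamma> y) B \<partial>p) + (\<integral>\<^sup>+ y. 1 - emeasure (\<gamma> y) B \<partial>p) = emeasure \<nu> B + emeasure \<nu> (- B)"
      using eq B B'(2) by (simp add: nn_integral_completion ms(1)[OF B])
    also have "emeasure \<nu> (- B) = 1 - emeasure \<nu> B"
      using emeasure_compl[OF B'(1) \<nu>.emeasure_finite[folded infinity_ennreal_def]] \<nu>.emeasure_space_1 by (simp add: P2_D(3)[OF \<nu>] Compl_eq_Diff_UNIV)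
    also have "emeasure \<nu> B + (1 - emeasure \<nu> B) = 1" by (rule add_diff_inverse_ennreal[OF \<nu>.emeasure_le_1])
    finally show "(\<integral>\<^sup>+ y. emeasure (\<gamma> y) B \<partial>p) + (\<integral>\<^sup>+ y. 1 - emeasure (\<gamma> y) B \<partial>p) = 1" .
  qed (rule ms(2)[OF B])
  show K: "\<gamma> \<in> completion p \<rightarrow>\<^sub>M prob_algebra borel"
  proof (rule measurable_prob_algebra_generated[where \<Omega> = UNIV and G = "sets borel"])
    show "sets borel = sigma_sets UNIV (sets borel)" using sets.sigma_sets_eq[of borel] by (metis space_borel)
  qed (use P2_D(1,2)[OF \<gamma>P] m in \<open>auto simp: Int_stable_def\<close>)
  have ne: "space (completion p) \<noteq> {}" by (simp add: P2_D(3)[OF p])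
  note Ks = measurable_prob_algebraD[OF K]
  show "completion p \<bind> \<gamma> = \<nu>"
  proof (rule measure_eqI)
    show s: "sets (completion p \<bind> \<gamma>) = sets \<nu>"
      using sets_bind[OF P2_D(1)[OF \<gamma>P] ne] P2_D(1)[OF \<nu>] by simp
    fix B assume "B \<in> sets (completion p \<bind> \<gamma>)"
    then have B: "B \<in> sets borel" using s P2_D(1)[OF \<nu>] by simp
    show "emeasure (completion p \<bind> \<gamma>) B = emeasure \<nu> B"
      unfolding emeasure_bind[OF ne Ks B] using eq B by simp
  qed
qed

lemma completion_P2:
  assumes "p \<in> P2"
  shows "(\<lambda>y. y) \<in> completion p \<rightarrow>\<^sub>M borel" "distr (completion p) borel (\<lambda>y. y) = p"
proof -
  have id: "(\<lambda>y. y) \<in> p \<rightarrow>\<^sub>M borel" using measurable_ident_sets[OF P2_D(1)[OF assms]] by (simp add: id_def)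
  show "(\<lambda>y. y) \<in> completion p \<rightarrow>\<^sub>M borel" by (rule measurable_completion[OF id])
  show "distr (completion p) borel (\<lambda>y. y) = p"
    unfolding distr_completion[OF id] by (rule distr_id2) (simp add: P2_D(1)[OF assms])
qed

section \<open>The weak transport cost\<close>

text \<open>
  A coupling with first marginal \<open>\<mu>\<close> is the same as a kernel that transports \<open>\<mu>\<close> to \<open>\<nu>\<close>.
\<close>

lemma H_cost_eq_kernels:
  fixes \<mu> \<nu> :: "(real^'d) measure"
  assumes \<mu>: "\<mu> \<in> P2" and \<nu>: "\<nu> \<in> P2"
  shows "H_cost f \<mu> \<nu> = (INF K\<in>{K. K \<in> borel \<rightarrow>\<^sub>M prob_algebra borel \<and> \<mu> \<bind> K = \<nu>}. \<integral>\<^sup>+x. G_cost f x (K x) \<partial>\<mu>)"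
proof (rule antisym)
  note P = P2_D[OF \<mu>]
  have ne: "space \<mu> \<noteq> {}" using P(3) by simp
  have into: "K \<in> \<mu> \<rightarrow>\<^sub>M N" if "K \<in> borel \<rightarrow>\<^sub>M N" for K and N :: "'n measure"
    using that unfolding measurable_cong_sets[OF P(1) refl] .
  have setsK: "sets (K x) = sets borel" "prob_space (K x)" "space (K x) = UNIV"
    if "K \<in> borel \<rightarrow>\<^sub>M prob_algebra borel" for K :: "real^'d \<Rightarrow> (real^'d) measure" and x
  proof -
    show s: "sets (K x) = sets borel" "prob_space (K x)"
      using measurable_space[OF that, of x] by (auto simp: space_prob_algebra)
    show "space (K x) = UNIV" using sets_eq_imp_space_eq[OF s(1)] by simp
  qed
  have em: "emeasure (\<mu> \<bind> K) B = (\<integral>\<^sup>+x. emeasure (K x) B \<partial>\<mu>)"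
    if "K \<in> borel \<rightarrow>\<^sub>M prob_algebra borel" "B \<in> sets borel" for K :: "real^'d \<Rightarrow> (real^'d) measure" and B
    by (rule emeasure_bind[OF ne measurable_prob_algebraD[OF into[OF that(1)]] that(2)])
  show "H_cost f \<mu> \<nu> \<le> (INF K\<in>{K. K \<in> borel \<rightarrow>\<^sub>M prob_algebra borel \<and> \<mu> \<bind> K = \<nu>}. \<integral>\<^sup>+x. G_cost f x (K x) \<partial>\<mu>)"
  proof (rule INF_greatest, clarify)
    fix K :: "real^'d \<Rightarrow> (real^'d) measure" assume K: "K \<in> borel \<rightarrow>\<^sub>M prob_algebra borel" and \<nu>K: "\<nu> = \<mu> \<bind> K"
    define L where "L x = distr (K x) borel (Pair x)" for x
    define \<gamma> where "\<gamma> = \<mu> \<bind> L"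
    have L: "L \<in> borel \<rightarrow>\<^sub>M prob_algebra borel"
      unfolding L_def by (rule measurable_distr_prob_space2[OF K]) (simp add: borel_prod)
    have s\<gamma>: "sets \<gamma> = sets borel" unfolding \<gamma>_def by (rule sets_bind[OF _ ne]) (simp add: L_def)
    have E\<gamma>: "emeasure \<gamma> E = (\<integral>\<^sup>+x. emeasure (K x) (Pair x -` E) \<partial>\<mu>)" if E: "E \<in> sets borel" for E
      unfolding \<gamma>_def emeasure_bind[OF ne measurable_prob_algebraD[OF into[OF L]] E] L_def
    proof (intro nn_integral_cong emeasure_distr[OF _ E, THEN trans])
      fix x show "Pair x \<in> K x \<rightarrow>\<^sub>M borel"
        unfolding measurable_cong_sets[OF setsK(1)[OF K] refl] by (intro borel_measurable_continuous_onI continuous_intros)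
    qed (simp add: setsK(3)[OF K])
    have m: "distr \<gamma> borel fst = \<mu>" "distr \<gamma> borel snd = \<nu>"
    proof -
      have fs: "fst \<in> \<gamma> \<rightarrow>\<^sub>M borel" "snd \<in> \<gamma> \<rightarrow>\<^sub>M borel"
        unfolding measurable_cong_sets[OF s\<gamma> refl] by (intro borel_measurable_continuous_onI continuous_intros)+
      have sp: "space \<gamma> = UNIV" using sets_eq_imp_space_eq[OF s\<gamma>] by simp
      have pb: "fst -` B \<in> sets (borel :: ((real^'d) \<times> (real^'d)) measure)" "snd -` B \<in> sets (borel :: ((real^'d) \<times> (real^'d)) measure)"
        if "B \<in> sets borel" for B :: "(real^'d) set"
        using measurable_sets[OF fs(1) that] measurable_sets[OF fs(2) that] by (simp_all add: sp s\<gamma>)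
      show "distr \<gamma> borel fst = \<mu>"
      proof (rule measure_eqI)
        fix B assume "B \<in> sets (distr \<gamma> borel fst)"
        then have B: "B \<in> sets borel" by simp
        have "emeasure (K x) (Pair x -` fst -` B) = indicator B x" for x
          using prob_space.emeasure_space_1[OF setsK(2)[OF K, of x]] by (auto simp: setsK(3)[OF K] vimage_def indicator_def)
        then show "emeasure (distr \<gamma> borel fst) B = emeasure \<mu> B"
          using B P(1) by (simp add: emeasure_distr[OF fs(1)] sp E\<gamma> pb)
      qed (simp add: P(1))
      show "distr \<gamma> borel snd = \<nu>"
      proof (rule measure_eqI)
        fix B assume "B \<in> sets (distr \<gamma> borel snd)"
        then have B: "B \<in> sets borel" by simp
        have "emeasure (distr \<gamma> borel snd) B = emeasure \<gamma> (snd -` B)" by (simp add: emeasure_distr[OF fs(2) B] sp)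
        also have "\<dots> = (\<integral>\<^sup>+x. emeasure (K x) (Pair x -` snd -` B) \<partial>\<mu>)" by (rule E\<gamma>[OF pb(2)[OF B]])
        also have "\<dots> = emeasure \<nu> B" unfolding \<nu>K em[OF K B] by (simp add: vimage_def)
        finally show "emeasure (distr \<gamma> borel snd) B = emeasure \<nu> B" .
      qed (simp add: P2_D(1)[OF \<nu>])
    qed
    have "prob_space (distr \<gamma> borel fst)" unfolding m(1) by (rule P(2))
    then have "prob_space \<gamma>"
      using prob_space_distrD[of fst \<gamma> borel] s\<gamma> by (simp add: measurable_cong_sets[OF s\<gamma> refl] borel_measurable_continuous_onI continuous_on_fst)
    then have "\<gamma> \<in> couplings \<mu> \<nu>" "disintegrates \<gamma> \<mu> K"
      using s\<gamma> m K E\<gamma> by (auto simp: couplings_def disintegrates_def)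
    then show "H_cost f \<mu> (\<mu> \<bind> K) \<le> (\<integral>\<^sup>+x. G_cost f x (K x) \<partial>\<mu>)"
      unfolding H_cost_def \<nu>K[symmetric] by (intro INF_lower2[of "(\<gamma>, K)"]) (auto simp: nn_integral_completion)
  qed
  show "(INF K\<in>{K. K \<in> borel \<rightarrow>\<^sub>M prob_algebra borel \<and> \<mu> \<bind> K = \<nu>}. \<integral>\<^sup>+x. G_cost f x (K x) \<partial>\<mu>) \<le> H_cost f \<mu> \<nu>"
    unfolding H_cost_def
  proof (rule INF_greatest, clarify)
    fix \<gamma> and k :: "real^'d \<Rightarrow> (real^'d) measure"
    assume c: "\<gamma> \<in> couplings \<mu> \<nu>" and d: "disintegrates \<gamma> \<mu> k"
    have k: "k \<in> borel \<rightarrow>\<^sub>M prob_algebra borel"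
      and E: "\<And>E. E \<in> sets borel \<Longrightarrow> emeasure \<gamma> E = (\<integral>\<^sup>+ x. emeasure (k x) (Pair x -` E) \<partial>\<mu>)"
      using d by (auto simp: disintegrates_def)
    have s\<gamma>: "sets \<gamma> = sets borel" and snd: "distr \<gamma> borel snd = \<nu>" using c by (auto simp: couplings_def)
    have ms: "snd \<in> \<gamma> \<rightarrow>\<^sub>M borel"
      unfolding measurable_cong_sets[OF s\<gamma> refl] by (intro borel_measurable_continuous_onI continuous_intros)
    have sp: "space \<gamma> = UNIV" using sets_eq_imp_space_eq[OF s\<gamma>] by simp
    have "\<mu> \<bind> k = \<nu>"
    proof (rule measure_eqI)
      show s: "sets (\<mu> \<bind> k) = sets \<nu>" using sets_bind[OF setsK(1)[OF k] ne] P2_D(1)[OF \<nu>] by simp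
      fix B assume "B \<in> sets (\<mu> \<bind> k)"
      then have B: "B \<in> sets borel" using s P2_D(1)[OF \<nu>] by simp
      have "snd -` B \<in> sets (borel :: ((real^'d) \<times> (real^'d)) measure)" using measurable_sets[OF ms B] by (simp add: sp s\<gamma>)
      then show "emeasure (\<mu> \<bind> k) B = emeasure \<nu> B"
        unfolding snd[symmetric] emeasure_distr[OF ms B] using em[OF k B] E by (simp add: sp vimage_def)
    qed
    then show "(INF K\<in>{K. K \<in> borel \<rightarrow>\<^sub>M prob_algebra borel \<and> \<mu> \<bind> K = \<nu>}. \<integral>\<^sup>+x. G_cost f x (K x) \<partial>\<mu>)
        \<le> (\<integral>\<^sup>+ x. G_cost f x (k x) \<partial>completion \<mu>)"
      using k by (intro INF_lower2[of k]) (auto simp: nn_integral_completion)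
  qed
qed

lemma le_add_INF_ennreal:
  fixes F :: "'a \<Rightarrow> ennreal" and G :: "'b \<Rightarrow> ennreal"
  assumes "\<And>i j. i \<in> I \<Longrightarrow> j \<in> J \<Longrightarrow> c \<le> F i + G j"
  shows "c \<le> (INF i\<in>I. F i) + (INF j\<in>J. G j)"
proof (rule ennreal_le_epsilon)
  fix e :: real assume fin: "(INF i\<in>I. F i) + (INF j\<in>J. G j) < top" and e: "0 < e"
  have "(INF i\<in>I. F i) < (INF i\<in>I. F i) + ennreal (e / 2)" "(INF j\<in>J. G j) < (INF j\<in>J. G j) + ennreal (e / 2)"
    using fin e by (auto simp: ennreal_add_left_cancel_less less_top[symmetric])
  then obtain i j where ij: "i \<in> I" "F i < (INF i\<in>I. F i) + ennreal (e / 2)" "j \<in> J" "G j < (INF j\<in>J. G j) + ennreal (e / 2)"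
    unfolding INF_less_iff by blast
  have "c \<le> F i + G j" by (rule assms[OF ij(1,3)])
  also have "\<dots> \<le> ((INF i\<in>I. F i) + ennreal (e / 2)) + ((INF j\<in>J. G j) + ennreal (e / 2))"
    using ij(2,4) by (intro add_mono less_imp_le)
  also have "\<dots> = (INF i\<in>I. F i) + (INF j\<in>J. G j) + (ennreal (e / 2) + ennreal (e / 2))" by (simp add: ac_simps)
  also have "ennreal (e / 2) + ennreal (e / 2) = ennreal e" using e by (subst ennreal_plus[symmetric]) auto
  finally show "c \<le> (INF i\<in>I. F i) + (INF j\<in>J. G j) + ennreal e" .
qed

section \<open>The transform as a countable infimum\<close>

lemma norm_add_square_le: "(norm (x + y))\<^sup>2 \<le> 2 * (norm x)\<^sup>2 + 2 * (norm y)\<^sup>2"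
proof -
  have "(norm (x + y))\<^sup>2 \<le> (norm x + norm y)\<^sup>2" by (rule power_mono[OF norm_triangle_ineq norm_ge_zero])
  also have "\<dots> \<le> 2 * (norm x)\<^sup>2 + 2 * (norm y)\<^sup>2"
    using zero_le_power2[of "norm x - norm y"] by (simp add: power2_eq_square algebra_simps)
  finally show ?thesis .
qed

lemma translate_P2:
  fixes p :: "(real^'d) measure"
  assumes p: "p \<in> P2"
  shows "distr p borel (\<lambda>w. w + a) \<in> P2"
    "(\<integral>\<^sup>+z. ennreal ((norm z)\<^sup>2) \<partial>distr p borel (\<lambda>w. w + a)) \<le> ennreal (2 * (LINT w|p. (norm w)\<^sup>2) + 2 * (norm a)\<^sup>2)"
    "g \<in> borel_measurable borel \<Longrightarrow> (LINT z|distr p borel (\<lambda>w. w + a). g z) = (LINT w|p. g (w + a) :: real)"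
proof -
  note P = P2_D[OF p]
  interpret prob_space p by (rule P(2))
  have t: "(\<lambda>w. w + a) \<in> p \<rightarrow>\<^sub>M borel" unfolding measurable_cong_sets[OF P(1) refl] by measurable
  have "(\<integral>\<^sup>+z. ennreal ((norm z)\<^sup>2) \<partial>distr p borel (\<lambda>w. w + a)) = (\<integral>\<^sup>+w. ennreal ((norm (w + a))\<^sup>2) \<partial>p)"
    by (rule nn_integral_distr[OF t]) measurable
  also have "\<dots> \<le> (\<integral>\<^sup>+w. ennreal (2 * (norm w)\<^sup>2 + 2 * (norm a)\<^sup>2) \<partial>p)"
    by (intro nn_integral_mono ennreal_leI norm_add_square_le)
  also have "\<dots> = ennreal (LINT w|p. 2 * (norm w)\<^sup>2 + 2 * (norm a)\<^sup>2)"
    by (rule nn_integral_eq_integral) (use P(4) in auto)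
  also have "(LINT w|p. 2 * (norm w)\<^sup>2 + 2 * (norm a)\<^sup>2) = 2 * (LINT w|p. (norm w)\<^sup>2) + 2 * (norm a)\<^sup>2"
    using P(4) by (simp add: prob_space)
  finally show b: "(\<integral>\<^sup>+z. ennreal ((norm z)\<^sup>2) \<partial>distr p borel (\<lambda>w. w + a)) \<le> ennreal (2 * (LINT w|p. (norm w)\<^sup>2) + 2 * (norm a)\<^sup>2)" .
  show "distr p borel (\<lambda>w. w + a) \<in> P2"
    using le_less_trans[OF b ennreal_less_top] prob_space_distr[OF t] by (simp add: P2_def)
  show "(LINT z|distr p borel (\<lambda>w. w + a). g z) = (LINT w|p. g (w + a) :: real)" if "g \<in> borel_measurable borel"
    by (rule integral_distr[OF t that])
qed

text \<open>
  Translates of dual functions are dual functions.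
\<close>

lemma dual_cost_translate:
  fixes p :: "(real^'d) measure"
  assumes p: "p \<in> P2"
  shows "dual_cost f (x + a) (distr p borel (\<lambda>w. w + a)) \<le> dual_cost f x p"
  unfolding dual_cost_def[of f "x + a"]
proof (rule SUP_least)
  fix \<psi> assume "\<psi> \<in> {\<psi>. dual_fn f \<psi>}"
  then obtain D D2 where c: "c2b \<psi> D D2" "\<And>y. (1/2) *\<^sub>R D2 y \<in> minorants f" by (auto simp: dual_fn_def)
  have "dual_fn f (\<lambda>y. \<psi> (y + a))"
    unfolding dual_fn_def using c2b_translate[OF c(1), of a] c(2) by blast
  from dual_cost_upper[OF this, of p x]
  show "ennreal ((LINT y|distr p borel (\<lambda>w. w + a). \<psi> y) - \<psi> (x + a)) \<le> dual_cost f x p"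
    by (simp add: translate_P2(3)[OF p borel_measurable_continuous_onI[OF c2b_D(5)[OF c(1)]]])
qed

lemma dual_cost_return: "dual_cost f x (return borel x) = 0"
proof -
  have "ennreal ((LINT y|return borel x. \<psi> y) - \<psi> x) = 0" if d: "dual_fn f \<psi>" for \<psi>
  proof -
    from d obtain D D2 where "c2b \<psi> D D2" unfolding dual_fn_def by blast
    from borel_measurable_continuous_onI[OF c2b_D(5)[OF this]] show ?thesis by (simp add: integral_return)
  qed
  then show ?thesis unfolding dual_cost_def by (intro antisym SUP_least) auto
qed

text \<open>
  The candidate for \<open>\<phi>\<^sup>G(y)\<close> that the translate of \<open>\<gamma>\<close> by \<open>y\<close> provides, with the cost measured at the origin.
\<close>

definition shift_cost :: "(real^'d^'d \<Rightarrow> ennreal) \<Rightarrow> (real^'d \<Rightarrow> real) \<Rightarrow> (real^'d) measure \<Rightarrow> real^'d \<Rightarrow> real" where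
  "shift_cost f \<phi> \<gamma> y = (LINT w|\<gamma>. \<phi> (w + y)) + enn2real (dual_cost f 0 \<gamma>)"

lemma shift_cost_continuous:
  fixes \<phi> :: "real^'d \<Rightarrow> real"
  assumes \<phi>: "\<phi> \<in> Phi_bb2" and \<gamma>: "\<gamma> \<in> P2"
  shows "continuous_on UNIV (shift_cost f \<phi> \<gamma>)"
proof (rule continuous_at_imp_continuous_on, rule ballI)
  fix y :: "real^'d"
  from \<phi> obtain C where C: "0 < C" "\<And>x. \<bar>\<phi> x\<bar> \<le> C * (1 + (norm x)\<^sup>2)" and c: "continuous_on UNIV \<phi>"
    by (auto simp: Phi_bb2_def)
  note P = P2_D[OF \<gamma>]
  have m: "(\<lambda>w. \<phi> (w + y)) \<in> borel_measurable \<gamma>" for y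
    unfolding measurable_cong_sets[OF P(1) refl]
    by (intro borel_measurable_continuous_onI continuous_on_compose2[OF c] continuous_intros) auto
  show "isCont (shift_cost f \<phi> \<gamma>) y"
    unfolding shift_cost_def[abs_def]
  proof (intro continuous_intros, unfold continuous_at_sequentially, intro allI impI)
    fix u assume u: "u \<longlonglongrightarrow> y"
    then obtain R where R: "0 < R" "\<And>n. norm (u n) \<le> R" using convergent_imp_Bseq[of u] by (auto simp: convergent_def Bseq_def)
    show "((\<lambda>y. LINT w|\<gamma>. \<phi> (w + y)) \<circ> u) \<longlonglongrightarrow> (LINT w|\<gamma>. \<phi> (w + y))"
      unfolding comp_def
    proof (rule integral_dominated_convergence[where w = "\<lambda>w. C * (1 + (2 * (norm w)\<^sup>2 + 2 * R\<^sup>2))"])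
      interpret prob_space \<gamma> by (rule P(2))
      show "integrable \<gamma> (\<lambda>w. C * (1 + (2 * (norm w)\<^sup>2 + 2 * R\<^sup>2)))" using P(4) by auto
      show "AE w in \<gamma>. (\<lambda>n. \<phi> (w + u n)) \<longlonglongrightarrow> \<phi> (w + y)"
        using c u by (intro AE_I2 isCont_tendsto_compose[of _ \<phi>] tendsto_intros) (auto simp: continuous_on_eq_continuous_at)
      show "AE w in \<gamma>. norm (\<phi> (w + u n)) \<le> C * (1 + (2 * (norm w)\<^sup>2 + 2 * R\<^sup>2))" for n
      proof (rule AE_I2)
        fix w
        have "(norm (u n))\<^sup>2 \<le> R\<^sup>2" by (rule power_mono[OF R(2) norm_ge_zero])
        then have "1 + (norm (w + u n))\<^sup>2 \<le> 1 + (2 * (norm w)\<^sup>2 + 2 * R\<^sup>2)"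
          using norm_add_square_le[of w "u n"] by linarith
        from order_trans[OF C(2)[of "w + u n"] mult_left_mono[OF this less_imp_le[OF C(1)]]]
        show "norm (\<phi> (w + u n)) \<le> C * (1 + (2 * (norm w)\<^sup>2 + 2 * R\<^sup>2))" by (simp only: real_norm_def)
      qed
    qed (use m in auto)
  qed
qed

text \<open>
  For each rational \<open>q\<close> the open sets \<open>{h\<^sub>i < q}\<close> have a countable subfamily with the same union.
\<close>

lemma countable_infimum:
  fixes h :: "'i \<Rightarrow> 'a::second_countable_topology \<Rightarrow> real"
  assumes c: "\<And>i. i \<in> I \<Longrightarrow> continuous_on UNIV (h i)" and I: "i0 \<in> I"
  obtains g :: "nat \<Rightarrow> 'i" where "range g \<subseteq> I" "g 0 = i0"
    "\<And>y r i. i \<in> I \<Longrightarrow> h i y < r \<Longrightarrow> \<exists>n. h (g n) y < r"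
proof -
  have "\<exists>J\<subseteq>I. countable J \<and> (\<Union>i\<in>J. {y. h i y < q}) = (\<Union>i\<in>I. {y. h i y < q})" for q
  proof -
    have "open S" if "S \<in> (\<lambda>i. {y. h i y < q}) ` I" for S
      using that c by (auto intro!: open_Collect_less continuous_on_const)
    then obtain F where F: "F \<subseteq> (\<lambda>i. {y. h i y < q}) ` I" "countable F" "\<Union>F = \<Union>((\<lambda>i. {y. h i y < q}) ` I)"
      by (rule Lindelof) (assumption, rule that)
    from F(1,2) obtain J where "J \<subseteq> I" "countable J" "F = (\<lambda>i. {y. h i y < q}) ` J"
      using countable_subset_image[of F "\<lambda>i. {y. h i y < q}" I] by blast
    then show ?thesis using F(3) by (intro exI[of _ J]) auto
  qed
  then have "\<forall>q. \<exists>J. J \<subseteq> I \<and> countable J \<and> (\<Union>i\<in>J. {y. h i y < q}) = (\<Union>i\<in>I. {y. h i y < q})" ..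
  from choice[OF this] obtain J
    where "\<forall>q. J q \<subseteq> I \<and> countable (J q) \<and> (\<Union>i\<in>J q. {y. h i y < q}) = (\<Union>i\<in>I. {y. h i y < q})" ..
  then have J: "J q \<subseteq> I" "countable (J q)" "(\<Union>i\<in>J q. {y. h i y < q}) = (\<Union>i\<in>I. {y. h i y < q})" for q by simp_all
  define A where "A = insert i0 (\<Union>q\<in>\<rat>. J q)"
  have A: "countable A" "A \<noteq> {}" "A \<subseteq> I" using J(1,2) I countable_rat by (auto simp: A_def)
  define g where "g n = (case n of 0 \<Rightarrow> i0 | Suc m \<Rightarrow> from_nat_into A m)" for n
  have rg: "range g \<subseteq> I"
  proof
    fix i assume "i \<in> range g"
    then obtain n where "i = g n" by blast
    then show "i \<in> I" using from_nat_into[OF A(2)] A(3) I by (cases n) (auto simp: g_def)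
  qed
  have "\<exists>n. h (g n) y < r" if i: "i \<in> I" "h i y < r" for y r i
  proof -
    obtain q where q: "q \<in> \<rat>" "h i y < q" "q < r" using Rats_dense_in_real[OF i(2)] by blast
    then have "y \<in> (\<Union>i\<in>J q. {y. h i y < q})" unfolding J(3) using i(1) by blast
    then obtain j where j: "j \<in> J q" "h j y < q" by blast
    then have "j \<in> A" using q(1) by (auto simp: A_def)
    then obtain m where "from_nat_into A m = j" using from_nat_into_surj[OF A(1)] by blast
    then have "h (g (Suc m)) y < r" using j q by (simp add: g_def)
    then show ?thesis by blast
  qed
  from that[OF rg _ this] show thesis by (simp add: g_def)
qed

text \<open>
  Among finitely many candidates the best one can be selected on Borel sets, one comparison at a time.
  Finiteness also keeps the second moments under control by \<open>A + 2 |y|\<^sup>2\<close>, so that the selected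
  kernel maps \<open>P2\<close> to itself.
\<close>

lemma shift_selection:
  fixes \<phi> :: "real^'d \<Rightarrow> real" and g :: "nat \<Rightarrow> (real^'d) measure"
  assumes \<phi>: "\<phi> \<in> Phi_bb2" and g: "\<And>i. g i \<in> P2" "\<And>i. dual_cost f 0 (g i) < \<infinity>"
  shows "\<exists>K A. K \<in> borel \<rightarrow>\<^sub>M prob_algebra borel \<and> 0 \<le> A \<and>
    (\<forall>y. K y \<in> P2 \<and> dual_cost f y (K y) < \<infinity> \<and> (\<integral>\<^sup>+z. ennreal ((norm z)\<^sup>2) \<partial>K y) \<le> ennreal (A + 2 * (norm y)\<^sup>2) \<and>
      (\<forall>i\<le>n. (LINT z|K y. \<phi> z) + enn2real (dual_cost f y (K y)) \<le> shift_cost f \<phi> (g i) y))"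
proof -
  define T where "T i y = distr (g i) borel (\<lambda>w. w + y)" for i and y :: "real^'d"
  define B where "B i = 2 * (LINT w|g i. (norm w)\<^sup>2)" for i
  have c: "continuous_on UNIV \<phi>" using \<phi> by (simp add: Phi_bb2_def)
  have Tm: "T i \<in> borel \<rightarrow>\<^sub>M prob_algebra borel" for i
    unfolding T_def
  proof (rule measurable_distr_prob_space2[where M = borel])
    show "(\<lambda>y. g i) \<in> borel \<rightarrow>\<^sub>M prob_algebra borel"
      using P2_D(1,2)[OF g(1)[of i]] by (auto simp: space_prob_algebra)
    show "(\<lambda>(y, w). w + y) \<in> borel \<Otimes>\<^sub>M borel \<rightarrow>\<^sub>M (borel :: (real^'d) measure)" by measurable
  qed
  have B0: "0 \<le> B i" for i by (simp add: B_def integral_nonneg_AE)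
  have T: "T i y \<in> P2" "dual_cost f y (T i y) < \<infinity>"
    "(\<integral>\<^sup>+z. ennreal ((norm z)\<^sup>2) \<partial>T i y) \<le> ennreal (B i + 2 * (norm y)\<^sup>2)"
    "(LINT z|T i y. \<phi> z) + enn2real (dual_cost f y (T i y)) \<le> shift_cost f \<phi> (g i) y" for i y
  proof -
    have le: "dual_cost f y (T i y) \<le> dual_cost f 0 (g i)"
      using dual_cost_translate[OF g(1)[of i], of f 0 y] by (simp add: T_def)
    show "T i y \<in> P2" "(\<integral>\<^sup>+z. ennreal ((norm z)\<^sup>2) \<partial>T i y) \<le> ennreal (B i + 2 * (norm y)\<^sup>2)"
      unfolding T_def B_def by (rule translate_P2[OF g(1)])+
    show "dual_cost f y (T i y) < \<infinity>" using le g(2) by (rule le_less_trans)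
    have "enn2real (dual_cost f y (T i y)) \<le> enn2real (dual_cost f 0 (g i))"
      by (rule enn2real_mono[OF le]) (use g(2)[of i] in simp)
    then show "(LINT z|T i y. \<phi> z) + enn2real (dual_cost f y (T i y)) \<le> shift_cost f \<phi> (g i) y"
      unfolding T_def shift_cost_def by (subst translate_P2(3)[OF g(1) borel_measurable_continuous_onI[OF c]]) simp
  qed
  show ?thesis
  proof (induction n)
    case 0
    show ?case by (rule exI[of _ "T 0"], rule exI[of _ "B 0"]) (use Tm T B0 in auto)
  next
    case (Suc n)
    then obtain K A where K: "K \<in> borel \<rightarrow>\<^sub>M prob_algebra borel" and A: "0 \<le> A"
      and KP: "\<And>y. K y \<in> P2" "\<And>y. dual_cost f y (K y) < \<infinity>"
        "\<And>y. (\<integral>\<^sup>+z. ennreal ((norm z)\<^sup>2) \<partial>K y) \<le> ennreal (A + 2 * (norm y)\<^sup>2)"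
        "\<And>y i. i \<le> n \<Longrightarrow> (LINT z|K y. \<phi> z) + enn2real (dual_cost f y (K y)) \<le> shift_cost f \<phi> (g i) y"
      by blast
    define S where "S = {y. (LINT z|K y. \<phi> z) + enn2real (dual_cost f y (K y)) \<le> shift_cost f \<phi> (g (Suc n)) y}"
    define K' where "K' y = (if y \<in> S then K y else T (Suc n) y)" for y
    obtain e where e: "e \<in> borel_measurable borel" "\<And>y. K y \<in> P2 \<Longrightarrow> dual_cost f y (K y) = e y"
      by (rule measurable_dual_cost[OF K, of f]) (rule that)
    have "(\<lambda>y. LINT z|K y. \<phi> z) \<in> borel_measurable borel"
      by (rule measurable_compose[OF measurable_prob_algebraD[OF K] integral_measurable_subprob_algebra[OF borel_measurable_continuous_onI[OF c]]])
    moreover have "(\<lambda>y. enn2real (dual_cost f y (K y))) \<in> borel_measurable borel"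
      unfolding e(2)[OF KP(1)] using e(1) by measurable
    moreover have "shift_cost f \<phi> (g (Suc n)) \<in> borel_measurable borel"
      by (rule borel_measurable_continuous_onI[OF shift_cost_continuous[OF \<phi> g(1)]])
    ultimately have S: "S \<in> sets borel" unfolding S_def by measurable
    have K': "K' \<in> borel \<rightarrow>\<^sub>M prob_algebra borel"
      unfolding K'_def by (rule measurable_If_set[OF K Tm]) (use S in simp)
    have "K' y \<in> P2 \<and> dual_cost f y (K' y) < \<infinity> \<and> (\<integral>\<^sup>+z. ennreal ((norm z)\<^sup>2) \<partial>K' y) \<le> ennreal (max A (B (Suc n)) + 2 * (norm y)\<^sup>2) \<and>
      (\<forall>i\<le>Suc n. (LINT z|K' y. \<phi> z) + enn2real (dual_cost f y (K' y)) \<le> shift_cost f \<phi> (g i) y)" for y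
    proof (cases "y \<in> S")
      case True
      have "ennreal (A + 2 * (norm y)\<^sup>2) \<le> ennreal (max A (B (Suc n)) + 2 * (norm y)\<^sup>2)" by (intro ennreal_leI) simp
      then show ?thesis using True KP(1-3)[of y] KP(4)[of _ y] by (auto simp: K'_def S_def le_Suc_eq intro: order_trans)
    next
      case False
      have "ennreal (B (Suc n) + 2 * (norm y)\<^sup>2) \<le> ennreal (max A (B (Suc n)) + 2 * (norm y)\<^sup>2)" by (intro ennreal_leI) simp
      moreover have "shift_cost f \<phi> (g (Suc n)) y \<le> shift_cost f \<phi> (g i) y" if "i \<le> n" for i
        using False KP(4)[OF that, of y] by (simp add: S_def)
      ultimately show ?thesis using False T[where i = "Suc n" and y = y]
        by (auto simp: K'_def le_Suc_eq intro: order_trans)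
    qed
    then show ?case using K' A by (intro exI[of _ K'] exI[of _ "max A (B (Suc n))"]) auto
  qed
qed

section \<open>The three assertions\<close>

lemma ident_P2:
  assumes "p \<in> P2"
  shows "(\<lambda>y. y) \<in> p \<rightarrow>\<^sub>M borel" "distr p borel (\<lambda>y. y) = p"
  using measurable_ident_sets[OF P2_D(1)[OF assms]] P2_D(1)[OF assms] by (auto intro: distr_id2)

lemma measurable_P2:
  assumes "p \<in> P2" "g \<in> borel \<rightarrow>\<^sub>M N"
  shows "g \<in> p \<rightarrow>\<^sub>M N"
  using assms(2) unfolding measurable_cong_sets[OF P2_D(1)[OF assms(1)] refl] .

text \<open>
  The composition of a kernel from \<open>\<mu>\<close> to \<open>p\<close> with one from \<open>p\<close> to \<open>\<nu>\<close> is a kernel from \<open>\<mu>\<close> to \<open>\<nu>\<close>, and gluing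
  applies at almost every starting point.
\<close>

lemma H_cost_triangle:
  fixes \<mu> \<nu> p :: "(real^'d) measure"
  assumes dual: "\<And>x q. q \<in> P2 \<Longrightarrow> G_cost f x q = dual_cost f x q"
    and P: "\<mu> \<in> P2" "\<nu> \<in> P2" "p \<in> P2"
  shows "H_cost f \<mu> \<nu> \<le> H_cost f \<mu> p + H_cost f p \<nu>"
  unfolding H_cost_eq_kernels[OF P(1,3)] H_cost_eq_kernels[OF P(3,2)]
proof (rule le_add_INF_ennreal)
  fix K1 K2 :: "real^'d \<Rightarrow> (real^'d) measure"
  assume "K1 \<in> {K. K \<in> borel \<rightarrow>\<^sub>M prob_algebra borel \<and> \<mu> \<bind> K = p}" "K2 \<in> {K. K \<in> borel \<rightarrow>\<^sub>M prob_algebra borel \<and> p \<bind> K = \<nu>}"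
  then have K1: "K1 \<in> borel \<rightarrow>\<^sub>M prob_algebra borel" "\<mu> \<bind> K1 = p" and K2: "K2 \<in> borel \<rightarrow>\<^sub>M prob_algebra borel" "p \<bind> K2 = \<nu>"
    by auto
  define K where "K x = K1 x \<bind> K2" for x
  have K: "K \<in> borel \<rightarrow>\<^sub>M prob_algebra borel" unfolding K_def by (rule measurable_bind_prob_space[OF K1(1) K2(1)])
  note K1\<mu> = measurable_P2[OF P(1) K1(1)] and K2p = measurable_P2[OF P(3) K2(1)] and K\<mu> = measurable_P2[OF P(1) K]
  have \<mu>K: "\<mu> \<bind> K = \<nu>"
    unfolding K_def[abs_def] K2(2)[symmetric] K1(2)[symmetric]
    by (rule bind_assoc[OF measurable_prob_algebraD[OF K1\<mu>] measurable_prob_algebraD[OF K2(1)], symmetric])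
  obtain e1 where e1: "e1 \<in> borel_measurable borel" "\<And>y. K1 y \<in> P2 \<Longrightarrow> dual_cost f y (K1 y) = e1 y"
    by (rule measurable_dual_cost[OF K1(1), of f]) (rule that)
  obtain e2 where e2: "e2 \<in> borel_measurable borel" "\<And>y. K2 y \<in> P2 \<Longrightarrow> dual_cost f y (K2 y) = e2 y"
    by (rule measurable_dual_cost[OF K2(1), of f]) (rule that)
  have ae1: "AE x in \<mu>. K1 x \<in> P2" by (rule bind_P2_AE[OF K1\<mu>]) (simp add: K1(2) P)
  have aeK: "AE x in \<mu>. K x \<in> P2" by (rule bind_P2_AE[OF K\<mu>]) (simp add: \<mu>K P)
  have ae2: "AE y in p. K2 y \<in> P2" by (rule bind_P2_AE[OF K2p]) (simp add: K2(2) P)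
  have ae12: "AE x in \<mu>. AE y in K1 x. K2 y \<in> P2"
    using ae2 unfolding K1(2)[symmetric] by (subst (asm) AE_bind[OF measurable_prob_algebraD[OF K1\<mu>] kernel_P2(3)[OF K2(1)]])
  have "AE x in \<mu>. G_cost f x (K x) \<le> e1 x + (\<integral>\<^sup>+y. e2 y \<partial>K1 x)"
    using ae1 aeK ae12
  proof eventually_elim
    case (elim x)
    have "G_cost f x (K x) = dual_cost f x (K1 x \<bind> K2)" using dual[OF elim(2)] by (simp add: K_def)
    also have "\<dots> \<le> dual_cost f x (K1 x) + (\<integral>\<^sup>+y. dual_cost f y (K2 y) \<partial>K1 x)"
      by (rule dual_cost_gluing[OF ident_P2[OF elim(1)] elim(1) measurable_P2[OF elim(1) K2(1)] elim(2)[unfolded K_def]])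
    also have "(\<integral>\<^sup>+y. dual_cost f y (K2 y) \<partial>K1 x) = (\<integral>\<^sup>+y. e2 y \<partial>K1 x)"
      by (rule nn_integral_cong_AE) (use elim(3) in eventually_elim, rule e2(2))
    finally show ?case by (simp add: e1(2)[OF elim(1)])
  qed
  then have "(\<integral>\<^sup>+x. G_cost f x (K x) \<partial>\<mu>) \<le> (\<integral>\<^sup>+x. e1 x + (\<integral>\<^sup>+y. e2 y \<partial>K1 x) \<partial>\<mu>)" by (rule nn_integral_mono_AE)
  also have "\<dots> = (\<integral>\<^sup>+x. e1 x \<partial>\<mu>) + (\<integral>\<^sup>+x. (\<integral>\<^sup>+y. e2 y \<partial>K1 x) \<partial>\<mu>)"
    by (rule nn_integral_add)
      (use measurable_P2[OF P(1) e1(1)] measurable_compose[OF measurable_prob_algebraD[OF K1\<mu>] nn_integral_measurable_subprob_algebra[OF e2(1)]] in auto)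
  also have "(\<integral>\<^sup>+x. (\<integral>\<^sup>+y. e2 y \<partial>K1 x) \<partial>\<mu>) = (\<integral>\<^sup>+y. e2 y \<partial>p)"
    unfolding K1(2)[symmetric] by (rule nn_integral_bind[OF e2(1) measurable_prob_algebraD[OF K1\<mu>], symmetric])
  also have "\<dots> = (\<integral>\<^sup>+y. G_cost f y (K2 y) \<partial>p)"
    by (rule nn_integral_cong_AE) (use ae2 in eventually_elim, simp add: dual e2(2))
  also have "(\<integral>\<^sup>+x. e1 x \<partial>\<mu>) = (\<integral>\<^sup>+x. G_cost f x (K1 x) \<partial>\<mu>)"
    by (rule nn_integral_cong_AE) (use ae1 in eventually_elim, simp add: dual e1(2))
  finally show "H_cost f \<mu> \<nu> \<le> (\<integral>\<^sup>+x. G_cost f x (K1 x) \<partial>\<mu>) + (\<integral>\<^sup>+y. G_cost f y (K2 y) \<partial>p)"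
    unfolding H_cost_eq_kernels[OF P(1,2)] using K \<mu>K by (intro INF_lower2[of K]) auto
qed

lemma G_cost_analytic_kernel:
  fixes \<nu> p :: "(real^'d) measure"
  assumes dual: "\<And>x q. q \<in> P2 \<Longrightarrow> G_cost f x q = dual_cost f x q"
    and P: "\<nu> \<in> P2" "p \<in> P2" and \<gamma>: "\<gamma> \<in> analytic_kernels"
    and eq: "\<forall>B\<in>sets borel. emeasure \<nu> B = (\<integral>\<^sup>+ y. emeasure (\<gamma> y) B \<partial>completion p)"
  shows "G_cost f x \<nu> \<le> G_cost f x p + (\<integral>\<^sup>+ y. G_cost f y (\<gamma> y) \<partial>completion p)"
proof -
  note a = analytic_kernel_measurable[OF \<gamma> P(2,1) eq]
  have "dual_cost f x (completion p \<bind> \<gamma>) \<le> dual_cost f x p + (\<integral>\<^sup>+y. dual_cost f y (\<gamma> y) \<partial>completion p)"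
    by (rule dual_cost_gluing[OF completion_P2[OF P(2)] P(2) a(2)]) (simp add: a(3) P)
  then show ?thesis by (simp add: a(3) dual P a(1))
qed

lemma bind_P2:
  fixes K :: "real^'d \<Rightarrow> (real^'d) measure"
  assumes p: "p \<in> P2" and K: "K \<in> borel \<rightarrow>\<^sub>M prob_algebra borel"
    and A: "0 \<le> A" "\<And>y. (\<integral>\<^sup>+z. ennreal ((norm z)\<^sup>2) \<partial>K y) \<le> ennreal (A + 2 * (norm y)\<^sup>2)"
  shows "p \<bind> K \<in> P2"
proof -
  note P = P2_D[OF p]
  interpret prob_space p by (rule P(2))
  note Ks = measurable_prob_algebraD[OF measurable_P2[OF p K]]
  have nm: "(\<lambda>z :: real^'d. ennreal ((norm z)\<^sup>2)) \<in> borel_measurable borel" by measurable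
  have s: "sets (K y) = sets borel" "prob_space (K y)" for y
    using measurable_space[OF K, of y] by (auto simp: space_prob_algebra)
  have "(\<integral>\<^sup>+z. ennreal ((norm z)\<^sup>2) \<partial>(p \<bind> K)) = (\<integral>\<^sup>+y. \<integral>\<^sup>+z. ennreal ((norm z)\<^sup>2) \<partial>K y \<partial>p)"
    by (rule nn_integral_bind[OF nm Ks])
  also have "\<dots> \<le> (\<integral>\<^sup>+y. ennreal (A + 2 * (norm y)\<^sup>2) \<partial>p)" by (intro nn_integral_mono A(2))
  also have "\<dots> = ennreal (LINT y|p. A + 2 * (norm y)\<^sup>2)"
    by (rule nn_integral_eq_integral) (use P(4) A(1) in auto)
  also have "\<dots> < \<infinity>" by simp
  finally have "(\<integral>\<^sup>+z. ennreal ((norm z)\<^sup>2) \<partial>(p \<bind> K)) < \<infinity>" .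
  moreover have "sets (p \<bind> K) = sets borel" by (rule sets_bind[OF s(1)]) (simp add: P(3))
  moreover have "prob_space (p \<bind> K)" by (rule prob_space_bind[OF _ Ks]) (use s(2) in auto)
  ultimately show ?thesis by (simp add: P2_def)
qed

text \<open>
  The choice \<open>p = \<delta>\<^sub>x\<close> gives \<open>\<phi>\<^sup>G\<^sup>G \<le> \<phi>\<^sup>G\<close>.  For the converse, the values \<open>V n\<close> of the selected kernels lie
  between \<open>\<phi>\<^sup>G\<close> and \<open>\<phi>\<close> and tend to \<open>\<phi>\<^sup>G\<close>; gluing the kernels to \<open>p\<close> yields
  \<open>\<phi>\<^sup>G(x) \<le> \<integral>V n dp + G x p\<close>, and dominated convergence concludes.
\<close>

lemma GG_transform_eq:
  fixes \<phi> :: "real^'d \<Rightarrow> real" and f :: "real^'d^'d \<Rightarrow> ennreal"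
  assumes dual: "\<And>x q. q \<in> P2 \<Longrightarrow> G_cost f x q = dual_cost f x q" and \<phi>: "\<phi> \<in> Phi_bb2"
  shows "GG_transform f \<phi> x = G_transform f \<phi> x"
proof -
  from \<phi> obtain b C where c: "continuous_on UNIV \<phi>" and b: "\<And>x. b \<le> \<phi> x" and C: "0 < C" "\<And>x. \<bar>\<phi> x\<bar> \<le> C * (1 + (norm x)\<^sup>2)"
    by (auto simp: Phi_bb2_def)
  have \<phi>b: "\<phi> \<in> borel_measurable borel" by (rule borel_measurable_continuous_onI[OF c])
  have i\<phi>: "integrable q \<phi>" if "q \<in> P2" for q by (rule P2_integrable[OF that \<phi>b C(2)])
  have Gt: "G_transform f \<xi> y = (INF p\<in>P2. ereal (LINT z|p. \<xi> z) + enn2ereal (dual_cost f y p))"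
    if "\<xi> \<in> borel_measurable borel" for \<xi> y
    unfolding G_transform_def
    by (intro INF_cong refl) (simp add: integral_completion[OF measurable_P2[OF _ that]] dual)
  have up: "G_transform f \<xi> y \<le> ereal (\<xi> y)" if "\<xi> \<in> borel_measurable borel" for \<xi> y
    unfolding Gt[OF that] by (rule INF_lower2[OF return_P2[of y]]) (simp add: integral_return that dual_cost_return zero_ennreal.rep_eq)
  have low: "ereal b \<le> G_transform f \<phi> y" for y
    unfolding Gt[OF \<phi>b]
  proof (rule INF_greatest)
    fix p :: "(real^'d) measure" assume p: "p \<in> P2"
    interpret prob_space p by (rule P2_D(2)[OF p])
    have "b \<le> (LINT z|p. \<phi> z)" by (rule integral_ge_const[OF i\<phi>[OF p]]) (simp add: b)
    then have "ereal b + 0 \<le> ereal (LINT z|p. \<phi> z) + enn2ereal (dual_cost f y p)" by (intro add_mono) auto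
    then show "ereal b \<le> ereal (LINT z|p. \<phi> z) + enn2ereal (dual_cost f y p)" by simp
  qed
  define u where "u y = real_of_ereal (G_transform f \<phi> y)" for y
  have u: "ereal (u y) = G_transform f \<phi> y" for y
    using low[of y] up[OF \<phi>b, of y] unfolding u_def by (cases "G_transform f \<phi> y") auto
  have ub: "b \<le> u y" "u y \<le> \<phi> y" for y
    using low[of y] up[OF \<phi>b, of y] unfolding u[symmetric] by auto
  have u_le: "u y \<le> (LINT z|q. \<phi> z) + enn2real (dual_cost f y q)" if "q \<in> P2" "dual_cost f y q < \<infinity>" for y q
  proof -
    have "enn2ereal (dual_cost f y q) = ereal (enn2real (dual_cost f y q))"
      using that(2) by (cases "dual_cost f y q") (auto simp: enn2ereal_ennreal)
    then have "ereal (u y) \<le> ereal (LINT z|q. \<phi> z) + ereal (enn2real (dual_cost f y q))"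
      unfolding u Gt[OF \<phi>b] by (intro INF_lower2[OF that(1)]) simp
    then show ?thesis by simp
  qed
  let ?\<Gamma> = "{\<gamma>\<in>P2. dual_cost f 0 \<gamma> < \<infinity>}"
  have r0: "return borel 0 \<in> ?\<Gamma>" by (simp add: return_P2 dual_cost_return)
  have "\<exists>g :: nat \<Rightarrow> _. range g \<subseteq> ?\<Gamma> \<and> g 0 = return borel 0 \<and>
    (\<forall>y r. \<forall>\<gamma>\<in>?\<Gamma>. shift_cost f \<phi> \<gamma> y < r \<longrightarrow> (\<exists>n. shift_cost f \<phi> (g n) y < r))"
  proof (rule countable_infimum[where h = "shift_cost f \<phi>" and I = ?\<Gamma>, OF _ r0])
    show "continuous_on UNIV (shift_cost f \<phi> \<gamma>)" if "\<gamma> \<in> ?\<Gamma>" for \<gamma>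
      by (rule shift_cost_continuous[OF \<phi>]) (use that in simp)
    fix g :: "nat \<Rightarrow> (real^'d) measure"
    assume g: "range g \<subseteq> ?\<Gamma>" "g 0 = return borel 0"
      "\<And>y r \<gamma>. \<gamma> \<in> ?\<Gamma> \<Longrightarrow> shift_cost f \<phi> \<gamma> y < r \<Longrightarrow> \<exists>n. shift_cost f \<phi> (g n) y < r"
    show ?thesis by (rule exI[of _ g], intro conjI allI ballI impI g)
  qed
  then obtain g :: "nat \<Rightarrow> (real^'d) measure" where g: "range g \<subseteq> ?\<Gamma>" "g 0 = return borel 0"
    and near': "\<forall>y r. \<forall>\<gamma>\<in>?\<Gamma>. shift_cost f \<phi> \<gamma> y < r \<longrightarrow> (\<exists>n. shift_cost f \<phi> (g n) y < r)"
    by (elim exE conjE)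
  have gP: "g i \<in> P2" "dual_cost f 0 (g i) < \<infinity>" for i using g(1) by auto
  have near: "\<exists>n. shift_cost f \<phi> (g n) y < r" if "u y < r" for y r
  proof -
    have "G_transform f \<phi> y < ereal r" using that by (simp add: u[symmetric])
    then obtain q where q: "q \<in> P2" "ereal (LINT z|q. \<phi> z) + enn2ereal (dual_cost f y q) < ereal r"
      unfolding Gt[OF \<phi>b] INF_less_iff by blast
    have fin: "dual_cost f y q < \<infinity>" using q(2) by (cases "dual_cost f y q") auto
    have lr: "(LINT z|q. \<phi> z) + enn2real (dual_cost f y q) < r"
      using q(2) fin by (cases "dual_cost f y q") (auto simp: enn2ereal_ennreal)
    let ?\<gamma> = "distr q borel (\<lambda>w. w + - y)"
    have le: "dual_cost f 0 ?\<gamma> \<le> dual_cost f y q" using dual_cost_translate[OF q(1), of f y "- y"] by simp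
    have "?\<gamma> \<in> ?\<Gamma>" using translate_P2(1)[OF q(1), of "- y"] le_less_trans[OF le fin] by simp
    moreover have "shift_cost f \<phi> ?\<gamma> y < r"
    proof -
      have "(\<lambda>w. \<phi> (w + y)) \<in> borel_measurable borel" by (rule measurable_compose[OF _ \<phi>b]) measurable
      from translate_P2(3)[OF q(1) this, of "- y"] have "(LINT w|?\<gamma>. \<phi> (w + y)) = (LINT z|q. \<phi> z)" by simp
      moreover have "enn2real (dual_cost f 0 ?\<gamma>) \<le> enn2real (dual_cost f y q)" by (rule enn2real_mono[OF le]) (use fin in simp)
      ultimately show ?thesis using lr by (simp add: shift_cost_def)
    qed
    ultimately show ?thesis by (rule near'[rule_format])
  qed
  define Q where "Q n KA \<longleftrightarrow> fst KA \<in> borel \<rightarrow>\<^sub>M prob_algebra borel \<and> 0 \<le> snd KA \<and>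
    (\<forall>y. fst KA y \<in> P2 \<and> dual_cost f y (fst KA y) < \<infinity> \<and> (\<integral>\<^sup>+z. ennreal ((norm z)\<^sup>2) \<partial>fst KA y) \<le> ennreal (snd KA + 2 * (norm y)\<^sup>2) \<and>
      (\<forall>i\<le>n. (LINT z|fst KA y. \<phi> z) + enn2real (dual_cost f y (fst KA y)) \<le> shift_cost f \<phi> (g i) y))"
    for n and KA :: "(real^'d \<Rightarrow> (real^'d) measure) \<times> real"
  have "\<exists>KA. Q n KA" for n
  proof -
    obtain K A where "Q n (K, A)" using shift_selection[where g = g and n = n, OF \<phi> gP] unfolding Q_def fst_conv snd_conv by (elim exE)
    then show ?thesis ..
  qed
  then have "\<forall>n. \<exists>KA. Q n KA" ..
  from choice[OF this] obtain KA where "\<forall>n. Q n (KA n)" ..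
  then have KA: "Q n (KA n)" for n ..
  define K where "K n = fst (KA n)" for n
  define A where "A n = snd (KA n)" for n
  have K: "K n \<in> borel \<rightarrow>\<^sub>M prob_algebra borel" and A: "0 \<le> A n"
    and KP: "K n y \<in> P2" "dual_cost f y (K n y) < \<infinity>"
      "(\<integral>\<^sup>+z. ennreal ((norm z)\<^sup>2) \<partial>K n y) \<le> ennreal (A n + 2 * (norm y)\<^sup>2)"
      "i \<le> n \<Longrightarrow> (LINT z|K n y. \<phi> z) + enn2real (dual_cost f y (K n y)) \<le> shift_cost f \<phi> (g i) y" for n y i
    using KA[of n] by (simp_all add: Q_def K_def A_def del: ennreal_plus)
  define V where "V n y = (LINT z|K n y. \<phi> z) + enn2real (dual_cost f y (K n y))" for n y
  have dm: "(\<lambda>y. dual_cost f y (K n y)) \<in> borel_measurable borel" for n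
  proof -
    obtain e where e: "e \<in> borel_measurable borel" "\<And>y. K n y \<in> P2 \<Longrightarrow> dual_cost f y (K n y) = e y"
      by (rule measurable_dual_cost[where f = f, OF K[of n]]) (rule that)
    show ?thesis unfolding e(2)[OF KP(1)] by (rule e(1))
  qed
  have "(\<lambda>y. LINT z|K n y. \<phi> z) \<in> borel_measurable borel" for n
    by (rule measurable_compose[OF measurable_prob_algebraD[OF K] integral_measurable_subprob_algebra[OF \<phi>b]])
  then have Vb: "V n \<in> borel_measurable borel" for n unfolding V_def using dm by measurable
  have uV: "u y \<le> V n y" for n y unfolding V_def by (rule u_le[OF KP(1,2)])
  have V\<phi>: "V n y \<le> \<phi> y" for n y
  proof -
    have "(\<lambda>w. \<phi> (w + y)) \<in> borel_measurable borel" by (rule measurable_compose[OF _ \<phi>b]) measurable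
    then have "shift_cost f \<phi> (g 0) y = \<phi> y" by (simp add: g(2) shift_cost_def integral_return dual_cost_return)
    then show ?thesis using KP(4)[of 0 n y] by (simp add: V_def)
  qed
  have lim: "(\<lambda>n. V n y) \<longlonglongrightarrow> u y" for y
  proof (rule LIMSEQ_I)
    fix r :: real assume "0 < r"
    then obtain n0 where n0: "shift_cost f \<phi> (g n0) y < u y + r" using near[of y "u y + r"] by auto
    have "norm (V n y - u y) < r" if "n0 \<le> n" for n
      using KP(4)[OF that, of y] n0 uV[of y n] by (simp add: V_def)
    then show "\<exists>no. \<forall>n\<ge>no. norm (V n y - u y) < r" by blast
  qed
  have ubm: "u \<in> borel_measurable borel" by (rule borel_measurable_LIMSEQ_real[OF lim Vb])
  have Vbound: "\<bar>V n y\<bar> \<le> (\<bar>b\<bar> + C) * (1 + (norm y)\<^sup>2)" for n y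
  proof -
    have "\<bar>V n y\<bar> \<le> \<bar>b\<bar> + \<bar>\<phi> y\<bar>" using ub(1)[of y] uV[of y n] V\<phi>[of n y] by linarith
    also have "\<dots> \<le> \<bar>b\<bar> * (1 + (norm y)\<^sup>2) + C * (1 + (norm y)\<^sup>2)"
      using C(2)[of y] by (intro add_mono) (auto simp: algebra_simps)
    finally show ?thesis by (simp add: algebra_simps)
  qed
  have key: "ereal (u x) \<le> ereal (LINT y|p. u y) + enn2ereal (dual_cost f x p)" if p: "p \<in> P2" for p
  proof (cases "dual_cost f x p")
    case (real d)
    have step: "u x \<le> (LINT y|p. V n y) + d" for n
    proof -
      note Kp = measurable_P2[OF p K[of n]]
      have \<nu>: "p \<bind> K n \<in> P2" by (rule bind_P2[OF p K[of n] A[of n] KP(3)])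
      note B = bind_integral[OF Kp \<nu> \<phi>b C(2)]
      have iV: "integrable p (V n)" by (rule P2_integrable[OF p Vb Vbound])
      have iD: "integrable p (\<lambda>y. enn2real (dual_cost f y (K n y)))"
        using Bochner_Integration.integrable_diff[OF iV B(1)] by (simp add: V_def)
      define s where "s = (LINT y|p. enn2real (dual_cost f y (K n y)))"
      have s0: "0 \<le> s" unfolding s_def by (rule integral_nonneg_AE) simp
      have "(\<integral>\<^sup>+y. dual_cost f y (K n y) \<partial>p) = (\<integral>\<^sup>+y. ennreal (enn2real (dual_cost f y (K n y))) \<partial>p)"
        using KP(2) by (intro nn_integral_cong) simp
      also have "\<dots> = ennreal s" unfolding s_def by (rule nn_integral_eq_integral[OF iD]) simp
      finally have "dual_cost f x (p \<bind> K n) \<le> ennreal d + ennreal s"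
        using dual_cost_gluing[where f = f and x = x, OF ident_P2[OF p] p Kp \<nu>] real by simp
      then have le: "dual_cost f x (p \<bind> K n) \<le> ennreal (d + s)" using real(1) s0 by (simp add: ennreal_plus)
      have "u x \<le> (LINT z|(p \<bind> K n). \<phi> z) + enn2real (dual_cost f x (p \<bind> K n))"
        by (rule u_le[OF \<nu>]) (rule le_less_trans[OF le], simp)
      also have "enn2real (dual_cost f x (p \<bind> K n)) \<le> d + s"
        using enn2real_mono[OF le ennreal_less_top] real(1) s0 by (simp del: ennreal_plus)
      also have "(LINT z|(p \<bind> K n). \<phi> z) + (d + s) = (LINT y|p. V n y) + d"
        unfolding B(2) s_def V_def using B(1) iD by simp
      finally show ?thesis by simp
    qed
    have "(\<lambda>n. LINT y|p. V n y) \<longlonglongrightarrow> (LINT y|p. u y)"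
    proof (rule integral_dominated_convergence[where w = "\<lambda>y. (\<bar>b\<bar> + C) * (1 + (norm y)\<^sup>2)"])
      show "integrable p (\<lambda>y. (\<bar>b\<bar> + C) * (1 + (norm y)\<^sup>2))"
        by (rule P2_integrable[OF p, of _ "\<bar>b\<bar> + C"]) (use C(1) in \<open>auto simp: abs_mult\<close>)
    qed (use lim Vbound measurable_P2[OF p ubm] measurable_P2[OF p Vb] in auto)
    then have "(\<lambda>n. (LINT y|p. V n y) + d) \<longlonglongrightarrow> (LINT y|p. u y) + d" by (intro tendsto_intros)
    then have "u x \<le> (LINT y|p. u y) + d" by (rule LIMSEQ_le_const) (use step in blast)
    then show ?thesis using real by (simp add: enn2ereal_ennreal)
  qed simp
  have "GG_transform f \<phi> x = G_transform f u x" by (simp add: GG_transform_def u_def[abs_def])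
  also have "\<dots> = ereal (u x)"
    by (rule antisym[OF up[OF ubm]]) (unfold Gt[OF ubm], rule INF_greatest, rule key)
  finally show ?thesis by (simp add: u)
qed

theorem proposition3p24:
  fixes f :: "real^'d^'d \<Rightarrow> ennreal" and \<kappa>\<^sub>1 :: real
  assumes "convex_fun f"
    and "pos_1_homogeneous f"
    and "lower_semicont f"
    and "fin_dom f \<subseteq> psd_mats"
    and "fin_dom f \<noteq> {}"
    and "fin_dom f \<subseteq> closure (fin_dom f \<inter> pd_mats)"
    and "fin_dom f = psd_mats"
    and "\<kappa>\<^sub>1 > 0"
    and "\<forall>A\<in>psd_mats. f A \<le> ennreal (\<kappa>\<^sub>1 * trace A)"
  shows
    "let assertion_i =
           (\<forall>\<mu>\<in>P2. \<forall>\<nu>\<in>P2. \<forall>p\<in>P2. H_cost f \<mu> \<nu> \<le> H_cost f \<mu> p + H_cost f p \<nu>);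
         assertion_ii =
           (\<forall>x. \<forall>\<nu>\<in>P2. \<forall>p\<in>P2. \<forall>\<gamma>\<in>analytic_kernels.
              (\<forall>B\<in>sets borel. emeasure \<nu> B = (\<integral>\<^sup>+ y. emeasure (\<gamma> y) B \<partial>completion p)) \<longrightarrow>
              G_cost f x \<nu> \<le> G_cost f x p + (\<integral>\<^sup>+ y. G_cost f y (\<gamma> y) \<partial>completion p));
         assertion_iii =
           (\<forall>\<phi>\<in>Phi_bb2. \<forall>x. GG_transform f \<phi> x = G_transform f \<phi> x)
     in (assertion_i \<longleftrightarrow> assertion_ii) \<and> (assertion_ii \<longleftrightarrow> assertion_iii)"
proof -
  have dual: "G_cost f x q = dual_cost f x q" if "q \<in> P2" for x and q :: "(real^'d) measure"
    by (rule G_cost_eq_dual_cost[OF assms(1-3,7) that])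
  have i: "\<forall>\<mu>\<in>P2. \<forall>\<nu>\<in>P2. \<forall>p\<in>P2. H_cost f \<mu> \<nu> \<le> H_cost f \<mu> p + H_cost f p \<nu>"
    using H_cost_triangle[OF dual] by blast
  have ii: "\<forall>x. \<forall>\<nu>\<in>P2. \<forall>p\<in>P2. \<forall>\<gamma>\<in>analytic_kernels.
      (\<forall>B\<in>sets borel. emeasure \<nu> B = (\<integral>\<^sup>+ y. emeasure (\<gamma> y) B \<partial>completion p)) \<longrightarrow>
      G_cost f x \<nu> \<le> G_cost f x p + (\<integral>\<^sup>+ y. G_cost f y (\<gamma> y) \<partial>completion p)"
    using G_cost_analytic_kernel[OF dual] by blast
  have iii: "\<forall>\<phi>\<in>Phi_bb2. \<forall>x. GG_transform f \<phi> x = G_transform f \<phi> x"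
    using GG_transform_eq[OF dual] by blast
  show ?thesis unfolding Let_def by (intro conjI iffI) (rule i ii iii)+
qed

end
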